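(* Let $(M,h)$ be a compact Kähler manifold with uniformly RC-positive curvature, and let $(N,g)$ be a Riemannian manifold with non-positive complex sectional curvature. Then there is no non-constant harmonic map from $(M,h)$ to $(N,g)$.
   Context: Manifolds are connected and maps are smooth. Uniform RC-positivity: for a Hermitian metric $h$ on a complex manifold $M$, let $R_{\alpha\bar\beta\gamma\bar\delta}=-\frac{\partial^2 h_{\gamma\bar\delta}}{\partial z^\alpha\partial\bar z^\beta}+h^{\mu\bar\nu}\frac{\partial h_{\gamma\bar\nu}}{\partial z^\alpha}\frac{\partial h_{\mu\bar\delta}}{\partial\bar z^\beta}$ be the curvature tensor of the Chern connection of $(T^{1,0}M,h)$ in local holomorphic coordinates, and $R(u,\bar u,v,\bar v)=R_{\alpha\bar\beta\gamma\bar\delta}u^\alpha\bar u^\beta v^\gamma\bar v^\delta$. $(M,h)$ has uniformly RC-positive curvature if at every point $q\in M$ there exists a vector $u\in T^{1,0}_qM$ such that $R(u,\bar u,v,\bar v)>0$ for every nonzero $v\in T^{1,0}_qM$. Non-positive complex sectional curvature: for $(N,g)$ with Levi-Civita connection $\nabla$, put $R(X,Y)Z=\nabla_X\nabla_YZ-\nabla_Y\nabla_XZ-\nabla_{[X,Y]}Z$ and $R(X,Y,Z,W)=g(R(X,Y)Z,W)$, extended $\mathbb{C}$-multilinearly to $T_{\mathbb{C}}N=TN\otimes\mathbb{C}$. $(N,g)$ has non-positive complex sectional curvature if $R(Z,\bar W,W,\bar Z)\le 0$ for all $Z,W\in T_{\mathbb{C}}N$ (at the same point). A smooth map $f:(M,h)\to(N,g)$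 is harmonic if it satisfies the Euler–Lagrange equation $(\nabla^{\mathscr E})^*df=0$ of the energy $E(f)=\int_M|df|^2\,dv_M$, where $\mathscr E=f^*(TN)$ carries the connection $\nabla^{\mathscr E}$ induced by the Levi-Civita connection of $N$ and $M$ carries the Riemannian metric underlying $h$. *)

theory Defs
  imports "HOL-Analysis.Analysis"
begin

section \<open>Smooth functions on open subsets of normed spaces\<close>

primrec times_diff_on ::
  "nat \<Rightarrow> ('a::real_normed_vector \<Rightarrow> 'b::real_normed_vector) \<Rightarrow> 'a set \<Rightarrow> bool" where
  "times_diff_on 0 f S \<longleftrightarrow> continuous_on S f"
| "times_diff_on (Suc k) f S \<longleftrightarrow>
     (\<forall>x\<in>S. f differentiable (at x)) \<and>
     (\<forall>v. times_diff_on k (\<lambda>x. frechet_derivative f (at x) v) S)"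

text \<open>Only used for open \<open>S\<close>.\<close>

definition smooth_on ::
  "('a::real_normed_vector \<Rightarrow> 'b::real_normed_vector) \<Rightarrow> 'a set \<Rightarrow> bool" where
  "smooth_on f S \<longleftrightarrow> (\<forall>k. times_diff_on k f S)"

definition pd :: "'n \<Rightarrow> (real^'n \<Rightarrow> 'b::real_normed_vector) \<Rightarrow> real^'n \<Rightarrow> 'b" where
  "pd a F x = frechet_derivative F (at x) (axis a 1)"


section \<open>Manifolds\<close>

text \<open>
  The underlying space of a manifold is a whole type. An atlas is an indexed family of charts; it
  need not be maximal. Tensor fields are families of coordinate expressions, one for each chart
  (as functions of the coordinates), subject to the transformation law. Values outside
  the image of a chart are irrelevant.
\<close>

record ('i, 'm, 'e) atlas =
  indices :: "'i set"
  patch :: "'i \<Rightarrow> 'm set"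
  chart :: "'i \<Rightarrow> 'm \<Rightarrow> 'e"

definition chart_image :: "('i, 'm, 'e) atlas \<Rightarrow> 'i \<Rightarrow> 'e set" where
  "chart_image A i = chart A i ` patch A i"

definition chart_inv :: "('i, 'm, 'e) atlas \<Rightarrow> 'i \<Rightarrow> 'e \<Rightarrow> 'm" where
  "chart_inv A i = inv_into (patch A i) (chart A i)"

definition overlap :: "('i, 'm, 'e) atlas \<Rightarrow> 'i \<Rightarrow> 'i \<Rightarrow> 'e set" where
  "overlap A i j = chart A i ` (patch A i \<inter> patch A j)"

definition transition :: "('i, 'm, 'e) atlas \<Rightarrow> 'i \<Rightarrow> 'i \<Rightarrow> 'e \<Rightarrow> 'e" where
  "transition A i j = chart A j \<circ> chart_inv A i"

definition topological_manifold ::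
  "('i, 'm::{t2_space, second_countable_topology}, 'e::euclidean_space) atlas \<Rightarrow> bool" where
  "topological_manifold A \<longleftrightarrow>
     connected (UNIV :: 'm set) \<and>
     (\<Union>i\<in>indices A. patch A i) = UNIV \<and>
     (\<forall>i\<in>indices A. open (patch A i) \<and> open (chart_image A i) \<and>
        homeomorphism (patch A i) (chart_image A i) (chart A i) (chart_inv A i))"

definition smooth_manifold ::
  "('i, 'm::{t2_space, second_countable_topology}, real^'n) atlas \<Rightarrow> bool" where
  "smooth_manifold A \<longleftrightarrow>
     topological_manifold A \<and>
     (\<forall>i\<in>indices A. \<forall>j\<in>indices A. smooth_on (transition A i j) (overlap A i j))"

definition complex_manifold ::
  "('i, 'm::{t2_space, second_countable_topology}, complex^'n) atlas \<Rightarrow> bool" where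
  "complex_manifold A \<longleftrightarrow>
     topological_manifold A \<and>
     (\<forall>i\<in>indices A. \<forall>j\<in>indices A. \<forall>z\<in>overlap A i j.
        \<exists>J :: complex^'n^'n. (transition A i j has_derivative (\<lambda>v. J *v v)) (at z))"


section \<open>Riemannian metrics, Levi-Civita connection and curvature\<close>

definition real_jacobian ::
  "('i, 'm, real^'n) atlas \<Rightarrow> 'i \<Rightarrow> 'i \<Rightarrow> real^'n \<Rightarrow> real^'n^'n" where
  "real_jacobian A i j x = matrix (frechet_derivative (transition A i j) (at x))"

definition riemannian_metric ::
  "('i, 'm, real^'n) atlas \<Rightarrow> ('i \<Rightarrow> real^'n \<Rightarrow> real^'n^'n) \<Rightarrow> bool" where
  "riemannian_metric A g \<longleftrightarrow>
     (\<forall>i\<in>indices A.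
        smooth_on (g i) (chart_image A i) \<and>
        (\<forall>x\<in>chart_image A i.
           transpose (g i x) = g i x \<and> (\<forall>v. v \<noteq> 0 \<longrightarrow> v \<bullet> (g i x *v v) > 0))) \<and>
     (\<forall>i\<in>indices A. \<forall>j\<in>indices A. \<forall>x\<in>overlap A i j.
        g i x = transpose (real_jacobian A i j x) ** g j (transition A i j x)
                  ** real_jacobian A i j x)"

definition riemannian_manifold ::
  "('i, 'm::{t2_space, second_countable_topology}, real^'n) atlas \<Rightarrow>
   ('i \<Rightarrow> real^'n \<Rightarrow> real^'n^'n) \<Rightarrow> bool" where
  "riemannian_manifold A g \<longleftrightarrow> smooth_manifold A \<and> riemannian_metric A g"

text \<open>
  In the rest of this section \<open>G\<close> is the matrix of a Riemannian metric in one chart, and vector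
  fields are vector-valued functions of the coordinates.
  \<open>christoffel G x i j k\<close> is $\Gamma^k_{ij}$, the coefficients of the Levi-Civita connection.
\<close>

definition christoffel ::
  "(real^'n \<Rightarrow> real^'n^'n) \<Rightarrow> real^'n \<Rightarrow> 'n \<Rightarrow> 'n \<Rightarrow> 'n \<Rightarrow> real" where
  "christoffel G x i j k =
     (\<Sum>l\<in>UNIV. matrix_inv (G x) $ k $ l *
        (pd i (\<lambda>y. G y $ j $ l) x + pd j (\<lambda>y. G y $ i $ l) x - pd l (\<lambda>y. G y $ i $ j) x)) / 2"

definition nabla ::
  "(real^'n \<Rightarrow> real^'n^'n) \<Rightarrow> (real^'n \<Rightarrow> real^'n) \<Rightarrow> (real^'n \<Rightarrow> real^'n) \<Rightarrow> real^'n \<Rightarrow> real^'n" where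
  "nabla G X Y x = frechet_derivative Y (at x) (X x) +
     (\<chi> k. \<Sum>i\<in>UNIV. \<Sum>j\<in>UNIV. christoffel G x i j k * X x $ i * Y x $ j)"

definition lie_bracket ::
  "(real^'n \<Rightarrow> real^'n) \<Rightarrow> (real^'n \<Rightarrow> real^'n) \<Rightarrow> real^'n \<Rightarrow> real^'n" where
  "lie_bracket X Y x = frechet_derivative Y (at x) (X x) - frechet_derivative X (at x) (Y x)"

definition curvature_operator ::
  "(real^'n \<Rightarrow> real^'n^'n) \<Rightarrow> (real^'n \<Rightarrow> real^'n) \<Rightarrow> (real^'n \<Rightarrow> real^'n) \<Rightarrow> (real^'n \<Rightarrow> real^'n)
     \<Rightarrow> real^'n \<Rightarrow> real^'n" where
  "curvature_operator G X Y Z x =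
     nabla G X (nabla G Y Z) x - nabla G Y (nabla G X Z) x - nabla G (lie_bracket X Y) Z x"

definition coord_field :: "'n \<Rightarrow> real^'n \<Rightarrow> real^'n" where
  "coord_field i = (\<lambda>_. axis i 1)"

definition curvature_coeff ::
  "(real^'n \<Rightarrow> real^'n^'n) \<Rightarrow> real^'n \<Rightarrow> 'n \<Rightarrow> 'n \<Rightarrow> 'n \<Rightarrow> 'n \<Rightarrow> real" where
  "curvature_coeff G x i j k l =
     (G x *v curvature_operator G (coord_field i) (coord_field j) (coord_field k) x)
       \<bullet> coord_field l x"

definition complex_curvature ::
  "(real^'n \<Rightarrow> real^'n^'n) \<Rightarrow> real^'n \<Rightarrow>
     complex^'n \<Rightarrow> complex^'n \<Rightarrow> complex^'n \<Rightarrow> complex^'n \<Rightarrow> complex" where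
  "complex_curvature G x X Y Z W =
     (\<Sum>i\<in>UNIV. \<Sum>j\<in>UNIV. \<Sum>k\<in>UNIV. \<Sum>l\<in>UNIV.
        of_real (curvature_coeff G x i j k l) * X $ i * Y $ j * Z $ k * W $ l)"

definition cnj_vec :: "complex^'n \<Rightarrow> complex^'n" where
  "cnj_vec v = (\<chi> i. cnj (v $ i))"

text \<open>
  By the symmetries of the curvature tensor $R(Z,\bar W,W,\bar Z)$ is a real number, so \<open>Re\<close>
  only changes the type.
\<close>

definition nonpositive_complex_sectional_curvature ::
  "('i, 'm, real^'n) atlas \<Rightarrow> ('i \<Rightarrow> real^'n \<Rightarrow> real^'n^'n) \<Rightarrow> bool" where
  "nonpositive_complex_sectional_curvature A g \<longleftrightarrow>
     (\<forall>i\<in>indices A. \<forall>x\<in>chart_image A i. \<forall>Z W.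
        Re (complex_curvature (g i) x Z (cnj_vec W) W (cnj_vec Z)) \<le> 0)"


section \<open>Hermitian and Kaehler metrics, RC-positivity\<close>

text \<open>
  In a chart, tangent vectors of type $(1,0)$ and real tangent vectors are both identified with
  vectors in $\mathbb{C}^n$. The entry \<open>H $ \<gamma> $ \<delta>\<close> of the matrix of a Hermitian metric is
  $h_{\gamma\bar\delta}$.
\<close>

definition hermitian_form :: "complex^'n^'n \<Rightarrow> complex^'n \<Rightarrow> complex^'n \<Rightarrow> complex" where
  "hermitian_form H u v = (\<Sum>\<alpha>\<in>UNIV. \<Sum>\<beta>\<in>UNIV. H $ \<alpha> $ \<beta> * u $ \<alpha> * cnj (v $ \<beta>))"

definition hermitian_metric ::
  "('i, 'm, complex^'n) atlas \<Rightarrow> ('i \<Rightarrow> complex^'n \<Rightarrow> complex^'n^'n) \<Rightarrow> bool" where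
  "hermitian_metric A h \<longleftrightarrow>
     (\<forall>i\<in>indices A.
        smooth_on (h i) (chart_image A i) \<and>
        (\<forall>z\<in>chart_image A i.
           (\<forall>\<alpha> \<beta>. h i z $ \<beta> $ \<alpha> = cnj (h i z $ \<alpha> $ \<beta>)) \<and>
           (\<forall>v. v \<noteq> 0 \<longrightarrow> Re (hermitian_form (h i z) v v) > 0))) \<and>
     (\<forall>i\<in>indices A. \<forall>j\<in>indices A. \<forall>z\<in>overlap A i j. \<forall>u v.
        hermitian_form (h i z) u v =
          hermitian_form (h j (transition A i j z))
            (frechet_derivative (transition A i j) (at z) u)
            (frechet_derivative (transition A i j) (at z) v))"

text \<open>
  The fundamental form $\omega(v,w) = g(Jv,w)$ with $g = \mathrm{Re}\,h$; a different
  normalisation multiplies it by a positive constant.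
\<close>

definition fundamental_form ::
  "(complex^'n \<Rightarrow> complex^'n^'n) \<Rightarrow> complex^'n \<Rightarrow> complex^'n \<Rightarrow> complex^'n \<Rightarrow> real" where
  "fundamental_form H z v w = Re (hermitian_form (H z) (\<i> *s v) w)"

text \<open>The exterior derivative of a 2-form, evaluated on constant vector fields.\<close>

definition ext_deriv2 ::
  "('a::real_normed_vector \<Rightarrow> 'a \<Rightarrow> 'a \<Rightarrow> real) \<Rightarrow> 'a \<Rightarrow> 'a \<Rightarrow> 'a \<Rightarrow> 'a \<Rightarrow> real" where
  "ext_deriv2 \<omega> x u v w =
     frechet_derivative (\<lambda>y. \<omega> y v w) (at x) u
     - frechet_derivative (\<lambda>y. \<omega> y u w) (at x) v
     + frechet_derivative (\<lambda>y. \<omega> y u v) (at x) w"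

definition kaehler_manifold ::
  "('i, 'm::{t2_space, second_countable_topology}, complex^'n) atlas \<Rightarrow>
   ('i \<Rightarrow> complex^'n \<Rightarrow> complex^'n^'n) \<Rightarrow> bool" where
  "kaehler_manifold A h \<longleftrightarrow>
     complex_manifold A \<and> hermitian_metric A h \<and>
     (\<forall>i\<in>indices A. \<forall>z\<in>chart_image A i. \<forall>u v w.
        ext_deriv2 (fundamental_form (h i)) z u v w = 0)"

definition wirtinger :: "'n \<Rightarrow> (complex^'n \<Rightarrow> complex) \<Rightarrow> complex^'n \<Rightarrow> complex" where
  "wirtinger \<alpha> F z =
     (frechet_derivative F (at z) (axis \<alpha> 1) - \<i> * frechet_derivative F (at z) (axis \<alpha> \<i>)) / 2"

definition wirtinger_bar :: "'n \<Rightarrow> (complex^'n \<Rightarrow> complex) \<Rightarrow> complex^'n \<Rightarrow> complex" where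
  "wirtinger_bar \<alpha> F z =
     (frechet_derivative F (at z) (axis \<alpha> 1) + \<i> * frechet_derivative F (at z) (axis \<alpha> \<i>)) / 2"

text \<open>
  The inverse $h^{\mu\bar\nu}$ satisfies $h^{\mu\bar\nu} h_{\gamma\bar\nu} = \delta^\mu_\gamma$,
  hence the transposed indices of \<open>matrix_inv\<close> below.
\<close>

definition chern_curvature_coeff ::
  "(complex^'n \<Rightarrow> complex^'n^'n) \<Rightarrow> complex^'n \<Rightarrow> 'n \<Rightarrow> 'n \<Rightarrow> 'n \<Rightarrow> 'n \<Rightarrow> complex" where
  "chern_curvature_coeff H z \<alpha> \<beta> \<gamma> \<delta> =
     - wirtinger \<alpha> (wirtinger_bar \<beta> (\<lambda>w. H w $ \<gamma> $ \<delta>)) z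
     + (\<Sum>\<mu>\<in>UNIV. \<Sum>\<nu>\<in>UNIV. matrix_inv (H z) $ \<nu> $ \<mu> *
          wirtinger \<alpha> (\<lambda>w. H w $ \<gamma> $ \<nu>) z * wirtinger_bar \<beta> (\<lambda>w. H w $ \<mu> $ \<delta>) z)"

definition chern_curvature ::
  "(complex^'n \<Rightarrow> complex^'n^'n) \<Rightarrow> complex^'n \<Rightarrow> complex^'n \<Rightarrow> complex^'n \<Rightarrow> complex" where
  "chern_curvature H z u v =
     (\<Sum>\<alpha>\<in>UNIV. \<Sum>\<beta>\<in>UNIV. \<Sum>\<gamma>\<in>UNIV. \<Sum>\<delta>\<in>UNIV.
        chern_curvature_coeff H z \<alpha> \<beta> \<gamma> \<delta> * u $ \<alpha> * cnj (u $ \<beta>) * v $ \<gamma> * cnj (v $ \<delta>))"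

text \<open>
  $R(u,\bar u,v,\bar v)$ is a real number because $h$ is Hermitian. The points of \<open>M\<close> are
  enumerated by their coordinates in each chart; since $R$ is a tensor, the condition at a point
  does not depend on the chart.
\<close>

definition uniformly_RC_positive ::
  "('i, 'm, complex^'n) atlas \<Rightarrow> ('i \<Rightarrow> complex^'n \<Rightarrow> complex^'n^'n) \<Rightarrow> bool" where
  "uniformly_RC_positive A h \<longleftrightarrow>
     (\<forall>i\<in>indices A. \<forall>z\<in>chart_image A i.
        \<exists>u. \<forall>v. v \<noteq> 0 \<longrightarrow> Re (chern_curvature (h i) z u v) > 0)"


section \<open>The underlying Riemannian manifold\<close>

text \<open>
  Real coordinates are the real parts (indices \<open>Inl\<close>) and imaginary parts (indices \<open>Inr\<close>) of the
  complex ones. The underlying Riemannian metric is $\mathrm{Re}\,h$; harmonicity is not affected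
  by a constant factor in the metric of the domain.
\<close>

definition realify :: "complex^'n \<Rightarrow> real^('n + 'n)" where
  "realify z = (\<chi> k. case k of Inl \<alpha> \<Rightarrow> Re (z $ \<alpha>) | Inr \<alpha> \<Rightarrow> Im (z $ \<alpha>))"

definition complexify :: "real^('n + 'n) \<Rightarrow> complex^'n" where
  "complexify x = (\<chi> \<alpha>. Complex (x $ Inl \<alpha>) (x $ Inr \<alpha>))"

definition underlying_atlas ::
  "('i, 'm, complex^'n) atlas \<Rightarrow> ('i, 'm, real^('n + 'n)) atlas" where
  "underlying_atlas A =
     \<lparr>indices = indices A, patch = patch A, chart = (\<lambda>i. realify \<circ> chart A i)\<rparr>"

definition underlying_metric ::
  "('i \<Rightarrow> complex^'n \<Rightarrow> complex^'n^'n) \<Rightarrow> 'i \<Rightarrow> real^('n + 'n) \<Rightarrow> real^('n + 'n)^('n + 'n)" where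
  "underlying_metric h i x =
     (\<chi> k l. Re (hermitian_form (h i (complexify x)) (complexify (axis k 1)) (complexify (axis l 1))))"


section \<open>Harmonic maps\<close>

definition local_rep ::
  "('i, 'm, 'e) atlas \<Rightarrow> ('j, 'p, 'd) atlas \<Rightarrow> ('m \<Rightarrow> 'p) \<Rightarrow> 'i \<Rightarrow> 'j \<Rightarrow> 'e \<Rightarrow> 'd" where
  "local_rep A B f i j = chart B j \<circ> f \<circ> chart_inv A i"

definition local_dom ::
  "('i, 'm, 'e) atlas \<Rightarrow> ('j, 'p, 'd) atlas \<Rightarrow> ('m \<Rightarrow> 'p) \<Rightarrow> 'i \<Rightarrow> 'j \<Rightarrow> 'e set" where
  "local_dom A B f i j = chart A i ` (patch A i \<inter> f -` patch B j)"

definition smooth_map ::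
  "('i, 'm::topological_space, real^'n) atlas \<Rightarrow> ('j, 'p::topological_space, real^'d) atlas \<Rightarrow>
   ('m \<Rightarrow> 'p) \<Rightarrow> bool" where
  "smooth_map A B f \<longleftrightarrow>
     continuous_on UNIV f \<and>
     (\<forall>i\<in>indices A. \<forall>j\<in>indices B. smooth_on (local_rep A B f i j) (local_dom A B f i j))"

text \<open>
  \<open>G\<close> and \<open>K\<close> are the matrices of the metrics of domain and target in charts, and \<open>F\<close> is the local
  representation of a map. A section \<open>s\<close> of the pull-back bundle $\mathscr{E}$ is a vector-valued
  function on the domain, and an $\mathscr{E}$-valued 1-form \<open>\<sigma>\<close> is the family of its components
  \<open>\<sigma> b\<close>. \<open>pullback_nabla K F a\<close> is $\nabla^{\mathscr{E}}_{\partial_a}$.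
\<close>

definition pullback_nabla ::
  "(real^'d \<Rightarrow> real^'d^'d) \<Rightarrow> (real^'n \<Rightarrow> real^'d) \<Rightarrow> 'n \<Rightarrow> (real^'n \<Rightarrow> real^'d) \<Rightarrow>
   real^'n \<Rightarrow> real^'d" where
  "pullback_nabla K F a s x = pd a s x +
     (\<chi> k. \<Sum>i\<in>UNIV. \<Sum>j\<in>UNIV. christoffel K (F x) i j k * pd a F x $ i * s x $ j)"

text \<open>
  The formal adjoint of $\nabla^{\mathscr{E}}$ for the $L^2$ inner products: since
  $dv = \sqrt{\det G}\,dx$ and $\nabla^{\mathscr{E}}$ is metric, integration by parts of
  $\int G^{ab}\langle\sigma_b, \nabla^{\mathscr{E}}_a s\rangle \sqrt{\det G}\,dx$ gives
  $(\nabla^{\mathscr{E}})^*\sigma =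
    -(\det G)^{-1/2}\,\nabla^{\mathscr{E}}_a(\sqrt{\det G}\,G^{ab}\sigma_b)$.
\<close>

definition pullback_nabla_adjoint ::
  "(real^'n \<Rightarrow> real^'n^'n) \<Rightarrow> (real^'d \<Rightarrow> real^'d^'d) \<Rightarrow> (real^'n \<Rightarrow> real^'d) \<Rightarrow>
   ('n \<Rightarrow> real^'n \<Rightarrow> real^'d) \<Rightarrow> real^'n \<Rightarrow> real^'d" where
  "pullback_nabla_adjoint G K F \<sigma> x =
     - (1 / sqrt (det (G x))) *\<^sub>R
       (\<Sum>a\<in>UNIV. pullback_nabla K F a
          (\<lambda>y. sqrt (det (G y)) *\<^sub>R (\<Sum>b\<in>UNIV. (matrix_inv (G y) $ a $ b) *\<^sub>R \<sigma> b y)) x)"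

definition harmonic_map ::
  "('i, 'm::topological_space, real^'n) atlas \<Rightarrow> ('i \<Rightarrow> real^'n \<Rightarrow> real^'n^'n) \<Rightarrow>
   ('j, 'p::topological_space, real^'d) atlas \<Rightarrow> ('j \<Rightarrow> real^'d \<Rightarrow> real^'d^'d) \<Rightarrow>
   ('m \<Rightarrow> 'p) \<Rightarrow> bool" where
  "harmonic_map A G B K f \<longleftrightarrow>
     smooth_map A B f \<and>
     (\<forall>i\<in>indices A. \<forall>j\<in>indices B. \<forall>x\<in>local_dom A B f i j.
        pullback_nabla_adjoint (G i) (K j) (local_rep A B f i j)
          (\<lambda>b. pd b (local_rep A B f i j)) x = 0)"

end

theory Submission
  imports Defs "HOL-Complex_Analysis.Cauchy_Integral_Formula"
begin

text \<open>
  The divergence of the $(2,0)$-part of the pulled back metric is a 1-form on \<open>M\<close>. For a harmonic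
  map, the Kaehler condition and the sign of the complex sectional curvature show that the
  divergence of this 1-form is a sum of non-negative terms, one of which is the squared norm of
  $f_{\alpha\bar\beta}$. Integration over the compact manifold \<open>M\<close> gives $f_{\alpha\bar\beta} = 0$. If
  \<open>f\<close> were not constant, $|\partial f(W)|^2 / |W|^2_h$ would have a positive maximum at some tangent
  vector \<open>W\<close>. Take \<open>u\<close> at its base point with $R(u,\bar u,v,\bar v) > 0$ for all \<open>v\<close> and extend \<open>W\<close> to a
  local holomorphic field whose covariant derivative along \<open>u\<close> vanishes there: along
  $u,\bar u$ the numerator then has a non-negative second derivative, because \<open>f\<close> is
  pluriharmonic, whereas that of the denominator is $-R(u,\bar u,W,\bar W) < 0$, which
  contradicts maximality.
\<close>

section \<open>Calculus of smooth functions\<close>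

text \<open>Derivatives are taken along constant coordinate directions, complexified as pairs of
  real ones because the map is only real differentiable; constant directions commute, so commutators
  contain no bracket terms. The Christoffel symbols of the domain never have to be introduced: an
  antiholomorphic derivative of a (2,0)-tensor is again tensorial under holomorphic changes of
  coordinates, and the Kaehler condition makes the volume density times the inverse metric
  divergence free. The obstacle is the passage from charts to \<open>M\<close>; it is met by
  expressing the 1-form through unitary frames and by comparing integrals of two charts only where
  the supports meet. The curvature of \<open>N\<close> enters twice with the same sign. In the
  Bochner formula it appears after an exchange of the last two arguments. In the second derivative
  of the numerator it appears in another order of arguments, which the Bianchi identity repairs
  because pluriharmonicity removes one of its three terms. The maximum principle is applied to
  numerator minus \<open>c\<close> times denominator, \<open>c\<close> being the maximal ratio,
  rather than to the ratio itself.\<close>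

definition dd :: "'a::real_normed_vector \<Rightarrow> ('a \<Rightarrow> 'b::real_normed_vector) \<Rightarrow> 'a \<Rightarrow> 'b" where
  "dd v F x = frechet_derivative F (at x) v"

lemma dd_eqI: "(F has_derivative F') (at x) \<Longrightarrow> dd v F x = F' v"
  unfolding dd_def using frechet_derivative_at by metis

lemma has_derivative_dd: "F differentiable at x \<Longrightarrow> (F has_derivative (\<lambda>v. dd v F x)) (at x)"
  unfolding dd_def using frechet_derivative_works by (metis eta_contract_eq)

lemma linear_dd: "F differentiable at x \<Longrightarrow> linear (\<lambda>v. dd v F x)"
  unfolding dd_def using linear_frechet_derivative by (metis eta_contract_eq)

lemma dd_add_dir: "F differentiable at x \<Longrightarrow> dd (v + w) F x = dd v F x + dd w F x"
  using linear_add[OF linear_dd] .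

lemma dd_scaleR_dir: "F differentiable at x \<Longrightarrow> dd (r *\<^sub>R v) F x = r *\<^sub>R dd v F x"
  using linear_cmul[OF linear_dd] .

lemma dd_cong:
  assumes "open S" "x \<in> S" "\<And>y. y \<in> S \<Longrightarrow> F y = G y"
  shows "dd v F x = dd v G x"
proof (cases "F differentiable at x")
  case True
  then have "(G has_derivative (\<lambda>v. dd v F x)) (at x)"
    using has_derivative_transform_within_open[OF has_derivative_dd assms(1,2)] assms(3) by metis
  then show ?thesis using dd_eqI by metis
next
  case False
  have "\<not> G differentiable at x"
  proof
    assume "G differentiable at x"
    then have "(F has_derivative (\<lambda>v. dd v G x)) (at x)"
      using has_derivative_transform_within_open[OF has_derivative_dd assms(1,2)] assms(3) by metis
    with False show False by (auto simp: differentiable_def)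
  qed
  \<comment> \<open>\<open>frechet_derivative\<close> is a choice from this predicate, which is
    empty for both functions here.\<close>
  then have "(\<lambda>f'. (F has_derivative f') (at x)) = (\<lambda>f'. (G has_derivative f') (at x))"
    using False by (auto simp: differentiable_def)
  then show ?thesis unfolding dd_def frechet_derivative_def by simp
qed

lemma differentiable_cong_open:
  assumes "open S" "x \<in> S" "\<And>y. y \<in> S \<Longrightarrow> f y = g y"
  shows "f differentiable at x \<longleftrightarrow> g differentiable at x"
proof -
  have "g differentiable at x" if "f differentiable at x" "\<And>y. y \<in> S \<Longrightarrow> f y = g y" for f g
    using has_derivative_transform_within_open[OF has_derivative_dd[OF that(1)] assms(1,2) that(2)]
    by (auto simp: differentiable_def)
  then show ?thesis using assms(3) by metis
qed

section \<open>Closure properties of \<open>k\<close> times differentiable functions\<close>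

lemma times_diff_on_Suc:
  "times_diff_on (Suc k) f S \<longleftrightarrow> (\<forall>x\<in>S. f differentiable at x) \<and> (\<forall>v. times_diff_on k (dd v f) S)"
  by (simp add: dd_def[abs_def])

declare times_diff_on.simps(2)[simp del]

lemma times_diff_on_cong:
  assumes "open S" "\<And>x. x \<in> S \<Longrightarrow> f x = g x"
  shows "times_diff_on k f S \<longleftrightarrow> times_diff_on k g S"
  using assms(2)
proof (induction k arbitrary: f g)
  case 0
  then show ?case by (simp cong: continuous_on_cong)
next
  case (Suc k)
  have "f differentiable at x \<longleftrightarrow> g differentiable at x" if "x \<in> S" for x
    using that Suc.prems differentiable_cong_open[OF \<open>open S\<close> that, of f g] by blast
  moreover have "times_diff_on k (dd v f) S \<longleftrightarrow> times_diff_on k (dd v g) S" for v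
    by (rule Suc.IH) (use dd_cong[OF assms(1)] Suc.prems in metis)
  ultimately show ?case by (simp add: times_diff_on_Suc)
qed

text \<open>Lets a proof supply an explicit derivative that is correct only on \<open>S\<close>, as
  the chain and product rules produce it.\<close>

lemma times_diff_on_SucI:
  assumes "open S" "\<And>x. x \<in> S \<Longrightarrow> (f has_derivative f' x) (at x)"
    and "\<And>v. times_diff_on k (\<lambda>x. f' x v) S"
  shows "times_diff_on (Suc k) f S"
  unfolding times_diff_on_Suc
proof (intro conjI ballI allI)
  show "f differentiable at x" if "x \<in> S" for x
    using differentiableI[OF assms(2)[OF that]] .
  show "times_diff_on k (dd v f) S" for v
    using times_diff_on_cong[OF assms(1), of "dd v f" "\<lambda>x. f' x v" k] assms(3) dd_eqI[OF assms(2)] by blast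
qed

lemma times_diff_on_SucD: "times_diff_on (Suc k) f S \<Longrightarrow> times_diff_on k f S"
proof (induction k arbitrary: f)
  case 0
  then show ?case
    by (auto simp: times_diff_on_Suc intro!: continuous_at_imp_continuous_on differentiable_imp_continuous_within)
next
  case (Suc k)
  then show ?case unfolding times_diff_on_Suc[of "Suc k"] times_diff_on_Suc[of k] by blast
qed

lemma times_diff_on_subset: "times_diff_on k f S \<Longrightarrow> T \<subseteq> S \<Longrightarrow> times_diff_on k f T"
  by (induction k arbitrary: f) (auto simp: times_diff_on_Suc intro: continuous_on_subset)

lemma times_diff_on_const: "times_diff_on k (\<lambda>_. c) S"
proof (induction k arbitrary: c)
  case (Suc k)
  have "dd v (\<lambda>_. c) = (\<lambda>_. 0)" for v :: 'a by (simp add: dd_def fun_eq_iff)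
  then show ?case using Suc by (simp add: times_diff_on_Suc)
qed simp

lemma times_diff_on_bounded_linear:
  assumes "bounded_linear f" shows "times_diff_on k f S"
proof (cases k)
  case 0
  then show ?thesis using assms by (simp add: linear_continuous_on)
next
  case (Suc m)
  have "dd v f = (\<lambda>_. f v)" for v
    using dd_eqI[OF bounded_linear_imp_has_derivative[OF assms]] by (simp add: fun_eq_iff)
  then show ?thesis using assms times_diff_on_const Suc
    by (auto simp: times_diff_on_Suc bounded_linear_imp_differentiable)
qed

lemma times_diff_on_add:
  assumes "open S" "times_diff_on k f S" "times_diff_on k g S"
  shows "times_diff_on k (\<lambda>x. f x + g x) S"
  using assms(2,3)
proof (induction k arbitrary: f g)
  case 0
  then show ?case by (simp add: continuous_on_add)
next
  case (Suc k)
  show ?case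
  proof (rule times_diff_on_SucI[OF assms(1)])
    show "((\<lambda>x. f x + g x) has_derivative (\<lambda>v. dd v f x + dd v g x)) (at x)" if "x \<in> S" for x
      using that Suc.prems by (intro has_derivative_add has_derivative_dd) (auto simp: times_diff_on_Suc)
    show "times_diff_on k (\<lambda>x. dd v f x + dd v g x) S" for v
      using Suc by (auto simp: times_diff_on_Suc)
  qed
qed

text \<open>The derivative is a sum of two products of the same kind, so the induction hypothesis
  applies to each. The abstract form serves multiplication, scaling and inner products at
  once.\<close>

lemma (in bounded_bilinear) times_diff_on:
  assumes "open S" "times_diff_on k f S" "times_diff_on k g S"
  shows "times_diff_on k (\<lambda>x. prod (f x) (g x)) S"
  using assms(2,3)
proof (induction k arbitrary: f g)
  case 0
  then show ?case by (simp add: continuous_on)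
next
  case (Suc k)
  have D: "((\<lambda>x. prod (f x) (g x)) has_derivative (\<lambda>v. prod (f x) (dd v g x) + prod (dd v f x) (g x))) (at x)"
    if "x \<in> S" for x
    using that Suc.prems by (intro FDERIV has_derivative_dd) (auto simp: times_diff_on_Suc)
  have "times_diff_on k (\<lambda>x. prod (f x) (dd v g x) + prod (dd v f x) (g x)) S" for v
    using Suc.prems times_diff_on_SucD[OF Suc.prems(1)] times_diff_on_SucD[OF Suc.prems(2)]
    by (intro times_diff_on_add[OF assms(1)] Suc.IH) (auto simp: times_diff_on_Suc)
  then show ?case using times_diff_on_SucI[OF assms(1) D] by blast
qed

lemma times_diff_on_sum:
  assumes "open S" "\<And>i. i \<in> I \<Longrightarrow> times_diff_on k (f i) S"
  shows "times_diff_on k (\<lambda>x. \<Sum>i\<in>I. f i x) S"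
  using assms(2)
proof (induction I rule: infinite_finite_induct)
  case (insert i I)
  then show ?case using times_diff_on_add[OF assms(1), of k "f i" "\<lambda>x. \<Sum>i\<in>I. f i x"] by simp
qed (simp_all add: times_diff_on_const)

text \<open>In the chain rule the point and the direction of the derivative of \<open>f\<close> both
  depend on \<open>x\<close>. Expanding the direction in a basis leaves products of scalar functions
  with derivatives of \<open>f\<close> in fixed directions, to which the induction hypothesis
  applies; this is why the middle space is Euclidean.\<close>

lemma times_diff_on_compose:
  fixes f :: "'b::euclidean_space \<Rightarrow> 'c::real_normed_vector" and g :: "'a::real_normed_vector \<Rightarrow> 'b"
  assumes "open S" "open T" "g ` S \<subseteq> T" "times_diff_on k f T" "times_diff_on k g S"
  shows "times_diff_on k (\<lambda>x. f (g x)) S"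
  using assms(3-5)
proof (induction k arbitrary: f)
  case 0
  then show ?case by (auto intro: continuous_on_compose2)
next
  case (Suc k)
  have df: "f differentiable at (g x)" and dg: "g differentiable at x" if "x \<in> S" for x
    using that Suc.prems by (auto simp: times_diff_on_Suc)
  have D: "((\<lambda>x. f (g x)) has_derivative (\<lambda>v. dd (dd v g x) f (g x))) (at x)" if "x \<in> S" for x
    using has_derivative_compose[OF has_derivative_dd[OF dg[OF that]] has_derivative_dd[OF df[OF that]]] .
  have E: "dd (dd v g x) f (g x) = (\<Sum>b\<in>Basis. (dd v g x \<bullet> b) *\<^sub>R dd b f (g x))" if "x \<in> S" for x v
  proof -
    have "dd (dd v g x) f (g x) = dd (\<Sum>b\<in>Basis. (dd v g x \<bullet> b) *\<^sub>R b) f (g x)"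
      by (simp add: euclidean_representation)
    also have "\<dots> = (\<Sum>b\<in>Basis. (dd v g x \<bullet> b) *\<^sub>R dd b f (g x))"
      unfolding linear_sum[OF linear_dd[OF df[OF that]]] linear_cmul[OF linear_dd[OF df[OF that]]] ..
    finally show ?thesis .
  qed
  have "times_diff_on k (\<lambda>x. \<Sum>b\<in>Basis. (dd v g x \<bullet> b) *\<^sub>R dd b f (g x)) S" for v
    using Suc.prems times_diff_on_SucD[OF Suc.prems(3)]
    by (intro times_diff_on_sum bounded_bilinear.times_diff_on[OF bounded_bilinear_scaleR]
        bounded_bilinear.times_diff_on[OF bounded_bilinear_inner] assms(1) times_diff_on_const Suc.IH)
      (auto simp: times_diff_on_Suc)
  moreover have "times_diff_on k (\<lambda>x. dd (dd v g x) f (g x)) S \<longleftrightarrow>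
      times_diff_on k (\<lambda>x. \<Sum>b\<in>Basis. (dd v g x \<bullet> b) *\<^sub>R dd b f (g x)) S" for v
    by (rule times_diff_on_cong[OF assms(1) E])
  ultimately show ?case using times_diff_on_SucI[OF assms(1) D] by blast
qed

text \<open>The derivative is a polynomial in the inverse itself and in \<open>dd v f\<close>, so
  the induction hypothesis is needed only for the same \<open>f\<close>. The square root below is
  treated in the same way.\<close>

lemma times_diff_on_inverse:
  fixes f :: "'a::real_normed_vector \<Rightarrow> 'b::real_normed_field"
  assumes "open S" "times_diff_on k f S" "\<And>x. x \<in> S \<Longrightarrow> f x \<noteq> 0"
  shows "times_diff_on k (\<lambda>x. inverse (f x)) S"
  using assms(2)
proof (induction k)
  case 0
  then show ?case using assms by (auto intro!: continuous_on_inverse)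
next
  case (Suc k)
  have D: "((\<lambda>x. inverse (f x)) has_derivative (\<lambda>v. - (inverse (f x) * dd v f x * inverse (f x)))) (at x)"
    if "x \<in> S" for x
    using that Suc.prems assms by (intro Deriv.has_derivative_inverse has_derivative_dd) (auto simp: times_diff_on_Suc)
  have 1: "times_diff_on k (\<lambda>x. inverse (f x)) S" using Suc times_diff_on_SucD by auto
  then have "times_diff_on k (\<lambda>x. (- 1) * (inverse (f x) * dd v f x * inverse (f x))) S" for v
    using Suc.prems by (intro bounded_bilinear.times_diff_on[OF bounded_bilinear_mult] assms times_diff_on_const)
       (auto simp: times_diff_on_Suc)
  then show ?case using times_diff_on_SucI[OF assms(1) D] by simp
qed

lemma times_diff_on_sqrt:
  fixes f :: "'a::real_normed_vector \<Rightarrow> real"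
  assumes "open S" "times_diff_on k f S" "\<And>x. x \<in> S \<Longrightarrow> f x > 0"
  shows "times_diff_on k (\<lambda>x. sqrt (f x)) S"
  using assms(2)
proof (induction k)
  case 0
  then show ?case using assms by (auto intro!: continuous_on_real_sqrt)
next
  case (Suc k)
  have D: "((\<lambda>x. sqrt (f x)) has_derivative (\<lambda>v. inverse (sqrt (f x)) / 2 * dd v f x)) (at x)"
    if "x \<in> S" for x
  proof -
    have "(sqrt has_derivative (\<lambda>y. inverse (sqrt (f x)) / 2 * y)) (at (f x))"
      using DERIV_real_sqrt[OF assms(3)[OF that]] unfolding has_field_derivative_def .
    moreover have "f differentiable at x" using Suc.prems that by (auto simp: times_diff_on_Suc)
    ultimately show ?thesis using has_derivative_compose[OF has_derivative_dd] by blast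
  qed
  have 1: "times_diff_on k (\<lambda>x. sqrt (f x)) S" using Suc times_diff_on_SucD by auto
  have "times_diff_on k (\<lambda>x. (inverse (sqrt (f x)) * (1 / 2)) * dd v f x) S" for v
  proof (intro bounded_bilinear.times_diff_on[OF bounded_bilinear_mult] times_diff_on_inverse assms(1) times_diff_on_const 1)
    show "sqrt (f x) \<noteq> 0" if "x \<in> S" for x using assms(3)[OF that] by simp
    show "times_diff_on k (dd v f) S" using Suc.prems by (simp add: times_diff_on_Suc)
  qed
  then show ?case using times_diff_on_SucI[OF assms(1) D] by simp
qed

section \<open>Closure properties of smooth functions\<close>

named_theorems smooth_intros

lemma smooth_on_differentiable: "smooth_on f S \<Longrightarrow> x \<in> S \<Longrightarrow> f differentiable at x"
  unfolding smooth_on_def using times_diff_on_Suc by metis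

lemma smooth_on_dd [smooth_intros]: "smooth_on f S \<Longrightarrow> smooth_on (dd v f) S"
  unfolding smooth_on_def using times_diff_on_Suc by metis

lemma smooth_on_dd' [smooth_intros]: "smooth_on f S \<Longrightarrow> smooth_on (\<lambda>x. dd v f x) S"
  using smooth_on_dd .

lemma smooth_on_continuous_on: "smooth_on f S \<Longrightarrow> continuous_on S f"
  unfolding smooth_on_def by (metis times_diff_on.simps(1))

lemma smooth_on_cong: "open S \<Longrightarrow> (\<And>x. x \<in> S \<Longrightarrow> f x = g x) \<Longrightarrow> smooth_on f S \<longleftrightarrow> smooth_on g S"
  unfolding smooth_on_def using times_diff_on_cong by blast

lemma smooth_on_subset: "smooth_on f S \<Longrightarrow> T \<subseteq> S \<Longrightarrow> smooth_on f T"
  unfolding smooth_on_def using times_diff_on_subset by blast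

lemma smooth_on_const [smooth_intros]: "smooth_on (\<lambda>_. c) S"
  by (simp add: smooth_on_def times_diff_on_const)

lemma smooth_on_bounded_linear: "bounded_linear f \<Longrightarrow> smooth_on f S"
  by (simp add: smooth_on_def times_diff_on_bounded_linear)

lemma smooth_on_add [smooth_intros]:
  "open S \<Longrightarrow> smooth_on f S \<Longrightarrow> smooth_on g S \<Longrightarrow> smooth_on (\<lambda>x. f x + g x) S"
  by (simp add: smooth_on_def times_diff_on_add)

lemma smooth_on_sum [smooth_intros]:
  "open S \<Longrightarrow> (\<And>i. i \<in> I \<Longrightarrow> smooth_on (f i) S) \<Longrightarrow> smooth_on (\<lambda>x. \<Sum>i\<in>I. f i x) S"
  by (simp add: smooth_on_def times_diff_on_sum)

lemma smooth_on_compose: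
  fixes f :: "'b::euclidean_space \<Rightarrow> 'c::real_normed_vector" and g :: "'a::real_normed_vector \<Rightarrow> 'b"
  shows "open S \<Longrightarrow> open T \<Longrightarrow> smooth_on f T \<Longrightarrow> smooth_on g S \<Longrightarrow> (\<And>x. x \<in> S \<Longrightarrow> g x \<in> T) \<Longrightarrow>
    smooth_on (\<lambda>x. f (g x)) S"
  unfolding smooth_on_def using times_diff_on_compose[of S T g _ f] by blast

lemma (in bounded_bilinear) smooth_on:
  "open S \<Longrightarrow> smooth_on f S \<Longrightarrow> smooth_on g S \<Longrightarrow> smooth_on (\<lambda>x. prod (f x) (g x)) S"
  by (simp add: smooth_on_def times_diff_on)

lemmas smooth_on_mult [smooth_intros] = bounded_bilinear.smooth_on[OF bounded_bilinear_mult]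
lemmas smooth_on_scaleR [smooth_intros] = bounded_bilinear.smooth_on[OF bounded_bilinear_scaleR]
lemmas smooth_on_inner [smooth_intros] = bounded_bilinear.smooth_on[OF bounded_bilinear_inner]

text \<open>A linear outer map commutes with differentiation, so the induction does not pass through
  the basis expansion of \<open>smooth_on_compose\<close> and works for a middle space of any
  dimension.\<close>

lemma (in bounded_linear) smooth_on:
  assumes "open S" "smooth_on g S"
  shows "smooth_on (\<lambda>x. f (g x)) S"
proof -
  have "times_diff_on k g S \<Longrightarrow> times_diff_on k (\<lambda>x. f (g x)) S" for k
  proof (induction k arbitrary: g)
    case 0
    then show ?case by (simp add: continuous_on)
  next
    case (Suc k)
    have D: "((\<lambda>x. f (g x)) has_derivative (\<lambda>v. f (dd v g x))) (at x)" if "x \<in> S" for x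
      using that Suc.prems by (intro has_derivative has_derivative_dd) (auto simp: times_diff_on_Suc)
    have "times_diff_on k (\<lambda>x. f (dd v g x)) S" for v
      using Suc by (auto simp: times_diff_on_Suc)
    then show ?case using times_diff_on_SucI[OF assms(1) D] by blast
  qed
  then show ?thesis using assms(2) by (simp add: smooth_on_def)
qed

lemmas smooth_on_cnj [smooth_intros] = bounded_linear.smooth_on[OF bounded_linear_cnj]
lemmas smooth_on_of_real [smooth_intros] = bounded_linear.smooth_on[OF bounded_linear_of_real]
lemmas smooth_on_Re [smooth_intros] = bounded_linear.smooth_on[OF bounded_linear_Re]
lemmas smooth_on_vec_nth [smooth_intros] = bounded_linear.smooth_on[OF bounded_linear_vec_nth]
lemmas smooth_on_minus [smooth_intros] = bounded_linear.smooth_on[OF bounded_linear_minus[OF bounded_linear_ident]]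

lemma smooth_on_diff [smooth_intros]:
  "open S \<Longrightarrow> smooth_on f S \<Longrightarrow> smooth_on g S \<Longrightarrow> smooth_on (\<lambda>x. f x - g x) S"
  using smooth_on_add[of S f "\<lambda>x. - g x"] smooth_on_minus[of S g] by simp

lemma smooth_on_id [smooth_intros]: "smooth_on (\<lambda>x. x) S"
  by (simp add: smooth_on_bounded_linear bounded_linear_ident)

lemma smooth_on_prod [smooth_intros]:
  fixes f :: "'i \<Rightarrow> 'a::real_normed_vector \<Rightarrow> 'b::{real_normed_algebra,comm_ring_1}"
  assumes "open S" "\<And>i. i \<in> I \<Longrightarrow> smooth_on (f i) S"
  shows "smooth_on (\<lambda>x. \<Prod>i\<in>I. f i x) S"
  using assms(2)
proof (induction I rule: infinite_finite_induct)
  case (insert i I)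
  then show ?case using smooth_on_mult[OF assms(1), of "f i" "\<lambda>x. \<Prod>i\<in>I. f i x"] by simp
qed (simp_all add: smooth_on_const)

lemma smooth_on_inverse [smooth_intros]:
  fixes f :: "'a::real_normed_vector \<Rightarrow> 'b::real_normed_field"
  shows "open S \<Longrightarrow> smooth_on f S \<Longrightarrow> (\<And>x. x \<in> S \<Longrightarrow> f x \<noteq> 0) \<Longrightarrow> smooth_on (\<lambda>x. inverse (f x)) S"
  unfolding smooth_on_def using times_diff_on_inverse by blast

lemma smooth_on_divide [smooth_intros]:
  fixes f :: "'a::real_normed_vector \<Rightarrow> 'b::real_normed_field"
  shows "open S \<Longrightarrow> smooth_on f S \<Longrightarrow> smooth_on g S \<Longrightarrow> (\<And>x. x \<in> S \<Longrightarrow> g x \<noteq> 0) \<Longrightarrow> smooth_on (\<lambda>x. f x / g x) S"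
  unfolding divide_inverse by (intro smooth_on_inverse smooth_on_mult)

lemma smooth_on_sqrt [smooth_intros]:
  fixes f :: "'a::real_normed_vector \<Rightarrow> real"
  shows "open S \<Longrightarrow> smooth_on f S \<Longrightarrow> (\<And>x. x \<in> S \<Longrightarrow> f x > 0) \<Longrightarrow> smooth_on (\<lambda>x. sqrt (f x)) S"
  unfolding smooth_on_def using times_diff_on_sqrt by blast

lemma smooth_on_vec:
  fixes f :: "'a::real_normed_vector \<Rightarrow> 'b::euclidean_space^'n"
  assumes "open S" "\<And>i. smooth_on (\<lambda>x. f x $ i) S"
  shows "smooth_on f S"
proof -
  have "linear (axis i :: 'b \<Rightarrow> 'b^'n)" for i
    by (rule linearI) (simp_all add: axis_def vec_eq_iff)
  then have "smooth_on (\<lambda>x. axis i (f x $ i) :: 'b^'n) S" for i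
    using bounded_linear.smooth_on[OF linear_conv_bounded_linear[THEN iffD1] assms(1) assms(2)] by blast
  then have "smooth_on (\<lambda>x. \<Sum>i\<in>UNIV. axis i (f x $ i)) S"
    by (rule smooth_on_sum[OF assms(1)])
  moreover have "(\<Sum>i\<in>UNIV. axis i (f x $ i)) = f x" for x
    by (simp add: vec_eq_iff axis_def sum.delta)
  ultimately show ?thesis by simp
qed

lemma smooth_on_vec_lambda [smooth_intros]:
  fixes f :: "'n::finite \<Rightarrow> 'a::real_normed_vector \<Rightarrow> 'b::euclidean_space"
  assumes "open S" "\<And>i. smooth_on (f i) S"
  shows "smooth_on (\<lambda>x. \<chi> i. f i x) S"
  by (rule smooth_on_vec) (simp_all add: assms)

lemma smooth_on_det [smooth_intros]:
  fixes M :: "'a::real_normed_vector \<Rightarrow> ('b::{real_normed_field,euclidean_space})^'n^'n"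
  assumes "open S" "\<And>i j. smooth_on (\<lambda>x. M x $ i $ j) S"
  shows "smooth_on (\<lambda>x. det (M x)) S"
  unfolding det_def by (rule smooth_on_sum smooth_on_mult smooth_on_const smooth_on_prod assms)+

lemma
  fixes A :: "'b::field^'n^'n"
  assumes "det A \<noteq> 0"
  shows matrix_inv_right: "A ** matrix_inv A = mat 1" and matrix_inv_left: "matrix_inv A ** A = mat 1"
proof -
  have "\<exists>A'. A ** A' = mat 1 \<and> A' ** A = mat 1"
    using assms unfolding invertible_det_nz[symmetric] invertible_def .
  then have "A ** matrix_inv A = mat 1 \<and> matrix_inv A ** A = mat 1"
    unfolding matrix_inv_def by (rule someI_ex)
  then show "A ** matrix_inv A = mat 1" "matrix_inv A ** A = mat 1" by blast+
qed

text \<open>Cramer's rule for the columns of the identity. It exhibits each entry as a quotient of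
  polynomials in the entries of \<open>A\<close>, from which smoothness of \<open>matrix_inv\<close>
  is read off.\<close>

lemma matrix_inv_cramer:
  fixes A :: "'b::field^'n^'n"
  assumes "det A \<noteq> 0"
  shows "matrix_inv A $ i $ j = det (\<chi> k l. if l = i then axis j 1 $ k else A $ k $ l) / det A"
proof -
  have "A ** matrix_inv A = mat 1"
    using matrix_inv_right[OF assms] .
  then have "A *v (matrix_inv A *v axis j 1) = axis j 1"
    by (simp add: matrix_vector_mul_assoc)
  then have "matrix_inv A *v axis j 1 = (\<chi> i. det (\<chi> k l. if l = i then axis j 1 $ k else A $ k $ l) / det A)"
    by (simp only: cramer[OF assms])
  moreover have "(matrix_inv A *v axis j 1) $ i = matrix_inv A $ i $ j"
    by (simp add: matrix_vector_mul_component matrix_vector_mult_def axis_def if_distrib cong: if_cong)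
  ultimately show ?thesis by simp
qed

lemma smooth_on_matrix_inv [smooth_intros]:
  fixes M :: "'a::real_normed_vector \<Rightarrow> ('b::{real_normed_field,euclidean_space})^'n^'n"
  assumes "open S" "\<And>i j. smooth_on (\<lambda>x. M x $ i $ j) S" "\<And>x. x \<in> S \<Longrightarrow> det (M x) \<noteq> 0"
  shows "smooth_on (\<lambda>x. matrix_inv (M x) $ i $ j) S"
proof -
  have "smooth_on (\<lambda>x. det (\<chi> k l. if l = i then axis j 1 $ k else M x $ k $ l) / det (M x)) S"
  proof (intro smooth_on_divide smooth_on_det assms)
    fix k l
    show "smooth_on (\<lambda>x. (\<chi> k l. if l = i then axis j 1 $ k else M x $ k $ l) $ k $ l) S"
      using assms(2)[of k l] smooth_on_const[of "axis j (1::'b) $ k" S] by (cases "l = i") simp_all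
  qed
  also have "?this \<longleftrightarrow> ?thesis"
    by (rule smooth_on_cong[OF assms(1)]) (simp only: matrix_inv_cramer[OF assms(3)])
  finally show ?thesis .
qed

section \<open>Rules for directional derivatives\<close>

lemma dd_const [simp]: "dd v (\<lambda>_. c) x = 0"
  by (simp add: dd_def)

lemma dd_add:
  "f differentiable at x \<Longrightarrow> g differentiable at x \<Longrightarrow> dd v (\<lambda>x. f x + g x) x = dd v f x + dd v g x"
  by (rule dd_eqI) (intro has_derivative_add has_derivative_dd)

lemma dd_diff:
  "f differentiable at x \<Longrightarrow> g differentiable at x \<Longrightarrow> dd v (\<lambda>x. f x - g x) x = dd v f x - dd v g x"
  by (rule dd_eqI) (intro has_derivative_diff has_derivative_dd)

lemma dd_sum:
  "(\<And>i. i \<in> I \<Longrightarrow> f i differentiable at x) \<Longrightarrow> dd v (\<lambda>x. \<Sum>i\<in>I. f i x) x = (\<Sum>i\<in>I. dd v (f i) x)"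
  by (rule dd_eqI) (intro has_derivative_sum has_derivative_dd)

lemma (in bounded_bilinear) dd_prod:
  "f differentiable at x \<Longrightarrow> g differentiable at x \<Longrightarrow>
    dd v (\<lambda>x. prod (f x) (g x)) x = prod (f x) (dd v g x) + prod (dd v f x) (g x)"
  by (rule dd_eqI) (intro FDERIV has_derivative_dd)

lemmas dd_mult = bounded_bilinear.dd_prod[OF bounded_bilinear_mult]
lemmas dd_scaleR = bounded_bilinear.dd_prod[OF bounded_bilinear_scaleR]

lemma (in bounded_linear) dd_apply:
  "g differentiable at x \<Longrightarrow> dd v (\<lambda>x. f (g x)) x = f (dd v g x)"
  by (rule dd_eqI) (intro has_derivative has_derivative_dd)

lemma (in bounded_linear) differentiable_apply:
  "g differentiable at x \<Longrightarrow> (\<lambda>x. f (g x)) differentiable at x"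
  unfolding differentiable_def using has_derivative by blast

lemma dd_bounded_linear: "bounded_linear f \<Longrightarrow> dd v f x = f v"
  using dd_eqI[OF bounded_linear_imp_has_derivative] .

lemmas dd_cnj = bounded_linear.dd_apply[OF bounded_linear_cnj]
lemmas dd_of_real = bounded_linear.dd_apply[OF bounded_linear_of_real]
lemmas dd_Re = bounded_linear.dd_apply[OF bounded_linear_Re]
lemmas dd_Im = bounded_linear.dd_apply[OF bounded_linear_Im]
lemmas dd_vec_nth = bounded_linear.dd_apply[OF bounded_linear_vec_nth]

lemma dd_compose:
  assumes "g differentiable at x" "f differentiable at (g x)"
  shows "dd v (\<lambda>x. f (g x)) x = dd (dd v g x) f (g x)"
  by (rule dd_eqI) (rule has_derivative_compose[OF has_derivative_dd[OF assms(1)] has_derivative_dd[OF assms(2)]])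

lemma dd_minus_dir: "F differentiable at x \<Longrightarrow> dd (- v) F x = - dd v F x"
  using linear_neg[OF linear_dd] .

section \<open>Symmetry of second derivatives\<close>

lemma has_vector_derivative_line:
  assumes "F differentiable at (x + t *\<^sub>R v)"
  shows "((\<lambda>t. F (x + t *\<^sub>R v)) has_vector_derivative dd v F (x + t *\<^sub>R v)) (at t)"
proof -
  have "((\<lambda>t. x + t *\<^sub>R v) has_derivative (\<lambda>h. h *\<^sub>R v)) (at t)"
    by (auto intro!: derivative_eq_intros)
  from has_derivative_compose[OF this has_derivative_dd[OF assms]]
  show ?thesis by (simp add: has_vector_derivative_def dd_scaleR_dir[OF assms])
qed

text \<open>Two applications of the mean value theorem, along \<open>u\<close> to a difference in
  \<open>v\<close> and along \<open>v\<close> to the derivative. The left-hand side is symmetric in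
  \<open>u\<close> and \<open>v\<close>, which is what makes it useful.\<close>

lemma mixed_difference:
  fixes F :: "'a::real_normed_vector \<Rightarrow> real"
  assumes F: "smooth_on F S" and "h > 0"
    and sub: "\<And>s r. s \<in> {0..h} \<Longrightarrow> r \<in> {0..h} \<Longrightarrow> x + s *\<^sub>R u + r *\<^sub>R v \<in> S"
  obtains s r where "s \<in> {0..h}" "r \<in> {0..h}"
    "F (x + h *\<^sub>R u + h *\<^sub>R v) - F (x + h *\<^sub>R u) - F (x + h *\<^sub>R v) + F x
       = h * (h * dd v (dd u F) (x + s *\<^sub>R u + r *\<^sub>R v))"
proof -
  have dF: "F differentiable at y" and dF': "dd u F differentiable at y" if "y \<in> S" for y
    using that F smooth_on_differentiable smooth_on_dd by blast+
  have 1: "((\<lambda>s. F ((x + r *\<^sub>R v) + s *\<^sub>R u)) has_real_derivative dd u F (x + s *\<^sub>R u + r *\<^sub>R v)) (at s)"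
    if "s \<in> {0..h}" "r \<in> {0..h}" for s r
    using has_vector_derivative_line[of F "x + r *\<^sub>R v" s u] dF[OF sub[OF that]]
    by (simp add: has_real_derivative_iff_has_vector_derivative add_ac)
  have "((\<lambda>s. F ((x + h *\<^sub>R v) + s *\<^sub>R u) - F ((x + 0 *\<^sub>R v) + s *\<^sub>R u)) has_real_derivative
      dd u F (x + s *\<^sub>R u + h *\<^sub>R v) - dd u F (x + s *\<^sub>R u + 0 *\<^sub>R v)) (at s)" if "0 \<le> s" "s \<le> h" for s
    using that \<open>h > 0\<close> by (intro DERIV_diff 1) auto
  from MVT2[OF \<open>h > 0\<close> this] obtain s where s: "0 < s" "s < h" and
    eq: "F (x + h *\<^sub>R v + h *\<^sub>R u) - F (x + h *\<^sub>R u) - (F (x + h *\<^sub>R v) - F x)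
      = h * (dd u F (x + s *\<^sub>R u + h *\<^sub>R v) - dd u F (x + s *\<^sub>R u))" by auto
  have "((\<lambda>r. dd u F ((x + s *\<^sub>R u) + r *\<^sub>R v)) has_real_derivative dd v (dd u F) (x + s *\<^sub>R u + r *\<^sub>R v)) (at r)"
    if "0 \<le> r" "r \<le> h" for r
    using has_vector_derivative_line[of "dd u F" "x + s *\<^sub>R u" r v] dF'[OF sub[of s r]] that s
    by (simp add: has_real_derivative_iff_has_vector_derivative)
  from MVT2[OF \<open>h > 0\<close> this] obtain r where r: "0 < r" "r < h"
    and "dd u F (x + s *\<^sub>R u + h *\<^sub>R v) - dd u F (x + s *\<^sub>R u) = h * dd v (dd u F) (x + s *\<^sub>R u + r *\<^sub>R v)"
    by auto
  with eq s r show ?thesis by (intro that[of s r]) (auto simp: algebra_simps)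
qed

text \<open>The second difference over a small parallelogram equals \<open>h * h\<close> times
  either mixed derivative, each at some point near \<open>x\<close>. If the two derivatives differed
  at \<open>x\<close>, continuity would keep them apart nearby.\<close>

lemma dd_commute_real:
  fixes F :: "'a::real_normed_vector \<Rightarrow> real"
  assumes F: "smooth_on F S" and "open S" "x \<in> S"
  shows "dd u (dd v F) x = dd v (dd u F) x"
proof (rule ccontr)
  assume ne: "\<not> ?thesis"
  \<comment> \<open>Half of the gap: two values within \<open>e\<close> of the two ends cannot
    coincide.\<close>
  define e where "e = \<bar>dd u (dd v F) x - dd v (dd u F) x\<bar> / 2"
  have "e > 0" using ne by (simp add: e_def)
  have "continuous_on S (dd u (dd v F))" "continuous_on S (dd v (dd u F))"
    using F by (auto intro!: smooth_on_continuous_on smooth_on_dd)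
  then have "isCont (dd u (dd v F)) x" "isCont (dd v (dd u F)) x"
    using assms(2,3) by (auto simp: continuous_on_eq_continuous_at)
  then obtain d1 d2 where "d1 > 0" "d2 > 0"
    and d1: "\<And>y. dist y x < d1 \<Longrightarrow> \<bar>dd u (dd v F) y - dd u (dd v F) x\<bar> < e"
    and d2: "\<And>y. dist y x < d2 \<Longrightarrow> \<bar>dd v (dd u F) y - dd v (dd u F) x\<bar> < e"
    using \<open>e > 0\<close> unfolding continuous_at dist_real_def[symmetric] by (metis continuous_at continuous_at_eps_delta)
  obtain d3 where "d3 > 0" and d3: "ball x d3 \<subseteq> S" using assms(2,3) openE by blast
  define d where "d = min d1 (min d2 d3)"
  \<comment> \<open>The parallelogram with sides \<open>h u\<close> and \<open>h v\<close> then
    stays inside the ball of radius \<open>d\<close>; the summand 1 keeps the denominator positive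
    when both directions vanish.\<close>
  define h where "h = d / (norm u + norm v + 1)"
  have "d > 0" "h > 0" using \<open>d1 > 0\<close> \<open>d2 > 0\<close> \<open>d3 > 0\<close> by (auto simp: d_def h_def add_nonneg_pos)
  have near: "dist (x + s *\<^sub>R u + r *\<^sub>R v) x < d" if "s \<in> {0..h}" "r \<in> {0..h}" for s r
  proof -
    have "dist (x + s *\<^sub>R u + r *\<^sub>R v) x = norm (s *\<^sub>R u + r *\<^sub>R v)" by (simp add: dist_norm add.assoc)
    also have "\<dots> \<le> s * norm u + r * norm v"
      using that norm_triangle_ineq[of "s *\<^sub>R u" "r *\<^sub>R v"] by simp
    also have "\<dots> \<le> h * norm u + h * norm v" using that by (intro add_mono mult_right_mono) auto
    also have "\<dots> = h * (norm u + norm v)" by (simp add: algebra_simps)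
    also have "\<dots> < h * (norm u + norm v + 1)"
      using \<open>h > 0\<close> by simp
    also have "\<dots> = d"
    proof -
      have "norm u + norm v + 1 > 0" using norm_ge_zero[of u] norm_ge_zero[of v] by linarith
      then show ?thesis by (simp add: h_def)
    qed
    finally show ?thesis .
  qed
  have inS: "x + s *\<^sub>R u + r *\<^sub>R v \<in> S" if "s \<in> {0..h}" "r \<in> {0..h}" for s r
    using near[OF that] d3 by (auto simp: d_def dist_commute)
  obtain s r where sr: "s \<in> {0..h}" "r \<in> {0..h}" and 1:
    "F (x + h *\<^sub>R u + h *\<^sub>R v) - F (x + h *\<^sub>R u) - F (x + h *\<^sub>R v) + F x
       = h * (h * dd v (dd u F) (x + s *\<^sub>R u + r *\<^sub>R v))"
    using mixed_difference[OF F \<open>h > 0\<close> inS] by blast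
  have inS': "x + s *\<^sub>R v + r *\<^sub>R u \<in> S" if "s \<in> {0..h}" "r \<in> {0..h}" for s r
    using inS[OF that(2,1)] by (simp add: add_ac)
  obtain s' r' where sr': "s' \<in> {0..h}" "r' \<in> {0..h}" and 2:
    "F (x + h *\<^sub>R v + h *\<^sub>R u) - F (x + h *\<^sub>R v) - F (x + h *\<^sub>R u) + F x
       = h * (h * dd u (dd v F) (x + s' *\<^sub>R v + r' *\<^sub>R u))"
    using mixed_difference[OF F \<open>h > 0\<close> inS'] by blast
  have "dd u (dd v F) (x + r' *\<^sub>R u + s' *\<^sub>R v) = dd v (dd u F) (x + s *\<^sub>R u + r *\<^sub>R v)"
  proof -
    have "h * (h * dd v (dd u F) (x + s *\<^sub>R u + r *\<^sub>R v)) = h * (h * dd u (dd v F) (x + s' *\<^sub>R v + r' *\<^sub>R u))"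
      unfolding 1[symmetric] 2[symmetric] by (simp add: algebra_simps)
    then show ?thesis using \<open>h > 0\<close> by (simp add: add_ac)
  qed
  moreover have "\<bar>dd u (dd v F) (x + r' *\<^sub>R u + s' *\<^sub>R v) - dd u (dd v F) x\<bar> < e"
    using near[OF sr'(2,1)] by (intro d1) (simp add: d_def)
  moreover have "\<bar>dd v (dd u F) (x + s *\<^sub>R u + r *\<^sub>R v) - dd v (dd u F) x\<bar> < e"
    using near[OF sr] by (intro d2) (simp add: d_def)
  moreover have "2 * e = \<bar>dd u (dd v F) x - dd v (dd u F) x\<bar>" by (simp add: e_def)
  ultimately show False by linarith
qed

lemma dd_commute:
  fixes F :: "'a::real_normed_vector \<Rightarrow> 'b::euclidean_space"
  assumes F: "smooth_on F S" and "open S" "x \<in> S"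
  shows "dd u (dd v F) x = dd v (dd u F) x"
proof (rule euclidean_eqI)
  fix b :: 'b assume "b \<in> Basis"
  have L: "bounded_linear (\<lambda>y. y \<bullet> b)" by (rule bounded_linear_inner_left)
  have *: "dd u (dd v (\<lambda>x. F x \<bullet> b)) x = dd u (dd v F) x \<bullet> b" for u v
  proof -
    have "dd u (dd v (\<lambda>x. F x \<bullet> b)) x = dd u (\<lambda>x. dd v F x \<bullet> b) x"
      by (intro dd_cong[OF assms(2,3)] bounded_linear.dd_apply[OF L] smooth_on_differentiable[OF F])
    also have "\<dots> = dd u (dd v F) x \<bullet> b"
      by (intro bounded_linear.dd_apply[OF L] smooth_on_differentiable[OF smooth_on_dd[OF F]] assms)
    finally show ?thesis .
  qed
  have "smooth_on (\<lambda>x. F x \<bullet> b) S"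
    by (rule bounded_linear.smooth_on[OF L assms(2,1)])
  from dd_commute_real[OF this assms(2,3), of u v]
  show "dd u (dd v F) x \<bullet> b = dd v (dd u F) x \<bullet> b" unfolding * .
qed

subsection \<open>Derivatives along complexified directions\<close>

text \<open>The pair \<open>(a, b)\<close> stands for the complexified tangent vector \<open>a + \<i> b\<close>.\<close>

definition cdd :: "'a::real_normed_vector \<times> 'a \<Rightarrow> ('a \<Rightarrow> complex) \<Rightarrow> 'a \<Rightarrow> complex" where
  "cdd X \<phi> x = dd (fst X) \<phi> x + \<i> * dd (snd X) \<phi> x"

definition cnj_dir :: "'a::real_normed_vector \<times> 'a \<Rightarrow> 'a \<times> 'a" where
  "cnj_dir X = (fst X, - snd X)"

lemma cnj_dir_cnj_dir [simp]: "cnj_dir (cnj_dir X) = X"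
  by (simp add: cnj_dir_def)

lemma smooth_on_cdd [smooth_intros]: "open S \<Longrightarrow> smooth_on f S \<Longrightarrow> smooth_on (cdd X f) S"
  unfolding cdd_def[abs_def] by (intro smooth_on_add smooth_on_mult smooth_on_dd smooth_on_const)

lemma smooth_on_cdd' [smooth_intros]: "open S \<Longrightarrow> smooth_on f S \<Longrightarrow> smooth_on (\<lambda>x. cdd X f x) S"
  using smooth_on_cdd .

lemma cdd_cong: "open S \<Longrightarrow> x \<in> S \<Longrightarrow> (\<And>y. y \<in> S \<Longrightarrow> f y = g y) \<Longrightarrow> cdd X f x = cdd X g x"
  unfolding cdd_def using dd_cong[of S x f g] by simp

lemma cdd_const [simp]: "cdd X (\<lambda>_. c) x = 0"
  by (simp add: cdd_def)

lemma cdd_add: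
  "f differentiable at x \<Longrightarrow> g differentiable at x \<Longrightarrow> cdd X (\<lambda>x. f x + g x) x = cdd X f x + cdd X g x"
  by (simp add: cdd_def dd_add algebra_simps)

lemma cdd_diff:
  "f differentiable at x \<Longrightarrow> g differentiable at x \<Longrightarrow> cdd X (\<lambda>x. f x - g x) x = cdd X f x - cdd X g x"
  by (simp add: cdd_def dd_diff algebra_simps)

lemma cdd_sum:
  "(\<And>i. i \<in> I \<Longrightarrow> f i differentiable at x) \<Longrightarrow> cdd X (\<lambda>x. \<Sum>i\<in>I. f i x) x = (\<Sum>i\<in>I. cdd X (f i) x)"
  by (simp add: cdd_def dd_sum sum_distrib_left sum.distrib)

lemma cdd_mult:
  "f differentiable at x \<Longrightarrow> g differentiable at x \<Longrightarrow>
    cdd X (\<lambda>x. f x * g x) x = f x * cdd X g x + cdd X f x * g x"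
  by (simp add: cdd_def dd_mult algebra_simps)

lemma cdd_cnj: "f differentiable at x \<Longrightarrow> cdd X (\<lambda>x. cnj (f x)) x = cnj (cdd (cnj_dir X) f x)"
  by (simp add: cdd_def cnj_dir_def dd_cnj dd_minus_dir)

lemma cdd_of_real: "f differentiable at x \<Longrightarrow>
    cdd X (\<lambda>x. complex_of_real (f x)) x = complex_of_real (dd (fst X) f x) + \<i> * complex_of_real (dd (snd X) f x)"
  by (simp add: cdd_def dd_of_real)

lemma cdd_commute:
  assumes "smooth_on f S" "open S" "x \<in> S"
  shows "cdd X (cdd Y f) x = cdd Y (cdd X f) x"
proof -
  have d: "dd v f differentiable at x" for v using assms smooth_on_dd smooth_on_differentiable by blast
  have m: "(\<lambda>x. \<i> * g x) differentiable at x" if "g differentiable at x" for g :: "'a \<Rightarrow> complex"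
    using that by simp
  have *: "dd u (cdd Y f) x = dd u (dd (fst Y) f) x + \<i> * dd u (dd (snd Y) f) x" for u Y
    unfolding cdd_def[abs_def] by (simp add: dd_add dd_mult d m)
  show ?thesis
    unfolding cdd_def[of X "cdd Y f"] cdd_def[of Y "cdd X f"] *
    using dd_commute[OF assms] by (simp add: algebra_simps)
qed

text \<open>Read as a complexified vector this is (u - i Ju)/2, the (1,0)-part of the real vector
  \<open>u\<close>. Hence \<open>cdd (hol (axis \<alpha> 1))\<close> is the Wirtinger derivative,
  and \<open>ahol\<close> gives its conjugate.\<close>

definition hol :: "complex^'n \<Rightarrow> (complex^'n) \<times> (complex^'n)" where
  "hol u = ((1/2) *\<^sub>R u, - ((1/2) *\<^sub>R (\<i> *s u)))"

definition ahol :: "complex^'n \<Rightarrow> (complex^'n) \<times> (complex^'n)" where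
  "ahol u = ((1/2) *\<^sub>R u, (1/2) *\<^sub>R (\<i> *s u))"

lemma cnj_dir_hol [simp]: "cnj_dir (hol u) = ahol u" and cnj_dir_ahol [simp]: "cnj_dir (ahol u) = hol u"
  by (simp_all add: cnj_dir_def hol_def ahol_def)

lemma cdd_hol: "f differentiable at x \<Longrightarrow> cdd (hol u) f x = (dd u f x - \<i> * dd (\<i> *s u) f x) / 2"
  and cdd_ahol: "f differentiable at x \<Longrightarrow> cdd (ahol u) f x = (dd u f x + \<i> * dd (\<i> *s u) f x) / 2"
  by (simp_all add: cdd_def hol_def ahol_def dd_minus_dir dd_scaleR_dir complex_eq_iff)

lemma
  fixes f :: "complex^'n \<Rightarrow> complex"
  shows wirtinger_eq_cdd: "f differentiable at z \<Longrightarrow> wirtinger \<alpha> f z = cdd (hol (axis \<alpha> 1)) f z"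
  and wirtinger_bar_eq_cdd: "f differentiable at z \<Longrightarrow> wirtinger_bar \<alpha> f z = cdd (ahol (axis \<alpha> 1)) f z"
proof -
  have "\<i> *s axis \<alpha> 1 = (axis \<alpha> \<i> :: complex^'n)" by (simp add: vec_eq_iff axis_def)
  then show "f differentiable at z \<Longrightarrow> wirtinger \<alpha> f z = cdd (hol (axis \<alpha> 1)) f z"
    "f differentiable at z \<Longrightarrow> wirtinger_bar \<alpha> f z = cdd (ahol (axis \<alpha> 1)) f z"
    by (simp_all add: wirtinger_def wirtinger_bar_def cdd_hol cdd_ahol dd_def)
qed

lemma dd_expand:
  fixes f :: "complex^'n \<Rightarrow> 'b::real_normed_vector"
  assumes "f differentiable at x"
  shows "dd u f x = (\<Sum>\<alpha>\<in>UNIV. Re (u $ \<alpha>) *\<^sub>R dd (axis \<alpha> 1) f x + Im (u $ \<alpha>) *\<^sub>R dd (axis \<alpha> \<i>) f x)"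
proof -
  have u: "u = (\<Sum>\<alpha>\<in>UNIV. Re (u $ \<alpha>) *\<^sub>R axis \<alpha> 1 + Im (u $ \<alpha>) *\<^sub>R axis \<alpha> \<i>)"
    by (simp add: vec_eq_iff axis_def sum.distrib if_distrib complex_eq_iff cong: if_cong)
  show ?thesis
    by (subst u) (simp only: linear_sum[OF linear_dd[OF assms]] dd_add_dir[OF assms] dd_scaleR_dir[OF assms])
qed

lemma cdd_hol_expand:
  assumes "f differentiable at x"
  shows "cdd (hol u) f x = (\<Sum>\<alpha>\<in>UNIV. u $ \<alpha> * cdd (hol (axis \<alpha> 1)) f x)"
    and "cdd (ahol u) f x = (\<Sum>\<alpha>\<in>UNIV. cnj (u $ \<alpha>) * cdd (ahol (axis \<alpha> 1)) f x)"
proof -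
  have i: "\<i> *s axis \<alpha> 1 = (axis \<alpha> \<i> :: complex^'n)" for \<alpha> by (simp add: vec_eq_iff axis_def)
  show "cdd (hol u) f x = (\<Sum>\<alpha>\<in>UNIV. u $ \<alpha> * cdd (hol (axis \<alpha> 1)) f x)"
    "cdd (ahol u) f x = (\<Sum>\<alpha>\<in>UNIV. cnj (u $ \<alpha>) * cdd (ahol (axis \<alpha> 1)) f x)"
    unfolding cdd_hol[OF assms] cdd_ahol[OF assms] dd_expand[OF assms, of u]
      dd_expand[OF assms, of "\<i> *s u"] i sum_distrib_left sum_subtractf[symmetric]
      sum_divide_distrib sum.distrib[symmetric]
    by (intro sum.cong refl; simp add: complex_eq_iff field_simps)+
qed

section \<open>The complexified curvature of a Riemannian metric\<close>

lemma pd_eq_dd: "pd a F x = dd (axis a 1) F x"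
  by (simp add: pd_def dd_def)

text \<open>Along the segment from the identity to \<open>M\<close> every matrix is positive on
  nonzero vectors and hence invertible, so the determinant keeps the sign that it has at the
  identity.\<close>

lemma positive_definite_det_pos:
  fixes M :: "real^'d^'d"
  assumes "\<And>v. v \<noteq> 0 \<Longrightarrow> v \<bullet> (M *v v) > 0"
  shows "det M > 0"
proof (rule ccontr)
  define P where "P t = (\<chi> i j. (1 - t) * (mat 1 :: real^'d^'d) $ i $ j + t * M $ i $ j)" for t
  assume "\<not> det M > 0"
  have P: "P t = (1 - t) *\<^sub>R mat 1 + t *\<^sub>R M" for t
    by (simp add: P_def vec_eq_iff)
  have ne: "det (P t) \<noteq> 0" if "0 \<le> t" "t \<le> 1" for t
  proof
    assume "det (P t) = 0"
    then obtain v where v: "v \<noteq> 0" "P t *v v = 0"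
      using invertible_det_nz invertible_left_inverse matrix_left_invertible_ker by metis
    have "v \<bullet> (P t *v v) = (1 - t) * (v \<bullet> v) + t * (v \<bullet> (M *v v))"
      unfolding P matrix_vector_mult_add_rdistrib scaleR_matrix_vector_assoc[symmetric]
      by (simp add: inner_add_right)
    moreover have "\<dots> > 0"
    proof (cases "t = 0")
      case False
      then have "t * (v \<bullet> (M *v v)) > 0" using that assms[OF v(1)] by simp
      moreover have "(1 - t) * (v \<bullet> v) \<ge> 0" using that by simp
      ultimately show ?thesis by linarith
    qed (use v in simp)
    ultimately show False using v(2) by simp
  qed
  have "continuous_on {0..1} (\<lambda>t. det (P t))"
    unfolding det_def P_def by (simp, intro continuous_intros)
  moreover have "det (P 0) = 1" "det (P 1) = det M" by (simp_all add: P)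
  ultimately have "\<exists>t\<ge>0. t \<le> 1 \<and> det (P t) = 0"
    using IVT2'[of "\<lambda>t. det (P t)" 1 0 0] \<open>\<not> det M > 0\<close> by auto
  then show False using ne by blast
qed

lemma sum_mult_axis [simp]:
  "(\<Sum>i\<in>UNIV. f i * axis j (1::'a::semiring_1) $ i) = f j"
  "(\<Sum>i\<in>UNIV. f i * axis j (1::'a::semiring_1) $ i * c) = f j * c"
proof -
  have "(\<Sum>i\<in>UNIV. f i * axis j (1::'a) $ i * c) = (\<Sum>i\<in>UNIV. if i = j then f j * c else 0)" for c
    by (rule sum.cong) (auto simp: axis_def)
  from this[of 1] this[of c] show "(\<Sum>i\<in>UNIV. f i * axis j (1::'a) $ i) = f j"
    "(\<Sum>i\<in>UNIV. f i * axis j (1::'a) $ i * c) = f j * c" by simp_all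
qed

text \<open>The component with upper index \<open>m\<close> of R applied to the coordinate fields i,
  j, k. \<open>curvature_operator_coord\<close> links it to the invariant definition.\<close>

definition riemann :: "(real^'d \<Rightarrow> real^'d^'d) \<Rightarrow> real^'d \<Rightarrow> 'd \<Rightarrow> 'd \<Rightarrow> 'd \<Rightarrow> 'd \<Rightarrow> real" where
  "riemann K x i j k m =
     dd (axis i 1) (\<lambda>y. christoffel K y j k m) x - dd (axis j 1) (\<lambda>y. christoffel K y i k m) x +
     ((\<Sum>l\<in>UNIV. christoffel K x i l m * christoffel K x j k l) -
      (\<Sum>l\<in>UNIV. christoffel K x j l m * christoffel K x i k l))"

section \<open>A Riemannian metric in one chart\<close>

locale metric_chart =
  fixes T :: "(real^'d) set" and K :: "real^'d \<Rightarrow> real^'d^'d"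
  assumes open_T: "open T" and smooth_K: "smooth_on K T"
    and transpose_K: "\<And>x. x \<in> T \<Longrightarrow> transpose (K x) = K x"
    and pos_K: "\<And>x v. x \<in> T \<Longrightarrow> v \<noteq> 0 \<Longrightarrow> v \<bullet> (K x *v v) > 0"
begin

lemma K_sym: "x \<in> T \<Longrightarrow> K x $ i $ j = K x $ j $ i"
proof -
  assume "x \<in> T"
  then have "K x $ i $ j = transpose (K x) $ i $ j" by (simp only: transpose_K)
  then show ?thesis by (simp add: transpose_def)
qed

lemma det_K: "x \<in> T \<Longrightarrow> det (K x) \<noteq> 0"
  using positive_definite_det_pos[OF pos_K] by (metis less_irrefl)

lemma smooth_K_entry [smooth_intros]: "smooth_on (\<lambda>x. K x $ i $ j) T"
  by (intro smooth_intros open_T smooth_K)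

lemma smooth_christoffel [smooth_intros]: "smooth_on (\<lambda>x. christoffel K x i j k) T"
  unfolding christoffel_def pd_eq_dd divide_inverse
  by (intro smooth_on_sum smooth_on_mult smooth_on_matrix_inv smooth_on_add smooth_on_diff
      smooth_on_dd' smooth_K_entry open_T det_K smooth_on_const)

lemma christoffel_sym: "x \<in> T \<Longrightarrow> christoffel K x i j k = christoffel K x j i k"
proof -
  assume x: "x \<in> T"
  have "pd l (\<lambda>y. K y $ i $ j) x = pd l (\<lambda>y. K y $ j $ i) x" for l
    unfolding pd_eq_dd by (rule dd_cong[OF open_T x K_sym])
  then show ?thesis unfolding christoffel_def by (simp add: algebra_simps)
qed

lemma christoffel_sym_fun: "y \<in> T \<Longrightarrow> dd v (\<lambda>x. christoffel K x i j k) y = dd v (\<lambda>x. christoffel K x j i k) y"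
  by (rule dd_cong[OF open_T]) (auto intro: christoffel_sym)

lemma christoffel_lower:
  assumes x: "x \<in> T"
  shows "(\<Sum>k\<in>UNIV. K x $ l $ k * christoffel K x i j k) =
    (pd i (\<lambda>y. K y $ j $ l) x + pd j (\<lambda>y. K y $ i $ l) x - pd l (\<lambda>y. K y $ i $ j) x) / 2"
proof -
  define c where "c m = (pd i (\<lambda>y. K y $ j $ m) x + pd j (\<lambda>y. K y $ i $ m) x - pd m (\<lambda>y. K y $ i $ j) x) / 2" for m
  have "(\<Sum>k\<in>UNIV. K x $ l $ k * christoffel K x i j k) = (\<Sum>k\<in>UNIV. \<Sum>m\<in>UNIV. K x $ l $ k * matrix_inv (K x) $ k $ m * c m)"
    by (simp add: christoffel_def c_def sum_divide_distrib sum_distrib_left mult.assoc)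
  also have "\<dots> = (\<Sum>m\<in>UNIV. (\<Sum>k\<in>UNIV. K x $ l $ k * matrix_inv (K x) $ k $ m) * c m)"
    by (subst sum.swap) (simp add: sum_distrib_right)
  also have "\<dots> = (\<Sum>m\<in>UNIV. (K x ** matrix_inv (K x)) $ l $ m * c m)"
    by (simp add: matrix_matrix_mult_def)
  also have "\<dots> = c l"
    unfolding matrix_inv_right[OF det_K[OF x]] by (simp add: mat_def if_distrib[where f="\<lambda>a. a * _"] cong: if_cong)
  finally show ?thesis by (simp add: c_def)
qed

text \<open>The right-hand side is a sum of two Christoffel symbols of the first kind; by the
  symmetry of the metric all derivatives but the one along i cancel in pairs.\<close>

lemma metric_compatible:
  assumes x: "x \<in> T"
  shows "dd (axis i 1) (\<lambda>y. K y $ j $ l) x =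
    (\<Sum>k\<in>UNIV. K x $ l $ k * christoffel K x i j k) + (\<Sum>k\<in>UNIV. K x $ j $ k * christoffel K x i l k)"
proof -
  have "pd i (\<lambda>y. K y $ j $ l) x = pd i (\<lambda>y. K y $ l $ j) x" for i j l
    unfolding pd_eq_dd by (rule dd_cong[OF open_T x K_sym])
  note this[of i j l] this[of l i j] this[of j i l]
  then show ?thesis unfolding christoffel_lower[OF x] pd_eq_dd by (simp add: field_simps)
qed

text \<open>The connection is torsion-free: with symmetric Christoffel symbols the terms of the
  cyclic sum cancel one by one.\<close>

lemma riemann_bianchi:
  assumes "x \<in> T"
  shows "riemann K x i j k m + riemann K x j k i m + riemann K x k i j m = 0"
  unfolding riemann_def
  using assms by (simp add: christoffel_sym[of x i k] christoffel_sym[of x j k] christoffel_sym[of x i j]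
      christoffel_sym_fun[of x _ i k] christoffel_sym_fun[of x _ j k] christoffel_sym_fun[of x _ i j])

text \<open>Second partial derivatives of the metric commute. Expressing them by metric
  compatibility, used twice, and exchanging the two derivatives leaves exactly the curvature
  symmetrised in its last two indices.\<close>

lemma riemann_antisym_last:
  assumes x: "x \<in> T"
  shows "(\<Sum>m\<in>UNIV. K x $ l $ m * riemann K x i j k m) = - (\<Sum>m\<in>UNIV. K x $ k $ m * riemann K x i j l m)"
proof -
  let ?G = "christoffel K x"
  let ?dG = "\<lambda>i j k m. dd (axis i 1) (\<lambda>y. christoffel K y j k m) x"
  have dK: "(\<lambda>y. K y $ a $ b) differentiable at x" for a b
    using smooth_on_differentiable[OF smooth_K_entry x] .
  have dG: "(\<lambda>y. christoffel K y a b c) differentiable at x" for a b c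
    using smooth_on_differentiable[OF smooth_christoffel x] .
  \<comment> \<open>The three kinds of terms in a derivative of a lowered Christoffel symbol:
    \<open>A\<close> differentiates the symbol, \<open>B\<close> and \<open>C\<close> are the two
    halves of the derivative of the metric.\<close>
  define A where "A i j k l = (\<Sum>m\<in>UNIV. K x $ l $ m * ?dG i j k m)" for i j k l
  define B where "B i j k l = (\<Sum>m\<in>UNIV. \<Sum>n\<in>UNIV. K x $ l $ n * ?G i m n * ?G j k m)" for i j k l
  define C where "C i j k l = (\<Sum>m\<in>UNIV. \<Sum>n\<in>UNIV. K x $ m $ n * ?G i l n * ?G j k m)" for i j k l
  have deriv_lower: "dd (axis i 1) (\<lambda>y. \<Sum>m\<in>UNIV. K y $ l $ m * christoffel K y j k m) x = A i j k l + B i j k l + C i j k l"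
    for i j k l
  proof -
    have "dd (axis i 1) (\<lambda>y. \<Sum>m\<in>UNIV. K y $ l $ m * christoffel K y j k m) x =
       (\<Sum>m\<in>UNIV. K x $ l $ m * ?dG i j k m + dd (axis i 1) (\<lambda>y. K y $ l $ m) x * ?G j k m)"
      by (simp add: dd_sum dd_mult dK dG)
    also have "\<dots> = A i j k l + (\<Sum>m\<in>UNIV. ((\<Sum>n\<in>UNIV. K x $ m $ n * ?G i l n) + (\<Sum>n\<in>UNIV. K x $ l $ n * ?G i m n)) * ?G j k m)"
      unfolding metric_compatible[OF x] A_def sum.distrib ..
    also have "\<dots> = A i j k l + B i j k l + C i j k l"
      by (simp add: B_def C_def sum.distrib sum_distrib_right distrib_right add.assoc)
    finally show ?thesis .
  qed
  have D: "dd (axis i 1) (dd (axis j 1) (\<lambda>y. K y $ k $ l)) x =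
      A i j k l + B i j k l + C i j k l + (A i j l k + B i j l k + C i j l k)" for i j k l
  proof -
    have "dd (axis i 1) (dd (axis j 1) (\<lambda>y. K y $ k $ l)) x = dd (axis i 1)
      (\<lambda>y. (\<Sum>m\<in>UNIV. K y $ l $ m * christoffel K y j k m) + (\<Sum>m\<in>UNIV. K y $ k $ m * christoffel K y j l m)) x"
      by (rule dd_cong[OF open_T x]) (rule metric_compatible)
    also have "\<dots> = dd (axis i 1) (\<lambda>y. \<Sum>m\<in>UNIV. K y $ l $ m * christoffel K y j k m) x +
        dd (axis i 1) (\<lambda>y. \<Sum>m\<in>UNIV. K y $ k $ m * christoffel K y j l m) x"
      by (rule dd_add) (auto intro!: differentiable_sum differentiable_mult dK dG)
    finally show ?thesis unfolding deriv_lower .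
  qed
  \<comment> \<open>This symmetry makes the \<open>C\<close> terms drop out of the comparison;
    \<open>A\<close> and \<open>B\<close> together form the lowered curvature.\<close>
  have CC: "C i j k l = C j i l k" for i j k l
    unfolding C_def by (subst sum.swap) (simp add: K_sym[OF x] mult_ac)
  have eq: "A i j k l + B i j k l + (A i j l k + B i j l k) = A j i k l + B j i k l + (A j i l k + B j i l k)"
    using dd_commute[OF smooth_K_entry open_T x, of "axis i 1" "axis j 1" k l] CC[of i j k l] CC[of i j l k]
    unfolding D by simp
  have R: "(\<Sum>m\<in>UNIV. K x $ l $ m * riemann K x i j k m) = A i j k l - A j i k l + (B i j k l - B j i k l)" for k l
  proof -
    have B: "(\<Sum>m\<in>UNIV. K x $ l $ m * (\<Sum>n\<in>UNIV. ?G i n m * ?G j k n)) = B i j k l" for i j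
      unfolding B_def sum_distrib_left by (subst sum.swap) (simp add: mult.assoc)
    show ?thesis
      unfolding riemann_def A_def B[symmetric]
      by (simp only: distrib_left right_diff_distrib sum.distrib sum_subtractf)
  qed
  show ?thesis unfolding R using eq by simp
qed

lemma curvature_operator_coord:
  assumes x: "x \<in> T"
  shows "curvature_operator K (coord_field i) (coord_field j) (coord_field k) x $ m = riemann K x i j k m"
proof -
  have n1: "nabla K (coord_field j) (coord_field k) = (\<lambda>y. \<chi> m. christoffel K y j k m)" for j k
  proof -
    have "(\<Sum>i\<in>UNIV. \<Sum>l\<in>UNIV. christoffel K y i l m * axis j 1 $ i * axis k 1 $ l) = christoffel K y j k m" for y m
      by (simp only: sum_mult_axis)
    then show ?thesis by (simp add: nabla_def coord_field_def fun_eq_iff vec_eq_iff)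
  qed
  have n2: "nabla K (coord_field i) (\<lambda>y. \<chi> m. christoffel K y j k m) x $ m =
      dd (axis i 1) (\<lambda>y. christoffel K y j k m) x + (\<Sum>l\<in>UNIV. christoffel K x i l m * christoffel K x j k l)" for i j
  proof -
    have "smooth_on (\<lambda>y. \<chi> m. christoffel K y j k m) T"
      by (intro smooth_on_vec_lambda open_T smooth_christoffel)
    then have "(\<lambda>y. \<chi> m. christoffel K y j k m) differentiable at x"
      using smooth_on_differentiable x by blast
    from dd_vec_nth[OF this, of "axis i 1" m]
    have "dd (axis i 1) (\<lambda>y. \<chi> m. christoffel K y j k m) x $ m = dd (axis i 1) (\<lambda>y. christoffel K y j k m) x"
      by simp
    moreover have "(\<Sum>a\<in>UNIV. \<Sum>l\<in>UNIV. christoffel K x a l m * axis i 1 $ a * christoffel K x j k l) =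
        (\<Sum>l\<in>UNIV. christoffel K x i l m * christoffel K x j k l)"
      by (subst sum.swap) (simp only: sum_mult_axis)
    ultimately show ?thesis by (simp add: nabla_def coord_field_def dd_def)
  qed
  have n3: "nabla K (lie_bracket (coord_field i) (coord_field j)) (coord_field k) x = 0"
    by (simp add: nabla_def lie_bracket_def coord_field_def vec_eq_iff)
  show ?thesis
    unfolding curvature_operator_def n1 n3 by (simp add: n2 riemann_def)
qed

lemma curvature_coeff_eq:
  assumes "x \<in> T"
  shows "curvature_coeff K x i j k l = (\<Sum>m\<in>UNIV. K x $ l $ m * riemann K x i j k m)"
  using curvature_operator_coord[OF assms]
  by (simp add: curvature_coeff_def coord_field_def inner_axis' inner_commute matrix_vector_mult_def)

end

text \<open>The complex bilinear, not Hermitian, extension of the metric. The Hermitian square norm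
  of \<open>u\<close> is \<open>bil M u (cnj_vec u)\<close>.\<close>

definition bil :: "real^'d^'d \<Rightarrow> complex^'d \<Rightarrow> complex^'d \<Rightarrow> complex" where
  "bil M u v = (\<Sum>k\<in>UNIV. \<Sum>l\<in>UNIV. of_real (M $ k $ l) * u $ k * v $ l)"

definition riemann_c :: "(real^'d \<Rightarrow> real^'d^'d) \<Rightarrow> real^'d \<Rightarrow> complex^'d \<Rightarrow> complex^'d \<Rightarrow> complex^'d \<Rightarrow> complex^'d" where
  "riemann_c K x u v w = (\<chi> m. \<Sum>i\<in>UNIV. \<Sum>j\<in>UNIV. \<Sum>k\<in>UNIV. of_real (riemann K x i j k m) * u $ i * v $ j * w $ k)"

lemma bil_add: "bil M (u + u') v = bil M u v + bil M u' v" "bil M u (v + v') = bil M u v + bil M u v'"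
  by (simp_all add: bil_def algebra_simps sum.distrib)

lemma bil_scale: "bil M (c *s u) v = c * bil M u v" "bil M u (c *s v) = c * bil M u v"
  by (simp_all add: bil_def sum_distrib_left mult_ac)

lemma bil_zero [simp]: "bil M 0 v = 0" "bil M u 0 = 0"
  by (simp_all add: bil_def)

lemma bil_sum: "bil M (\<Sum>a\<in>I. u a) v = (\<Sum>a\<in>I. bil M (u a) v)" "bil M w (\<Sum>a\<in>I. u a) = (\<Sum>a\<in>I. bil M w (u a))"
  by (induction I rule: infinite_finite_induct) (simp_all add: bil_add)

lemma bil_minus: "bil M (- u) v = - bil M u v" "bil M u (- v) = - bil M u v"
  by (simp_all add: bil_def sum_negf)

lemma cnj_vec_nth [simp]: "cnj_vec v $ i = cnj (v $ i)"
  by (simp add: cnj_vec_def)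

lemma cnj_vec_cnj_vec [simp]: "cnj_vec (cnj_vec v) = v"
  by (simp add: vec_eq_iff)

lemma cnj_bil: "cnj (bil M u v) = bil M (cnj_vec u) (cnj_vec v)"
  by (simp add: bil_def)

section \<open>Identities of the complexified metric and curvature\<close>

context metric_chart
begin

lemma bil_sym: "x \<in> T \<Longrightarrow> bil (K x) u v = bil (K x) v u"
  unfolding bil_def by (subst sum.swap) (simp add: K_sym mult_ac)

lemma bil_cnj_real:
  assumes "x \<in> T"
  shows "bil (K x) u (cnj_vec u) = of_real ((\<chi> i. Re (u $ i)) \<bullet> (K x *v (\<chi> i. Re (u $ i))) +
      (\<chi> i. Im (u $ i)) \<bullet> (K x *v (\<chi> i. Im (u $ i))))" (is "_ = of_real (?a + ?b)")
proof -
  have "Im (bil (K x) u (cnj_vec u)) = 0"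
    using bil_sym[OF assms, of u "cnj_vec u"] cnj_bil[of "K x" u "cnj_vec u"]
    by (simp add: complex_eq_iff)
  moreover have "Re (bil (K x) u (cnj_vec u)) = ?a + ?b"
    by (simp add: bil_def inner_vec_def matrix_vector_mult_def sum_distrib_left sum.distrib[symmetric] algebra_simps)
  ultimately show ?thesis by (simp add: complex_eq_iff)
qed

lemma bil_cnj_nonneg: "x \<in> T \<Longrightarrow> Re (bil (K x) u (cnj_vec u)) \<ge> 0"
  and bil_cnj_pos: "x \<in> T \<Longrightarrow> u \<noteq> 0 \<Longrightarrow> Re (bil (K x) u (cnj_vec u)) > 0"
proof -
  assume x: "x \<in> T"
  have nn: "v \<bullet> (K x *v v) \<ge> 0" for v using pos_K[OF x, of v] by (cases "v = 0") auto
  then show "Re (bil (K x) u (cnj_vec u)) \<ge> 0" unfolding bil_cnj_real[OF x] by simp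
  assume "u \<noteq> 0"
  then consider "(\<chi> i. Re (u $ i)) \<noteq> 0" | "(\<chi> i. Im (u $ i)) \<noteq> 0"
    by (auto simp: vec_eq_iff complex_eq_iff)
  then show "Re (bil (K x) u (cnj_vec u)) > 0"
    unfolding bil_cnj_real[OF x] using pos_K[OF x] nn
    by cases (auto intro: add_pos_nonneg add_nonneg_pos)
qed

lemma riemann_c_bianchi:
  assumes "x \<in> T"
  shows "riemann_c K x u v w + riemann_c K x v w u + riemann_c K x w u v = 0"
proof -
  have 1: "(\<Sum>i\<in>UNIV. \<Sum>j\<in>UNIV. \<Sum>k\<in>UNIV. of_real (riemann K x i j k m) * v $ i * w $ j * u $ k) =
     (\<Sum>i\<in>UNIV. \<Sum>j\<in>UNIV. \<Sum>k\<in>UNIV. of_real (riemann K x j k i m) * u $ i * v $ j * w $ k)" for m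
  proof -
    have "(\<Sum>i\<in>UNIV. \<Sum>j\<in>UNIV. \<Sum>k\<in>UNIV. of_real (riemann K x i j k m) * v $ i * w $ j * u $ k) =
       (\<Sum>i\<in>UNIV. \<Sum>k\<in>UNIV. \<Sum>j\<in>UNIV. of_real (riemann K x i j k m) * v $ i * w $ j * u $ k)"
      by (rule sum.cong[OF refl]) (rule sum.swap)
    also have "\<dots> = (\<Sum>k\<in>UNIV. \<Sum>i\<in>UNIV. \<Sum>j\<in>UNIV. of_real (riemann K x i j k m) * v $ i * w $ j * u $ k)"
      by (rule sum.swap)
    finally show ?thesis by (simp add: mult_ac)
  qed
  have 2: "(\<Sum>i\<in>UNIV. \<Sum>j\<in>UNIV. \<Sum>k\<in>UNIV. of_real (riemann K x i j k m) * w $ i * u $ j * v $ k) =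
     (\<Sum>i\<in>UNIV. \<Sum>j\<in>UNIV. \<Sum>k\<in>UNIV. of_real (riemann K x k i j m) * u $ i * v $ j * w $ k)" for m
  proof -
    have "(\<Sum>i\<in>UNIV. \<Sum>j\<in>UNIV. \<Sum>k\<in>UNIV. of_real (riemann K x i j k m) * w $ i * u $ j * v $ k) =
       (\<Sum>j\<in>UNIV. \<Sum>i\<in>UNIV. \<Sum>k\<in>UNIV. of_real (riemann K x i j k m) * w $ i * u $ j * v $ k)"
      by (rule sum.swap)
    also have "\<dots> = (\<Sum>j\<in>UNIV. \<Sum>k\<in>UNIV. \<Sum>i\<in>UNIV. of_real (riemann K x i j k m) * w $ i * u $ j * v $ k)"
      by (rule sum.cong[OF refl]) (rule sum.swap)
    finally show ?thesis by (simp add: mult_ac)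
  qed
  have "of_real (riemann K x i j k m) + of_real (riemann K x j k i m) + of_real (riemann K x k i j m) = (0::complex)" for i j k m
    using riemann_bianchi[OF assms, of i j k m] by (metis of_real_add of_real_0)
  then show ?thesis
    unfolding vec_eq_iff riemann_c_def by (simp add: 1 2 sum.distrib[symmetric] distrib_right[symmetric])
qed

lemma bil_riemann_c:
  "bil (K x) (riemann_c K x u v w) t =
    (\<Sum>i\<in>UNIV. \<Sum>j\<in>UNIV. \<Sum>k\<in>UNIV. \<Sum>l\<in>UNIV. of_real (\<Sum>m\<in>UNIV. K x $ m $ l * riemann K x i j k m) * u $ i * v $ j * w $ k * t $ l)"
proof -
  have "bil (K x) (riemann_c K x u v w) t = (\<Sum>m\<in>UNIV. \<Sum>l\<in>UNIV. \<Sum>i\<in>UNIV. \<Sum>j\<in>UNIV. \<Sum>k\<in>UNIV.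
      of_real (K x $ m $ l * riemann K x i j k m) * u $ i * v $ j * w $ k * t $ l)"
    by (simp add: bil_def riemann_c_def sum_distrib_left sum_distrib_right mult_ac)
  also have "\<dots> = (\<Sum>i\<in>UNIV. \<Sum>j\<in>UNIV. \<Sum>k\<in>UNIV. \<Sum>l\<in>UNIV. \<Sum>m\<in>UNIV.
      of_real (K x $ m $ l * riemann K x i j k m) * u $ i * v $ j * w $ k * t $ l)"
    unfolding sum.cartesian_product
    by (rule sum.reindex_bij_witness[where i = "\<lambda>(i,j,k,l,m). (m,l,i,j,k)" and j = "\<lambda>(m,l,i,j,k). (i,j,k,l,m)"]) auto
  finally show ?thesis by (simp add: sum_distrib_right)
qed

lemma complex_curvature_eq:
  assumes "x \<in> T"
  shows "complex_curvature K x u v w t = bil (K x) (riemann_c K x u v w) t"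
  unfolding complex_curvature_def bil_riemann_c curvature_coeff_eq[OF assms]
  by (simp only: K_sym[OF assms])

lemma riemann_c_antisym_last:
  assumes "x \<in> T"
  shows "bil (K x) (riemann_c K x u v w) t = - bil (K x) (riemann_c K x u v t) w"
proof -
  define S where "S i j k l = (\<Sum>m\<in>UNIV. K x $ m $ l * riemann K x i j k m)" for i j k l
  have "S i j k l = (\<Sum>m\<in>UNIV. K x $ l $ m * riemann K x i j k m)" for i j k l
    unfolding S_def by (rule sum.cong[OF refl]) (simp add: K_sym[OF assms, of l])
  then have S: "S i j k l = - S i j l k" for i j k l
    using riemann_antisym_last[OF assms, of l i j k] by simp
  have "(\<Sum>k\<in>UNIV. \<Sum>l\<in>UNIV. of_real (S i j k l) * u $ i * v $ j * w $ k * t $ l) =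
      - (\<Sum>k\<in>UNIV. \<Sum>l\<in>UNIV. of_real (S i j k l) * u $ i * v $ j * t $ k * w $ l)" for i j
    unfolding sum_negf[symmetric] by (subst sum.swap, intro sum.cong[OF refl], subst S) simp
  then show ?thesis
    unfolding bil_riemann_c S_def[symmetric] sum_negf[symmetric] by simp
qed

end

section \<open>The pull-back connection along a smooth map\<close>

text \<open>The complexified differential \<open>df(X)\<close>, the connection form of the pull-back bundle, and its
  covariant derivative, all along a complexified direction.\<close>

definition cpush :: "('a::euclidean_space \<Rightarrow> real^'d) \<Rightarrow> 'a \<times> 'a \<Rightarrow> 'a \<Rightarrow> complex^'d" where
  "cpush F X z = (\<chi> k. cdd X (\<lambda>z. of_real (F z $ k)) z)"

definition conn :: "(real^'d \<Rightarrow> real^'d^'d) \<Rightarrow> ('a::euclidean_space \<Rightarrow> real^'d) \<Rightarrow> 'a \<times> 'a \<Rightarrow> 'a \<Rightarrow> 'd \<Rightarrow> 'd \<Rightarrow> complex" where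
  "conn K F X z k j = (\<Sum>i\<in>UNIV. of_real (christoffel K (F z) i j k) * cpush F X z $ i)"

definition cnabla :: "(real^'d \<Rightarrow> real^'d^'d) \<Rightarrow> ('a::euclidean_space \<Rightarrow> real^'d) \<Rightarrow> 'a \<times> 'a \<Rightarrow> ('a \<Rightarrow> complex^'d) \<Rightarrow> 'a \<Rightarrow> complex^'d" where
  "cnabla K F X s z = (\<chi> k. cdd X (\<lambda>z. s z $ k) z + (\<Sum>j\<in>UNIV. conn K F X z k j * s z $ j))"

locale map_chart = metric_chart T K
  for T :: "(real^'d) set" and K :: "real^'d \<Rightarrow> real^'d^'d" +
  fixes S :: "'a::euclidean_space set" and F :: "'a \<Rightarrow> real^'d"
  assumes open_S: "open S" and smooth_F: "smooth_on F S" and F_in: "\<And>z. z \<in> S \<Longrightarrow> F z \<in> T"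
begin

lemma smooth_on_F [smooth_intros]: "smooth_on (\<lambda>z. complex_of_real (F z $ k)) S"
  by (intro smooth_intros open_S smooth_F)

lemma smooth_cpush_nth: "smooth_on (\<lambda>z. cpush F X z $ k) S"
  unfolding cpush_def by (simp, intro smooth_intros open_S)

lemma smooth_cpush: "smooth_on (cpush F X) S"
  by (rule smooth_on_vec[OF open_S smooth_cpush_nth])

lemma smooth_compose_F: "smooth_on \<phi> T \<Longrightarrow> smooth_on (\<lambda>z. complex_of_real (\<phi> (F z))) S"
  by (rule smooth_on_of_real[OF open_S smooth_on_compose[OF open_S open_T _ smooth_F F_in]])

lemma smooth_conn: "smooth_on (\<lambda>z. conn K F X z k j) S"
  unfolding conn_def
  by (intro smooth_on_sum smooth_on_mult open_S smooth_cpush_nth smooth_compose_F smooth_christoffel)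

lemma smooth_cnabla_nth: "smooth_on s S \<Longrightarrow> smooth_on (\<lambda>z. cnabla K F X s z $ k) S"
  unfolding cnabla_def
  by (simp, intro smooth_on_add smooth_on_sum smooth_on_mult open_S smooth_conn smooth_on_cdd' smooth_on_vec_nth)

lemma smooth_cnabla: "smooth_on s S \<Longrightarrow> smooth_on (cnabla K F X s) S"
  by (rule smooth_on_vec[OF open_S smooth_cnabla_nth])

lemma smooth_bil:
  assumes "smooth_on s S" "smooth_on t S"
  shows "smooth_on (\<lambda>z. bil (K (F z)) (s z) (t z)) S"
  unfolding bil_def
  by (intro smooth_on_sum smooth_on_mult open_S smooth_compose_F smooth_K_entry smooth_on_vec_nth assms)

lemma cpush_nth:
  assumes "z \<in> S"
  shows "cpush F X z $ k = of_real (dd (fst X) F z $ k) + \<i> * of_real (dd (snd X) F z $ k)"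
proof -
  have d: "F differentiable at z" using smooth_on_differentiable[OF smooth_F assms] .
  have "(\<lambda>z. F z $ k) differentiable at z"
    by (rule bounded_linear.differentiable_apply[OF bounded_linear_vec_nth d])
  then show ?thesis by (simp add: cpush_def cdd_of_real dd_vec_nth[OF d])
qed

lemma cdd_compose_F:
  assumes "smooth_on \<phi> T" "z \<in> S"
  shows "cdd X (\<lambda>z. of_real (\<phi> (F z))) z = (\<Sum>i\<in>UNIV. of_real (dd (axis i 1) \<phi> (F z)) * cpush F X z $ i)"
proof -
  have d: "F differentiable at z" and d': "\<phi> differentiable at (F z)"
    using smooth_on_differentiable[OF smooth_F assms(2)] smooth_on_differentiable[OF assms(1) F_in[OF assms(2)]] .
  have "(\<lambda>z. \<phi> (F z)) differentiable at z"
    using differentiable_chain_at[OF d d'] by (simp add: o_def)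
  moreover have "dd v (\<lambda>z. \<phi> (F z)) z = (\<Sum>i\<in>UNIV. dd v F z $ i * dd (axis i 1) \<phi> (F z))" for v
  proof -
    have "dd v F z = (\<Sum>i\<in>UNIV. dd v F z $ i *\<^sub>R axis i 1)"
      by (simp add: vec_eq_iff axis_def if_distrib cong: if_cong)
    then have "dd (dd v F z) \<phi> (F z) = dd (\<Sum>i\<in>UNIV. dd v F z $ i *\<^sub>R axis i 1) \<phi> (F z)" by simp
    also have "\<dots> = (\<Sum>i\<in>UNIV. dd v F z $ i * dd (axis i 1) \<phi> (F z))"
      unfolding linear_sum[OF linear_dd[OF d']] dd_scaleR_dir[OF d'] by simp
    finally show ?thesis unfolding dd_compose[OF d d'] .
  qed
  ultimately show ?thesis
    by (simp add: cdd_of_real cpush_nth[OF assms(2)] sum_distrib_left sum.distrib[symmetric] algebra_simps)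
qed

text \<open>Symmetry of the second fundamental form: constant directions commute and the connection
  of the target is torsion-free.\<close>

lemma cnabla_cpush_commute:
  assumes z: "z \<in> S"
  shows "cnabla K F X (cpush F Y) z = cnabla K F Y (cpush F X) z"
proof -
  have "cdd X (\<lambda>z. cpush F Y z $ k) z = cdd Y (\<lambda>z. cpush F X z $ k) z" for k
    unfolding cpush_def using cdd_commute[OF smooth_on_F open_S z] by simp
  moreover have "(\<Sum>j\<in>UNIV. conn K F X z k j * cpush F Y z $ j) = (\<Sum>j\<in>UNIV. conn K F Y z k j * cpush F X z $ j)" for k
    unfolding conn_def sum_distrib_right
    by (subst sum.swap) (simp add: christoffel_sym[OF F_in[OF z]] mult_ac)
  ultimately show ?thesis by (simp add: cnabla_def)
qed

text \<open>The pull-back connection is metric: by the chain rule a derivative of the metric along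
  \<open>F\<close> is a combination of its coordinate derivatives, which
  \<open>metric_compatible\<close> turns into the two connection terms.\<close>

lemma cdd_bil:
  assumes z: "z \<in> S" and s: "smooth_on s S" and t: "smooth_on t S"
  shows "cdd X (\<lambda>z. bil (K (F z)) (s z) (t z)) z =
    bil (K (F z)) (cnabla K F X s z) (t z) + bil (K (F z)) (s z) (cnabla K F X t z)"
proof -
  have dK: "(\<lambda>z. complex_of_real (K (F z) $ k $ l)) differentiable at z" for k l
    using smooth_on_differentiable[OF smooth_compose_F[OF smooth_K_entry] z] .
  have ds: "(\<lambda>z. s z $ k) differentiable at z" and dt: "(\<lambda>z. t z $ k) differentiable at z" for k
    using smooth_on_differentiable[OF smooth_on_vec_nth[OF open_S s] z]
      smooth_on_differentiable[OF smooth_on_vec_nth[OF open_S t] z] by blast+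
  have conn: "cdd X (\<lambda>z. of_real (K (F z) $ k $ l)) z =
      (\<Sum>m\<in>UNIV. of_real (K (F z) $ m $ l) * conn K F X z m k) + (\<Sum>m\<in>UNIV. of_real (K (F z) $ k $ m) * conn K F X z m l)" for k l
  proof -
    have "cdd X (\<lambda>z. of_real (K (F z) $ k $ l)) z = (\<Sum>i\<in>UNIV. of_real (
       (\<Sum>m\<in>UNIV. K (F z) $ l $ m * christoffel K (F z) i k m) + (\<Sum>m\<in>UNIV. K (F z) $ k $ m * christoffel K (F z) i l m)) * cpush F X z $ i)"
      unfolding cdd_compose_F[OF smooth_K_entry z] metric_compatible[OF F_in[OF z]] ..
    also have "\<dots> = (\<Sum>i\<in>UNIV. \<Sum>m\<in>UNIV. of_real (K (F z) $ l $ m) * (of_real (christoffel K (F z) i k m) * cpush F X z $ i)) +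
       (\<Sum>i\<in>UNIV. \<Sum>m\<in>UNIV. of_real (K (F z) $ k $ m) * (of_real (christoffel K (F z) i l m) * cpush F X z $ i))"
      by (simp add: distrib_right sum.distrib sum_distrib_right mult.assoc)
    also have "\<dots> = (\<Sum>m\<in>UNIV. of_real (K (F z) $ l $ m) * conn K F X z m k) + (\<Sum>m\<in>UNIV. of_real (K (F z) $ k $ m) * conn K F X z m l)"
      unfolding conn_def sum_distrib_left by (intro arg_cong2[where f="(+)"] sum.swap)
    finally show ?thesis by (simp only: K_sym[OF F_in[OF z], of l])
  qed
  have "cdd X (\<lambda>z. bil (K (F z)) (s z) (t z)) z = (\<Sum>k\<in>UNIV. \<Sum>l\<in>UNIV.
      cdd X (\<lambda>z. of_real (K (F z) $ k $ l)) z * s z $ k * t z $ l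
      + of_real (K (F z) $ k $ l) * cdd X (\<lambda>z. s z $ k) z * t z $ l
      + of_real (K (F z) $ k $ l) * s z $ k * cdd X (\<lambda>z. t z $ l) z)"
    unfolding bil_def by (simp add: cdd_sum cdd_mult dK ds dt algebra_simps)
  also have "\<dots> = (\<Sum>k\<in>UNIV. \<Sum>l\<in>UNIV. cdd X (\<lambda>z. of_real (K (F z) $ k $ l)) z * s z $ k * t z $ l)
      + (\<Sum>k\<in>UNIV. \<Sum>l\<in>UNIV. of_real (K (F z) $ k $ l) * cdd X (\<lambda>z. s z $ k) z * t z $ l)
      + (\<Sum>k\<in>UNIV. \<Sum>l\<in>UNIV. of_real (K (F z) $ k $ l) * s z $ k * cdd X (\<lambda>z. t z $ l) z)"
    by (simp add: sum.distrib)
  also have "(\<Sum>k\<in>UNIV. \<Sum>l\<in>UNIV. cdd X (\<lambda>z. of_real (K (F z) $ k $ l)) z * s z $ k * t z $ l) =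
     (\<Sum>k\<in>UNIV. \<Sum>l\<in>UNIV. of_real (K (F z) $ k $ l) * (\<Sum>m\<in>UNIV. conn K F X z k m * s z $ m) * t z $ l) +
     (\<Sum>k\<in>UNIV. \<Sum>l\<in>UNIV. of_real (K (F z) $ k $ l) * s z $ k * (\<Sum>m\<in>UNIV. conn K F X z l m * t z $ m))"
  proof -
    have "(\<Sum>k\<in>UNIV. \<Sum>l\<in>UNIV. cdd X (\<lambda>z. of_real (K (F z) $ k $ l)) z * s z $ k * t z $ l) =
      (\<Sum>k\<in>UNIV. \<Sum>l\<in>UNIV. \<Sum>m\<in>UNIV. of_real (K (F z) $ m $ l) * conn K F X z m k * s z $ k * t z $ l) +
      (\<Sum>k\<in>UNIV. \<Sum>l\<in>UNIV. \<Sum>m\<in>UNIV. of_real (K (F z) $ k $ m) * conn K F X z m l * s z $ k * t z $ l)"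
      unfolding conn by (simp add: distrib_right sum.distrib sum_distrib_right)
    also have "(\<Sum>k\<in>UNIV. \<Sum>l\<in>UNIV. \<Sum>m\<in>UNIV. of_real (K (F z) $ m $ l) * conn K F X z m k * s z $ k * t z $ l) =
      (\<Sum>k\<in>UNIV. \<Sum>l\<in>UNIV. \<Sum>m\<in>UNIV. of_real (K (F z) $ k $ l) * conn K F X z k m * s z $ m * t z $ l)"
      unfolding sum.cartesian_product
      by (rule sum.reindex_bij_witness[where i = "\<lambda>(k,l,m). (m,l,k)" and j = "\<lambda>(k,l,m). (m,l,k)"]) auto
    also have "(\<Sum>k\<in>UNIV. \<Sum>l\<in>UNIV. \<Sum>m\<in>UNIV. of_real (K (F z) $ k $ m) * conn K F X z m l * s z $ k * t z $ l) =
      (\<Sum>k\<in>UNIV. \<Sum>l\<in>UNIV. \<Sum>m\<in>UNIV. of_real (K (F z) $ k $ l) * conn K F X z l m * s z $ k * t z $ m)"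
      by (rule sum.cong[OF refl]) (rule sum.swap)
    finally show ?thesis by (simp add: sum_distrib_left sum_distrib_right mult_ac)
  qed
  finally show ?thesis
    unfolding bil_def cnabla_def by (simp add: distrib_left distrib_right sum.distrib)
qed

text \<open>The curvature of a pull-back connection is the pull-back of the curvature. There is no
  bracket term because \<open>X\<close> and \<open>Y\<close> are constant directions.\<close>

lemma cnabla_commutator:
  assumes z: "z \<in> S" and s: "smooth_on s S"
  shows "cnabla K F X (cnabla K F Y s) z - cnabla K F Y (cnabla K F X s) z =
    riemann_c K (F z) (cpush F X z) (cpush F Y z) (s z)"
proof -
  let ?G = "\<lambda>X k j. conn K F X z k j"
  have ds: "(\<lambda>z. s z $ k) differentiable at z" "cdd X (\<lambda>z. s z $ k) differentiable at z" for k X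
    using smooth_on_differentiable[OF smooth_on_vec_nth[OF open_S s] z]
      smooth_on_differentiable[OF smooth_on_cdd[OF open_S smooth_on_vec_nth[OF open_S s]] z] by blast+
  have dc: "(\<lambda>z. conn K F X z k j) differentiable at z" for X k j
    using smooth_on_differentiable[OF smooth_conn z] .
  have dp: "(\<lambda>z. cpush F X z $ k) differentiable at z" for X k
    using smooth_on_differentiable[OF smooth_cpush_nth z] .
  have dG: "(\<lambda>z. complex_of_real (christoffel K (F z) i j k)) differentiable at z" for i j k
    using smooth_on_differentiable[OF smooth_compose_F[OF smooth_christoffel] z] .
  \<comment> \<open>All terms that differentiate \<open>s\<close> are symmetric in \<open>X\<close>
    and \<open>Y\<close>; only the last sum, of order zero in \<open>s\<close>, survives in the
    commutator.\<close>
  have 1: "cnabla K F X (cnabla K F Y s) z $ k =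
      cdd X (cdd Y (\<lambda>z. s z $ k)) z +
      (\<Sum>j\<in>UNIV. ?G Y k j * cdd X (\<lambda>z. s z $ j) z) + (\<Sum>j\<in>UNIV. ?G X k j * cdd Y (\<lambda>z. s z $ j) z) +
      (\<Sum>j\<in>UNIV. (cdd X (\<lambda>z. conn K F Y z k j) z + (\<Sum>m\<in>UNIV. ?G X k m * ?G Y m j)) * s z $ j)" for X Y k
  proof -
    have "cnabla K F X (cnabla K F Y s) z $ k =
        cdd X (\<lambda>z. cdd Y (\<lambda>z. s z $ k) z + (\<Sum>j\<in>UNIV. conn K F Y z k j * s z $ j)) z
        + (\<Sum>j\<in>UNIV. ?G X k j * (cdd Y (\<lambda>z. s z $ j) z + (\<Sum>m\<in>UNIV. ?G Y j m * s z $ m)))"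
      by (simp add: cnabla_def)
    also have "cdd X (\<lambda>z. cdd Y (\<lambda>z. s z $ k) z + (\<Sum>j\<in>UNIV. conn K F Y z k j * s z $ j)) z =
       cdd X (cdd Y (\<lambda>z. s z $ k)) z + (\<Sum>j\<in>UNIV. ?G Y k j * cdd X (\<lambda>z. s z $ j) z + cdd X (\<lambda>z. conn K F Y z k j) z * s z $ j)"
      by (simp add: cdd_add cdd_sum cdd_mult ds dc)
    also have "(\<Sum>j\<in>UNIV. ?G X k j * (cdd Y (\<lambda>z. s z $ j) z + (\<Sum>m\<in>UNIV. ?G Y j m * s z $ m))) =
      (\<Sum>j\<in>UNIV. ?G X k j * cdd Y (\<lambda>z. s z $ j) z) + (\<Sum>j\<in>UNIV. (\<Sum>m\<in>UNIV. ?G X k m * ?G Y m j) * s z $ j)"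
    proof -
      have "(\<Sum>j\<in>UNIV. \<Sum>m\<in>UNIV. ?G X k j * (?G Y j m * s z $ m)) = (\<Sum>j\<in>UNIV. (\<Sum>m\<in>UNIV. ?G X k m * ?G Y m j) * s z $ j)"
        by (subst sum.swap) (simp add: sum_distrib_right mult.assoc)
      then show ?thesis by (simp add: distrib_left sum.distrib sum_distrib_left)
    qed
    finally show ?thesis by (simp add: sum.distrib distrib_right)
  qed
  \<comment> \<open>The curvature matrix, obtained below as the antisymmetrised derivative of the
    connection matrix plus the commutator of connection matrices.\<close>
  define D where "D k j = (\<Sum>i\<in>UNIV. \<Sum>l\<in>UNIV. of_real (riemann K (F z) i l j k) * cpush F X z $ i * cpush F Y z $ l)" for k j
  have 2: "cdd X (\<lambda>z. conn K F Y z k j) z + (\<Sum>m\<in>UNIV. ?G X k m * ?G Y m j) -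
     (cdd Y (\<lambda>z. conn K F X z k j) z + (\<Sum>m\<in>UNIV. ?G Y k m * ?G X m j)) = D k j" for k j
  proof -
    let ?dG = "\<lambda>i l. complex_of_real (dd (axis i 1) (\<lambda>x. christoffel K x l j k) (F z))"
    have c: "cdd X (\<lambda>z. conn K F Y z k j) z =
       (\<Sum>l\<in>UNIV. of_real (christoffel K (F z) l j k) * cdd X (\<lambda>z. cpush F Y z $ l) z) +
       (\<Sum>i\<in>UNIV. \<Sum>l\<in>UNIV. ?dG i l * cpush F X z $ i * cpush F Y z $ l)" for X Y
    proof -
      have "cdd X (\<lambda>z. conn K F Y z k j) z = (\<Sum>l\<in>UNIV. of_real (christoffel K (F z) l j k) * cdd X (\<lambda>z. cpush F Y z $ l) z
         + (\<Sum>i\<in>UNIV. ?dG i l * cpush F X z $ i) * cpush F Y z $ l)"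
        unfolding conn_def by (simp add: cdd_sum cdd_mult dp dG cdd_compose_F[OF smooth_christoffel z])
      also have "\<dots> = (\<Sum>l\<in>UNIV. of_real (christoffel K (F z) l j k) * cdd X (\<lambda>z. cpush F Y z $ l) z)
         + (\<Sum>l\<in>UNIV. \<Sum>i\<in>UNIV. ?dG i l * cpush F X z $ i * cpush F Y z $ l)"
        by (simp add: sum.distrib sum_distrib_right)
      also have "(\<Sum>l\<in>UNIV. \<Sum>i\<in>UNIV. ?dG i l * cpush F X z $ i * cpush F Y z $ l) =
          (\<Sum>i\<in>UNIV. \<Sum>l\<in>UNIV. ?dG i l * cpush F X z $ i * cpush F Y z $ l)"
        by (rule sum.swap)
      finally show ?thesis .
    qed
    have cc: "cdd X (\<lambda>z. cpush F Y z $ l) z = cdd Y (\<lambda>z. cpush F X z $ l) z" for l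
      unfolding cpush_def using cdd_commute[OF smooth_on_F open_S z] by simp
    define Q where "Q i l = (\<Sum>m\<in>UNIV. christoffel K (F z) i m k * christoffel K (F z) l j m)" for i l
    have g: "(\<Sum>m\<in>UNIV. ?G X k m * ?G Y m j) = (\<Sum>i\<in>UNIV. \<Sum>l\<in>UNIV.
        of_real (Q i l) * cpush F X z $ i * cpush F Y z $ l)" for X Y
    proof -
      have "(\<Sum>m\<in>UNIV. ?G X k m * ?G Y m j) = (\<Sum>m\<in>UNIV. \<Sum>i\<in>UNIV. \<Sum>l\<in>UNIV.
         of_real (christoffel K (F z) i m k * christoffel K (F z) l j m) * cpush F X z $ i * cpush F Y z $ l)"
        unfolding conn_def by (simp add: sum_product mult_ac)
      also have "\<dots> = (\<Sum>i\<in>UNIV. \<Sum>l\<in>UNIV. \<Sum>m\<in>UNIV.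
         of_real (christoffel K (F z) i m k * christoffel K (F z) l j m) * cpush F X z $ i * cpush F Y z $ l)"
        unfolding sum.cartesian_product
        by (rule sum.reindex_bij_witness[where i = "\<lambda>(i,l,m). (m,i,l)" and j = "\<lambda>(m,i,l). (i,l,m)"]) auto
      finally show ?thesis by (simp add: Q_def sum_distrib_right)
    qed
    have R: "riemann K (F z) i l j k = dd (axis i 1) (\<lambda>x. christoffel K x l j k) (F z)
        - dd (axis l 1) (\<lambda>x. christoffel K x i j k) (F z) + (Q i l - Q l i)" for i l
      by (simp add: riemann_def Q_def)
    have sw: "(\<Sum>i\<in>UNIV. \<Sum>l\<in>UNIV. f i l * cpush F Y z $ i * cpush F X z $ l) =
       (\<Sum>i\<in>UNIV. \<Sum>l\<in>UNIV. f l i * cpush F X z $ i * cpush F Y z $ l)" for f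
      by (subst sum.swap) (simp add: mult_ac)
    show ?thesis
      unfolding c g cc sw[of ?dG] sw[of "\<lambda>i l. of_real (Q i l)"] D_def R
      by (simp add: sum.distrib[symmetric] sum_subtractf[symmetric] algebra_simps)
  qed
  have "(cnabla K F X (cnabla K F Y s) z - cnabla K F Y (cnabla K F X s) z) $ k = (\<Sum>j\<in>UNIV. D k j * s z $ j)" for k
  proof -
    have "(cnabla K F X (cnabla K F Y s) z - cnabla K F Y (cnabla K F X s) z) $ k =
      (\<Sum>j\<in>UNIV. (cdd X (\<lambda>z. conn K F Y z k j) z + (\<Sum>m\<in>UNIV. ?G X k m * ?G Y m j)) * s z $ j) -
      (\<Sum>j\<in>UNIV. (cdd Y (\<lambda>z. conn K F X z k j) z + (\<Sum>m\<in>UNIV. ?G Y k m * ?G X m j)) * s z $ j)"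
      unfolding vector_minus_component 1
      using cdd_commute[OF smooth_on_vec_nth[OF open_S s] open_S z, of X Y k] by simp
    then show ?thesis unfolding sum_subtractf[symmetric] left_diff_distrib[symmetric] 2 .
  qed
  moreover have "(\<Sum>j\<in>UNIV. D k j * s z $ j) = riemann_c K (F z) (cpush F X z) (cpush F Y z) (s z) $ k" for k
  proof -
    have "(\<Sum>j\<in>UNIV. D k j * s z $ j) = (\<Sum>j\<in>UNIV. \<Sum>i\<in>UNIV. \<Sum>l\<in>UNIV. of_real (riemann K (F z) i l j k) * cpush F X z $ i * cpush F Y z $ l * s z $ j)"
      by (simp add: D_def sum_distrib_right)
    also have "\<dots> = (\<Sum>i\<in>UNIV. \<Sum>l\<in>UNIV. \<Sum>j\<in>UNIV. of_real (riemann K (F z) i l j k) * cpush F X z $ i * cpush F Y z $ l * s z $ j)"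
      unfolding sum.cartesian_product
      by (rule sum.reindex_bij_witness[where i = "\<lambda>(i,l,m). (m,i,l)" and j = "\<lambda>(m,i,l). (i,l,m)"]) auto
    finally show ?thesis by (simp add: riemann_c_def)
  qed
  ultimately show ?thesis by (simp add: vec_eq_iff)
qed

lemma cnj_cpush: "z \<in> S \<Longrightarrow> cnj_vec (cpush F X z) = cpush F (cnj_dir X) z"
  using cdd_cnj[OF smooth_on_differentiable[OF smooth_on_F], of z "cnj_dir X"]
  by (simp add: vec_eq_iff cpush_def)

lemma cnj_cnabla:
  assumes "z \<in> S" "smooth_on s S"
  shows "cnj_vec (cnabla K F X s z) = cnabla K F (cnj_dir X) (\<lambda>z. cnj_vec (s z)) z"
proof -
  have "cdd (cnj_dir X) (\<lambda>z. cnj (s z $ k)) z = cnj (cdd X (\<lambda>z. s z $ k) z)" for k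
    using cdd_cnj[OF smooth_on_differentiable[OF smooth_on_vec_nth[OF open_S assms(2)] assms(1)], of "cnj_dir X"] by simp
  moreover have "cnj (conn K F X z k j) = conn K F (cnj_dir X) z k j" for k j
    unfolding conn_def cnj_cpush[OF assms(1), symmetric] by simp
  ultimately show ?thesis by (simp add: vec_eq_iff cnabla_def)
qed

lemma cnabla_scale:
  assumes "z \<in> S" "smooth_on s S" "smooth_on \<phi> S"
  shows "cnabla K F X (\<lambda>z. \<phi> z *s s z) z = cdd X \<phi> z *s s z + \<phi> z *s cnabla K F X s z"
  using smooth_on_differentiable[OF smooth_on_vec_nth[OF open_S assms(2)] assms(1)]
    smooth_on_differentiable[OF assms(3,1)]
  by (simp add: vec_eq_iff cnabla_def cdd_mult sum_distrib_left algebra_simps)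

lemma cnabla_sum:
  assumes "z \<in> S" "\<And>a. a \<in> I \<Longrightarrow> smooth_on (s a) S"
  shows "cnabla K F X (\<lambda>z. \<Sum>a\<in>I. s a z) z = (\<Sum>a\<in>I. cnabla K F X (s a) z)"
proof -
  have d: "(\<lambda>z. s a z $ k) differentiable at z" if "a \<in> I" for a k
    using smooth_on_differentiable[OF smooth_on_vec_nth[OF open_S assms(2)[OF that]] assms(1)] .
  have "(\<Sum>j\<in>UNIV. conn K F X z k j * (\<Sum>a\<in>I. s a z $ j)) = (\<Sum>a\<in>I. \<Sum>j\<in>UNIV. conn K F X z k j * s a z $ j)" for k
    unfolding sum_distrib_left by (rule sum.swap)
  then show ?thesis
    by (simp add: vec_eq_iff cnabla_def cdd_sum d sum.distrib)
qed

lemma cnabla_cong: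
  assumes "z \<in> S" "\<And>y. y \<in> S \<Longrightarrow> s y = t y"
  shows "cnabla K F X s z = cnabla K F X t z"
  using cdd_cong[OF open_S assms(1), of "\<lambda>z. s z $ k" "\<lambda>z. t z $ k" X for k] assms
  by (simp add: cnabla_def)

end

section \<open>Kaehler metrics in a chart\<close>

lemma hermitian_form_add: "hermitian_form M (u + u') v = hermitian_form M u v + hermitian_form M u' v"
  "hermitian_form M u (v + v') = hermitian_form M u v + hermitian_form M u v'"
  by (simp_all add: hermitian_form_def algebra_simps sum.distrib)

lemma hermitian_form_scale: "hermitian_form M (c *s u) v = c * hermitian_form M u v"
  "hermitian_form M u (c *s v) = cnj c * hermitian_form M u v"
  by (simp_all add: hermitian_form_def sum_distrib_left mult_ac)

lemma sum_axis_cnj: "(\<Sum>i\<in>UNIV. f i * cnj (axis j 1 $ i)) = f j"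
proof -
  have "(\<Sum>i\<in>UNIV. f i * cnj (axis j 1 $ i)) = (\<Sum>i\<in>UNIV. if i = j then f j else 0)"
    by (rule sum.cong) (auto simp: axis_def)
  then show ?thesis by simp
qed

lemma hermitian_form_axis: "hermitian_form M (axis \<mu> 1) (axis \<nu> 1) = M $ \<mu> $ \<nu>"
  unfolding hermitian_form_def by (simp add: sum_axis_cnj)

section \<open>Inverse matrices from unitary frames\<close>

lemma matrix_inv_unique: "A ** B = mat 1 \<Longrightarrow> B ** A = mat 1 \<Longrightarrow> matrix_inv (A::'a::field^'n^'n) = B"
  by (metis invertible_def invertible_det_nz matrix_inv_left matrix_mul_assoc matrix_mul_lid matrix_mul_rid)

text \<open>If the rows of \<open>P\<close> and the columns of \<open>Q\<close> are a frame and its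
  conjugate, the hypothesis says that the frame is orthonormal. The Hermitian metric and its
  underlying real metric are both inverted in this way.\<close>

lemma matrix_inv_from_frame:
  fixes P M Q :: "'a::field^'n^'n"
  assumes "P ** M ** Q = mat 1"
  shows "matrix_inv M = Q ** P"
proof -
  have "P ** (M ** Q) = mat 1" using assms by (simp add: matrix_mul_assoc)
  then have "(M ** Q) ** P = mat 1" using matrix_left_right_inverse by blast
  then have 1: "M ** (Q ** P) = mat 1" by (simp add: matrix_mul_assoc)
  then have "(Q ** P) ** M = mat 1" by (rule iffD1[OF matrix_left_right_inverse])
  with 1 show ?thesis by (rule matrix_inv_unique)
qed

text \<open>Gram-Schmidt by dimension count: for a proper subset \<open>A\<close> of the indices
  there is a nonzero vector orthogonal to all vectors chosen so far, and it only has to be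
  normalised.\<close>

lemma unitary_frame_exists:
  fixes M :: "complex^'n^'n"
  assumes herm: "\<And>\<alpha> \<beta>. M $ \<beta> $ \<alpha> = cnj (M $ \<alpha> $ \<beta>)"
    and pos: "\<And>v. v \<noteq> 0 \<Longrightarrow> Re (hermitian_form M v v) > 0"
  obtains e :: "'n \<Rightarrow> complex^'n" where "\<And>a b. hermitian_form M (e a) (e b) = (if a = b then 1 else 0)"
proof -
  have cnj: "cnj (hermitian_form M u v) = hermitian_form M v u" for u v
  proof -
    have "cnj (hermitian_form M u v) = (\<Sum>\<alpha>\<in>UNIV. \<Sum>\<beta>\<in>UNIV. M $ \<beta> $ \<alpha> * cnj (u $ \<alpha>) * v $ \<beta>)"
      by (simp add: hermitian_form_def herm[symmetric])
    then show ?thesis unfolding hermitian_form_def by (subst sum.swap) (simp add: mult_ac)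
  qed
  have "\<exists>e :: 'n \<Rightarrow> complex^'n. \<forall>a\<in>A. \<forall>b\<in>A. hermitian_form M (e a) (e b) = (if a = b then 1 else 0)" for A :: "'n set"
  proof (induction A rule: infinite_finite_induct)
    case (insert c A)
    then obtain e where e: "\<And>a b. a \<in> A \<Longrightarrow> b \<in> A \<Longrightarrow> hermitian_form M (e a) (e b) = (if a = b then 1 else 0)"
      by blast
    \<comment> \<open>Row \<open>b\<close> of \<open>L\<close> expresses orthogonality to
      \<open>e b\<close>, and rows outside \<open>A\<close> are zero. As \<open>c\<close> is outside
      \<open>A\<close>, the matrix is singular and has a kernel vector.\<close>
    define L where "L = (\<chi> b \<alpha>. if b \<in> A then \<Sum>\<beta>\<in>UNIV. M $ \<alpha> $ \<beta> * cnj (e b $ \<beta>) else 0)"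
    have "row c L = 0" using insert.hyps by (simp add: row_def L_def vec_eq_iff)
    then have "det L = 0" by (rule det_zero_row)
    then obtain v where v: "v \<noteq> 0" "L *v v = 0"
      using invertible_det_nz invertible_left_inverse matrix_left_invertible_ker by metis
    have orth: "hermitian_form M v (e b) = 0" if "b \<in> A" for b
    proof -
      have "hermitian_form M v (e b) = (L *v v) $ b"
        using that by (simp add: hermitian_form_def matrix_vector_mult_def L_def sum_distrib_left sum_distrib_right mult_ac)
      then show ?thesis using v(2) by simp
    qed
    define r where "r = Re (hermitian_form M v v)"
    have "r > 0" using pos[OF v(1)] by (simp add: r_def)
    have vv: "hermitian_form M v v = of_real r" using cnj[of v v] by (simp add: r_def complex_eq_iff)
    define w where "w = complex_of_real (1 / sqrt r) *s v"
    have ww: "hermitian_form M w w = 1"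
      using \<open>r > 0\<close> unfolding w_def hermitian_form_scale vv
      by (simp flip: of_real_mult)
    have we: "hermitian_form M w (e b) = 0" "hermitian_form M (e b) w = 0" if "b \<in> A" for b
      using orth[OF that] cnj[of v "e b"] by (simp_all add: w_def hermitian_form_scale)
    have "\<forall>a\<in>insert c A. \<forall>b\<in>insert c A. hermitian_form M ((e(c := w)) a) ((e(c := w)) b) = (if a = b then 1 else 0)"
      using insert.hyps e ww we by auto
    then show ?case by blast
  qed auto
  from this[of UNIV] obtain e :: "'n \<Rightarrow> complex^'n"
    where "\<forall>a b. hermitian_form M (e a) (e b) = (if a = b then 1 else 0)" by auto
  then show ?thesis by (intro that[of e]) blast
qed

lemma frame_matrix_inv:
  fixes M :: "complex^'n^'n" and e :: "'n \<Rightarrow> complex^'n"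
  assumes "\<And>a b. hermitian_form M (e a) (e b) = (if a = b then 1 else 0)"
  shows "matrix_inv M $ \<nu> $ \<mu> = (\<Sum>a\<in>UNIV. e a $ \<mu> * cnj (e a $ \<nu>))"
proof -
  have "(\<chi> a \<mu>. e a $ \<mu>) ** M ** (\<chi> \<nu> a. cnj (e a $ \<nu>)) = mat 1"
  proof -
    have "((\<chi> a \<mu>. e a $ \<mu>) ** M ** (\<chi> \<nu> a. cnj (e a $ \<nu>))) $ a $ b = hermitian_form M (e a) (e b)" for a b
    proof -
      have "((\<chi> a \<mu>. e a $ \<mu>) ** M ** (\<chi> \<nu> a. cnj (e a $ \<nu>))) $ a $ b =
          (\<Sum>\<nu>\<in>UNIV. \<Sum>\<mu>\<in>UNIV. M $ \<mu> $ \<nu> * e a $ \<mu> * cnj (e b $ \<nu>))"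
        by (simp add: matrix_matrix_mult_def sum_distrib_left sum_distrib_right mult_ac)
      then show ?thesis unfolding hermitian_form_def by (subst sum.swap) simp
    qed
    then show ?thesis unfolding vec_eq_iff by (simp add: mat_def assms)
  qed
  from matrix_inv_from_frame[OF this] show ?thesis
    by (simp add: matrix_matrix_mult_def mult.commute)
qed

subsection \<open>The underlying real metric\<close>

lemma sum_UNIV_sum: "(\<Sum>k\<in>(UNIV :: ('a::finite + 'b::finite) set). f k) = (\<Sum>a\<in>UNIV. f (Inl a)) + (\<Sum>b\<in>UNIV. f (Inr b))"
  unfolding UNIV_Plus_UNIV[symmetric] by (subst sum.Plus) simp_all

lemma realify_nth [simp]: "realify z $ Inl \<alpha> = Re (z $ \<alpha>)" "realify z $ Inr \<alpha> = Im (z $ \<alpha>)"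
  by (simp_all add: realify_def)

lemma complexify_nth [simp]: "complexify x $ \<alpha> = Complex (x $ Inl \<alpha>) (x $ Inr \<alpha>)"
  by (simp add: complexify_def)

lemma complexify_realify [simp]: "complexify (realify z) = z"
  by (simp add: vec_eq_iff)

lemma realify_complexify [simp]: "realify (complexify x) = x"
proof -
  have "realify (complexify x) $ k = x $ k" for k by (cases k) simp_all
  then show ?thesis by (simp add: vec_eq_iff)
qed

lemma linear_realify: "linear realify"
proof (rule linearI)
  fix x y :: "complex^'n" and r :: real
  have "realify (x + y) $ k = (realify x + realify y) $ k" "realify (r *\<^sub>R x) $ k = (r *\<^sub>R realify x) $ k" for k
    by (cases k; simp)+
  then show "realify (x + y) = realify x + realify y" "realify (r *\<^sub>R x) = r *\<^sub>R realify x"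
    by (simp_all add: vec_eq_iff)
qed

lemma linear_complexify: "linear complexify"
  by (rule linearI) (simp_all add: vec_eq_iff complex_eq_iff)

definition real_part_metric :: "complex^'n^'n \<Rightarrow> real^('n + 'n)^('n + 'n)" where
  "real_part_metric M = (\<chi> k l. Re (hermitian_form M (complexify (axis k 1)) (complexify (axis l 1))))"

lemma hermitian_form_scaleR:
  "hermitian_form M (r *\<^sub>R u) v = r *\<^sub>R hermitian_form M u v" "hermitian_form M u (r *\<^sub>R v) = r *\<^sub>R hermitian_form M u v"
  by (simp_all add: hermitian_form_def scaleR_sum_right)

lemma hermitian_form_sum:
  "hermitian_form M (\<Sum>k\<in>I. u k) v = (\<Sum>k\<in>I. hermitian_form M (u k) v)"
  "hermitian_form M w (\<Sum>k\<in>I. u k) = (\<Sum>k\<in>I. hermitian_form M w (u k))"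
proof -
  have [simp]: "hermitian_form M 0 v = 0" "hermitian_form M v 0 = 0" for v by (simp_all add: hermitian_form_def)
  show "hermitian_form M (\<Sum>k\<in>I. u k) v = (\<Sum>k\<in>I. hermitian_form M (u k) v)"
    "hermitian_form M w (\<Sum>k\<in>I. u k) = (\<Sum>k\<in>I. hermitian_form M w (u k))"
    by (induction I rule: infinite_finite_induct) (simp_all add: hermitian_form_add)
qed

lemma real_part_metric_apply:
  "Re (hermitian_form M (complexify x) (complexify y)) = (\<Sum>k\<in>UNIV. \<Sum>l\<in>UNIV. x $ k * real_part_metric M $ k $ l * y $ l)"
proof -
  have e: "complexify x = (\<Sum>k\<in>UNIV. x $ k *\<^sub>R complexify (axis k 1))" for x
  proof -
    have "x = (\<Sum>k\<in>UNIV. x $ k *\<^sub>R axis k 1)"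
      by (simp add: vec_eq_iff axis_def if_distrib cong: if_cong)
    then have "complexify x = complexify (\<Sum>k\<in>UNIV. x $ k *\<^sub>R axis k 1)" by simp
    then show ?thesis by (simp add: linear_sum[OF linear_complexify] linear_cmul[OF linear_complexify])
  qed
  have "hermitian_form M (complexify x) (complexify y) =
     (\<Sum>k\<in>UNIV. \<Sum>l\<in>UNIV. x $ k *\<^sub>R y $ l *\<^sub>R hermitian_form M (complexify (axis k 1)) (complexify (axis l 1)))"
    unfolding e[of x] e[of y] hermitian_form_sum hermitian_form_scaleR scaleR_sum_right
    by (subst sum.swap) (simp only: scaleR_left_commute)
  then show ?thesis by (simp add: real_part_metric_def mult_ac)
qed

lemma real_part_metric_quadratic: "x \<bullet> (real_part_metric M *v x) = Re (hermitian_form M (complexify x) (complexify x))"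
  unfolding real_part_metric_apply
  by (simp add: inner_vec_def matrix_vector_mult_def sum_distrib_left mult_ac)

text \<open>The vectors \<open>e a\<close> together with their multiples by \<open>\<i>\<close> form
  an orthonormal real frame for the real part of the Hermitian metric.\<close>

lemma frame_real_metric_inv:
  fixes M :: "complex^'n^'n" and e :: "'n \<Rightarrow> complex^'n"
  assumes e: "\<And>a b. hermitian_form M (e a) (e b) = (if a = b then 1 else 0)"
  shows "matrix_inv (real_part_metric M) $ k $ l =
    (\<Sum>a\<in>UNIV. realify (e a) $ k * realify (e a) $ l + realify (\<i> *s e a) $ k * realify (\<i> *s e a) $ l)"
proof -
  define f where "f p = (case p of Inl a \<Rightarrow> e a | Inr a \<Rightarrow> \<i> *s e a)" for p
  define P where "P = (\<chi> p k. realify (f p) $ k)"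
  have "(P ** real_part_metric M ** transpose P) $ p $ q = Re (hermitian_form M (f p) (f q))" for p q
  proof -
    have "(P ** real_part_metric M ** transpose P) $ p $ q =
        (\<Sum>l\<in>UNIV. \<Sum>k\<in>UNIV. realify (f p) $ k * real_part_metric M $ k $ l * realify (f q) $ l)"
      by (simp add: matrix_matrix_mult_def P_def transpose_def sum_distrib_right)
    also have "\<dots> = (\<Sum>k\<in>UNIV. \<Sum>l\<in>UNIV. realify (f p) $ k * real_part_metric M $ k $ l * realify (f q) $ l)"
      by (rule sum.swap)
    finally show ?thesis using real_part_metric_apply[of M "realify (f p)" "realify (f q)"] by simp
  qed
  moreover have "Re (hermitian_form M (f p) (f q)) = (if p = q then 1 else 0)" for p q
    by (auto simp: f_def hermitian_form_scale e split: sum.splits)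
  ultimately have "P ** real_part_metric M ** transpose P = mat 1"
    unfolding vec_eq_iff by (simp add: mat_def)
  from matrix_inv_from_frame[OF this] show ?thesis
    by (simp add: matrix_matrix_mult_def transpose_def P_def f_def sum_UNIV_sum sum.distrib)
qed

text \<open>Jacobi's formula. Differentiating the Leibniz expansion replaces one row at a time by
  its derivative; writing that row as a combination of the rows of \<open>M x\<close>, only the
  coefficient of the replaced row contributes.\<close>

lemma dd_det:
  fixes M :: "'a::real_normed_vector \<Rightarrow> real^'k^'k"
  assumes d: "\<And>i j. (\<lambda>x. M x $ i $ j) differentiable at x" and "det (M x) \<noteq> 0"
  shows "dd v (\<lambda>x. det (M x)) x = det (M x) * (\<Sum>i\<in>UNIV. \<Sum>l\<in>UNIV. matrix_inv (M x) $ l $ i * dd v (\<lambda>x. M x $ i $ l) x)"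
proof -
  define N where "N i j = dd v (\<lambda>x. M x $ i $ j) x" for i j
  \<comment> \<open>The coordinates of the derivative of row \<open>i\<close> with respect to the
    rows of \<open>M x\<close>, that is, row \<open>i\<close> of the derivative times the
    inverse.\<close>
  define c where "c i = (\<chi> l. \<Sum>m\<in>UNIV. N i m * matrix_inv (M x) $ m $ l)" for i
  have "((\<lambda>x. det (M x)) has_derivative (\<lambda>v. \<Sum>p\<in>{p. p permutes UNIV}.
      of_int (sign p) * (\<Sum>i\<in>UNIV. dd v (\<lambda>x. M x $ i $ p i) x * (\<Prod>j\<in>UNIV - {i}. M x $ j $ p j)))) (at x)"
    unfolding det_def by (intro has_derivative_sum has_derivative_mult_right has_derivative_prod has_derivative_dd d)
  from dd_eqI[OF this, of v]
  have "dd v (\<lambda>x. det (M x)) x = (\<Sum>p\<in>{p. p permutes UNIV}. \<Sum>i\<in>UNIV. of_int (sign p) * (N i (p i) * (\<Prod>j\<in>UNIV - {i}. M x $ j $ p j)))"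
    by (simp add: sum_distrib_left N_def)
  also have "\<dots> = (\<Sum>i\<in>UNIV. \<Sum>p\<in>{p. p permutes UNIV}. of_int (sign p) * (N i (p i) * (\<Prod>j\<in>UNIV - {i}. M x $ j $ p j)))"
    by (rule sum.swap)
  also have "\<dots> = (\<Sum>i\<in>UNIV. det ((\<chi> j. if j = i then \<Sum>l\<in>UNIV. c i $ l *s row l (M x) else row j (M x)) :: real^'k^'k))"
  proof (rule sum.cong[OF refl])
    fix i
    have r: "(\<Sum>l\<in>UNIV. c i $ l *s row l (M x)) $ m = N i m" for m
    proof -
      have "(\<Sum>l\<in>UNIV. c i $ l *s row l (M x)) $ m = (\<Sum>l\<in>UNIV. \<Sum>q\<in>UNIV. N i q * (matrix_inv (M x) $ q $ l * M x $ l $ m))"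
        by (simp add: c_def row_def sum_distrib_right mult.assoc)
      also have "\<dots> = (\<Sum>q\<in>UNIV. N i q * (matrix_inv (M x) ** M x) $ q $ m)"
        by (subst sum.swap) (simp add: matrix_matrix_mult_def sum_distrib_left)
      also have "\<dots> = N i m"
        unfolding matrix_inv_left[OF assms(2)] by (simp add: mat_def if_distrib cong: if_cong)
      finally show ?thesis .
    qed
    then have rv: "(\<Sum>l\<in>UNIV. c i $ l *s row l (M x)) = (\<chi> m. N i m)" by (simp add: vec_eq_iff)
    have "(\<Prod>j\<in>UNIV. ((\<chi> j. if j = i then \<Sum>l\<in>UNIV. c i $ l *s row l (M x) else row j (M x)) :: real^'k^'k) $ j $ p j) =
        N i (p i) * (\<Prod>j\<in>UNIV - {i}. M x $ j $ p j)" for p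
      unfolding rv by (subst prod.remove[of UNIV i]) (simp_all add: row_def)
    then show "(\<Sum>p\<in>{p. p permutes UNIV}. of_int (sign p) * (N i (p i) * (\<Prod>j\<in>UNIV - {i}. M x $ j $ p j))) =
        det ((\<chi> j. if j = i then \<Sum>l\<in>UNIV. c i $ l *s row l (M x) else row j (M x)) :: real^'k^'k)"
      unfolding det_def by simp
  qed
  also have "\<dots> = (\<Sum>i\<in>UNIV. c i $ i * det (M x))"
    unfolding cramer_lemma_transpose ..
  finally show ?thesis
    by (simp add: c_def N_def sum_distrib_left mult_ac)
qed

abbreviation dz :: "'n \<Rightarrow> (complex^'n \<Rightarrow> complex) \<Rightarrow> complex^'n \<Rightarrow> complex" where
  "dz \<alpha> \<equiv> cdd (hol (axis \<alpha> 1))"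

abbreviation dzb :: "'n \<Rightarrow> (complex^'n \<Rightarrow> complex) \<Rightarrow> complex^'n \<Rightarrow> complex" where
  "dzb \<alpha> \<equiv> cdd (ahol (axis \<alpha> 1))"

section \<open>A Hermitian metric in one chart: inverse and volume density\<close>

locale hermitian_chart =
  fixes U :: "(complex^'n) set" and H :: "complex^'n \<Rightarrow> complex^'n^'n"
  assumes open_U: "open U" and smooth_H: "smooth_on H U"
    and herm_H: "\<And>z \<alpha> \<beta>. z \<in> U \<Longrightarrow> H z $ \<beta> $ \<alpha> = cnj (H z $ \<alpha> $ \<beta>)"
    and pos_H: "\<And>z v. z \<in> U \<Longrightarrow> v \<noteq> 0 \<Longrightarrow> Re (hermitian_form (H z) v v) > 0"
begin

text \<open>\<open>hinv \<alpha> \<beta>\<close> is $h^{\alpha\bar\beta}$, and \<open>vol\<close> is the density of the Riemannian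
  volume in the real coordinates.\<close>

definition hinv :: "'n \<Rightarrow> 'n \<Rightarrow> complex^'n \<Rightarrow> complex" where
  "hinv \<alpha> \<beta> z = matrix_inv (H z) $ \<beta> $ \<alpha>"

definition vol :: "complex^'n \<Rightarrow> real" where
  "vol z = sqrt (det (real_part_metric (H z)))"

lemma smooth_H_entry: "smooth_on (\<lambda>z. H z $ \<alpha> $ \<beta>) U"
  by (intro smooth_on_vec_nth open_U smooth_H)

lemma det_H: assumes "z \<in> U" shows "det (H z) \<noteq> 0"
proof
  assume "det (H z) = 0"
  then obtain v where v: "v \<noteq> 0" "H z *v v = 0"
    using invertible_det_nz invertible_left_inverse matrix_left_invertible_ker by metis
  \<comment> \<open>The form conjugates its second argument, so a kernel vector of the matrix is a
    null vector of the form only after conjugation.\<close>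
  have "hermitian_form (H z) (cnj_vec v) (cnj_vec v) = (\<Sum>\<alpha>\<in>UNIV. cnj (v $ \<alpha>) * (H z *v v) $ \<alpha>)"
    by (simp add: hermitian_form_def matrix_vector_mult_def sum_distrib_left mult_ac)
  also have "\<dots> = 0" using v(2) by simp
  finally have "Re (hermitian_form (H z) (cnj_vec v) (cnj_vec v)) = 0" by simp
  moreover have "cnj_vec v \<noteq> 0" using v(1) by (auto simp: vec_eq_iff)
  ultimately show False using pos_H[OF assms, of "cnj_vec v"] by simp
qed

lemma unitary_frame:
  assumes "z \<in> U"
  shows "\<exists>e :: 'n \<Rightarrow> complex^'n. \<forall>a b. hermitian_form (H z) (e a) (e b) = (if a = b then 1 else 0)"
proof (rule unitary_frame_exists[of "H z"])
  fix e :: "'n \<Rightarrow> complex^'n"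
  assume "\<And>a b. hermitian_form (H z) (e a) (e b) = (if a = b then 1 else 0)"
  then show ?thesis by blast
qed (use herm_H[OF assms] pos_H[OF assms] in blast)+

lemma smooth_hinv: "smooth_on (hinv \<alpha> \<beta>) U"
  unfolding hinv_def[abs_def] by (rule smooth_on_matrix_inv[OF open_U smooth_H_entry det_H])

lemma hinv_left: "z \<in> U \<Longrightarrow> (\<Sum>\<nu>\<in>UNIV. H z $ \<mu> $ \<nu> * hinv \<kappa> \<nu> z) = (if \<mu> = \<kappa> then 1 else 0)"
  and hinv_right: "z \<in> U \<Longrightarrow> (\<Sum>\<mu>\<in>UNIV. hinv \<mu> \<nu> z * H z $ \<mu> $ \<kappa>) = (if \<nu> = \<kappa> then 1 else 0)"
proof -
  assume z: "z \<in> U"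
  have "(\<Sum>\<nu>\<in>UNIV. H z $ \<mu> $ \<nu> * hinv \<kappa> \<nu> z) = (H z ** matrix_inv (H z)) $ \<mu> $ \<kappa>"
    by (simp add: matrix_matrix_mult_def hinv_def)
  then show "(\<Sum>\<nu>\<in>UNIV. H z $ \<mu> $ \<nu> * hinv \<kappa> \<nu> z) = (if \<mu> = \<kappa> then 1 else 0)"
    unfolding matrix_inv_right[OF det_H[OF z]] by (simp add: mat_def)
  have "(\<Sum>\<mu>\<in>UNIV. hinv \<mu> \<nu> z * H z $ \<mu> $ \<kappa>) = (matrix_inv (H z) ** H z) $ \<nu> $ \<kappa>"
    by (simp add: matrix_matrix_mult_def hinv_def)
  then show "(\<Sum>\<mu>\<in>UNIV. hinv \<mu> \<nu> z * H z $ \<mu> $ \<kappa>) = (if \<nu> = \<kappa> then 1 else 0)"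
    unfolding matrix_inv_left[OF det_H[OF z]] by (simp add: mat_def)
qed

lemma hinv_frame:
  fixes e :: "'n \<Rightarrow> complex^'n"
  assumes "\<And>a b. hermitian_form (H z) (e a) (e b) = (if a = b then 1 else 0)"
  shows "hinv \<alpha> \<beta> z = (\<Sum>a\<in>UNIV. e a $ \<alpha> * cnj (e a $ \<beta>))"
  unfolding hinv_def using frame_matrix_inv[OF assms] .

lemma cnj_hinv: "z \<in> U \<Longrightarrow> cnj (hinv \<alpha> \<beta> z) = hinv \<beta> \<alpha> z"
proof -
  assume "z \<in> U"
  from unitary_frame[OF this] obtain e :: "'n \<Rightarrow> complex^'n" where "\<forall>a b. hermitian_form (H z) (e a) (e b) = (if a = b then 1 else 0)"
    by blast
  note e = this[rule_format]
  show ?thesis unfolding hinv_frame[OF e] by (simp add: mult.commute)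
qed

text \<open>Differentiate the relation between \<open>H\<close> and its inverse and contract with
  the inverse once more.\<close>

lemma cdd_hinv:
  assumes z: "z \<in> U"
  shows "cdd X (hinv \<alpha> \<beta>) z =
    - (\<Sum>\<mu>\<in>UNIV. \<Sum>\<nu>\<in>UNIV. hinv \<mu> \<beta> z * cdd X (\<lambda>z. H z $ \<mu> $ \<nu>) z * hinv \<alpha> \<nu> z)"
proof -
  have d: "(\<lambda>z. H z $ \<mu> $ \<nu>) differentiable at z" "hinv \<mu> \<nu> differentiable at z" for \<mu> \<nu>
    using smooth_on_differentiable[OF smooth_H_entry z] smooth_on_differentiable[OF smooth_hinv z] by blast+
  have "(\<Sum>\<nu>\<in>UNIV. H z $ \<mu> $ \<nu> * cdd X (hinv \<alpha> \<nu>) z) = - (\<Sum>\<nu>\<in>UNIV. cdd X (\<lambda>z. H z $ \<mu> $ \<nu>) z * hinv \<alpha> \<nu> z)" for \<mu>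
  proof -
    have "cdd X (\<lambda>z. \<Sum>\<nu>\<in>UNIV. H z $ \<mu> $ \<nu> * hinv \<alpha> \<nu> z) z = cdd X (\<lambda>z. if \<mu> = \<alpha> then 1 else 0) z"
      by (rule cdd_cong[OF open_U z hinv_left])
    then have "(\<Sum>\<nu>\<in>UNIV. H z $ \<mu> $ \<nu> * cdd X (hinv \<alpha> \<nu>) z) + (\<Sum>\<nu>\<in>UNIV. cdd X (\<lambda>z. H z $ \<mu> $ \<nu>) z * hinv \<alpha> \<nu> z) = 0"
      by (simp add: cdd_sum cdd_mult d sum.distrib)
    then show ?thesis by (simp add: eq_neg_iff_add_eq_0)
  qed
  then have "(\<Sum>\<mu>\<in>UNIV. hinv \<mu> \<beta> z * (\<Sum>\<nu>\<in>UNIV. H z $ \<mu> $ \<nu> * cdd X (hinv \<alpha> \<nu>) z)) =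
      - (\<Sum>\<mu>\<in>UNIV. \<Sum>\<nu>\<in>UNIV. hinv \<mu> \<beta> z * cdd X (\<lambda>z. H z $ \<mu> $ \<nu>) z * hinv \<alpha> \<nu> z)"
    by (simp add: sum_negf sum_distrib_left mult.assoc)
  moreover have "(\<Sum>\<mu>\<in>UNIV. hinv \<mu> \<beta> z * (\<Sum>\<nu>\<in>UNIV. H z $ \<mu> $ \<nu> * cdd X (hinv \<alpha> \<nu>) z)) = cdd X (hinv \<alpha> \<beta>) z"
  proof -
    have "(\<Sum>\<mu>\<in>UNIV. hinv \<mu> \<beta> z * (\<Sum>\<nu>\<in>UNIV. H z $ \<mu> $ \<nu> * cdd X (hinv \<alpha> \<nu>) z)) =
       (\<Sum>\<nu>\<in>UNIV. \<Sum>\<mu>\<in>UNIV. hinv \<mu> \<beta> z * H z $ \<mu> $ \<nu> * cdd X (hinv \<alpha> \<nu>) z)"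
      unfolding sum_distrib_left by (subst sum.swap) (simp add: mult.assoc)
    also have "\<dots> = (\<Sum>\<nu>\<in>UNIV. (if \<beta> = \<nu> then 1 else 0) * cdd X (hinv \<alpha> \<nu>) z)"
      unfolding sum_distrib_right[symmetric] hinv_right[OF z] ..
    also have "\<dots> = (\<Sum>\<nu>\<in>UNIV. if \<beta> = \<nu> then cdd X (hinv \<alpha> \<nu>) z else 0)"
      by (rule sum.cong) auto
    finally show ?thesis by simp
  qed
  ultimately show ?thesis by simp
qed

lemma real_part_metric_pos: "z \<in> U \<Longrightarrow> v \<noteq> 0 \<Longrightarrow> v \<bullet> (real_part_metric (H z) *v v) > 0"
proof -
  assume z: "z \<in> U" and "v \<noteq> 0"
  then have "complexify v \<noteq> 0"
    by (metis linear_0[OF linear_realify] realify_complexify)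
  then show ?thesis unfolding real_part_metric_quadratic using pos_H[OF z] by blast
qed

lemma det_real_part_metric_pos: "z \<in> U \<Longrightarrow> det (real_part_metric (H z)) > 0"
  by (rule positive_definite_det_pos) (rule real_part_metric_pos)

lemma vol_pos: "z \<in> U \<Longrightarrow> vol z > 0"
  unfolding vol_def using det_real_part_metric_pos by simp

lemma smooth_hermitian_form: "smooth_on (\<lambda>z. hermitian_form (H z) u v) U"
  unfolding hermitian_form_def
  by (rule smooth_on_sum smooth_on_mult smooth_H_entry smooth_on_const open_U)+

lemma smooth_real_part_metric: "smooth_on (\<lambda>z. real_part_metric (H z) $ k $ l) U"
  unfolding real_part_metric_def by (simp, rule smooth_on_Re[OF open_U smooth_hermitian_form])

lemma smooth_vol: "smooth_on vol U"
  unfolding vol_def[abs_def]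
  by (rule smooth_on_sqrt[OF open_U smooth_on_det[OF open_U smooth_real_part_metric] det_real_part_metric_pos])

text \<open>The logarithmic derivative of \<open>vol\<close> is half the trace of the inverse real
  metric times its derivative. In the frame of \<open>e a\<close> and \<open>\<i> *s e a\<close> the
  two halves agree and give the real part of the Hermitian trace, which is real because both factors
  are Hermitian.\<close>

lemma dd_vol:
  assumes z: "z \<in> U"
  shows "complex_of_real (dd v vol z) = of_real (vol z) * (\<Sum>\<mu>\<in>UNIV. \<Sum>\<nu>\<in>UNIV. hinv \<mu> \<nu> z * dd v (\<lambda>z. H z $ \<mu> $ \<nu>) z)"
proof -
  let ?G = "\<lambda>z. real_part_metric (H z)"
  obtain e :: "'n \<Rightarrow> complex^'n" where "\<forall>a b. hermitian_form (H z) (e a) (e b) = (if a = b then 1 else 0)"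
    using unitary_frame[OF z] by blast
  note e = this[rule_format]
  have dH: "(\<lambda>z. H z $ \<mu> $ \<nu>) differentiable at z" for \<mu> \<nu>
    using smooth_on_differentiable[OF smooth_H_entry z] .
  define N where "N \<mu> \<nu> = dd v (\<lambda>z. H z $ \<mu> $ \<nu>) z" for \<mu> \<nu>
  define N' where "N' = (\<chi> \<mu> \<nu>. N \<mu> \<nu>)"
  have dform: "dd v (\<lambda>z. hermitian_form (H z) u w) z = hermitian_form N' u w" for u w
    unfolding hermitian_form_def by (simp add: dd_sum dd_mult dH N'_def N_def)
  have dG: "dd v (\<lambda>z. ?G z $ k $ l) z = real_part_metric N' $ k $ l" for k l
  proof -
    have "dd v (\<lambda>z. Re (hermitian_form (H z) u w)) z = Re (dd v (\<lambda>z. hermitian_form (H z) u w) z)" for u w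
      by (rule dd_Re[OF smooth_on_differentiable[OF smooth_hermitian_form z]])
    then show ?thesis by (simp add: real_part_metric_def dform)
  qed
  have hN: "N \<nu> \<mu> = cnj (N \<mu> \<nu>)" for \<mu> \<nu>
  proof -
    have "N \<nu> \<mu> = dd v (\<lambda>z. cnj (H z $ \<mu> $ \<nu>)) z"
      unfolding N_def by (rule dd_cong[OF open_U z]) (rule herm_H)
    then show ?thesis by (simp add: dd_cnj dH N_def)
  qed
  have "dd v vol z = (inverse (sqrt (det (?G z))) / 2) * dd v (\<lambda>z. det (?G z)) z"
  proof -
    have d: "(\<lambda>z. det (?G z)) differentiable at z"
      by (rule smooth_on_differentiable[OF smooth_on_det[OF open_U smooth_real_part_metric] z])
    have "(sqrt has_derivative (*) (inverse (sqrt (det (?G z))) / 2)) (at (det (?G z)))"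
      using DERIV_real_sqrt[OF det_real_part_metric_pos[OF z]] unfolding has_field_derivative_def .
    from dd_eqI[OF has_derivative_compose[OF has_derivative_dd[OF d] this], of v]
    show ?thesis unfolding vol_def[abs_def] .
  qed
  also have "\<dots> = (vol z / 2) * (\<Sum>i\<in>UNIV. \<Sum>l\<in>UNIV. matrix_inv (?G z) $ l $ i * real_part_metric N' $ i $ l)"
  proof -
    have "dd v (\<lambda>z. det (?G z)) z = det (?G z) * (\<Sum>i\<in>UNIV. \<Sum>l\<in>UNIV. matrix_inv (?G z) $ l $ i * dd v (\<lambda>z. ?G z $ i $ l) z)"
      using det_real_part_metric_pos[OF z]
      by (intro dd_det smooth_on_differentiable[OF smooth_real_part_metric z]) simp
    moreover have "det (?G z) = vol z * vol z" using det_real_part_metric_pos[OF z] by (simp add: vol_def)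
    moreover have "vol z > 0" using vol_pos[OF z] .
    ultimately show ?thesis by (simp add: vol_def[symmetric] dG)
  qed
  also have "(\<Sum>i\<in>UNIV. \<Sum>l\<in>UNIV. matrix_inv (?G z) $ l $ i * real_part_metric N' $ i $ l) =
      (\<Sum>a\<in>UNIV. Re (hermitian_form N' (e a) (e a)) + Re (hermitian_form N' (\<i> *s e a) (\<i> *s e a)))"
  proof -
    have "(\<Sum>i\<in>UNIV. \<Sum>l\<in>UNIV. matrix_inv (?G z) $ l $ i * real_part_metric N' $ i $ l) =
       (\<Sum>i\<in>UNIV. \<Sum>l\<in>UNIV. \<Sum>a\<in>UNIV. realify (e a) $ i * real_part_metric N' $ i $ l * realify (e a) $ l +
          realify (\<i> *s e a) $ i * real_part_metric N' $ i $ l * realify (\<i> *s e a) $ l)"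
      unfolding frame_real_metric_inv[OF e] sum_distrib_right
      by (intro sum.cong refl) (simp add: algebra_simps)
    also have "\<dots> = (\<Sum>a\<in>UNIV. \<Sum>i\<in>UNIV. \<Sum>l\<in>UNIV. realify (e a) $ i * real_part_metric N' $ i $ l * realify (e a) $ l +
          realify (\<i> *s e a) $ i * real_part_metric N' $ i $ l * realify (\<i> *s e a) $ l)"
      unfolding sum.cartesian_product
      by (rule sum.reindex_bij_witness[where i = "\<lambda>(m,i,l). (i,l,m)" and j = "\<lambda>(i,l,m). (m,i,l)"]) auto
    also have "\<dots> = (\<Sum>a\<in>UNIV. Re (hermitian_form N' (e a) (e a)) + Re (hermitian_form N' (\<i> *s e a) (\<i> *s e a)))"
      using real_part_metric_apply[of N' "realify _" "realify _"] by (simp add: sum.distrib)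
    finally show ?thesis .
  qed
  also have "\<dots> = 2 * Re (\<Sum>a\<in>UNIV. hermitian_form N' (e a) (e a))"
    by (simp add: hermitian_form_scale sum_distrib_left)
  also have "(\<Sum>a\<in>UNIV. hermitian_form N' (e a) (e a)) = (\<Sum>\<mu>\<in>UNIV. \<Sum>\<nu>\<in>UNIV. hinv \<mu> \<nu> z * N \<mu> \<nu>)"
  proof -
    have "(\<Sum>a\<in>UNIV. hermitian_form N' (e a) (e a)) = (\<Sum>\<mu>\<in>UNIV. \<Sum>\<nu>\<in>UNIV. \<Sum>a\<in>UNIV. N \<mu> \<nu> * e a $ \<mu> * cnj (e a $ \<nu>))"
      unfolding hermitian_form_def N'_def sum.cartesian_product
      by (rule sum.reindex_bij_witness[where j = "\<lambda>(m,i,l). (i,l,m)" and i = "\<lambda>(i,l,m). (m,i,l)"]) auto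
    then show ?thesis by (simp add: hinv_frame[OF e] sum_distrib_left sum_distrib_right mult_ac)
  qed
  finally have "dd v vol z = vol z * Re (\<Sum>\<mu>\<in>UNIV. \<Sum>\<nu>\<in>UNIV. hinv \<mu> \<nu> z * N \<mu> \<nu>)" by simp
  moreover have "Im (\<Sum>\<mu>\<in>UNIV. \<Sum>\<nu>\<in>UNIV. hinv \<mu> \<nu> z * N \<mu> \<nu>) = 0"
  proof -
    have "cnj (\<Sum>\<mu>\<in>UNIV. \<Sum>\<nu>\<in>UNIV. hinv \<mu> \<nu> z * N \<mu> \<nu>) = (\<Sum>\<mu>\<in>UNIV. \<Sum>\<nu>\<in>UNIV. hinv \<nu> \<mu> z * N \<nu> \<mu>)"
      by (simp add: cnj_hinv[OF z] hN[symmetric])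
    also have "\<dots> = (\<Sum>\<mu>\<in>UNIV. \<Sum>\<nu>\<in>UNIV. hinv \<mu> \<nu> z * N \<mu> \<nu>)" by (rule sum.swap)
    finally have "cnj (\<Sum>\<mu>\<in>UNIV. \<Sum>\<nu>\<in>UNIV. hinv \<mu> \<nu> z * N \<mu> \<nu>) = (\<Sum>\<mu>\<in>UNIV. \<Sum>\<nu>\<in>UNIV. hinv \<mu> \<nu> z * N \<mu> \<nu>)" .
    moreover have "Im w = 0" if "cnj w = w" for w using that by (simp add: complex_eq_iff)
    ultimately show ?thesis by blast
  qed
  ultimately show ?thesis unfolding N_def[symmetric] by (simp add: complex_eq_iff)
qed

lemma cdd_vol:
  assumes z: "z \<in> U"
  shows "cdd X (\<lambda>z. of_real (vol z)) z = of_real (vol z) * (\<Sum>\<mu>\<in>UNIV. \<Sum>\<nu>\<in>UNIV. hinv \<mu> \<nu> z * cdd X (\<lambda>z. H z $ \<mu> $ \<nu>) z)"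
  unfolding cdd_of_real[OF smooth_on_differentiable[OF smooth_vol z]] dd_vol[OF z]
  by (simp add: cdd_def sum_distrib_left sum.distrib[symmetric] algebra_simps)

end

section \<open>Consequences of the Kaehler condition\<close>

locale kaehler_chart = hermitian_chart U H for U :: "(complex^'n) set" and H +
  assumes kaehler: "\<And>z u v w. z \<in> U \<Longrightarrow> ext_deriv2 (fundamental_form H) z u v w = 0"
begin

text \<open>This is the part of \<open>d\<omega> = 0\<close> of type $(1,2)$, which is extracted by replacing each argument
  by its multiple with \<open>\<i>\<close>.\<close>

lemma kaehler_form_sym:
  assumes z: "z \<in> U"
  shows "cdd (ahol w) (\<lambda>z. hermitian_form (H z) u v) z = cdd (ahol v) (\<lambda>z. hermitian_form (H z) u w) z"
proof -
  define t where "t u v w = dd u (\<lambda>z. hermitian_form (H z) v w) z" for u v w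
  have d: "(\<lambda>z. hermitian_form (H z) v w) differentiable at z" for v w
    using smooth_on_differentiable[OF smooth_hermitian_form z] .
  have t2: "t u (\<i> *s v) w = \<i> * t u v w" and t3: "t u v (\<i> *s w) = - \<i> * t u v w" for u v w
  proof -
    have "dd u (\<lambda>z. c * hermitian_form (H z) v w) z = c * t u v w" for c
      by (simp add: dd_mult d t_def)
    from this[of \<i>] this[of "cnj \<i>"] show "t u (\<i> *s v) w = \<i> * t u v w" "t u v (\<i> *s w) = - \<i> * t u v w"
      unfolding t_def hermitian_form_scale by simp_all
  qed
  have "frechet_derivative (\<lambda>y. fundamental_form H y v w) (at z) u = Re (\<i> * t u v w)" for u v w
  proof -
    have "frechet_derivative (\<lambda>y. fundamental_form H y v w) (at z) u = dd u (\<lambda>y. Re (hermitian_form (H y) (\<i> *s v) w)) z"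
      by (simp add: dd_def fundamental_form_def)
    also have "\<dots> = Re (dd u (\<lambda>y. hermitian_form (H y) (\<i> *s v) w) z)" by (rule dd_Re[OF d])
    also have "dd u (\<lambda>y. hermitian_form (H y) (\<i> *s v) w) z = \<i> * t u v w"
      using t2[of u v w] by (simp add: t_def)
    finally show ?thesis .
  qed
  then have E: "Im (t u v w) - Im (t v u w) + Im (t w u v) = 0" for u v w
    using kaehler[OF z, of u v w] by (simp add: ext_deriv2_def)
  have "t w u v + \<i> * t (\<i> *s w) u v = t v u w + \<i> * t (\<i> *s v) u w"
    using E[of u v w] E[of "\<i> *s u" v w] E[of u "\<i> *s v" w] E[of "\<i> *s u" "\<i> *s v" w]
      E[of u v "\<i> *s w"] E[of "\<i> *s u" v "\<i> *s w"] E[of u "\<i> *s v" "\<i> *s w"] E[of "\<i> *s u" "\<i> *s v" "\<i> *s w"]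
    unfolding t2 t3 by (simp add: complex_eq_iff)
  then show ?thesis unfolding cdd_ahol[OF d] t_def by simp
qed

lemma kaehler_sym:
  assumes "z \<in> U"
  shows "dzb \<beta> (\<lambda>z. H z $ \<mu> $ \<nu>) z = dzb \<nu> (\<lambda>z. H z $ \<mu> $ \<beta>) z"
  using kaehler_form_sym[OF assms, of "axis \<beta> 1" "axis \<mu> 1" "axis \<nu> 1"] by (simp add: hermitian_form_axis)

text \<open>The form of \<open>kaehler_sym\<close> with raised indices; it is what cancels the
  derivatives of the inverse metric in \<open>bochner_eq\<close>.\<close>

lemma kaehler_hinv:
  assumes z: "z \<in> U"
  shows "(\<Sum>\<beta>\<in>UNIV. hinv \<alpha> \<beta> z * dzb \<beta> (hinv \<mu> \<nu>) z) = (\<Sum>\<beta>\<in>UNIV. hinv \<mu> \<beta> z * dzb \<beta> (hinv \<alpha> \<nu>) z)"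
proof -
  have e: "(\<Sum>\<beta>\<in>UNIV. hinv \<alpha> \<beta> z * dzb \<beta> (hinv \<mu> \<nu>) z) = - (\<Sum>\<beta>\<in>UNIV. \<Sum>\<sigma>\<in>UNIV. \<Sum>\<tau>\<in>UNIV.
      hinv \<alpha> \<beta> z * hinv \<sigma> \<nu> z * dzb \<beta> (\<lambda>z. H z $ \<sigma> $ \<tau>) z * hinv \<mu> \<tau> z)" for \<alpha> \<mu>
    unfolding cdd_hinv[OF z] by (simp add: sum_distrib_left sum_negf mult.assoc)
  have "(\<Sum>\<beta>\<in>UNIV. \<Sum>\<sigma>\<in>UNIV. \<Sum>\<tau>\<in>UNIV. hinv \<alpha> \<beta> z * hinv \<sigma> \<nu> z * dzb \<beta> (\<lambda>z. H z $ \<sigma> $ \<tau>) z * hinv \<mu> \<tau> z) =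
     (\<Sum>\<beta>\<in>UNIV. \<Sum>\<sigma>\<in>UNIV. \<Sum>\<tau>\<in>UNIV. hinv \<mu> \<beta> z * hinv \<sigma> \<nu> z * dzb \<beta> (\<lambda>z. H z $ \<sigma> $ \<tau>) z * hinv \<alpha> \<tau> z)"
    unfolding sum.cartesian_product
    by (rule sum.reindex_bij_witness[where i = "\<lambda>(b,s,t). (t,s,b)" and j = "\<lambda>(b,s,t). (t,s,b)"])
      (auto simp: kaehler_sym[OF z] mult_ac)
  then show ?thesis unfolding e by simp
qed

text \<open>The derivatives of the density and of the inverse metric produce the same triple sum up
  to an exchange of two antiholomorphic indices, and \<open>kaehler_sym\<close> permits this
  exchange. Hence divergences contain no derivatives of the metric.\<close>

lemma kaehler_divergence:
  assumes z: "z \<in> U"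
  shows "(\<Sum>\<beta>\<in>UNIV. dzb \<beta> (\<lambda>z. of_real (vol z) * hinv \<alpha> \<beta> z) z) = 0"
proof -
  have d: "(\<lambda>z. complex_of_real (vol z)) differentiable at z" "hinv \<alpha> \<beta> differentiable at z" for \<beta>
    using smooth_on_differentiable[OF smooth_on_of_real[OF open_U smooth_vol] z]
      smooth_on_differentiable[OF smooth_hinv z] by blast+
  have "(\<Sum>\<beta>\<in>UNIV. dzb \<beta> (\<lambda>z. of_real (vol z) * hinv \<alpha> \<beta> z) z) =
    of_real (vol z) * ((\<Sum>\<beta>\<in>UNIV. \<Sum>\<mu>\<in>UNIV. \<Sum>\<nu>\<in>UNIV. hinv \<mu> \<nu> z * dzb \<beta> (\<lambda>z. H z $ \<mu> $ \<nu>) z * hinv \<alpha> \<beta> z) -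
       (\<Sum>\<beta>\<in>UNIV. \<Sum>\<mu>\<in>UNIV. \<Sum>\<nu>\<in>UNIV. hinv \<mu> \<beta> z * dzb \<beta> (\<lambda>z. H z $ \<mu> $ \<nu>) z * hinv \<alpha> \<nu> z))"
    by (simp add: cdd_mult d cdd_vol[OF z] cdd_hinv[OF z] sum_subtractf[symmetric] sum_distrib_left sum_distrib_right algebra_simps)
  also have "(\<Sum>\<beta>\<in>UNIV. \<Sum>\<mu>\<in>UNIV. \<Sum>\<nu>\<in>UNIV. hinv \<mu> \<beta> z * dzb \<beta> (\<lambda>z. H z $ \<mu> $ \<nu>) z * hinv \<alpha> \<nu> z) =
     (\<Sum>\<beta>\<in>UNIV. \<Sum>\<mu>\<in>UNIV. \<Sum>\<nu>\<in>UNIV. hinv \<mu> \<nu> z * dzb \<beta> (\<lambda>z. H z $ \<mu> $ \<nu>) z * hinv \<alpha> \<beta> z)"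
    unfolding sum.cartesian_product
    by (rule sum.reindex_bij_witness[where i = "\<lambda>(b,s,t). (t,s,b)" and j = "\<lambda>(b,s,t). (t,s,b)"])
      (auto simp: kaehler_sym[OF z])
  finally show ?thesis by simp
qed

end

section \<open>The Bochner formula for harmonic maps\<close>

lemma riemann_c_scale:
  "riemann_c K x (c *s u) v w = c *s riemann_c K x u v w"
  "riemann_c K x u (c *s v) w = c *s riemann_c K x u v w"
  "riemann_c K x u v (c *s w) = c *s riemann_c K x u v w"
  by (simp_all add: riemann_c_def vec_eq_iff sum_distrib_left mult_ac)

lemma riemann_c_add:
  "riemann_c K x (u + u') v w = riemann_c K x u v w + riemann_c K x u' v w"
  "riemann_c K x u (v + v') w = riemann_c K x u v w + riemann_c K x u v' w"
  "riemann_c K x u v (w + w') = riemann_c K x u v w + riemann_c K x u v w'"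
  by (simp_all add: riemann_c_def vec_eq_iff sum.distrib distrib_left distrib_right)

lemma riemann_c_sum:
  "riemann_c K x (\<Sum>a\<in>I. u a) v w = (\<Sum>a\<in>I. riemann_c K x (u a) v w)"
  "riemann_c K x v (\<Sum>a\<in>I. u a) w = (\<Sum>a\<in>I. riemann_c K x v (u a) w)"
  "riemann_c K x v w (\<Sum>a\<in>I. u a) = (\<Sum>a\<in>I. riemann_c K x v w (u a))"
proof -
  have [simp]: "riemann_c K x 0 v w = 0" "riemann_c K x v 0 w = 0" "riemann_c K x v w 0 = 0" for v w
    by (simp_all add: riemann_c_def vec_eq_iff)
  show "riemann_c K x (\<Sum>a\<in>I. u a) v w = (\<Sum>a\<in>I. riemann_c K x (u a) v w)"
    "riemann_c K x v (\<Sum>a\<in>I. u a) w = (\<Sum>a\<in>I. riemann_c K x v (u a) w)"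
    "riemann_c K x v w (\<Sum>a\<in>I. u a) = (\<Sum>a\<in>I. riemann_c K x v w (u a))"
    by (induction I rule: infinite_finite_induct) (simp_all add: riemann_c_add)
qed

text \<open>The Euclidean divergence in the real and imaginary coordinates. The Riemannian
  divergence of \<open>X\<close> is that of \<open>vol\<close> times \<open>X\<close>, divided by
  \<open>vol\<close>.\<close>

definition rdiv :: "(complex^'n \<Rightarrow> complex^'n) \<Rightarrow> complex^'n \<Rightarrow> real" where
  "rdiv X z = (\<Sum>\<beta>\<in>UNIV. Re (dd (axis \<beta> 1) X z $ \<beta>) + Im (dd (axis \<beta> \<i>) X z $ \<beta>))"

locale harmonic_chart = kaehler_chart U H + map_chart T K U F
  for U :: "(complex^'n) set" and H and T :: "(real^'d) set" and K and F +
  assumes harmonic: "\<And>z. z \<in> U \<Longrightarrow>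
      (\<Sum>\<alpha>\<in>UNIV. \<Sum>\<beta>\<in>UNIV. hinv \<alpha> \<beta> z *s cnabla K F (ahol (axis \<beta> 1)) (cpush F (hol (axis \<alpha> 1))) z) = 0"
    and curvature: "\<And>x Z W. x \<in> T \<Longrightarrow> Re (complex_curvature K x Z (cnj_vec W) W (cnj_vec Z)) \<le> 0"
begin

text \<open>\<open>df \<alpha>\<close> is $f_\alpha$, \<open>hess \<alpha> \<beta>\<close> is $f_{\alpha\bar\beta}$, and \<open>hopf\<close> is the $(2,0)$-part of
  the pulled back metric. The divergence of \<open>hopf\<close> is the 1-form \<open>hdiv\<close>, and \<open>hfield\<close> is the real
  vector field whose divergence is the real part of the divergence \<open>bochner\<close> of \<open>hdiv\<close>.\<close>

definition df :: "'n \<Rightarrow> complex^'n \<Rightarrow> complex^'d" where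
  "df \<alpha> = cpush F (hol (axis \<alpha> 1))"

definition dfb :: "'n \<Rightarrow> complex^'n \<Rightarrow> complex^'d" where
  "dfb \<alpha> = cpush F (ahol (axis \<alpha> 1))"

definition hess :: "'n \<Rightarrow> 'n \<Rightarrow> complex^'n \<Rightarrow> complex^'d" where
  "hess \<alpha> \<beta> = cnabla K F (ahol (axis \<beta> 1)) (df \<alpha>)"

definition hopf :: "'n \<Rightarrow> 'n \<Rightarrow> complex^'n \<Rightarrow> complex" where
  "hopf \<alpha> \<mu> z = bil (K (F z)) (df \<alpha> z) (df \<mu> z)"

definition hdiv :: "'n \<Rightarrow> complex^'n \<Rightarrow> complex" where
  "hdiv \<alpha> z = (\<Sum>\<mu>\<in>UNIV. \<Sum>\<nu>\<in>UNIV. hinv \<mu> \<nu> z * dzb \<nu> (hopf \<alpha> \<mu>) z)"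

definition bochner :: "complex^'n \<Rightarrow> complex" where
  "bochner z = (\<Sum>\<alpha>\<in>UNIV. \<Sum>\<beta>\<in>UNIV. hinv \<alpha> \<beta> z * dzb \<beta> (hdiv \<alpha>) z)"

definition hfield :: "complex^'n \<Rightarrow> complex^'n" where
  "hfield z = (\<chi> \<beta>. cnj (\<Sum>\<alpha>\<in>UNIV. hinv \<alpha> \<beta> z * hdiv \<alpha> z) / 2)"

lemma smooth_df: "smooth_on (df \<alpha>) U" and smooth_dfb: "smooth_on (dfb \<alpha>) U"
  unfolding df_def dfb_def by (rule smooth_cpush)+

lemma smooth_hess: "smooth_on (hess \<alpha> \<beta>) U"
  unfolding hess_def by (rule smooth_cnabla[OF smooth_df])

lemma smooth_hopf: "smooth_on (hopf \<alpha> \<mu>) U"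
  unfolding hopf_def[abs_def] by (rule smooth_bil[OF smooth_df smooth_df])

lemma smooth_hdiv: "smooth_on (hdiv \<alpha>) U"
  unfolding hdiv_def[abs_def]
  by (rule smooth_on_sum smooth_on_mult smooth_hinv smooth_on_cdd' smooth_hopf open_U)+

lemma smooth_hfield: "smooth_on hfield U"
  unfolding hfield_def[abs_def] divide_inverse
  by (rule smooth_on_vec_lambda smooth_on_sum smooth_on_mult smooth_hinv smooth_hdiv open_U smooth_on_cnj smooth_on_const)+

lemma hess_commute: "z \<in> U \<Longrightarrow> hess \<alpha> \<beta> z = cnabla K F (hol (axis \<alpha> 1)) (dfb \<beta>) z"
  unfolding hess_def df_def dfb_def by (rule cnabla_cpush_commute)

lemma cnj_hess: "z \<in> U \<Longrightarrow> cnj_vec (hess \<alpha> \<beta> z) = hess \<beta> \<alpha> z"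
proof -
  assume z: "z \<in> U"
  have "cnj_vec (hess \<alpha> \<beta> z) = cnabla K F (hol (axis \<beta> 1)) (\<lambda>z. cnj_vec (df \<alpha> z)) z"
    unfolding hess_def by (simp add: cnj_cnabla[OF z smooth_df])
  also have "\<dots> = cnabla K F (hol (axis \<beta> 1)) (dfb \<alpha>) z"
    by (rule cnabla_cong[OF z]) (simp add: df_def dfb_def cnj_cpush)
  finally show ?thesis using hess_commute[OF z] by simp
qed

lemma hess_trace: "z \<in> U \<Longrightarrow> (\<Sum>\<alpha>\<in>UNIV. \<Sum>\<beta>\<in>UNIV. hinv \<alpha> \<beta> z *s hess \<alpha> \<beta> z) = 0"
  unfolding hess_def df_def by (rule harmonic)

text \<open>Of the two terms of the product rule, one contains the trace of \<open>hess\<close> and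
  vanishes by harmonicity.\<close>

lemma hdiv_eq:
  assumes z: "z \<in> U"
  shows "hdiv \<alpha> z = (\<Sum>\<mu>\<in>UNIV. \<Sum>\<nu>\<in>UNIV. hinv \<mu> \<nu> z * bil (K (F z)) (hess \<alpha> \<nu> z) (df \<mu> z))"
proof -
  have "dzb \<nu> (hopf \<alpha> \<mu>) z = bil (K (F z)) (hess \<alpha> \<nu> z) (df \<mu> z) + bil (K (F z)) (df \<alpha> z) (hess \<mu> \<nu> z)" for \<mu> \<nu>
    unfolding hopf_def[abs_def] hess_def by (rule cdd_bil[OF z smooth_df smooth_df])
  then have "hdiv \<alpha> z = (\<Sum>\<mu>\<in>UNIV. \<Sum>\<nu>\<in>UNIV. hinv \<mu> \<nu> z * bil (K (F z)) (hess \<alpha> \<nu> z) (df \<mu> z)) +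
      bil (K (F z)) (df \<alpha> z) (\<Sum>\<mu>\<in>UNIV. \<Sum>\<nu>\<in>UNIV. hinv \<mu> \<nu> z *s hess \<mu> \<nu> z)"
    by (simp add: hdiv_def bil_sum bil_scale distrib_left sum.distrib)
  then show ?thesis by (simp add: hess_trace[OF z])
qed

text \<open>The trace of \<open>hess\<close> vanishes identically, so its derivative does too; this
  trades a derivative of \<open>hess\<close> for one of the inverse metric.\<close>

lemma cnabla_hess_trace:
  assumes z: "z \<in> U"
  shows "(\<Sum>\<alpha>\<in>UNIV. \<Sum>\<beta>\<in>UNIV. hinv \<alpha> \<beta> z *s cnabla K F X (hess \<alpha> \<beta>) z) =
    - (\<Sum>\<alpha>\<in>UNIV. \<Sum>\<beta>\<in>UNIV. cdd X (hinv \<alpha> \<beta>) z *s hess \<alpha> \<beta> z)"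
proof -
  have s: "smooth_on (\<lambda>z. hinv \<alpha> \<beta> z *s hess \<alpha> \<beta> z) U" for \<alpha> \<beta>
    by (rule smooth_on_vec[OF open_U], simp, rule smooth_on_mult[OF open_U smooth_hinv smooth_on_vec_nth[OF open_U smooth_hess]])
  have "cnabla K F X (\<lambda>z. \<Sum>\<alpha>\<in>UNIV. \<Sum>\<beta>\<in>UNIV. hinv \<alpha> \<beta> z *s hess \<alpha> \<beta> z) z = cnabla K F X (\<lambda>z. 0) z"
    by (rule cnabla_cong[OF z hess_trace])
  also have "\<dots> = 0" by (simp add: cnabla_def vec_eq_iff)
  also have "cnabla K F X (\<lambda>z. \<Sum>\<alpha>\<in>UNIV. \<Sum>\<beta>\<in>UNIV. hinv \<alpha> \<beta> z *s hess \<alpha> \<beta> z) z =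
      (\<Sum>\<alpha>\<in>UNIV. \<Sum>\<beta>\<in>UNIV. cnabla K F X (\<lambda>z. hinv \<alpha> \<beta> z *s hess \<alpha> \<beta> z) z)"
    by (subst cnabla_sum[OF z]) (simp_all add: cnabla_sum[OF z] s smooth_on_sum[OF open_U])
  also have "\<dots> = (\<Sum>\<alpha>\<in>UNIV. \<Sum>\<beta>\<in>UNIV. cdd X (hinv \<alpha> \<beta>) z *s hess \<alpha> \<beta> z) +
      (\<Sum>\<alpha>\<in>UNIV. \<Sum>\<beta>\<in>UNIV. hinv \<alpha> \<beta> z *s cnabla K F X (hess \<alpha> \<beta>) z)"
    by (simp add: cnabla_scale[OF z smooth_hess smooth_hinv] sum.distrib)
  finally show ?thesis by (simp add: eq_neg_iff_add_eq_0 add.commute)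
qed

text \<open>Every third derivative of the map disappears. Commuting two antiholomorphic derivatives
  of \<open>df \<alpha>\<close> costs the curvature term, after which the third derivatives occur in
  a trace that harmonicity controls.\<close>

lemma bochner_eq:
  assumes z: "z \<in> U"
  shows "bochner z =
    (\<Sum>\<alpha>\<in>UNIV. \<Sum>\<beta>\<in>UNIV. \<Sum>\<mu>\<in>UNIV. \<Sum>\<nu>\<in>UNIV. hinv \<alpha> \<beta> z * hinv \<mu> \<nu> z *
      bil (K (F z)) (riemann_c K (F z) (dfb \<beta> z) (dfb \<nu> z) (df \<alpha> z)) (df \<mu> z)) +
    (\<Sum>\<alpha>\<in>UNIV. \<Sum>\<beta>\<in>UNIV. \<Sum>\<mu>\<in>UNIV. \<Sum>\<nu>\<in>UNIV. hinv \<alpha> \<beta> z * hinv \<mu> \<nu> z *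
      bil (K (F z)) (hess \<alpha> \<nu> z) (hess \<mu> \<beta> z))" (is "_ = ?T3 + ?T4")
proof -
  let ?b = "bil (K (F z))"
  have dh: "hinv \<mu> \<nu> differentiable at z" for \<mu> \<nu> using smooth_on_differentiable[OF smooth_hinv z] .
  have db: "(\<lambda>z. bil (K (F z)) (hess \<alpha> \<nu> z) (df \<mu> z)) differentiable at z" for \<alpha> \<mu> \<nu>
    using smooth_on_differentiable[OF smooth_bil[OF smooth_hess smooth_df] z] .
  \<comment> \<open>The indices are exchanged so that \<open>\<alpha>\<close> and
    \<open>\<beta>\<close>, which are contracted with \<open>hinv\<close>, both sit on
    \<open>hess\<close>.\<close>
  have comm: "cnabla K F (ahol (axis \<beta> 1)) (hess \<alpha> \<nu>) z =
      cnabla K F (ahol (axis \<nu> 1)) (hess \<alpha> \<beta>) z + riemann_c K (F z) (dfb \<beta> z) (dfb \<nu> z) (df \<alpha> z)" for \<alpha> \<beta> \<nu>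
    using cnabla_commutator[OF z smooth_df[of \<alpha>], of "ahol (axis \<beta> 1)" "ahol (axis \<nu> 1)"]
    unfolding hess_def dfb_def by (simp add: algebra_simps)
  have D: "dzb \<beta> (hdiv \<alpha>) z = (\<Sum>\<mu>\<in>UNIV. \<Sum>\<nu>\<in>UNIV. dzb \<beta> (hinv \<mu> \<nu>) z * ?b (hess \<alpha> \<nu> z) (df \<mu> z) +
      hinv \<mu> \<nu> z * ?b (cnabla K F (ahol (axis \<nu> 1)) (hess \<alpha> \<beta>) z) (df \<mu> z) +
      hinv \<mu> \<nu> z * ?b (riemann_c K (F z) (dfb \<beta> z) (dfb \<nu> z) (df \<alpha> z)) (df \<mu> z) +
      hinv \<mu> \<nu> z * ?b (hess \<alpha> \<nu> z) (hess \<mu> \<beta> z))" for \<alpha> \<beta>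
  proof -
    have "dzb \<beta> (hdiv \<alpha>) z = dzb \<beta> (\<lambda>z. \<Sum>\<mu>\<in>UNIV. \<Sum>\<nu>\<in>UNIV. hinv \<mu> \<nu> z * bil (K (F z)) (hess \<alpha> \<nu> z) (df \<mu> z)) z"
      by (rule cdd_cong[OF open_U z hdiv_eq])
    also have "\<dots> = (\<Sum>\<mu>\<in>UNIV. \<Sum>\<nu>\<in>UNIV. hinv \<mu> \<nu> z * dzb \<beta> (\<lambda>z. bil (K (F z)) (hess \<alpha> \<nu> z) (df \<mu> z)) z
        + dzb \<beta> (hinv \<mu> \<nu>) z * ?b (hess \<alpha> \<nu> z) (df \<mu> z))"
      by (simp add: cdd_sum cdd_mult dh db)
    also have "\<dots> = (\<Sum>\<mu>\<in>UNIV. \<Sum>\<nu>\<in>UNIV. dzb \<beta> (hinv \<mu> \<nu>) z * ?b (hess \<alpha> \<nu> z) (df \<mu> z) +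
      hinv \<mu> \<nu> z * ?b (cnabla K F (ahol (axis \<nu> 1)) (hess \<alpha> \<beta>) z) (df \<mu> z) +
      hinv \<mu> \<nu> z * ?b (riemann_c K (F z) (dfb \<beta> z) (dfb \<nu> z) (df \<alpha> z)) (df \<mu> z) +
      hinv \<mu> \<nu> z * ?b (hess \<alpha> \<nu> z) (hess \<mu> \<beta> z))"
    proof (intro sum.cong refl)
      fix \<mu> \<nu>
      have "dzb \<beta> (\<lambda>z. bil (K (F z)) (hess \<alpha> \<nu> z) (df \<mu> z)) z =
          ?b (cnabla K F (ahol (axis \<beta> 1)) (hess \<alpha> \<nu>) z) (df \<mu> z) + ?b (hess \<alpha> \<nu> z) (hess \<mu> \<beta> z)"
        unfolding hess_def[of \<mu> \<beta>] by (rule cdd_bil[OF z smooth_hess smooth_df])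
      then show "hinv \<mu> \<nu> z * dzb \<beta> (\<lambda>z. bil (K (F z)) (hess \<alpha> \<nu> z) (df \<mu> z)) z
        + dzb \<beta> (hinv \<mu> \<nu>) z * ?b (hess \<alpha> \<nu> z) (df \<mu> z) =
        dzb \<beta> (hinv \<mu> \<nu>) z * ?b (hess \<alpha> \<nu> z) (df \<mu> z) +
        hinv \<mu> \<nu> z * ?b (cnabla K F (ahol (axis \<nu> 1)) (hess \<alpha> \<beta>) z) (df \<mu> z) +
        hinv \<mu> \<nu> z * ?b (riemann_c K (F z) (dfb \<beta> z) (dfb \<nu> z) (df \<alpha> z)) (df \<mu> z) +
        hinv \<mu> \<nu> z * ?b (hess \<alpha> \<nu> z) (hess \<mu> \<beta> z)"
        unfolding comm[of \<beta> \<alpha> \<nu>] bil_add by (simp add: distrib_left)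
    qed
    finally show ?thesis .
  qed
  define T1 where "T1 = (\<Sum>\<alpha>\<in>UNIV. \<Sum>\<beta>\<in>UNIV. \<Sum>\<mu>\<in>UNIV. \<Sum>\<nu>\<in>UNIV. hinv \<alpha> \<beta> z * dzb \<beta> (hinv \<mu> \<nu>) z * ?b (hess \<alpha> \<nu> z) (df \<mu> z))"
  define T2 where "T2 = (\<Sum>\<alpha>\<in>UNIV. \<Sum>\<beta>\<in>UNIV. \<Sum>\<mu>\<in>UNIV. \<Sum>\<nu>\<in>UNIV. hinv \<alpha> \<beta> z * hinv \<mu> \<nu> z * ?b (cnabla K F (ahol (axis \<nu> 1)) (hess \<alpha> \<beta>) z) (df \<mu> z))"
  have "bochner z = T1 + T2 + ?T3 + ?T4"
    unfolding bochner_def D T1_def T2_def by (simp add: sum_distrib_left sum.distrib distrib_left mult.assoc)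
  \<comment> \<open>\<open>cnabla_hess_trace\<close> moves the derivative in \<open>T2\<close> onto
    \<open>hinv \<alpha> \<beta>\<close>; after relabelling, \<open>kaehler_hinv\<close> identifies
    the result with minus \<open>T1\<close>.\<close>
  moreover have "T1 + T2 = 0"
  proof -
    have "T2 = (\<Sum>\<mu>\<in>UNIV. \<Sum>\<nu>\<in>UNIV. \<Sum>\<alpha>\<in>UNIV. \<Sum>\<beta>\<in>UNIV. hinv \<mu> \<nu> z * (hinv \<alpha> \<beta> z * ?b (cnabla K F (ahol (axis \<nu> 1)) (hess \<alpha> \<beta>) z) (df \<mu> z)))"
      unfolding T2_def sum.cartesian_product
      by (rule sum.reindex_bij_witness[where i = "\<lambda>(m,n,a,b). (a,b,m,n)" and j = "\<lambda>(a,b,m,n). (m,n,a,b)"])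
        (auto simp: mult_ac)
    also have "\<dots> = (\<Sum>\<mu>\<in>UNIV. \<Sum>\<nu>\<in>UNIV. hinv \<mu> \<nu> z * ?b (\<Sum>\<alpha>\<in>UNIV. \<Sum>\<beta>\<in>UNIV. hinv \<alpha> \<beta> z *s cnabla K F (ahol (axis \<nu> 1)) (hess \<alpha> \<beta>) z) (df \<mu> z))"
      by (simp add: bil_sum bil_scale sum_distrib_left)
    also have "\<dots> = - (\<Sum>\<mu>\<in>UNIV. \<Sum>\<nu>\<in>UNIV. \<Sum>\<alpha>\<in>UNIV. \<Sum>\<beta>\<in>UNIV. hinv \<mu> \<nu> z * (dzb \<nu> (hinv \<alpha> \<beta>) z * ?b (hess \<alpha> \<beta> z) (df \<mu> z)))"
      unfolding cnabla_hess_trace[OF z]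
      by (simp add: bil_minus bil_sum bil_scale sum_distrib_left sum_negf)
    also have "(\<Sum>\<mu>\<in>UNIV. \<Sum>\<nu>\<in>UNIV. \<Sum>\<alpha>\<in>UNIV. \<Sum>\<beta>\<in>UNIV. hinv \<mu> \<nu> z * (dzb \<nu> (hinv \<alpha> \<beta>) z * ?b (hess \<alpha> \<beta> z) (df \<mu> z))) =
       (\<Sum>\<alpha>\<in>UNIV. \<Sum>\<mu>\<in>UNIV. \<Sum>\<nu>\<in>UNIV. \<Sum>\<beta>\<in>UNIV. hinv \<mu> \<beta> z * dzb \<beta> (hinv \<alpha> \<nu>) z * ?b (hess \<alpha> \<nu> z) (df \<mu> z))"
      unfolding sum.cartesian_product
      by (rule sum.reindex_bij_witness[where i = "\<lambda>(a,m,n,b). (m,b,a,n)" and j = "\<lambda>(m,b,a,n). (a,m,n,b)"])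
        (auto simp: mult_ac)
    also have "\<dots> = (\<Sum>\<alpha>\<in>UNIV. \<Sum>\<mu>\<in>UNIV. \<Sum>\<nu>\<in>UNIV. \<Sum>\<beta>\<in>UNIV. hinv \<alpha> \<beta> z * dzb \<beta> (hinv \<mu> \<nu>) z * ?b (hess \<alpha> \<nu> z) (df \<mu> z))"
      unfolding sum_distrib_right[symmetric] kaehler_hinv[OF z] ..
    also have "\<dots> = T1"
      unfolding T1_def sum.cartesian_product
      by (rule sum.reindex_bij_witness[where i = "\<lambda>(a,b,m,n). (a,m,n,b)" and j = "\<lambda>(a,m,n,b). (a,b,m,n)"]) auto
    finally show ?thesis by simp
  qed
  ultimately show ?thesis by simp
qed

text \<open>In a unitary frame the inverse metric is a sum over frame vectors, so both contractions
  become double sums over the vectors \<open>G a\<close> = df(e_a) and the mixed second derivatives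
  \<open>B a b\<close>. The second factor of the last term is conjugate to the first because
  \<open>hess\<close> is Hermitian.\<close>

lemma bochner_frame:
  fixes e :: "'n \<Rightarrow> complex^'n"
  assumes z: "z \<in> U" and e: "\<And>a b. hermitian_form (H z) (e a) (e b) = (if a = b then 1 else 0)"
  defines "G \<equiv> \<lambda>a. \<Sum>\<alpha>\<in>UNIV. e a $ \<alpha> *s df \<alpha> z"
    and "B \<equiv> \<lambda>a b. \<Sum>\<alpha>\<in>UNIV. \<Sum>\<nu>\<in>UNIV. (e a $ \<alpha> * cnj (e b $ \<nu>)) *s hess \<alpha> \<nu> z"
  shows "bochner z = (\<Sum>a\<in>UNIV. \<Sum>b\<in>UNIV.
      bil (K (F z)) (riemann_c K (F z) (cnj_vec (G a)) (cnj_vec (G b)) (G a)) (G b) +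
      bil (K (F z)) (B a b) (cnj_vec (B a b)))"
proof -
  let ?b = "bil (K (F z))" and ?R = "riemann_c K (F z)"
  have sw: "(\<Sum>\<alpha>\<in>UNIV. \<Sum>\<beta>\<in>UNIV. \<Sum>\<mu>\<in>UNIV. \<Sum>\<nu>\<in>UNIV. hinv \<alpha> \<beta> z * hinv \<mu> \<nu> z * t \<alpha> \<beta> \<mu> \<nu>) =
    (\<Sum>a\<in>UNIV. \<Sum>b\<in>UNIV. \<Sum>\<alpha>\<in>UNIV. \<Sum>\<beta>\<in>UNIV. \<Sum>\<mu>\<in>UNIV. \<Sum>\<nu>\<in>UNIV.
       e a $ \<alpha> * cnj (e a $ \<beta>) * (e b $ \<mu> * cnj (e b $ \<nu>)) * t \<alpha> \<beta> \<mu> \<nu>)" for t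
  proof -
    have "(\<Sum>\<alpha>\<in>UNIV. \<Sum>\<beta>\<in>UNIV. \<Sum>\<mu>\<in>UNIV. \<Sum>\<nu>\<in>UNIV. hinv \<alpha> \<beta> z * hinv \<mu> \<nu> z * t \<alpha> \<beta> \<mu> \<nu>) =
      (\<Sum>\<alpha>\<in>UNIV. \<Sum>\<beta>\<in>UNIV. \<Sum>\<mu>\<in>UNIV. \<Sum>\<nu>\<in>UNIV. \<Sum>a\<in>UNIV. \<Sum>b\<in>UNIV.
       e a $ \<alpha> * cnj (e a $ \<beta>) * (e b $ \<mu> * cnj (e b $ \<nu>)) * t \<alpha> \<beta> \<mu> \<nu>)"
      unfolding hinv_frame[OF e] sum_product unfolding sum_distrib_right ..
    also have "\<dots> = (\<Sum>a\<in>UNIV. \<Sum>b\<in>UNIV. \<Sum>\<alpha>\<in>UNIV. \<Sum>\<beta>\<in>UNIV. \<Sum>\<mu>\<in>UNIV. \<Sum>\<nu>\<in>UNIV.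
       e a $ \<alpha> * cnj (e a $ \<beta>) * (e b $ \<mu> * cnj (e b $ \<nu>)) * t \<alpha> \<beta> \<mu> \<nu>)"
      unfolding sum.cartesian_product
      by (rule sum.reindex_bij_witness[where i = "\<lambda>(a,b,p,q,m,n). (p,q,m,n,a,b)" and j = "\<lambda>(p,q,m,n,a,b). (a,b,p,q,m,n)"]) auto
    finally show ?thesis .
  qed
  have cG: "cnj_vec (G a) = (\<Sum>\<beta>\<in>UNIV. cnj (e a $ \<beta>) *s dfb \<beta> z)" for a
  proof -
    have "cnj_vec (df \<beta> z) = dfb \<beta> z" for \<beta> unfolding df_def dfb_def by (simp add: cnj_cpush[OF z])
    then have "cnj (df \<beta> z $ k) = dfb \<beta> z $ k" for \<beta> k by (metis cnj_vec_nth)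
    then show ?thesis by (simp add: vec_eq_iff G_def)
  qed
  have cB: "cnj_vec (B a b) = (\<Sum>\<mu>\<in>UNIV. \<Sum>\<beta>\<in>UNIV. (e b $ \<mu> * cnj (e a $ \<beta>)) *s hess \<mu> \<beta> z)" for a b
  proof -
    have h: "cnj (hess \<alpha> \<beta> z $ k) = hess \<beta> \<alpha> z $ k" for \<alpha> \<beta> k using cnj_hess[OF z, of \<alpha> \<beta>] by (metis cnj_vec_nth)
    have "cnj_vec (B a b) = (\<Sum>\<alpha>\<in>UNIV. \<Sum>\<nu>\<in>UNIV. (e b $ \<nu> * cnj (e a $ \<alpha>)) *s hess \<nu> \<alpha> z)"
      by (simp add: vec_eq_iff B_def h mult_ac)
    also have "\<dots> = (\<Sum>\<mu>\<in>UNIV. \<Sum>\<beta>\<in>UNIV. (e b $ \<mu> * cnj (e a $ \<beta>)) *s hess \<mu> \<beta> z)" by (rule sum.swap)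
    finally show ?thesis .
  qed
  have R: "?b (?R (cnj_vec (G a)) (cnj_vec (G b)) (G a)) (G b) =
    (\<Sum>\<alpha>\<in>UNIV. \<Sum>\<beta>\<in>UNIV. \<Sum>\<mu>\<in>UNIV. \<Sum>\<nu>\<in>UNIV. e a $ \<alpha> * cnj (e a $ \<beta>) * (e b $ \<mu> * cnj (e b $ \<nu>)) *
      ?b (?R (dfb \<beta> z) (dfb \<nu> z) (df \<alpha> z)) (df \<mu> z))" for a b
  proof -
    have "?b (?R (cnj_vec (G a)) (cnj_vec (G b)) (G a)) (G b) =
      (\<Sum>\<mu>\<in>UNIV. \<Sum>\<alpha>\<in>UNIV. \<Sum>\<nu>\<in>UNIV. \<Sum>\<beta>\<in>UNIV. e b $ \<mu> * (e a $ \<alpha> * (cnj (e b $ \<nu>) * (cnj (e a $ \<beta>) *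
        ?b (?R (dfb \<beta> z) (dfb \<nu> z) (df \<alpha> z)) (df \<mu> z)))))"
      unfolding cG by (simp only: G_def riemann_c_sum riemann_c_scale bil_sum bil_scale sum_distrib_left)
    also have "\<dots> = (\<Sum>\<alpha>\<in>UNIV. \<Sum>\<beta>\<in>UNIV. \<Sum>\<mu>\<in>UNIV. \<Sum>\<nu>\<in>UNIV. e a $ \<alpha> * cnj (e a $ \<beta>) * (e b $ \<mu> * cnj (e b $ \<nu>)) *
      ?b (?R (dfb \<beta> z) (dfb \<nu> z) (df \<alpha> z)) (df \<mu> z))"
      unfolding sum.cartesian_product
      by (rule sum.reindex_bij_witness[where i = "\<lambda>(a,b,m,n). (m,a,n,b)" and j = "\<lambda>(m,a,n,b). (a,b,m,n)"])
        (auto simp: mult_ac)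
    finally show ?thesis .
  qed
  have H: "?b (B a b) (cnj_vec (B a b)) =
    (\<Sum>\<alpha>\<in>UNIV. \<Sum>\<beta>\<in>UNIV. \<Sum>\<mu>\<in>UNIV. \<Sum>\<nu>\<in>UNIV. e a $ \<alpha> * cnj (e a $ \<beta>) * (e b $ \<mu> * cnj (e b $ \<nu>)) *
      ?b (hess \<alpha> \<nu> z) (hess \<mu> \<beta> z))" for a b
  proof -
    have "?b (B a b) (cnj_vec (B a b)) =
      (\<Sum>\<mu>\<in>UNIV. \<Sum>\<beta>\<in>UNIV. \<Sum>\<alpha>\<in>UNIV. \<Sum>\<nu>\<in>UNIV. (e b $ \<mu> * cnj (e a $ \<beta>)) * ((e a $ \<alpha> * cnj (e b $ \<nu>)) *
        ?b (hess \<alpha> \<nu> z) (hess \<mu> \<beta> z)))"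
      unfolding cB by (simp only: B_def bil_sum bil_scale sum_distrib_left)
    also have "\<dots> = (\<Sum>\<alpha>\<in>UNIV. \<Sum>\<beta>\<in>UNIV. \<Sum>\<mu>\<in>UNIV. \<Sum>\<nu>\<in>UNIV. e a $ \<alpha> * cnj (e a $ \<beta>) * (e b $ \<mu> * cnj (e b $ \<nu>)) *
      ?b (hess \<alpha> \<nu> z) (hess \<mu> \<beta> z))"
      unfolding sum.cartesian_product
      by (rule sum.reindex_bij_witness[where i = "\<lambda>(a,b,m,n). (m,b,a,n)" and j = "\<lambda>(m,b,a,n). (a,b,m,n)"])
        (auto simp: mult_ac)
    finally show ?thesis .
  qed
  show ?thesis
    unfolding bochner_eq[OF z] sw sum.distrib R H ..
qed

text \<open>The curvature hypothesis with Z the conjugate of \<open>u\<close> and W equal to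
  \<open>v\<close>, followed by the exchange of the last two arguments, which reverses the
  sign.\<close>

lemma curvature_term_nonneg:
  assumes "x \<in> T"
  shows "Re (bil (K x) (riemann_c K x (cnj_vec u) (cnj_vec v) u) v) \<ge> 0"
proof -
  have "Re (bil (K x) (riemann_c K x (cnj_vec u) (cnj_vec v) v) u) \<le> 0"
    using curvature[OF assms, of "cnj_vec u" v] by (simp add: complex_curvature_eq[OF assms])
  then show ?thesis using riemann_c_antisym_last[OF assms, of "cnj_vec u" "cnj_vec v" u v] by simp
qed

text \<open>Each pair of frame vectors contributes a curvature term and a squared norm, both
  non-negative. If the total is zero, every norm is, and since the frame spans, \<open>hess\<close>
  vanishes on coordinate vectors as well.\<close>

lemma bochner_nonneg: "z \<in> U \<Longrightarrow> Re (bochner z) \<ge> 0"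
  and bochner_zero: "z \<in> U \<Longrightarrow> Re (bochner z) = 0 \<Longrightarrow> hess \<alpha> \<beta> z = 0"
proof -
  assume z: "z \<in> U"
  obtain e :: "'n \<Rightarrow> complex^'n" where "\<forall>a b. hermitian_form (H z) (e a) (e b) = (if a = b then 1 else 0)"
    using unitary_frame[OF z] by blast
  note e = this[rule_format]
  define G where "G a = (\<Sum>\<alpha>\<in>UNIV. e a $ \<alpha> *s df \<alpha> z)" for a
  define B where "B a b = (\<Sum>\<alpha>\<in>UNIV. \<Sum>\<nu>\<in>UNIV. (e a $ \<alpha> * cnj (e b $ \<nu>)) *s hess \<alpha> \<nu> z)" for a b
  define r where "r a b = Re (bil (K (F z)) (riemann_c K (F z) (cnj_vec (G a)) (cnj_vec (G b)) (G a)) (G b)) +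
      Re (bil (K (F z)) (B a b) (cnj_vec (B a b)))" for a b
  have eq: "Re (bochner z) = (\<Sum>a\<in>UNIV. \<Sum>b\<in>UNIV. r a b)"
    using arg_cong[OF bochner_frame[OF z e], of Re] by (simp add: r_def G_def B_def)
  have nn: "r a b \<ge> 0" for a b
    unfolding r_def by (intro add_nonneg_nonneg curvature_term_nonneg bil_cnj_nonneg F_in z)
  show "Re (bochner z) \<ge> 0" unfolding eq by (intro sum_nonneg nn)
  assume "Re (bochner z) = 0"
  then have "\<forall>a\<in>UNIV. (\<Sum>b\<in>UNIV. r a b) = 0"
    unfolding eq by (subst (asm) sum_nonneg_eq_0_iff) (auto intro: sum_nonneg nn)
  then have r0: "r a b = 0" for a b
    using sum_nonneg_eq_0_iff[of UNIV "r a"] nn by auto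
  have B0: "B a b = 0" for a b
  proof (rule ccontr)
    assume "B a b \<noteq> 0"
    from bil_cnj_pos[OF F_in[OF z] this] curvature_term_nonneg[OF F_in[OF z], of "G a" "G b"]
    have "r a b > 0" unfolding r_def by simp
    then show False by (simp add: r0)
  qed
  \<comment> \<open>Expands a coordinate vector in the frame; the coefficient, called
    \<open>c\<close> below, is its Hermitian product with \<open>e a\<close>.\<close>
  have ax: "(\<Sum>a\<in>UNIV. cnj (\<Sum>\<beta>\<in>UNIV. cnj (H z $ \<gamma> $ \<beta>) * e a $ \<beta>) * e a $ \<mu>) = (if \<gamma> = \<mu> then 1 else 0)" for \<gamma> \<mu>
  proof -
    have "(\<Sum>a\<in>UNIV. cnj (\<Sum>\<beta>\<in>UNIV. cnj (H z $ \<gamma> $ \<beta>) * e a $ \<beta>) * e a $ \<mu>) = (\<Sum>\<beta>\<in>UNIV. H z $ \<gamma> $ \<beta> * hinv \<mu> \<beta> z)"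
      unfolding hinv_frame[OF e] sum_distrib_left
      by (subst sum.swap) (simp add: sum_distrib_left sum_distrib_right mult_ac)
    then show ?thesis by (simp add: hinv_left[OF z])
  qed
  define c where "c \<gamma> a = cnj (\<Sum>\<beta>\<in>UNIV. cnj (H z $ \<gamma> $ \<beta>) * e a $ \<beta>)" for \<gamma> a
  have "hess \<alpha> \<beta> z = (\<Sum>\<mu>\<in>UNIV. \<Sum>\<nu>\<in>UNIV. ((\<Sum>a\<in>UNIV. c \<alpha> a * e a $ \<mu>) * cnj (\<Sum>b\<in>UNIV. c \<beta> b * e b $ \<nu>)) *s hess \<mu> \<nu> z)"
  proof -
    have "(\<Sum>\<mu>\<in>UNIV. \<Sum>\<nu>\<in>UNIV. ((\<Sum>a\<in>UNIV. c \<alpha> a * e a $ \<mu>) * cnj (\<Sum>b\<in>UNIV. c \<beta> b * e b $ \<nu>)) *s hess \<mu> \<nu> z) =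
       (\<Sum>\<mu>\<in>UNIV. \<Sum>\<nu>\<in>UNIV. if \<alpha> = \<mu> then (if \<beta> = \<nu> then hess \<mu> \<nu> z else 0) else 0)"
      unfolding ax c_def by (intro sum.cong refl) simp
    also have "\<dots> = (\<Sum>\<mu>\<in>UNIV. if \<alpha> = \<mu> then hess \<mu> \<beta> z else 0)"
      by (intro sum.cong refl) simp
    finally show ?thesis by simp
  qed
  also have "\<dots> = (\<Sum>a\<in>UNIV. \<Sum>b\<in>UNIV. (c \<alpha> a * cnj (c \<beta> b)) *s B a b)"
  proof -
    have "(\<Sum>\<mu>\<in>UNIV. \<Sum>\<nu>\<in>UNIV. ((\<Sum>a\<in>UNIV. c \<alpha> a * e a $ \<mu>) * cnj (\<Sum>b\<in>UNIV. c \<beta> b * e b $ \<nu>)) * hess \<mu> \<nu> z $ k) =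
      (\<Sum>\<mu>\<in>UNIV. \<Sum>\<nu>\<in>UNIV. \<Sum>a\<in>UNIV. \<Sum>b\<in>UNIV. c \<alpha> a * e a $ \<mu> * cnj (c \<beta> b * e b $ \<nu>) * hess \<mu> \<nu> z $ k)" for k
      unfolding cnj_sum sum_product unfolding sum_distrib_right ..
    also have "\<dots> k = (\<Sum>a\<in>UNIV. \<Sum>b\<in>UNIV. \<Sum>\<mu>\<in>UNIV. \<Sum>\<nu>\<in>UNIV. c \<alpha> a * cnj (c \<beta> b) * (e a $ \<mu> * cnj (e b $ \<nu>) * hess \<mu> \<nu> z $ k))" for k
      unfolding sum.cartesian_product
      by (rule sum.reindex_bij_witness[where i = "\<lambda>(a,b,m,n). (m,n,a,b)" and j = "\<lambda>(m,n,a,b). (a,b,m,n)"])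
        (auto simp: mult_ac)
    finally show ?thesis by (simp add: vec_eq_iff B_def sum_distrib_left)
  qed
  also have "\<dots> = 0" by (simp add: B0)
  finally show "hess \<alpha> \<beta> z = 0" .
qed

text \<open>For P = p + iq both sides reduce to (p_x - q_y)/2 in each coordinate, which accounts for
  the conjugate and the factor 1/2 in \<open>hfield\<close>. The derivatives of density and metric
  drop out by \<open>kaehler_divergence\<close>.\<close>

lemma rdiv_hfield:
  assumes z: "z \<in> U"
  shows "rdiv (\<lambda>z. vol z *\<^sub>R hfield z) z = vol z * Re (bochner z)"
proof -
  define P where "P \<beta> z = (\<Sum>\<alpha>\<in>UNIV. of_real (vol z) * hinv \<alpha> \<beta> z * hdiv \<alpha> z)" for \<beta> z
  have sP: "smooth_on (P \<beta>) U" for \<beta>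
    unfolding P_def[abs_def]
    by (rule smooth_on_sum smooth_on_mult smooth_hinv smooth_hdiv open_U smooth_on_of_real smooth_vol)+
  have dP: "P \<beta> differentiable at z" for \<beta> using smooth_on_differentiable[OF sP z] .
  have dV: "(\<lambda>z. of_real (vol z) * hinv \<alpha> \<beta> z) differentiable at z" for \<alpha> \<beta>
    by (rule smooth_on_differentiable[OF _ z]) (rule smooth_on_mult smooth_hinv open_U smooth_on_of_real smooth_vol)+
  have dY: "hdiv \<alpha> differentiable at z" for \<alpha> using smooth_on_differentiable[OF smooth_hdiv z] .
  have dm: "(\<lambda>z. of_real (vol z) * hinv \<alpha> \<beta> z * hdiv \<alpha> z) differentiable at z" for \<alpha> \<beta>
    by (rule smooth_on_differentiable[OF _ z]) (rule smooth_on_mult smooth_hinv smooth_hdiv open_U smooth_on_of_real smooth_vol)+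
  have dX: "(\<lambda>z. vol z *\<^sub>R hfield z) differentiable at z"
    by (rule smooth_on_differentiable[OF smooth_on_scaleR[OF open_U smooth_vol smooth_hfield] z])
  have X: "dd v (\<lambda>z. vol z *\<^sub>R hfield z) z $ \<beta> = cnj (dd v (P \<beta>) z) / 2" for v \<beta>
  proof -
    have "dd v (\<lambda>z. vol z *\<^sub>R hfield z) z $ \<beta> = dd v (\<lambda>z. (vol z *\<^sub>R hfield z) $ \<beta>) z"
      using dd_vec_nth[OF dX] by simp
    also have "\<dots> = dd v (\<lambda>z. (1/2) * cnj (P \<beta> z)) z"
    proof (rule dd_cong[OF open_U z])
      fix y
      have "(vol y *\<^sub>R hfield y) $ \<beta> = of_real (vol y) * hfield y $ \<beta>"
        by (subst vector_scaleR_component) (rule scaleR_conv_of_real)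
      also have "\<dots> = (1/2) * cnj (P \<beta> y)"
        by (simp add: hfield_def P_def sum_distrib_left sum_divide_distrib mult_ac)
      finally show "(vol y *\<^sub>R hfield y) $ \<beta> = (1/2) * cnj (P \<beta> y)" .
    qed
    also have "\<dots> = (1/2) * cnj (dd v (P \<beta>) z)"
      unfolding dd_mult[OF differentiable_const bounded_linear.differentiable_apply[OF bounded_linear_cnj dP]]
        dd_cnj[OF dP] by simp
    finally show ?thesis by simp
  qed
  have "rdiv (\<lambda>z. vol z *\<^sub>R hfield z) z = Re (\<Sum>\<beta>\<in>UNIV. dzb \<beta> (P \<beta>) z)"
  proof -
    have "\<i> *s axis \<beta> 1 = (axis \<beta> \<i> :: complex^'n)" for \<beta> by (simp add: vec_eq_iff axis_def)
    then show ?thesis by (simp add: rdiv_def X cdd_ahol[OF dP] add_divide_distrib diff_divide_distrib)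
  qed
  also have "(\<Sum>\<beta>\<in>UNIV. dzb \<beta> (P \<beta>) z) = of_real (vol z) * bochner z"
  proof -
    have "(\<Sum>\<beta>\<in>UNIV. dzb \<beta> (P \<beta>) z) =
      (\<Sum>\<beta>\<in>UNIV. \<Sum>\<alpha>\<in>UNIV. of_real (vol z) * hinv \<alpha> \<beta> z * dzb \<beta> (hdiv \<alpha>) z) +
      (\<Sum>\<beta>\<in>UNIV. \<Sum>\<alpha>\<in>UNIV. dzb \<beta> (\<lambda>z. of_real (vol z) * hinv \<alpha> \<beta> z) z * hdiv \<alpha> z)"
    proof -
      have "dzb \<beta> (P \<beta>) z = (\<Sum>\<alpha>\<in>UNIV. of_real (vol z) * hinv \<alpha> \<beta> z * dzb \<beta> (hdiv \<alpha>) z +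
          dzb \<beta> (\<lambda>z. of_real (vol z) * hinv \<alpha> \<beta> z) z * hdiv \<alpha> z)" for \<beta>
        unfolding P_def[abs_def] by (subst cdd_sum[OF dm]) (simp add: cdd_mult[OF dV dY])
      then show ?thesis by (simp add: sum.distrib)
    qed
    also have "(\<Sum>\<beta>\<in>UNIV. \<Sum>\<alpha>\<in>UNIV. dzb \<beta> (\<lambda>z. of_real (vol z) * hinv \<alpha> \<beta> z) z * hdiv \<alpha> z) = 0"
      by (subst sum.swap) (simp add: sum_distrib_right[symmetric] kaehler_divergence[OF z])
    also have "(\<Sum>\<beta>\<in>UNIV. \<Sum>\<alpha>\<in>UNIV. of_real (vol z) * hinv \<alpha> \<beta> z * dzb \<beta> (hdiv \<alpha>) z) = of_real (vol z) * bochner z"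
      unfolding bochner_def by (subst sum.swap) (simp add: sum_distrib_left mult.assoc)
    finally show ?thesis by simp
  qed
  finally show ?thesis by simp
qed

end

section \<open>The maximum principle for pluriharmonic maps\<close>

text \<open>At a maximum the first derivative along \<open>v\<close> is zero. Were the second
  positive, the first would be positive shortly after, and by the mean value theorem the function
  would exceed its maximum.\<close>

lemma second_derivative_max:
  fixes \<phi> :: "'a::real_normed_vector \<Rightarrow> real"
  assumes \<phi>: "smooth_on \<phi> U" and "open U" "x \<in> U" and max: "\<And>y. y \<in> U \<Longrightarrow> \<phi> y \<le> \<phi> x"
  shows "dd v (dd v \<phi>) x \<le> 0"
proof (rule ccontr)
  assume pos: "\<not> ?thesis"
  have "continuous_on UNIV (\<lambda>t::real. x + t *\<^sub>R v)" by (intro continuous_intros)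
  then have "open ((\<lambda>t::real. x + t *\<^sub>R v) -` U)" using \<open>open U\<close> by (rule open_vimage[rotated])
  moreover have "0 \<in> (\<lambda>t::real. x + t *\<^sub>R v) -` U" using \<open>x \<in> U\<close> by simp
  ultimately obtain d where d: "d > 0" "ball 0 d \<subseteq> (\<lambda>t::real. x + t *\<^sub>R v) -` U"
    by (rule openE)
  then have inU: "x + t *\<^sub>R v \<in> U" if "\<bar>t\<bar> < d" for t using that by (auto simp: subset_iff)
  have g: "((\<lambda>t. \<phi> (x + t *\<^sub>R v)) has_real_derivative dd v \<phi> (x + t *\<^sub>R v)) (at t)" if "\<bar>t\<bar> < d" for t
    using has_vector_derivative_line[OF smooth_on_differentiable[OF \<phi> inU[OF that]]]
    by (simp add: has_real_derivative_iff_has_vector_derivative)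
  have "((\<lambda>t. dd v \<phi> (x + t *\<^sub>R v)) has_real_derivative dd v (dd v \<phi>) (x + 0 *\<^sub>R v)) (at 0)"
    using has_vector_derivative_line[OF smooth_on_differentiable[OF smooth_on_dd[OF \<phi>] inU[of 0]]] d(1)
    by (simp add: has_real_derivative_iff_has_vector_derivative)
  from DERIV_pos_inc_right[OF this] pos
  obtain e where "e > 0" and e: "\<And>h. 0 < h \<Longrightarrow> h < e \<Longrightarrow> dd v \<phi> (x + 0 *\<^sub>R v) < dd v \<phi> (x + h *\<^sub>R v)"
    by (auto simp: not_le)
  have "dd v \<phi> (x + 0 *\<^sub>R v) = 0"
    by (rule DERIV_local_max[OF g[of 0] d(1)]) (use d(1) max inU in auto)
  with e have e: "\<And>h. 0 < h \<Longrightarrow> h < e \<Longrightarrow> 0 < dd v \<phi> (x + h *\<^sub>R v)" by simp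
  define h where "h = min d e / 2"
  have h: "0 < h" "h < d" "h < e" using d(1) \<open>e > 0\<close> by (auto simp: h_def min_def)
  obtain s where s: "0 < s" "s < h" "\<phi> (x + h *\<^sub>R v) - \<phi> (x + 0 *\<^sub>R v) = (h - 0) * dd v \<phi> (x + s *\<^sub>R v)"
    using MVT2[OF h(1), of "\<lambda>t. \<phi> (x + t *\<^sub>R v)" "\<lambda>t. dd v \<phi> (x + t *\<^sub>R v)"] g h by force
  moreover have "(h - 0) * dd v \<phi> (x + s *\<^sub>R v) > 0"
    using e[of s] s(1,2) h by simp
  ultimately have "\<phi> (x + h *\<^sub>R v) > \<phi> x" by simp
  then show False using max[OF inU[of h]] h by simp
qed

lemma dd_cmult:
  fixes f :: "'a::real_normed_vector \<Rightarrow> 'b::real_normed_algebra"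
  shows "f differentiable at x \<Longrightarrow> dd v (\<lambda>x. c * f x) x = c * dd v f x"
  using dd_mult[OF differentiable_const, of f x v c] by simp

text \<open>The operator is a quarter of the Laplacian on the complex line spanned by
  \<open>u\<close>; the mixed terms cancel because derivatives commute.\<close>

lemma cdd_hol_ahol_max:
  fixes \<psi> :: "complex^'n \<Rightarrow> complex"
  assumes \<psi>: "smooth_on \<psi> U" and "open U" "x \<in> U" and max: "\<And>y. y \<in> U \<Longrightarrow> Re (\<psi> y) \<le> Re (\<psi> x)"
  shows "Re (cdd (hol u) (cdd (ahol u) \<psi>) x) \<le> 0"
proof -
  have d: "dd v \<psi> differentiable at x" for v
    by (rule smooth_on_differentiable[OF smooth_on_dd[OF \<psi>] assms(3)])
  have a: "dd w (cdd (ahol u) \<psi>) x = (dd w (dd u \<psi>) x + \<i> * dd w (dd (\<i> *s u) \<psi>) x) / 2" for w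
  proof -
    have "dd w (cdd (ahol u) \<psi>) x = dd w (\<lambda>x. (1/2) * (dd u \<psi> x + \<i> * dd (\<i> *s u) \<psi> x)) x"
      by (rule dd_cong[OF assms(2,3)]) (simp add: cdd_ahol[OF smooth_on_differentiable[OF \<psi>]])
    also have "\<dots> = (dd w (dd u \<psi>) x + \<i> * dd w (dd (\<i> *s u) \<psi>) x) / 2"
      unfolding dd_cmult[OF differentiable_add[OF d differentiable_mult[OF differentiable_const d]]]
        dd_add[OF d differentiable_mult[OF differentiable_const d]] dd_cmult[OF d] by simp
    finally show ?thesis .
  qed
  have "Re (dd v (dd v \<psi>) x) \<le> 0" for v
  proof -
    have "Re (dd v (dd v \<psi>) x) = dd v (dd v (\<lambda>x. Re (\<psi> x))) x"
    proof -
      have "dd v (dd v (\<lambda>x. Re (\<psi> x))) x = dd v (\<lambda>x. Re (dd v \<psi> x)) x"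
        by (rule dd_cong[OF assms(2,3)]) (rule dd_Re[OF smooth_on_differentiable[OF \<psi>]])
      then show ?thesis by (simp add: dd_Re[OF d])
    qed
    also have "\<dots> \<le> 0"
      by (rule second_derivative_max[OF smooth_on_Re[OF assms(2) \<psi>] assms(2,3) max])
    finally show ?thesis .
  qed
  from this[of u] this[of "\<i> *s u"]
  have "Re (dd u (dd u \<psi>) x) + Re (dd (\<i> *s u) (dd (\<i> *s u) \<psi>) x) \<le> 0" by simp
  moreover have eq: "cdd (hol u) (cdd (ahol u) \<psi>) x = (dd u (dd u \<psi>) x + dd (\<i> *s u) (dd (\<i> *s u) \<psi>) x) / 4"
  proof -
    have "cdd (ahol u) \<psi> differentiable at x"
      by (rule smooth_on_differentiable[OF smooth_on_cdd[OF assms(2) \<psi>] assms(3)])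
    then show ?thesis
      using dd_commute[OF \<psi> assms(2,3), of u "\<i> *s u"] by (simp add: cdd_hol a field_simps)
  qed
  ultimately show ?thesis unfolding eq Re_divide_numeral plus_complex.sel by simp
qed

section \<open>Second derivative of the squared length of a holomorphic field\<close>

context hermitian_chart
begin

lemma chern_curvature_eq:
  assumes z: "z \<in> U"
  shows "chern_curvature H z u v = (\<Sum>\<gamma>\<in>UNIV. \<Sum>\<delta>\<in>UNIV.
      (- cdd (hol u) (cdd (ahol u) (\<lambda>z. H z $ \<gamma> $ \<delta>)) z + (\<Sum>\<mu>\<in>UNIV. \<Sum>\<nu>\<in>UNIV.
        hinv \<mu> \<nu> z * cdd (hol u) (\<lambda>z. H z $ \<gamma> $ \<nu>) z * cdd (ahol u) (\<lambda>z. H z $ \<mu> $ \<delta>) z)) * v $ \<gamma> * cnj (v $ \<delta>))"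
proof -
  have dH: "(\<lambda>z. H z $ \<gamma> $ \<delta>) differentiable at y" if "y \<in> U" for \<gamma> \<delta> y
    by (rule smooth_on_differentiable[OF smooth_H_entry that])
  have dH': "cdd X (\<lambda>z. H z $ \<gamma> $ \<delta>) differentiable at z" for \<gamma> \<delta> X
    by (rule smooth_on_differentiable[OF smooth_on_cdd[OF open_U smooth_H_entry] z])
  have w2: "wirtinger \<alpha> (wirtinger_bar \<beta> (\<lambda>w. H w $ \<gamma> $ \<delta>)) z = dz \<alpha> (dzb \<beta> (\<lambda>w. H w $ \<gamma> $ \<delta>)) z" for \<alpha> \<beta> \<gamma> \<delta>
  proof -
    have "wirtinger_bar \<beta> (\<lambda>w. H w $ \<gamma> $ \<delta>) differentiable at z"
      using differentiable_cong_open[OF open_U z, of "dzb \<beta> (\<lambda>w. H w $ \<gamma> $ \<delta>)" "wirtinger_bar \<beta> (\<lambda>w. H w $ \<gamma> $ \<delta>)"]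
        wirtinger_bar_eq_cdd[OF dH] dH' by simp
    then have "wirtinger \<alpha> (wirtinger_bar \<beta> (\<lambda>w. H w $ \<gamma> $ \<delta>)) z = dz \<alpha> (wirtinger_bar \<beta> (\<lambda>w. H w $ \<gamma> $ \<delta>)) z"
      by (rule wirtinger_eq_cdd)
    also have "\<dots> = dz \<alpha> (dzb \<beta> (\<lambda>w. H w $ \<gamma> $ \<delta>)) z"
      by (rule cdd_cong[OF open_U z]) (rule wirtinger_bar_eq_cdd[OF dH])
    finally show ?thesis .
  qed
  have c: "chern_curvature_coeff H z \<alpha> \<beta> \<gamma> \<delta> = - dz \<alpha> (dzb \<beta> (\<lambda>w. H w $ \<gamma> $ \<delta>)) z +
      (\<Sum>\<mu>\<in>UNIV. \<Sum>\<nu>\<in>UNIV. hinv \<mu> \<nu> z * dz \<alpha> (\<lambda>z. H z $ \<gamma> $ \<nu>) z * dzb \<beta> (\<lambda>z. H z $ \<mu> $ \<delta>) z)" for \<alpha> \<beta> \<gamma> \<delta>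
    unfolding chern_curvature_coeff_def w2 wirtinger_eq_cdd[OF dH[OF z]] wirtinger_bar_eq_cdd[OF dH[OF z]] hinv_def ..
  have e2: "cdd (hol u) (cdd (ahol u) (\<lambda>z. H z $ \<gamma> $ \<delta>)) z = (\<Sum>\<alpha>\<in>UNIV. \<Sum>\<beta>\<in>UNIV. u $ \<alpha> * cnj (u $ \<beta>) * dz \<alpha> (dzb \<beta> (\<lambda>w. H w $ \<gamma> $ \<delta>)) z)" for \<gamma> \<delta>
  proof -
    have "dz \<alpha> (cdd (ahol u) (\<lambda>z. H z $ \<gamma> $ \<delta>)) z = (\<Sum>\<beta>\<in>UNIV. cnj (u $ \<beta>) * dz \<alpha> (dzb \<beta> (\<lambda>w. H w $ \<gamma> $ \<delta>)) z)" for \<alpha>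
    proof -
      have "dz \<alpha> (cdd (ahol u) (\<lambda>z. H z $ \<gamma> $ \<delta>)) z = dz \<alpha> (\<lambda>z. \<Sum>\<beta>\<in>UNIV. cnj (u $ \<beta>) * dzb \<beta> (\<lambda>w. H w $ \<gamma> $ \<delta>) z) z"
        by (rule cdd_cong[OF open_U z]) (rule cdd_hol_expand(2)[OF dH])
      then show ?thesis by (simp add: cdd_sum cdd_mult dH')
    qed
    then show ?thesis unfolding cdd_hol_expand(1)[OF dH', of u] by (simp add: sum_distrib_left mult.assoc)
  qed
  have e1: "(\<Sum>\<mu>\<in>UNIV. \<Sum>\<nu>\<in>UNIV. hinv \<mu> \<nu> z * cdd (hol u) (\<lambda>z. H z $ \<gamma> $ \<nu>) z * cdd (ahol u) (\<lambda>z. H z $ \<mu> $ \<delta>) z) =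
     (\<Sum>\<alpha>\<in>UNIV. \<Sum>\<beta>\<in>UNIV. u $ \<alpha> * cnj (u $ \<beta>) * (\<Sum>\<mu>\<in>UNIV. \<Sum>\<nu>\<in>UNIV. hinv \<mu> \<nu> z * dz \<alpha> (\<lambda>z. H z $ \<gamma> $ \<nu>) z * dzb \<beta> (\<lambda>z. H z $ \<mu> $ \<delta>) z))" for \<gamma> \<delta>
  proof -
    have "(\<Sum>\<mu>\<in>UNIV. \<Sum>\<nu>\<in>UNIV. hinv \<mu> \<nu> z * cdd (hol u) (\<lambda>z. H z $ \<gamma> $ \<nu>) z * cdd (ahol u) (\<lambda>z. H z $ \<mu> $ \<delta>) z) =
      (\<Sum>\<mu>\<in>UNIV. \<Sum>\<nu>\<in>UNIV. \<Sum>\<alpha>\<in>UNIV. \<Sum>\<beta>\<in>UNIV. hinv \<mu> \<nu> z * ((u $ \<alpha> * dz \<alpha> (\<lambda>z. H z $ \<gamma> $ \<nu>) z) * (cnj (u $ \<beta>) * dzb \<beta> (\<lambda>z. H z $ \<mu> $ \<delta>) z)))"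
      unfolding cdd_hol_expand[OF dH[OF z], of u] mult.assoc unfolding sum_product unfolding sum_distrib_left
      by (simp only: mult.assoc)
    also have "\<dots> = (\<Sum>\<alpha>\<in>UNIV. \<Sum>\<beta>\<in>UNIV. \<Sum>\<mu>\<in>UNIV. \<Sum>\<nu>\<in>UNIV. u $ \<alpha> * cnj (u $ \<beta>) * (hinv \<mu> \<nu> z * dz \<alpha> (\<lambda>z. H z $ \<gamma> $ \<nu>) z * dzb \<beta> (\<lambda>z. H z $ \<mu> $ \<delta>) z))"
      unfolding sum.cartesian_product
      by (rule sum.reindex_bij_witness[where i = "\<lambda>(a,b,m,n). (m,n,a,b)" and j = "\<lambda>(m,n,a,b). (a,b,m,n)"])
        (auto simp: mult_ac)
    finally show ?thesis by (simp add: sum_distrib_left)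
  qed
  have "chern_curvature H z u v = (\<Sum>\<gamma>\<in>UNIV. \<Sum>\<delta>\<in>UNIV. \<Sum>\<alpha>\<in>UNIV. \<Sum>\<beta>\<in>UNIV.
      chern_curvature_coeff H z \<alpha> \<beta> \<gamma> \<delta> * u $ \<alpha> * cnj (u $ \<beta>) * v $ \<gamma> * cnj (v $ \<delta>))"
    unfolding chern_curvature_def sum.cartesian_product
    by (rule sum.reindex_bij_witness[where i = "\<lambda>(a,b,m,n). (m,n,a,b)" and j = "\<lambda>(m,n,a,b). (a,b,m,n)"]) auto
  also have "\<dots> = (\<Sum>\<gamma>\<in>UNIV. \<Sum>\<delta>\<in>UNIV. (\<Sum>\<alpha>\<in>UNIV. \<Sum>\<beta>\<in>UNIV.
      u $ \<alpha> * cnj (u $ \<beta>) * chern_curvature_coeff H z \<alpha> \<beta> \<gamma> \<delta>) * v $ \<gamma> * cnj (v $ \<delta>))"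
    unfolding sum_distrib_right by (intro sum.cong refl) (simp add: mult_ac)
  also have "\<dots> = (\<Sum>\<gamma>\<in>UNIV. \<Sum>\<delta>\<in>UNIV. (- cdd (hol u) (cdd (ahol u) (\<lambda>z. H z $ \<gamma> $ \<delta>)) z + (\<Sum>\<mu>\<in>UNIV. \<Sum>\<nu>\<in>UNIV.
        hinv \<mu> \<nu> z * cdd (hol u) (\<lambda>z. H z $ \<gamma> $ \<nu>) z * cdd (ahol u) (\<lambda>z. H z $ \<mu> $ \<delta>) z)) * v $ \<gamma> * cnj (v $ \<delta>))"
    unfolding c e1 e2 by (simp add: right_diff_distrib sum_subtractf)
  finally show ?thesis .
qed

text \<open>At \<open>z\<close> the derivative \<open>A\<close> of the holomorphic vector field \<open>W\<close> is chosen so that the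
  Chern covariant derivative of \<open>W\<close> in the direction \<open>u\<close> vanishes.\<close>

lemma hermitian_form_second_derivative:
  assumes z: "z \<in> U" and W: "\<And>\<gamma>. smooth_on (\<lambda>y. W y $ \<gamma>) U"
    and WX: "\<And>\<gamma> y. y \<in> U \<Longrightarrow> cdd (hol u) (\<lambda>y. W y $ \<gamma>) y = A $ \<gamma>"
    and WXb: "\<And>\<gamma> y. y \<in> U \<Longrightarrow> cdd (ahol u) (\<lambda>y. W y $ \<gamma>) y = 0"
    and A: "\<And>\<mu>. A $ \<mu> = - (\<Sum>\<gamma>\<in>UNIV. \<Sum>\<nu>\<in>UNIV. hinv \<mu> \<nu> z * cdd (hol u) (\<lambda>z. H z $ \<gamma> $ \<nu>) z * W z $ \<gamma>)"
  shows "cdd (hol u) (cdd (ahol u) (\<lambda>y. hermitian_form (H y) (W y) (W y))) z = - chern_curvature H z u (W z)"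
proof -
  let ?X = "hol u" and ?Xb = "ahol u"
  have dH: "(\<lambda>z. H z $ \<gamma> $ \<delta>) differentiable at y" "cdd ?Xb (\<lambda>z. H z $ \<gamma> $ \<delta>) differentiable at y" if "y \<in> U" for \<gamma> \<delta> y
    using smooth_on_differentiable[OF smooth_H_entry that]
      smooth_on_differentiable[OF smooth_on_cdd[OF open_U smooth_H_entry] that] by blast+
  have dW: "(\<lambda>y. W y $ \<gamma>) differentiable at y" "(\<lambda>y. cnj (W y $ \<gamma>)) differentiable at y" if "y \<in> U" for \<gamma> y
    using smooth_on_differentiable[OF W that] smooth_on_differentiable[OF smooth_on_cnj[OF open_U W] that] by blast+
  have WX': "cdd ?X (\<lambda>y. cnj (W y $ \<gamma>)) y = 0" "cdd ?Xb (\<lambda>y. cnj (W y $ \<gamma>)) y = cnj (A $ \<gamma>)" if "y \<in> U" for \<gamma> y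
    using that by (simp_all add: cdd_cnj dW WX WXb)
  have 1: "cdd ?Xb (\<lambda>y. hermitian_form (H y) (W y) (W y)) y = (\<Sum>\<gamma>\<in>UNIV. \<Sum>\<delta>\<in>UNIV.
      cdd ?Xb (\<lambda>z. H z $ \<gamma> $ \<delta>) y * W y $ \<gamma> * cnj (W y $ \<delta>) + H y $ \<gamma> $ \<delta> * W y $ \<gamma> * cnj (A $ \<delta>))" if "y \<in> U" for y
    unfolding hermitian_form_def using that
    by (simp add: cdd_sum cdd_mult dH dW WXb WX' algebra_simps)
  \<comment> \<open>The vanishing covariant derivative of \<open>W\<close> along \<open>u\<close> at
    \<open>z\<close>, with its index lowered. It eliminates every term that contains the conjugate
    of \<open>A\<close>; the remaining \<open>A\<close> supplies the quadratic part of the Chern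
    curvature.\<close>
  have nabla0: "(\<Sum>\<gamma>\<in>UNIV. cdd ?X (\<lambda>z. H z $ \<gamma> $ \<delta>) z * W z $ \<gamma> + H z $ \<gamma> $ \<delta> * A $ \<gamma>) = 0" for \<delta>
  proof -
    have "(\<Sum>\<mu>\<in>UNIV. H z $ \<mu> $ \<delta> * A $ \<mu>) = - (\<Sum>\<mu>\<in>UNIV. \<Sum>\<gamma>\<in>UNIV. \<Sum>\<nu>\<in>UNIV. hinv \<mu> \<nu> z * H z $ \<mu> $ \<delta> * (cdd ?X (\<lambda>z. H z $ \<gamma> $ \<nu>) z * W z $ \<gamma>))"
      unfolding A by (simp add: sum_distrib_left sum_negf mult_ac)
    also have "(\<Sum>\<mu>\<in>UNIV. \<Sum>\<gamma>\<in>UNIV. \<Sum>\<nu>\<in>UNIV. hinv \<mu> \<nu> z * H z $ \<mu> $ \<delta> * (cdd ?X (\<lambda>z. H z $ \<gamma> $ \<nu>) z * W z $ \<gamma>)) =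
       (\<Sum>\<gamma>\<in>UNIV. \<Sum>\<nu>\<in>UNIV. \<Sum>\<mu>\<in>UNIV. hinv \<mu> \<nu> z * H z $ \<mu> $ \<delta> * (cdd ?X (\<lambda>z. H z $ \<gamma> $ \<nu>) z * W z $ \<gamma>))"
      unfolding sum.cartesian_product
      by (rule sum.reindex_bij_witness[where i = "\<lambda>(g,n,m). (m,g,n)" and j = "\<lambda>(m,g,n). (g,n,m)"]) auto
    also have "\<dots> = (\<Sum>\<gamma>\<in>UNIV. \<Sum>\<nu>\<in>UNIV. if \<nu> = \<delta> then cdd ?X (\<lambda>z. H z $ \<gamma> $ \<nu>) z * W z $ \<gamma> else 0)"
      unfolding sum_distrib_right[symmetric] hinv_right[OF z] by (intro sum.cong refl) simp
    also have "\<dots> = (\<Sum>\<gamma>\<in>UNIV. cdd ?X (\<lambda>z. H z $ \<gamma> $ \<delta>) z * W z $ \<gamma>)" by simp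
    finally show ?thesis by (simp add: sum.distrib)
  qed
  have "cdd ?X (cdd ?Xb (\<lambda>y. hermitian_form (H y) (W y) (W y))) z = cdd ?X (\<lambda>y. \<Sum>\<gamma>\<in>UNIV. \<Sum>\<delta>\<in>UNIV.
      cdd ?Xb (\<lambda>z. H z $ \<gamma> $ \<delta>) y * W y $ \<gamma> * cnj (W y $ \<delta>) + H y $ \<gamma> $ \<delta> * W y $ \<gamma> * cnj (A $ \<delta>)) z"
    by (rule cdd_cong[OF open_U z 1])
  also have "\<dots> = (\<Sum>\<gamma>\<in>UNIV. \<Sum>\<delta>\<in>UNIV.
      cdd ?X (cdd ?Xb (\<lambda>z. H z $ \<gamma> $ \<delta>)) z * W z $ \<gamma> * cnj (W z $ \<delta>) + cdd ?Xb (\<lambda>z. H z $ \<gamma> $ \<delta>) z * A $ \<gamma> * cnj (W z $ \<delta>)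
      + (cdd ?X (\<lambda>z. H z $ \<gamma> $ \<delta>) z * W z $ \<gamma> + H z $ \<gamma> $ \<delta> * A $ \<gamma>) * cnj (A $ \<delta>))"
    using z by (simp add: cdd_sum cdd_mult cdd_add dH dW WX WX' algebra_simps)
  also have "\<dots> = (\<Sum>\<gamma>\<in>UNIV. \<Sum>\<delta>\<in>UNIV. cdd ?X (cdd ?Xb (\<lambda>z. H z $ \<gamma> $ \<delta>)) z * W z $ \<gamma> * cnj (W z $ \<delta>))
      + (\<Sum>\<gamma>\<in>UNIV. \<Sum>\<delta>\<in>UNIV. cdd ?Xb (\<lambda>z. H z $ \<gamma> $ \<delta>) z * A $ \<gamma> * cnj (W z $ \<delta>))
      + (\<Sum>\<gamma>\<in>UNIV. \<Sum>\<delta>\<in>UNIV. (cdd ?X (\<lambda>z. H z $ \<gamma> $ \<delta>) z * W z $ \<gamma> + H z $ \<gamma> $ \<delta> * A $ \<gamma>) * cnj (A $ \<delta>))"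
    unfolding sum.distrib ..
  also have "(\<Sum>\<gamma>\<in>UNIV. \<Sum>\<delta>\<in>UNIV. (cdd ?X (\<lambda>z. H z $ \<gamma> $ \<delta>) z * W z $ \<gamma> + H z $ \<gamma> $ \<delta> * A $ \<gamma>) * cnj (A $ \<delta>)) =
      (\<Sum>\<delta>\<in>UNIV. (\<Sum>\<gamma>\<in>UNIV. cdd ?X (\<lambda>z. H z $ \<gamma> $ \<delta>) z * W z $ \<gamma> + H z $ \<gamma> $ \<delta> * A $ \<gamma>) * cnj (A $ \<delta>))"
    unfolding sum_distrib_right by (rule sum.swap)
  also have "(\<Sum>\<delta>\<in>UNIV. (\<Sum>\<gamma>\<in>UNIV. cdd ?X (\<lambda>z. H z $ \<gamma> $ \<delta>) z * W z $ \<gamma> + H z $ \<gamma> $ \<delta> * A $ \<gamma>) * cnj (A $ \<delta>)) = 0"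
    by (simp only: nabla0 mult_zero_left sum.neutral_const)
  also have "(\<Sum>\<gamma>\<in>UNIV. \<Sum>\<delta>\<in>UNIV. cdd ?Xb (\<lambda>z. H z $ \<gamma> $ \<delta>) z * A $ \<gamma> * cnj (W z $ \<delta>)) =
      - (\<Sum>\<gamma>\<in>UNIV. \<Sum>\<delta>\<in>UNIV. (\<Sum>\<mu>\<in>UNIV. \<Sum>\<nu>\<in>UNIV. hinv \<mu> \<nu> z * cdd ?X (\<lambda>z. H z $ \<gamma> $ \<nu>) z * cdd ?Xb (\<lambda>z. H z $ \<mu> $ \<delta>) z) * W z $ \<gamma> * cnj (W z $ \<delta>))"
  proof -
    have "(\<Sum>\<mu>\<in>UNIV. \<Sum>\<delta>\<in>UNIV. cdd ?Xb (\<lambda>z. H z $ \<mu> $ \<delta>) z * A $ \<mu> * cnj (W z $ \<delta>)) =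
       - (\<Sum>\<mu>\<in>UNIV. \<Sum>\<delta>\<in>UNIV. \<Sum>\<gamma>\<in>UNIV. \<Sum>\<nu>\<in>UNIV. hinv \<mu> \<nu> z * cdd ?X (\<lambda>z. H z $ \<gamma> $ \<nu>) z * cdd ?Xb (\<lambda>z. H z $ \<mu> $ \<delta>) z * W z $ \<gamma> * cnj (W z $ \<delta>))"
      unfolding A by (simp add: sum_distrib_left sum_distrib_right sum_negf mult_ac)
    also have "(\<Sum>\<mu>\<in>UNIV. \<Sum>\<delta>\<in>UNIV. \<Sum>\<gamma>\<in>UNIV. \<Sum>\<nu>\<in>UNIV. hinv \<mu> \<nu> z * cdd ?X (\<lambda>z. H z $ \<gamma> $ \<nu>) z * cdd ?Xb (\<lambda>z. H z $ \<mu> $ \<delta>) z * W z $ \<gamma> * cnj (W z $ \<delta>)) =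
       (\<Sum>\<gamma>\<in>UNIV. \<Sum>\<delta>\<in>UNIV. \<Sum>\<mu>\<in>UNIV. \<Sum>\<nu>\<in>UNIV. hinv \<mu> \<nu> z * cdd ?X (\<lambda>z. H z $ \<gamma> $ \<nu>) z * cdd ?Xb (\<lambda>z. H z $ \<mu> $ \<delta>) z * W z $ \<gamma> * cnj (W z $ \<delta>))"
      unfolding sum.cartesian_product
      by (rule sum.reindex_bij_witness[where i = "\<lambda>(g,d,m,n). (m,d,g,n)" and j = "\<lambda>(m,d,g,n). (g,d,m,n)"]) auto
    finally show ?thesis by (simp add: sum_distrib_right)
  qed
  finally show ?thesis
    unfolding chern_curvature_eq[OF z] by (simp add: sum_negf[symmetric] sum.distrib[symmetric] algebra_simps)
qed

end

section \<open>Second derivative of the energy along a holomorphic field\<close>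

context map_chart
begin

lemma conn_sum_dir:
  assumes "cpush F X z = (\<Sum>\<alpha>\<in>I. c \<alpha> *s cpush F (Y \<alpha>) z)"
  shows "conn K F X z k j = (\<Sum>\<alpha>\<in>I. c \<alpha> * conn K F (Y \<alpha>) z k j)"
  unfolding conn_def assms
  by (simp add: sum_distrib_left) (subst sum.swap, simp add: mult_ac)

end

context harmonic_chart
begin

lemma cpush_hol: "z \<in> U \<Longrightarrow> cpush F (hol u) z = (\<Sum>\<alpha>\<in>UNIV. u $ \<alpha> *s df \<alpha> z)"
  and cpush_ahol: "z \<in> U \<Longrightarrow> cpush F (ahol u) z = (\<Sum>\<alpha>\<in>UNIV. cnj (u $ \<alpha>) *s dfb \<alpha> z)"
  unfolding df_def dfb_def cpush_def
  by (simp_all add: vec_eq_iff cdd_hol_expand[OF smooth_on_differentiable[OF smooth_on_F], where u = u])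

lemma cnabla_ahol:
  assumes z: "z \<in> U" and s: "smooth_on s U"
  shows "cnabla K F (ahol u) s z = (\<Sum>\<beta>\<in>UNIV. cnj (u $ \<beta>) *s cnabla K F (ahol (axis \<beta> 1)) s z)"
proof -
  have "conn K F (ahol u) z k j = (\<Sum>\<beta>\<in>UNIV. cnj (u $ \<beta>) * conn K F (ahol (axis \<beta> 1)) z k j)" for k j
    by (rule conn_sum_dir) (simp add: cpush_ahol[OF z, of u] dfb_def)
  then have "(\<Sum>j\<in>UNIV. conn K F (ahol u) z k j * s z $ j) =
     (\<Sum>\<beta>\<in>UNIV. cnj (u $ \<beta>) * (\<Sum>j\<in>UNIV. conn K F (ahol (axis \<beta> 1)) z k j * s z $ j))" for k
    by (simp add: sum_distrib_left sum_distrib_right mult.assoc) (rule sum.swap)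
  then show ?thesis
    by (simp add: vec_eq_iff cnabla_def distrib_left sum.distrib
      cdd_hol_expand(2)[OF smooth_on_differentiable[OF smooth_on_vec_nth[OF open_U s] z], where u = u])
qed

text \<open>For a pluriharmonic map the section \<open>s\<close> = df(W) is annihilated by the
  antiholomorphic covariant derivative along \<open>u\<close>. The second derivative of its squared
  norm is therefore the squared norm of its holomorphic derivative plus a single curvature
  term.\<close>

lemma energy_second_derivative:
  assumes hess0: "\<And>\<alpha> \<beta> y. y \<in> U \<Longrightarrow> hess \<alpha> \<beta> y = 0" and z: "z \<in> U" and W: "\<And>\<gamma>. smooth_on (\<lambda>y. W y $ \<gamma>) U"
    and WXb: "\<And>\<gamma> y. y \<in> U \<Longrightarrow> cdd (ahol u) (\<lambda>y. W y $ \<gamma>) y = 0"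
  shows "Re (cdd (hol u) (cdd (ahol u) (\<lambda>y. bil (K (F y)) (\<Sum>\<gamma>\<in>UNIV. W y $ \<gamma> *s df \<gamma> y) (cnj_vec (\<Sum>\<gamma>\<in>UNIV. W y $ \<gamma> *s df \<gamma> y)))) z) \<ge> 0"
proof -
  let ?X = "hol u" and ?Xb = "ahol u"
  define s where "s y = (\<Sum>\<gamma>\<in>UNIV. W y $ \<gamma> *s df \<gamma> y)" for y
  have st: "smooth_on (\<lambda>y. W y $ \<gamma> *s df \<gamma> y) U" for \<gamma>
    by (rule smooth_on_vec[OF open_U], simp, rule smooth_on_mult[OF open_U W smooth_on_vec_nth[OF open_U smooth_df]])
  have ss: "smooth_on s U" unfolding s_def[abs_def] by (rule smooth_on_sum[OF open_U st])
  have sc: "smooth_on (\<lambda>y. cnj_vec (s y)) U"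
    by (rule smooth_on_vec[OF open_U], simp, rule smooth_on_cnj[OF open_U smooth_on_vec_nth[OF open_U ss]])
  have d0: "cnabla K F (ahol w) (df \<gamma>) y = 0" if "y \<in> U" for y \<gamma> w
    using hess0[OF that] unfolding cnabla_ahol[OF that smooth_df, where u = w] hess_def by simp
  have Xbs: "cnabla K F ?Xb s y = 0" if "y \<in> U" for y
    unfolding s_def[abs_def]
    by (simp add: cnabla_sum[OF that st] cnabla_scale[OF that smooth_df W] WXb[OF that] d0[OF that])
  have Xsc: "cnabla K F ?X (\<lambda>y. cnj_vec (s y)) y = 0" if "y \<in> U" for y
    using cnj_cnabla[OF that ss, of ?Xb] Xbs[OF that] by (simp add: vec_eq_iff)
  define t where "t = cnabla K F ?Xb (\<lambda>y. cnj_vec (s y))"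
  have st': "smooth_on t U" unfolding t_def by (rule smooth_cnabla[OF sc])
  have tz: "t z = cnj_vec (cnabla K F ?X s z)"
    using cnj_cnabla[OF z ss, of ?X] by (simp add: t_def)
  have "cdd ?X (cdd ?Xb (\<lambda>y. bil (K (F y)) (s y) (cnj_vec (s y)))) z = cdd ?X (\<lambda>y. bil (K (F y)) (s y) (t y)) z"
    by (rule cdd_cong[OF open_U z]) (simp add: cdd_bil[OF _ ss sc] Xbs t_def)
  also have "\<dots> = bil (K (F z)) (cnabla K F ?X s z) (t z) + bil (K (F z)) (s z) (cnabla K F ?X t z)"
    by (rule cdd_bil[OF z ss st'])
  also have "cnabla K F ?X t z = riemann_c K (F z) (cpush F ?X z) (cpush F ?Xb z) (cnj_vec (s z))"
  proof -
    have "cnabla K F ?Xb (cnabla K F ?X (\<lambda>y. cnj_vec (s y))) z = cnabla K F ?Xb (\<lambda>y. 0) z"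
      by (rule cnabla_cong[OF z Xsc])
    also have "\<dots> = 0" by (simp add: cnabla_def vec_eq_iff)
    finally show ?thesis using cnabla_commutator[OF z sc, of ?X ?Xb] by (simp add: t_def)
  qed
  finally have eq: "cdd ?X (cdd ?Xb (\<lambda>y. bil (K (F y)) (s y) (cnj_vec (s y)))) z =
     bil (K (F z)) (cnabla K F ?X s z) (cnj_vec (cnabla K F ?X s z)) +
     bil (K (F z)) (s z) (riemann_c K (F z) (cpush F ?X z) (cpush F ?Xb z) (cnj_vec (s z)))"
    unfolding tz .
  have sz: "s z = cpush F (hol (W z)) z" by (simp add: s_def cpush_hol[OF z])
  have sz': "cnj_vec (s z) = cpush F (ahol (W z)) z"
    unfolding sz by (simp add: cnj_cpush[OF z])
  have cX: "cpush F ?Xb z = cnj_vec (cpush F ?X z)" by (simp add: cnj_cpush[OF z])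
  \<comment> \<open>Antiholomorphic covariant derivatives annihilate each
    \<open>df \<gamma>\<close>, so the curvature of two antiholomorphic directions acts on it as
    zero. This is the Bianchi term that drops out.\<close>
  have "riemann_c K (F z) (cpush F ?Xb z) (cnj_vec (s z)) (cpush F ?X z) = 0"
  proof -
    have "riemann_c K (F z) (cpush F ?Xb z) (cpush F (ahol (W z)) z) (df \<gamma> z) = 0" for \<gamma>
    proof -
      have "cnabla K F X (cnabla K F (ahol w) (df \<gamma>)) z = 0" for X w
      proof -
        have "cnabla K F X (cnabla K F (ahol w) (df \<gamma>)) z = cnabla K F X (\<lambda>y. 0) z"
          by (rule cnabla_cong[OF z d0])
        then show ?thesis by (simp add: cnabla_def vec_eq_iff)
      qed
      then show ?thesis using cnabla_commutator[OF z smooth_df, of ?Xb "ahol (W z)" \<gamma>] by simp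
    qed
    then show ?thesis unfolding sz' cpush_hol[OF z, where u = u] by (simp add: riemann_c_sum riemann_c_scale)
  qed
  then have "riemann_c K (F z) (cpush F ?X z) (cpush F ?Xb z) (cnj_vec (s z)) =
     - riemann_c K (F z) (cnj_vec (s z)) (cpush F ?X z) (cpush F ?Xb z)"
    using riemann_c_bianchi[OF F_in[OF z], of "cpush F ?X z" "cpush F ?Xb z" "cnj_vec (s z)"]
    by (simp add: eq_neg_iff_add_eq_0)
  \<comment> \<open>The remaining Bianchi term has the argument pattern of the curvature hypothesis,
    with Z the conjugate of \<open>s z\<close> and W the conjugate of df(u).\<close>
  then have "Re (bil (K (F z)) (s z) (riemann_c K (F z) (cpush F ?X z) (cpush F ?Xb z) (cnj_vec (s z)))) =
     - Re (bil (K (F z)) (riemann_c K (F z) (cnj_vec (s z)) (cpush F ?X z) (cpush F ?Xb z)) (s z))"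
    by (simp add: bil_minus bil_sym[OF F_in[OF z], of "s z"])
  also have "\<dots> \<ge> 0"
    using curvature[OF F_in[OF z], of "cnj_vec (s z)" "cpush F ?Xb z"]
    by (simp add: complex_curvature_eq[OF F_in[OF z]] cX)
  finally show ?thesis
    unfolding s_def[symmetric] eq using bil_cnj_nonneg[OF F_in[OF z], of "cnabla K F ?X s z"] by simp
qed

text \<open>\<open>c\<close> is the maximal ratio of energy to squared length, attained at
  \<open>W0\<close>. Positivity of the curvature in the single direction \<open>u\<close> against
  \<open>W0\<close> contradicts this, whatever \<open>W0\<close> is; hence the uniformity in the
  curvature condition.\<close>

theorem no_maximum:
  assumes hess0: "\<And>\<alpha> \<beta> y. y \<in> U \<Longrightarrow> hess \<alpha> \<beta> y = 0" and z: "z \<in> U"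
    and RC: "\<And>v. v \<noteq> 0 \<Longrightarrow> Re (chern_curvature H z u v) > 0"
    and "c > 0" and W0: "W0 \<noteq> 0"
    and le: "\<And>y W. y \<in> U \<Longrightarrow> Re (bil (K (F y)) (cpush F (hol W) y) (cnj_vec (cpush F (hol W) y))) \<le> c * Re (hermitian_form (H y) W W)"
    and eq: "Re (bil (K (F z)) (cpush F (hol W0) z) (cnj_vec (cpush F (hol W0) z))) = c * Re (hermitian_form (H z) W0 W0)"
  shows False
proof -
  \<comment> \<open>A nonzero component of \<open>u\<close> is needed as divisor in the affine
    function below.\<close>
  have "u \<noteq> 0"
  proof
    assume "u = 0"
    then have "chern_curvature H z u W0 = 0" by (simp add: chern_curvature_def)
    then show False using RC[OF W0] by simp
  qed
  then obtain \<alpha> where \<alpha>: "u $ \<alpha> \<noteq> 0" by (auto simp: vec_eq_iff)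
  define A where "A = (\<chi> \<mu>. - (\<Sum>\<gamma>\<in>UNIV. \<Sum>\<nu>\<in>UNIV. hinv \<mu> \<nu> z * cdd (hol u) (\<lambda>z. H z $ \<gamma> $ \<nu>) z * W0 $ \<gamma>))"
  \<comment> \<open>A holomorphic affine function that vanishes at \<open>z\<close> and has
    derivative 1 along \<open>hol u\<close>, so that \<open>W\<close> starts at \<open>W0\<close>
    with derivative \<open>A\<close>.\<close>
  define \<l> where "\<l> y = (y - z) $ \<alpha> / u $ \<alpha>" for y
  define W where "W y = W0 + \<l> y *s A" for y
  have ll: "\<l> = (\<lambda>y. (y $ \<alpha>) * (1 / u $ \<alpha>) - z $ \<alpha> / u $ \<alpha>)"
    by (simp add: \<l>_def fun_eq_iff diff_divide_distrib)
  have sl: "smooth_on \<l> U"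
    unfolding ll by (rule smooth_on_diff smooth_on_mult smooth_on_const smooth_on_vec_nth smooth_on_id open_U)+
  have dl: "dd v \<l> y = v $ \<alpha> / u $ \<alpha>" for v y
  proof -
    have b: "bounded_linear (\<lambda>y. (y $ \<alpha>) * (1 / u $ \<alpha>))"
      by (intro bounded_linear_mult_const bounded_linear_vec_nth)
    then have "dd v \<l> y = dd v (\<lambda>y. (y $ \<alpha>) * (1 / u $ \<alpha>)) y"
      unfolding ll by (simp add: dd_diff bounded_linear_imp_differentiable)
    then show ?thesis using dd_bounded_linear[OF b] by simp
  qed
  have cl: "cdd (hol u) \<l> y = 1" "cdd (ahol u) \<l> y = 0" if "y \<in> U" for y
    using \<alpha> smooth_on_differentiable[OF sl that] by (simp_all add: cdd_hol cdd_ahol dl)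
  have W: "smooth_on (\<lambda>y. W y $ \<gamma>) U" for \<gamma>
    unfolding W_def by (simp, (rule smooth_on_add smooth_on_mult smooth_on_const sl open_U)+)
  have cW: "cdd X (\<lambda>y. W y $ \<gamma>) y = cdd X \<l> y * A $ \<gamma>" if "y \<in> U" for X :: "(complex^'n) \<times> (complex^'n)" and \<gamma> y
    unfolding W_def using smooth_on_differentiable[OF sl that] by (simp add: cdd_add cdd_mult)
  have Wz: "W z = W0" by (simp add: W_def \<l>_def)
  define E where "E y = bil (K (F y)) (\<Sum>\<gamma>\<in>UNIV. W y $ \<gamma> *s df \<gamma> y) (cnj_vec (\<Sum>\<gamma>\<in>UNIV. W y $ \<gamma> *s df \<gamma> y))" for y
  define N where "N y = hermitian_form (H y) (W y) (W y)" for y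
  have sN: "smooth_on N U"
    unfolding N_def[abs_def] hermitian_form_def
    by (rule smooth_on_sum smooth_on_mult smooth_on_cnj smooth_H_entry W open_U)+
  have sW: "smooth_on (\<lambda>y. \<Sum>\<gamma>\<in>UNIV. W y $ \<gamma> *s df \<gamma> y) U"
    by (rule smooth_on_vec[OF open_U], simp,
        rule smooth_on_sum[OF open_U smooth_on_mult[OF open_U W smooth_on_vec_nth[OF open_U smooth_df]]])
  have sWc: "smooth_on (\<lambda>y. cnj_vec (\<Sum>\<gamma>\<in>UNIV. W y $ \<gamma> *s df \<gamma> y)) U"
    by (rule smooth_on_vec[OF open_U], subst cnj_vec_nth, rule smooth_on_cnj[OF open_U smooth_on_vec_nth[OF open_U sW]])
  have sE: "smooth_on E U"
    unfolding E_def[abs_def] by (rule smooth_bil[OF sW sWc])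
  \<comment> \<open>Non-positive near \<open>z\<close> and zero at \<open>z\<close>, thus maximal
    there, and free of the derivatives that a quotient would bring.\<close>
  define \<psi> where "\<psi> y = E y - of_real c * N y" for y
  have s\<psi>: "smooth_on \<psi> U" unfolding \<psi>_def[abs_def]
    by (intro smooth_on_diff smooth_on_mult open_U sE sN smooth_on_const)
  have "Re (\<psi> y) \<le> Re (\<psi> z)" if "y \<in> U" for y
    using le[OF that, of "W y"] eq that z by (simp add: \<psi>_def E_def N_def cpush_hol Wz)
  from cdd_hol_ahol_max[OF s\<psi> open_U z this]
  have "Re (cdd (hol u) (cdd (ahol u) \<psi>) z) \<le> 0" .
  moreover have "cdd (hol u) (cdd (ahol u) \<psi>) z = cdd (hol u) (cdd (ahol u) E) z - of_real c * cdd (hol u) (cdd (ahol u) N) z"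
  proof -
    have dE: "E differentiable at y" "N differentiable at y" "cdd (ahol u) E differentiable at y" "cdd (ahol u) N differentiable at y"
      if "y \<in> U" for y
      using that by (auto intro: smooth_on_differentiable[OF sE] smooth_on_differentiable[OF sN]
        smooth_on_differentiable[OF smooth_on_cdd[OF open_U sE]] smooth_on_differentiable[OF smooth_on_cdd[OF open_U sN]])
    have "cdd (hol u) (cdd (ahol u) \<psi>) z = cdd (hol u) (\<lambda>y. cdd (ahol u) E y - of_real c * cdd (ahol u) N y) z"
      by (rule cdd_cong[OF open_U z]) (simp add: \<psi>_def[abs_def] cdd_diff cdd_mult dE)
    also have "\<dots> = cdd (hol u) (cdd (ahol u) E) z - of_real c * cdd (hol u) (cdd (ahol u) N) z"
      by (simp add: cdd_diff cdd_mult dE[OF z])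
    finally show ?thesis .
  qed
  moreover have "Re (cdd (hol u) (cdd (ahol u) E) z) \<ge> 0"
    unfolding E_def[abs_def] by (rule energy_second_derivative[OF hess0 z W]) (simp_all only: cW cl mult_zero_left)
  moreover have "cdd (hol u) (cdd (ahol u) N) z = - chern_curvature H z u W0"
    unfolding N_def[abs_def] Wz[symmetric]
    by (rule hermitian_form_second_derivative[OF z W, where A=A]) (simp_all add: cW cl A_def Wz)
  moreover have "c * Re (chern_curvature H z u W0) > 0" using \<open>c > 0\<close> RC[OF W0] by simp
  ultimately show False by simp
qed

end

section \<open>Harmonicity in complex coordinates\<close>

lemma bounded_linear_realify: "bounded_linear realify"
  using linear_realify linear_conv_bounded_linear by blast

lemma bounded_linear_complexify: "bounded_linear complexify"
  using linear_complexify linear_conv_bounded_linear by blast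

text \<open>The differentiability assumption concerns the function in complex coordinates; that of
  \<open>\<phi>\<close> itself follows by composing with \<open>complexify\<close>.\<close>

lemma pd_realify:
  assumes "(\<lambda>w. \<phi> (realify w)) differentiable at z"
  shows "pd a \<phi> (realify z) = dd (complexify (axis a 1)) (\<lambda>w. \<phi> (realify w)) z"
proof -
  have "dd (axis a 1) (\<lambda>x. \<phi> (realify (complexify x))) (realify z) =
      dd (dd (axis a 1) complexify (realify z)) (\<lambda>w. \<phi> (realify w)) (complexify (realify z))"
    by (rule dd_compose[OF bounded_linear_imp_differentiable[OF bounded_linear_complexify]]) (simp add: assms)
  then show ?thesis by (simp add: pd_eq_dd dd_bounded_linear[OF bounded_linear_complexify])
qed

lemma complexify_axis: "complexify (axis (Inl \<alpha>) 1) = axis \<alpha> 1" "complexify (axis (Inr \<alpha>) 1) = axis \<alpha> \<i>"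
  by (auto simp: vec_eq_iff axis_def complex_eq_iff)

context hermitian_chart
begin

lemma real_metric_inv:
  assumes z: "z \<in> U"
  shows "matrix_inv (real_part_metric (H z)) $ Inl \<alpha> $ Inl \<beta> = Re (hinv \<alpha> \<beta> z)"
    "matrix_inv (real_part_metric (H z)) $ Inl \<alpha> $ Inr \<beta> = - Im (hinv \<alpha> \<beta> z)"
    "matrix_inv (real_part_metric (H z)) $ Inr \<alpha> $ Inl \<beta> = Im (hinv \<alpha> \<beta> z)"
    "matrix_inv (real_part_metric (H z)) $ Inr \<alpha> $ Inr \<beta> = Re (hinv \<alpha> \<beta> z)"
proof -
  obtain e :: "'n \<Rightarrow> complex^'n" where "\<forall>a b. hermitian_form (H z) (e a) (e b) = (if a = b then 1 else 0)"
    using unitary_frame[OF z] by blast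
  note e = this[rule_format]
  show "matrix_inv (real_part_metric (H z)) $ Inl \<alpha> $ Inl \<beta> = Re (hinv \<alpha> \<beta> z)"
    "matrix_inv (real_part_metric (H z)) $ Inl \<alpha> $ Inr \<beta> = - Im (hinv \<alpha> \<beta> z)"
    "matrix_inv (real_part_metric (H z)) $ Inr \<alpha> $ Inl \<beta> = Im (hinv \<alpha> \<beta> z)"
    "matrix_inv (real_part_metric (H z)) $ Inr \<alpha> $ Inr \<beta> = Re (hinv \<alpha> \<beta> z)"
    unfolding frame_real_metric_inv[OF e] hinv_frame[OF e] Re_sum Im_sum sum_negf[symmetric]
    by (auto intro!: sum.cong)
qed

lemma smooth_real_metric_inv: "smooth_on (\<lambda>w. matrix_inv (real_part_metric (H w)) $ a $ b) U"
  using det_real_part_metric_pos by (intro smooth_on_matrix_inv open_U smooth_real_part_metric) force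

end

text \<open>The real and imaginary parts of \<open>kaehler_divergence\<close> and its conjugate. In
  other words, the real coordinate functions are harmonic, so the Laplacian has no first-order
  part.\<close>

lemma (in kaehler_chart) real_kaehler_divergence:
  assumes z: "z \<in> U"
  shows "(\<Sum>a\<in>UNIV. dd (complexify (axis a 1)) (\<lambda>w. vol w * matrix_inv (real_part_metric (H w)) $ a $ b) z) = 0"
proof -
  have sq: "smooth_on (\<lambda>w. of_real (vol w) * hinv \<alpha> \<beta> w) U" for \<alpha> \<beta>
    by (rule smooth_on_mult smooth_on_of_real smooth_vol smooth_hinv open_U)+
  have dq: "(\<lambda>w. of_real (vol w) * hinv \<alpha> \<beta> w) differentiable at z" for \<alpha> \<beta>
    by (rule smooth_on_differentiable[OF sq z])
  define D where "D v \<alpha> \<beta> = dd v (\<lambda>w. of_real (vol w) * hinv \<alpha> \<beta> w) z" for v \<alpha> \<beta>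
  have "(\<Sum>\<alpha>\<in>UNIV. dz \<alpha> (\<lambda>w. of_real (vol w) * hinv \<alpha> \<beta> w) z) = 0" for \<beta>
  proof -
    have "dzb \<alpha> (\<lambda>w. cnj (of_real (vol w) * hinv \<alpha> \<beta> w)) z = dzb \<alpha> (\<lambda>w. of_real (vol w) * hinv \<beta> \<alpha> w) z" for \<alpha>
      by (rule cdd_cong[OF open_U z]) (simp add: cnj_hinv)
    then have "cnj (dz \<alpha> (\<lambda>w. of_real (vol w) * hinv \<alpha> \<beta> w) z) = dzb \<alpha> (\<lambda>w. of_real (vol w) * hinv \<beta> \<alpha> w) z" for \<alpha>
      using cdd_cnj[OF dq, of "ahol (axis \<alpha> 1)" \<alpha> \<beta>] by simp
    from arg_cong[OF this, of cnj]
    have "dz \<alpha> (\<lambda>w. of_real (vol w) * hinv \<alpha> \<beta> w) z = cnj (dzb \<alpha> (\<lambda>w. of_real (vol w) * hinv \<beta> \<alpha> w) z)" for \<alpha>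
      by simp
    then show ?thesis using kaehler_divergence[OF z, of \<beta>] by (simp flip: cnj_sum)
  qed
  moreover have "dz \<alpha> (\<lambda>w. of_real (vol w) * hinv \<alpha> \<beta> w) z = (D (axis \<alpha> 1) \<alpha> \<beta> - \<i> * D (axis \<alpha> \<i>) \<alpha> \<beta>) / 2" for \<alpha> \<beta>
  proof -
    have "\<i> *s axis \<alpha> 1 = (axis \<alpha> \<i> :: complex^'n)" by (simp add: vec_eq_iff axis_def)
    then show ?thesis by (simp add: cdd_hol[OF dq] D_def)
  qed
  ultimately have 0: "(\<Sum>\<alpha>\<in>UNIV. D (axis \<alpha> 1) \<alpha> \<beta> - \<i> * D (axis \<alpha> \<i>) \<alpha> \<beta>) = 0" for \<beta>
    by (simp flip: sum_divide_distrib)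
  have R: "dd v (\<lambda>w. vol w * Re (hinv \<alpha> \<beta> w)) z = Re (D v \<alpha> \<beta>)" and I: "dd v (\<lambda>w. vol w * Im (hinv \<alpha> \<beta> w)) z = Im (D v \<alpha> \<beta>)"
    and I': "dd v (\<lambda>w. vol w * - Im (hinv \<alpha> \<beta> w)) z = - Im (D v \<alpha> \<beta>)" for v \<alpha> \<beta>
  proof -
    show "dd v (\<lambda>w. vol w * Re (hinv \<alpha> \<beta> w)) z = Re (D v \<alpha> \<beta>)"
      using dd_Re[OF dq, of v \<alpha> \<beta>] by (simp add: D_def)
    show *: "dd v (\<lambda>w. vol w * Im (hinv \<alpha> \<beta> w)) z = Im (D v \<alpha> \<beta>)"
      using dd_Im[OF dq, of v \<alpha> \<beta>] by (simp add: D_def)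
    have d: "(\<lambda>w. vol w * Im (hinv \<alpha> \<beta> w)) differentiable at z"
      using bounded_linear.differentiable_apply[OF bounded_linear_Im dq, of \<alpha> \<beta>] by simp
    show "dd v (\<lambda>w. vol w * - Im (hinv \<alpha> \<beta> w)) z = - Im (D v \<alpha> \<beta>)"
      using dd_cmult[OF d, of v "-1"] * by simp
  qed
  have c: "dd v (\<lambda>w. vol w * matrix_inv (real_part_metric (H w)) $ Inl \<alpha> $ Inl \<beta>) z = Re (D v \<alpha> \<beta>)"
    "dd v (\<lambda>w. vol w * matrix_inv (real_part_metric (H w)) $ Inl \<alpha> $ Inr \<beta>) z = - Im (D v \<alpha> \<beta>)"
    "dd v (\<lambda>w. vol w * matrix_inv (real_part_metric (H w)) $ Inr \<alpha> $ Inl \<beta>) z = Im (D v \<alpha> \<beta>)"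
    "dd v (\<lambda>w. vol w * matrix_inv (real_part_metric (H w)) $ Inr \<alpha> $ Inr \<beta>) z = Re (D v \<alpha> \<beta>)" for v \<alpha> \<beta>
    unfolding R[symmetric] I'[symmetric] unfolding I[symmetric]
    by (rule dd_cong[OF open_U z], simp only: real_metric_inv)+
  show ?thesis
  proof (cases b)
    case (Inl \<beta>)
    have "(\<Sum>a\<in>UNIV. dd (complexify (axis a 1)) (\<lambda>w. vol w * matrix_inv (real_part_metric (H w)) $ a $ b) z) =
      Re (\<Sum>\<alpha>\<in>UNIV. D (axis \<alpha> 1) \<alpha> \<beta> - \<i> * D (axis \<alpha> \<i>) \<alpha> \<beta>)"
      unfolding sum_UNIV_sum complexify_axis Inl c
      by (simp add: sum.distrib)
    then show ?thesis by (simp only: 0 zero_complex.sel)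
  next
    case (Inr \<beta>)
    have "(\<Sum>a\<in>UNIV. dd (complexify (axis a 1)) (\<lambda>w. vol w * matrix_inv (real_part_metric (H w)) $ a $ b) z) =
      - Im (\<Sum>\<alpha>\<in>UNIV. D (axis \<alpha> 1) \<alpha> \<beta> - \<i> * D (axis \<alpha> \<i>) \<alpha> \<beta>)"
      unfolding sum_UNIV_sum complexify_axis Inr c
      by (simp add: sum_negf sum_subtractf)
    then show ?thesis by (simp only: 0 zero_complex.sel minus_zero)
  qed
qed

text \<open>The setting of \<open>harmonic_chart\<close> before its harmonicity and curvature
  assumptions are made; the former is derived here from the real Euler-Lagrange equation.\<close>

locale kaehler_map_chart = kaehler_chart U H + map_chart T K U F
  for U :: "(complex^'n) set" and H and T :: "(real^'d) set" and K and F
begin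

text \<open>The second fundamental form of \<open>F\<close> in real directions, without the
  Christoffel symbols of the domain, whose trace vanishes in these coordinates.\<close>

definition rhess :: "complex^'n \<Rightarrow> complex^'n \<Rightarrow> complex^'n \<Rightarrow> 'd \<Rightarrow> real" where
  "rhess z u v k = dd u (dd v F) z $ k +
     (\<Sum>i\<in>UNIV. \<Sum>j\<in>UNIV. christoffel K (F z) i j k * dd u F z $ i * dd v F z $ j)"

lemma rhess_sym: assumes z: "z \<in> U" shows "rhess z u v k = rhess z v u k"
proof -
  have "(\<Sum>i\<in>UNIV. \<Sum>j\<in>UNIV. christoffel K (F z) i j k * dd u F z $ i * dd v F z $ j) =
      (\<Sum>i\<in>UNIV. \<Sum>j\<in>UNIV. christoffel K (F z) i j k * dd v F z $ i * dd u F z $ j)"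
    by (subst sum.swap) (simp add: christoffel_sym[OF F_in[OF z]] mult_ac)
  then show ?thesis by (simp add: rhess_def dd_commute[OF smooth_F open_U z, of u v])
qed

lemma cnabla_cpush_rhess:
  assumes z: "z \<in> U"
  shows "cnabla K F X (cpush F Y) z $ k = of_real (rhess z (fst X) (fst Y) k - rhess z (snd X) (snd Y) k) +
     \<i> * of_real (rhess z (fst X) (snd Y) k + rhess z (snd X) (fst Y) k)"
proof -
  have d: "dd v F differentiable at z" for v
    by (rule smooth_on_differentiable[OF smooth_on_dd[OF smooth_F] z])
  have dk: "(\<lambda>w. dd v F w $ k) differentiable at z" for v k
    by (rule bounded_linear.differentiable_apply[OF bounded_linear_vec_nth d])
  have "dd u (\<lambda>w. cpush F Y w $ k) z = of_real (dd u (dd (fst Y) F) z $ k) + \<i> * of_real (dd u (dd (snd Y) F) z $ k)" for u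
  proof -
    have "dd u (\<lambda>w. cpush F Y w $ k) z = dd u (\<lambda>w. of_real (dd (fst Y) F w $ k) + \<i> * of_real (dd (snd Y) F w $ k)) z"
      by (rule dd_cong[OF open_U z]) (rule cpush_nth)
    also have "\<dots> = dd u (\<lambda>w. of_real (dd (fst Y) F w $ k)) z + dd u (\<lambda>w. \<i> * of_real (dd (snd Y) F w $ k)) z"
      by (intro dd_add differentiable_mult differentiable_const bounded_linear.differentiable_apply[OF bounded_linear_of_real dk])
    also have "dd u (\<lambda>w. \<i> * of_real (dd (snd Y) F w $ k)) z = \<i> * dd u (\<lambda>w. of_real (dd (snd Y) F w $ k)) z"
      by (intro dd_cmult bounded_linear.differentiable_apply[OF bounded_linear_of_real dk])
    finally show ?thesis by (simp add: dd_of_real[OF dk] dd_vec_nth[OF d])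
  qed
  then have 1: "cdd X (\<lambda>w. cpush F Y w $ k) z =
     of_real (dd (fst X) (dd (fst Y) F) z $ k - dd (snd X) (dd (snd Y) F) z $ k) +
     \<i> * of_real (dd (fst X) (dd (snd Y) F) z $ k + dd (snd X) (dd (fst Y) F) z $ k)"
    by (simp add: cdd_def complex_eq_iff)
  have 2: "(\<Sum>j\<in>UNIV. conn K F X z k j * cpush F Y z $ j) =
     (\<Sum>i\<in>UNIV. \<Sum>j\<in>UNIV. of_real (christoffel K (F z) i j k) * cpush F X z $ i * cpush F Y z $ j)"
    unfolding conn_def sum_distrib_right by (rule sum.swap)
  have "cnabla K F X (cpush F Y) z $ k = cdd X (\<lambda>w. cpush F Y w $ k) z +
     (\<Sum>i\<in>UNIV. \<Sum>j\<in>UNIV. of_real (christoffel K (F z) i j k) * cpush F X z $ i * cpush F Y z $ j)"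
    unfolding 2[symmetric] by (simp add: cnabla_def)
  note eq = this
  show ?thesis
    unfolding eq 1 cpush_nth[OF z] rhess_def
    by (simp add: complex_eq_iff sum.distrib sum_subtractf algebra_simps)
qed

lemma rhess_scale:
  assumes z: "z \<in> U"
  shows "rhess z (a *\<^sub>R u) (b *\<^sub>R v) k = a * b * rhess z u v k"
proof -
  have d: "F differentiable at w" if "w \<in> U" for w by (rule smooth_on_differentiable[OF smooth_F that])
  have d': "dd v F differentiable at z" for v
    by (rule smooth_on_differentiable[OF smooth_on_dd[OF smooth_F] z])
  have "dd (a *\<^sub>R u) (dd (b *\<^sub>R v) F) z = dd (a *\<^sub>R u) (\<lambda>w. b *\<^sub>R dd v F w) z"
    by (rule dd_cong[OF open_U z]) (rule dd_scaleR_dir[OF d])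
  also have "\<dots> = b *\<^sub>R dd (a *\<^sub>R u) (dd v F) z"
    by (rule bounded_linear.dd_apply[OF bounded_linear_scaleR_right d'])
  also have "\<dots> = (a * b) *\<^sub>R dd u (dd v F) z" by (simp add: dd_scaleR_dir[OF d'])
  finally show ?thesis
    by (simp add: rhess_def dd_scaleR_dir[OF d[OF z]] distrib_left sum_distrib_left mult_ac)
qed

text \<open>The factor 1/4 comes from the halves in \<open>hol\<close> and \<open>ahol\<close>. The
  real part of the complex trace collects the four blocks of the real inverse metric.\<close>

lemma complex_trace:
  assumes z: "z \<in> U"
  shows "(\<Sum>\<alpha>\<in>UNIV. \<Sum>\<beta>\<in>UNIV. hinv \<alpha> \<beta> z *s cnabla K F (ahol (axis \<beta> 1)) (cpush F (hol (axis \<alpha> 1))) z) $ k =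
    of_real (\<Sum>a\<in>UNIV. \<Sum>b\<in>UNIV. matrix_inv (real_part_metric (H z)) $ a $ b *
      rhess z (complexify (axis a 1)) (complexify (axis b 1)) k) / 4"
proof -
  have i: "\<i> *s axis \<alpha> 1 = (axis \<alpha> \<i> :: complex^'n)" for \<alpha> by (simp add: vec_eq_iff axis_def)
  define P where "P \<alpha> \<beta> = rhess z (axis \<alpha> 1) (axis \<beta> 1) k + rhess z (axis \<alpha> \<i>) (axis \<beta> \<i>) k" for \<alpha> \<beta>
  define Q where "Q \<alpha> \<beta> = rhess z (axis \<alpha> \<i>) (axis \<beta> 1) k - rhess z (axis \<alpha> 1) (axis \<beta> \<i>) k" for \<alpha> \<beta>
  have PQ: "P \<beta> \<alpha> = P \<alpha> \<beta>" "Q \<beta> \<alpha> = - Q \<alpha> \<beta>" for \<alpha> \<beta>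
    by (simp_all add: P_def Q_def rhess_sym[OF z, of "axis \<beta> _"])
  have c: "cnabla K F (ahol (axis \<beta> 1)) (cpush F (hol (axis \<alpha> 1))) z $ k = (of_real (P \<alpha> \<beta>) - \<i> * of_real (Q \<alpha> \<beta>)) / 4" for \<alpha> \<beta>
  proof -
    have "rhess z ((1/2) *\<^sub>R u) ((1/2) *\<^sub>R v) k = rhess z u v k / 4" "rhess z ((1/2) *\<^sub>R u) (- ((1/2) *\<^sub>R v)) k = - rhess z u v k / 4" for u v
      using rhess_scale[OF z, of "1/2" u "1/2" v k] rhess_scale[OF z, of "1/2" u "-1/2" v k] by simp_all
    then have "cnabla K F (ahol (axis \<beta> 1)) (cpush F (hol (axis \<alpha> 1))) z $ k = (of_real (P \<beta> \<alpha>) + \<i> * of_real (Q \<beta> \<alpha>)) / 4"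
      unfolding cnabla_cpush_rhess[OF z] by (simp add: hol_def ahol_def i P_def Q_def complex_eq_iff field_simps)
    then show ?thesis by (simp add: PQ[of \<beta> \<alpha>])
  qed
  define R where "R \<alpha> \<beta> = Re (hinv \<alpha> \<beta> z) * P \<alpha> \<beta> + Im (hinv \<alpha> \<beta> z) * Q \<alpha> \<beta>" for \<alpha> \<beta>
  define I where "I \<alpha> \<beta> = Im (hinv \<alpha> \<beta> z) * P \<alpha> \<beta> - Re (hinv \<alpha> \<beta> z) * Q \<alpha> \<beta>" for \<alpha> \<beta>
  \<comment> \<open>The imaginary part is antisymmetric in its two indices, since the inverse metric
    is Hermitian, \<open>P\<close> symmetric and \<open>Q\<close> antisymmetric.\<close>
  have I0: "(\<Sum>\<alpha>\<in>UNIV. \<Sum>\<beta>\<in>UNIV. I \<alpha> \<beta>) = 0"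
  proof -
    have h: "Re (hinv \<beta> \<alpha> z) = Re (hinv \<alpha> \<beta> z)" "Im (hinv \<beta> \<alpha> z) = - Im (hinv \<alpha> \<beta> z)" for \<alpha> \<beta>
      unfolding cnj_hinv[OF z, of \<alpha> \<beta>, symmetric] by simp_all
    have "I \<beta> \<alpha> = - I \<alpha> \<beta>" for \<alpha> \<beta> unfolding I_def h[of \<beta> \<alpha>] PQ[of \<beta> \<alpha>] by simp
    then have "(\<Sum>\<alpha>\<in>UNIV. \<Sum>\<beta>\<in>UNIV. I \<beta> \<alpha>) = - (\<Sum>\<alpha>\<in>UNIV. \<Sum>\<beta>\<in>UNIV. I \<alpha> \<beta>)"
      unfolding sum_negf[symmetric] by (intro sum.cong refl)
    moreover have "(\<Sum>\<alpha>\<in>UNIV. \<Sum>\<beta>\<in>UNIV. I \<alpha> \<beta>) = (\<Sum>\<alpha>\<in>UNIV. \<Sum>\<beta>\<in>UNIV. I \<beta> \<alpha>)" by (rule sum.swap)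
    ultimately show ?thesis by simp
  qed
  have "hinv \<alpha> \<beta> z * cnabla K F (ahol (axis \<beta> 1)) (cpush F (hol (axis \<alpha> 1))) z $ k = of_real (R \<alpha> \<beta>) / 4 + \<i> * of_real (I \<alpha> \<beta>) / 4" for \<alpha> \<beta>
    unfolding c by (simp add: complex_eq_iff R_def I_def algebra_simps)
  then have "(\<Sum>\<alpha>\<in>UNIV. \<Sum>\<beta>\<in>UNIV. hinv \<alpha> \<beta> z *s cnabla K F (ahol (axis \<beta> 1)) (cpush F (hol (axis \<alpha> 1))) z) $ k =
    of_real (\<Sum>\<alpha>\<in>UNIV. \<Sum>\<beta>\<in>UNIV. R \<alpha> \<beta>) / 4 + \<i> * of_real (\<Sum>\<alpha>\<in>UNIV. \<Sum>\<beta>\<in>UNIV. I \<alpha> \<beta>) / 4"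
    by (simp add: sum.distrib sum_divide_distrib sum_distrib_left)
  moreover have "(\<Sum>a\<in>UNIV. \<Sum>b\<in>UNIV. matrix_inv (real_part_metric (H z)) $ a $ b *
      rhess z (complexify (axis a 1)) (complexify (axis b 1)) k) = (\<Sum>\<alpha>\<in>UNIV. \<Sum>\<beta>\<in>UNIV. R \<alpha> \<beta>)"
    unfolding sum_UNIV_sum complexify_axis real_metric_inv[OF z] R_def P_def Q_def
    by (simp add: sum.distrib sum_subtractf sum_negf algebra_simps)
  ultimately show ?thesis unfolding I0 by simp
qed

text \<open>The product rule splits the adjoint into derivatives of the density times the inverse
  metric, which \<open>real_kaehler_divergence\<close> removes, and the real trace of
  \<open>rhess\<close>, which \<open>complex_trace\<close> compares with the complex one.\<close>

lemma harmonic_from_adjoint: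
  assumes z: "z \<in> U" and F: "F = (\<lambda>w. Ft (realify w))"
    and adj: "pullback_nabla_adjoint (\<lambda>x. real_part_metric (H (complexify x))) K Ft (\<lambda>b. pd b Ft) (realify z) = 0"
  shows "(\<Sum>\<alpha>\<in>UNIV. \<Sum>\<beta>\<in>UNIV. hinv \<alpha> \<beta> z *s cnabla K F (ahol (axis \<beta> 1)) (cpush F (hol (axis \<alpha> 1))) z) = 0"
proof -
  define \<epsilon> :: "'n + 'n \<Rightarrow> complex^'n" where "\<epsilon> a = complexify (axis a 1)" for a
  define M where "M a b w = matrix_inv (real_part_metric (H w)) $ a $ b" for a b w
  define S where "S a w = vol w *\<^sub>R (\<Sum>b\<in>UNIV. M a b w *\<^sub>R dd (\<epsilon> b) F w)" for a w
  have smooth_M: "smooth_on (M a b) U" for a b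
    unfolding M_def[abs_def] by (rule smooth_real_metric_inv)
  have sS: "smooth_on (S a) U" for a
    unfolding S_def[abs_def]
    by (rule smooth_on_scaleR smooth_vol smooth_on_sum smooth_on_dd' smooth_F smooth_M open_U)+
  have pdF: "pd b Ft (realify w) = dd (\<epsilon> b) F w" if "w \<in> U" for b w
    unfolding \<epsilon>_def F by (rule pd_realify) (use smooth_on_differentiable[OF smooth_F that] F in simp)
  define St where "St a y = sqrt (det (real_part_metric (H (complexify y)))) *\<^sub>R
     (\<Sum>b\<in>UNIV. (matrix_inv (real_part_metric (H (complexify y))) $ a $ b) *\<^sub>R pd b Ft y)" for a y
  have St: "St a (realify w) = S a w" if "w \<in> U" for a w
    by (simp add: St_def S_def vol_def M_def pdF[OF that])
  have pdS: "pd a (St b) (realify z) = dd (\<epsilon> a) (S b) z" for a b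
  proof -
    have "(\<lambda>w. St b (realify w)) differentiable at z"
      using differentiable_cong_open[OF open_U z, of "\<lambda>w. St b (realify w)" "S b"] St
        smooth_on_differentiable[OF sS z] by blast
    from pd_realify[OF this, of a] have "pd a (St b) (realify z) = dd (\<epsilon> a) (\<lambda>w. St b (realify w)) z"
      by (simp add: \<epsilon>_def)
    also have "\<dots> = dd (\<epsilon> a) (S b) z" by (rule dd_cong[OF open_U z St])
    finally show ?thesis .
  qed
  have "vol z > 0" by (rule vol_pos[OF z])
  have "pullback_nabla_adjoint (\<lambda>x. real_part_metric (H (complexify x))) K Ft (\<lambda>b. pd b Ft) (realify z) =
      - (1 / vol z) *\<^sub>R (\<Sum>a\<in>UNIV. pullback_nabla K Ft a (St a) (realify z))"
    by (simp add: pullback_nabla_adjoint_def St_def[abs_def] vol_def)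
  then have "(\<Sum>a\<in>UNIV. pullback_nabla K Ft a (St a) (realify z)) = 0"
    using adj \<open>vol z > 0\<close> by simp
  then have eq: "(\<Sum>a\<in>UNIV. dd (\<epsilon> a) (S a) z $ k + (\<Sum>i\<in>UNIV. \<Sum>j\<in>UNIV. christoffel K (F z) i j k * dd (\<epsilon> a) F z $ i * S a z $ j)) = 0" for k
    by (simp add: vec_eq_iff pullback_nabla_def pdS pdF[OF z] St[OF z] F[symmetric, THEN fun_cong])
  have dM: "(\<lambda>w. vol w * M a b w) differentiable at z" for a b
    by (rule smooth_on_differentiable[OF smooth_on_mult[OF open_U smooth_vol smooth_M] z])
  have dF: "dd v F differentiable at z" for v
    by (rule smooth_on_differentiable[OF smooth_on_dd[OF smooth_F] z])
  have "dd (\<epsilon> a) (S a) z $ k + (\<Sum>i\<in>UNIV. \<Sum>j\<in>UNIV. christoffel K (F z) i j k * dd (\<epsilon> a) F z $ i * S a z $ j) =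
     (\<Sum>b\<in>UNIV. dd (\<epsilon> a) (\<lambda>w. vol w * M a b w) z * dd (\<epsilon> b) F z $ k) + vol z * (\<Sum>b\<in>UNIV. M a b z * rhess z (\<epsilon> a) (\<epsilon> b) k)" for a k
  proof -
    have "S a = (\<lambda>w. \<Sum>b\<in>UNIV. (vol w * M a b w) *\<^sub>R dd (\<epsilon> b) F w)"
      by (simp add: S_def fun_eq_iff scaleR_sum_right)
    then have "dd (\<epsilon> a) (S a) z = (\<Sum>b\<in>UNIV. (vol z * M a b z) *\<^sub>R dd (\<epsilon> a) (dd (\<epsilon> b) F) z + dd (\<epsilon> a) (\<lambda>w. vol w * M a b w) z *\<^sub>R dd (\<epsilon> b) F z)"
      using differentiable_scaleR[OF dM dF] by (simp add: dd_sum dd_scaleR[OF dM dF])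
    moreover have "(\<Sum>i\<in>UNIV. \<Sum>j\<in>UNIV. christoffel K (F z) i j k * dd (\<epsilon> a) F z $ i * S a z $ j) =
       (\<Sum>b\<in>UNIV. vol z * M a b z * (\<Sum>i\<in>UNIV. \<Sum>j\<in>UNIV. christoffel K (F z) i j k * dd (\<epsilon> a) F z $ i * dd (\<epsilon> b) F z $ j))"
    proof -
      have "(\<Sum>i\<in>UNIV. \<Sum>j\<in>UNIV. christoffel K (F z) i j k * dd (\<epsilon> a) F z $ i * S a z $ j) =
         (\<Sum>i\<in>UNIV. \<Sum>j\<in>UNIV. \<Sum>b\<in>UNIV. vol z * M a b z * (christoffel K (F z) i j k * dd (\<epsilon> a) F z $ i * dd (\<epsilon> b) F z $ j))"
        by (simp add: S_def sum_distrib_left mult_ac)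
      also have "\<dots> = (\<Sum>b\<in>UNIV. \<Sum>i\<in>UNIV. \<Sum>j\<in>UNIV. vol z * M a b z * (christoffel K (F z) i j k * dd (\<epsilon> a) F z $ i * dd (\<epsilon> b) F z $ j))"
        unfolding sum.cartesian_product
        by (rule sum.reindex_bij_witness[where i = "\<lambda>(b,i,j). (i,j,b)" and j = "\<lambda>(i,j,b). (b,i,j)"]) auto
      finally show ?thesis by (simp add: sum_distrib_left)
    qed
    ultimately show ?thesis
      by (simp add: rhess_def sum.distrib distrib_left sum_distrib_left mult_ac)
  qed
  note expand = this
  have "(\<Sum>a\<in>UNIV. \<Sum>b\<in>UNIV. dd (\<epsilon> a) (\<lambda>w. vol w * M a b w) z * dd (\<epsilon> b) F z $ k) = 0" for k
    by (subst sum.swap) (simp add: sum_distrib_right[symmetric] \<epsilon>_def M_def real_kaehler_divergence[OF z])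
  with eq have "vol z * (\<Sum>a\<in>UNIV. \<Sum>b\<in>UNIV. M a b z * rhess z (\<epsilon> a) (\<epsilon> b) k) = 0" for k
    unfolding expand sum.distrib sum_distrib_left[symmetric] by simp
  then have "(\<Sum>a\<in>UNIV. \<Sum>b\<in>UNIV. M a b z * rhess z (\<epsilon> a) (\<epsilon> b) k) = 0" for k
    using \<open>vol z > 0\<close> by simp
  then show ?thesis
    unfolding vec_eq_iff complex_trace[OF z] by (simp add: M_def \<epsilon>_def)
qed

end

section \<open>Integration in complex coordinates\<close>

text \<open>The change of variables theorem of the library needs a well-ordered index type; the type
  \<open>'a wo\<close> is a copy of a finite type with an arbitrary well-ordering.\<close>

typedef 'a wo = "UNIV :: 'a set" by simp

definition wo_rank :: "'a::finite wo \<Rightarrow> nat" where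
  "wo_rank x = (SOME f :: 'a \<Rightarrow> nat. inj f) (Rep_wo x)"

lemma inj_wo_rank: "inj wo_rank"
proof -
  have "\<exists>f :: 'a \<Rightarrow> nat. inj f"
    using finite_imp_inj_to_nat_seg[of "UNIV :: 'a set"] by auto
  then have i: "inj (SOME f :: 'a \<Rightarrow> nat. inj f)" by (rule someI_ex)
  show ?thesis
  proof (rule injI)
    fix x y :: "'a wo"
    assume "wo_rank x = wo_rank y"
    then have "Rep_wo x = Rep_wo y" unfolding wo_rank_def by (rule injD[OF i])
    then show "x = y" by (simp only: Rep_wo_inject)
  qed
qed

instance wo :: (finite) finite
proof
  have "inj (Rep_wo :: 'a wo \<Rightarrow> 'a)" by (rule injI) (simp only: Rep_wo_inject)
  then show "finite (UNIV :: 'a wo set)" by (rule inj_on_finite[of _ _ UNIV]) simp_all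
qed

instantiation wo :: (finite) wellorder
begin

definition less_eq_wo :: "'a wo \<Rightarrow> 'a wo \<Rightarrow> bool" where "x \<le> y \<longleftrightarrow> wo_rank x \<le> wo_rank y"
definition less_wo :: "'a wo \<Rightarrow> 'a wo \<Rightarrow> bool" where "x < y \<longleftrightarrow> wo_rank x < wo_rank y"

instance
proof
  fix x y z :: "'a wo"
  show "x < y \<longleftrightarrow> x \<le> y \<and> \<not> y \<le> x" "x \<le> x" "x \<le> y \<Longrightarrow> y \<le> z \<Longrightarrow> x \<le> z" "x \<le> y \<or> y \<le> x"
    by (auto simp: less_eq_wo_def less_wo_def)
  show "x \<le> y \<Longrightarrow> y \<le> x \<Longrightarrow> x = y"
    unfolding less_eq_wo_def by (rule injD[OF inj_wo_rank]) simp
next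
  fix P :: "'a wo \<Rightarrow> bool" and a
  assume step: "\<And>x. (\<And>y. y < x \<Longrightarrow> P y) \<Longrightarrow> P x"
  show "P a"
  proof (induction "wo_rank a" arbitrary: a rule: less_induct)
    case less
    show ?case by (rule step, rule less) (simp add: less_wo_def)
  qed
qed

end

lemma bij_Rep_wo: "bij (Rep_wo :: 'a wo \<Rightarrow> 'a)"
  by (rule o_bij[of Abs_wo]) (simp_all add: fun_eq_iff Rep_wo_inverse Abs_wo_inverse)

text \<open>Conjugation with \<open>f\<close> carries the permutations of one index type bijectively
  to those of the other and preserves signs.\<close>

lemma det_reindex:
  fixes A :: "real^'b^'b" and f :: "'a::finite \<Rightarrow> 'b::finite"
  assumes "bij f"
  shows "det (\<chi> i j. A $ f i $ f j) = det A"
proof -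
  have inv: "inv_into UNIV f (f x) = x" for x using assms by (simp add: bij_is_inj)
  have "bij_betw (map_permutation UNIV f) {p. p permutes UNIV} {p. p permutes UNIV}"
  proof (rule bij_betwI[where g = "map_permutation UNIV (inv f)"])
    have *: "map_permutation UNIV g (map_permutation UNIV h p) = p" if "g \<circ> h = id" "h \<circ> g = id" "bij g" "bij h"
      for g :: "'c \<Rightarrow> 'd" and h :: "'d \<Rightarrow> 'c" and p
    proof -
      have "inv_into UNIV g = h" "inv_into UNIV h = g"
        using that by (metis inv_unique_comp)+
      then show ?thesis
        using that by (auto simp: map_permutation_def restrict_id_def fun_eq_iff bij_is_surj o_def)
    qed
    show "map_permutation UNIV f \<in> {p. p permutes UNIV} \<rightarrow> {p. p permutes UNIV}"
      using map_permutation_permutes[of f UNIV UNIV] assms by auto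
    show "map_permutation UNIV (inv f) \<in> {p. p permutes UNIV} \<rightarrow> {p. p permutes UNIV}"
      using map_permutation_permutes[of "inv f" UNIV UNIV] bij_imp_bij_inv[OF assms] by auto
    show "map_permutation UNIV (inv f) (map_permutation UNIV f p) = p" for p
      using assms by (intro * bij_imp_bij_inv) (auto simp: fun_eq_iff bij_is_inj bij_is_surj surj_f_inv_f)
    show "map_permutation UNIV f (map_permutation UNIV (inv f) p) = p" for p
      using assms by (intro * bij_imp_bij_inv) (auto simp: fun_eq_iff bij_is_inj bij_is_surj surj_f_inv_f)
  qed
  from sum.reindex_bij_betw[OF this, of "\<lambda>p. of_int (sign p) * (\<Prod>i\<in>UNIV. A $ i $ p i)"]
  have "det A = (\<Sum>p\<in>{p. p permutes UNIV}. of_int (sign (map_permutation UNIV f p)) * (\<Prod>i\<in>UNIV. A $ i $ map_permutation UNIV f p i))"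
    by (simp add: det_def)
  also have "\<dots> = (\<Sum>p\<in>{p. p permutes UNIV}. of_int (sign p) * (\<Prod>i\<in>UNIV. A $ f i $ f (p i)))"
  proof (rule sum.cong[OF refl])
    fix p :: "'a \<Rightarrow> 'a" assume "p \<in> {p. p permutes UNIV}"
    then have "sign (map_permutation UNIV f p) = sign p"
      by (intro sign_map_permutation) (use assms in \<open>auto simp: bij_is_inj\<close>)
    moreover have "(\<Prod>i\<in>UNIV. A $ i $ map_permutation UNIV f p i) = (\<Prod>i\<in>UNIV. A $ f i $ map_permutation UNIV f p (f i))"
      by (rule prod.reindex_bij_betw[OF assms, symmetric])
    moreover have "map_permutation UNIV f p (f i) = f (p i)" for i
      using assms by (simp add: map_permutation_def inv bij_is_surj)
    ultimately show "of_int (sign (map_permutation UNIV f p)) * (\<Prod>i\<in>UNIV. A $ i $ map_permutation UNIV f p i) =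
        of_int (sign p) * (\<Prod>i\<in>UNIV. A $ f i $ f (p i))" by simp
  qed
  also have "\<dots> = det (\<chi> i j. A $ f i $ f j)" by (simp add: det_def)
  finally show ?thesis by simp
qed

definition to_wo :: "complex^'n \<Rightarrow> real^(('n + 'n) wo)" where
  "to_wo z = (\<chi> k. realify z $ Rep_wo k)"

definition of_wo :: "real^(('n + 'n) wo) \<Rightarrow> complex^'n" where
  "of_wo x = complexify (\<chi> k. x $ Abs_wo k)"

lemma to_wo_of_wo [simp]: "to_wo (of_wo x) = x" and of_wo_to_wo [simp]: "of_wo (to_wo z) = z"
  by (simp_all add: to_wo_def of_wo_def Rep_wo_inverse Abs_wo_inverse)

lemma linear_to_wo: "linear to_wo"
  by (rule linearI) (simp_all add: to_wo_def vec_eq_iff linear_add[OF linear_realify] linear_cmul[OF linear_realify])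

lemma linear_of_wo: "linear of_wo"
  by (rule linearI) (simp_all add: of_wo_def vec_eq_iff complex_eq_iff)

lemma bounded_linear_of_wo: "bounded_linear of_wo" and bounded_linear_to_wo: "bounded_linear to_wo"
  using linear_of_wo linear_to_wo linear_conv_bounded_linear by blast+

lemma continuous_on_of_wo [continuous_intros]: "continuous_on S of_wo"
  by (rule linear_continuous_on[OF bounded_linear_of_wo])

lemma continuous_on_to_wo [continuous_intros]: "continuous_on S to_wo"
  by (rule linear_continuous_on[OF bounded_linear_to_wo])

text \<open>The determinant of \<open>D\<close> as a real linear map in twice the complex dimension;
  its absolute value is the Jacobian factor in the change of variables.\<close>

definition real_det :: "(complex^'n \<Rightarrow> complex^'n) \<Rightarrow> real" where
  "real_det D = det (matrix (\<lambda>x. realify (D (complexify x))))"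

lemma det_wo:
  fixes D :: "complex^'n \<Rightarrow> complex^'n"
  shows "det (matrix (\<lambda>x. to_wo (D (of_wo x)))) = real_det D"
proof -
  have "of_wo (axis j 1) = complexify (axis (Rep_wo j) 1)" for j :: "('n + 'n) wo"
    unfolding of_wo_def by (rule arg_cong[where f = complexify])
      (auto simp: vec_eq_iff axis_def Abs_wo_inverse Rep_wo_inverse)
  then have "matrix (\<lambda>x. to_wo (D (of_wo x))) = (\<chi> i j. matrix (\<lambda>x. realify (D (complexify x))) $ Rep_wo i $ Rep_wo j)"
    unfolding matrix_def to_wo_def by simp
  then show ?thesis unfolding real_det_def by (simp add: det_reindex[OF bij_Rep_wo])
qed

section \<open>Integrals of continuous functions with compact support\<close>

definition ccont :: "('a::euclidean_space \<Rightarrow> real) \<Rightarrow> bool" where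
  "ccont f \<longleftrightarrow> continuous_on UNIV f \<and> (\<exists>K. compact K \<and> (\<forall>x. x \<notin> K \<longrightarrow> f x = 0))"

text \<open>Lebesgue measure on the complex coordinate space, transported to the well-ordered index
  type.\<close>

definition cint :: "(complex^'n \<Rightarrow> real) \<Rightarrow> real" where
  "cint f = (\<integral>x. f (of_wo x) \<partial>lborel)"

lemma ccont_integrable: "ccont f \<Longrightarrow> integrable lborel f"
proof -
  assume "ccont f"
  then obtain K where K: "compact K" "\<And>x. x \<notin> K \<Longrightarrow> f x = 0" "continuous_on UNIV f" by (auto simp: ccont_def)
  have "(\<lambda>x. indicator K x *\<^sub>R f x) = f" using K(2) by (auto simp: fun_eq_iff indicator_def)
  then show ?thesis
    using borel_integrable_compact[OF K(1) continuous_on_subset[OF K(3) subset_UNIV]] by simp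
qed

lemma ccont_of_wo: "ccont f \<Longrightarrow> ccont (\<lambda>x. f (of_wo x))"
proof -
  assume "ccont f"
  then obtain K where K: "compact K" "\<And>x. x \<notin> K \<Longrightarrow> f x = 0" "continuous_on UNIV f" by (auto simp: ccont_def)
  have "f (of_wo x) = 0" if "x \<notin> to_wo ` K" for x
    using that by (intro K(2)) (metis imageI to_wo_of_wo)
  moreover have "continuous_on UNIV (\<lambda>x. f (of_wo x))"
    by (rule continuous_on_compose2[OF K(3) continuous_on_of_wo]) simp
  moreover have "compact (to_wo ` K)"
    by (rule compact_continuous_image[OF continuous_on_to_wo K(1)])
  ultimately show ?thesis unfolding ccont_def by blast
qed

lemma ccont_add: "ccont f \<Longrightarrow> ccont g \<Longrightarrow> ccont (\<lambda>x. f x + g x)"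
proof -
  assume "ccont f" "ccont g"
  then obtain K L where "compact K" "\<And>x. x \<notin> K \<Longrightarrow> f x = 0" "continuous_on UNIV f"
     "compact L" "\<And>x. x \<notin> L \<Longrightarrow> g x = 0" "continuous_on UNIV g" by (auto simp: ccont_def)
  then show ?thesis unfolding ccont_def
    by (intro conjI exI[of _ "K \<union> L"] continuous_intros compact_Un) auto
qed

lemma cint_add: "ccont f \<Longrightarrow> ccont g \<Longrightarrow> cint (\<lambda>x. f x + g x) = cint f + cint g"
  unfolding cint_def by (intro Bochner_Integration.integral_add ccont_integrable ccont_of_wo)

lemma cint_sum: "(\<And>i. i \<in> I \<Longrightarrow> ccont (f i)) \<Longrightarrow> cint (\<lambda>x. \<Sum>i\<in>I. f i x) = (\<Sum>i\<in>I. cint (f i))"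
  unfolding cint_def by (intro Bochner_Integration.integral_sum ccont_integrable ccont_of_wo)

lemma cint_nonneg: "(\<And>x. f x \<ge> 0) \<Longrightarrow> cint f \<ge> 0"
  unfolding cint_def by (intro Bochner_Integration.integral_nonneg)

text \<open>The set where \<open>f\<close> is nonzero is open by continuity and null by the
  vanishing integral, and a nonempty open set is not null.\<close>

lemma cint_zero_imp:
  assumes "ccont f" "\<And>x. f x \<ge> 0" "cint f = 0"
  shows "f z = 0"
proof (rule ccontr)
  assume nz: "f z \<noteq> 0"
  have cc: "ccont (\<lambda>x. f (of_wo x))" using ccont_of_wo[OF assms(1)] .
  have "AE x in lborel. f (of_wo x) = 0"
    using assms(3) integral_nonneg_eq_0_iff_AE[OF ccont_integrable[OF cc]] assms(2) by (simp add: cint_def)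
  then have "{x. f (of_wo x) \<noteq> 0} \<in> null_sets lebesgue"
  proof -
    have "{x. f (of_wo x) \<noteq> 0} \<in> sets borel"
      using cc unfolding ccont_def by (intro borel_open open_Collect_neq continuous_intros) auto
    with \<open>AE x in lborel. f (of_wo x) = 0\<close> show ?thesis
      by (subst (asm) AE_iff_null) (auto intro: null_sets_completionI)
  qed
  then have "negligible {x. f (of_wo x) \<noteq> 0}" by (simp add: negligible_iff_null_sets)
  moreover have "open {x. f (of_wo x) \<noteq> 0}"
    using cc unfolding ccont_def by (intro open_Collect_neq continuous_intros) auto
  moreover have "to_wo z \<in> {x. f (of_wo x) \<noteq> 0}" using nz by simp
  ultimately show False using open_not_negligible by blast
qed

text \<open>Difference quotients have integral zero by translation invariance, and they converge
  dominatedly to the derivative.\<close>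

lemma integral_dd_zero:
  fixes f :: "'a::euclidean_space \<Rightarrow> real"
  assumes f: "times_diff_on 1 f UNIV" and K: "compact K" "\<And>x. x \<notin> K \<Longrightarrow> f x = 0"
  shows "(\<integral>x. dd e f x \<partial>lborel) = 0"
proof -
  have df: "f differentiable at x" for x using f by (simp add: times_diff_on_Suc)
  have cdf: "continuous_on UNIV (dd e f)" using f by (simp add: times_diff_on_Suc)
  have cf: "continuous_on UNIV f" using times_diff_on_SucD[of 0 f UNIV] f by simp
  have ccf: "ccont f" using cf K unfolding ccont_def by blast
  have df0: "dd e f x = 0" if "x \<notin> K" for x
  proof -
    have "dd e f x = dd e (\<lambda>_. 0) x"
      by (rule dd_cong[of "- K"]) (use that K compact_imp_closed in auto)
    then show ?thesis by simp
  qed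
  obtain B where B: "\<And>x. \<bar>dd e f x\<bar> \<le> B" "B \<ge> 0"
  proof -
    have "bounded (dd e f ` K)"
      using compact_continuous_image[OF continuous_on_subset[OF cdf] K(1)] compact_imp_bounded by auto
    then obtain b where b: "\<And>x. x \<in> K \<Longrightarrow> \<bar>dd e f x\<bar> \<le> b" unfolding bounded_iff by auto
    have "\<bar>dd e f x\<bar> \<le> max b 0" for x
      using b[of x] df0[of x] by (cases "x \<in> K") (simp_all add: le_max_iff_disj)
    then show ?thesis by (intro that[of "max b 0"]) auto
  qed
  \<comment> \<open>Outside \<open>K'\<close> neither \<open>x\<close> nor \<open>x\<close> plus a
    multiple of \<open>e\<close> by a factor up to 1 lies in \<open>K\<close>, so all difference
    quotients vanish there; \<open>K'\<close> is the common support of the dominating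
    function.\<close>
  define K' where "K' = (\<lambda>(x, t). x - t *\<^sub>R e) ` (K \<times> {0..1::real})"
  have "compact K'" unfolding K'_def split_beta
    by (intro compact_continuous_image compact_Times K(1) compact_Icc continuous_intros)
  define h where "h n x = real (Suc n) * (f (x + (1 / real (Suc n)) *\<^sub>R e) - f x)" for n x
  have bound: "\<bar>h n x\<bar> \<le> B * indicator K' x" for n x
  proof (cases "x \<in> K'")
    case True
    have "((\<lambda>t. f (x + t *\<^sub>R e)) has_real_derivative dd e f (x + t *\<^sub>R e)) (at t)" for t
      using has_vector_derivative_line[OF df] by (simp add: has_real_derivative_iff_has_vector_derivative)
    from MVT2[of 0 "1 / real (Suc n)", OF _ this]
    obtain t where "f (x + (1 / real (Suc n)) *\<^sub>R e) - f x = (1 / real (Suc n)) * dd e f (x + t *\<^sub>R e)" by auto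
    then have "h n x = dd e f (x + t *\<^sub>R e)" by (simp add: h_def del: of_nat_Suc)
    then show ?thesis using B True by simp
  next
    case False
    have "x \<notin> K"
    proof
      assume "x \<in> K"
      then have "(\<lambda>(x, t). x - t *\<^sub>R e) (x, 0) \<in> K'" unfolding K'_def by (intro imageI) auto
      then show False using False by simp
    qed
    moreover have "x + (1 / real (Suc n)) *\<^sub>R e \<notin> K"
    proof
      assume "x + (1 / real (Suc n)) *\<^sub>R e \<in> K"
      then have "(\<lambda>(x, t). x - t *\<^sub>R e) (x + (1 / real (Suc n)) *\<^sub>R e, 1 / real (Suc n)) \<in> K'"
        unfolding K'_def by (intro imageI) auto
      then show False using False by simp
    qed
    ultimately show ?thesis using False by (simp add: h_def K(2))
  qed
  have shift: "(\<integral>x. f (x + c) \<partial>lborel) = (\<integral>x. f x \<partial>lborel)" "integrable lborel (\<lambda>x. f (x + c))" for c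
  proof -
    have m: "f \<in> borel_measurable borel" using cf by (simp add: borel_measurable_continuous_onI)
    have "(\<integral>x. f x \<partial>lborel) = (\<integral>x. f x \<partial>distr lborel borel ((+) c))" by (simp add: lborel_distr_plus)
    also have "\<dots> = (\<integral>x. f (c + x) \<partial>lborel)" by (rule integral_distr) (use m in auto)
    finally show "(\<integral>x. f (x + c) \<partial>lborel) = (\<integral>x. f x \<partial>lborel)" by (simp add: add.commute)
    have "integrable (distr lborel borel ((+) c)) f" using ccont_integrable[OF ccf] by (simp add: lborel_distr_plus)
    then have "integrable lborel (\<lambda>x. f (c + x))" by (subst (asm) integrable_distr_eq) (use m in auto)
    then show "integrable lborel (\<lambda>x. f (x + c))" by (simp add: add.commute)
  qed
  have h0: "(\<integral>x. h n x \<partial>lborel) = 0" and hi: "integrable lborel (h n)" for n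
    unfolding h_def using shift[of "(1 / real (Suc n)) *\<^sub>R e"] ccont_integrable[OF ccf]
    by (simp_all del: of_nat_Suc)
  have "(\<lambda>n. \<integral>x. h n x \<partial>lborel) \<longlonglongrightarrow> (\<integral>x. dd e f x \<partial>lborel)"
  proof (rule integral_dominated_convergence[where w = "\<lambda>x. B * indicator K' x"])
    show "dd e f \<in> borel_measurable lborel" using cdf by (simp add: borel_measurable_continuous_onI)
    show "h n \<in> borel_measurable lborel" for n using hi[of n] by blast
    show "integrable lborel (\<lambda>x. B * indicator K' x)"
      using \<open>compact K'\<close> emeasure_bounded_finite[OF compact_imp_bounded[OF \<open>compact K'\<close>]]
      by (intro integrable_mult_right integrable_real_indicator) (simp_all add: compact_imp_closed borel_closed)
    show "AE x in lborel. norm (h n x) \<le> B * indicator K' x" for n using bound by simp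
    show "AE x in lborel. (\<lambda>n. h n x) \<longlonglongrightarrow> dd e f x"
    proof (rule AE_I2)
      fix x
      have "((\<lambda>t. f (x + t *\<^sub>R e)) has_real_derivative dd e f (x + 0 *\<^sub>R e)) (at 0)"
        using has_vector_derivative_line[OF df, where x = x and t = 0 and v = e] by (simp add: has_real_derivative_iff_has_vector_derivative)
      then have lim: "((\<lambda>t. (f (x + t *\<^sub>R e) - f x) / t) \<longlongrightarrow> dd e f x) (at 0)"
        by (simp add: has_field_derivative_iff)
      have "filterlim (\<lambda>n. 1 / real (Suc n)) (at 0) sequentially"
        using LIMSEQ_inverse_real_of_nat by (simp add: filterlim_at inverse_eq_divide)
      from filterlim_compose[OF lim this] show "(\<lambda>n. h n x) \<longlonglongrightarrow> dd e f x"
        by (simp add: h_def field_simps)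
    qed
  qed
  then show ?thesis by (simp add: h0 LIMSEQ_const_iff)
qed

lemma cint_dd_zero:
  assumes f: "times_diff_on 1 f UNIV" and K: "compact K" "\<And>x. x \<notin> K \<Longrightarrow> f x = 0"
  shows "cint (dd e f) = 0"
proof -
  have "times_diff_on 1 (\<lambda>x. f (of_wo x)) UNIV"
    by (rule times_diff_on_compose[OF open_UNIV open_UNIV _ f times_diff_on_bounded_linear[OF bounded_linear_of_wo]]) simp
  moreover have "compact (to_wo ` K)"
    by (rule compact_continuous_image[OF continuous_on_to_wo K(1)])
  moreover have "f (of_wo x) = 0" if "x \<notin> to_wo ` K" for x
    using that by (intro K(2)) (metis imageI to_wo_of_wo)
  ultimately have "(\<integral>x. dd (to_wo e) (\<lambda>x. f (of_wo x)) x \<partial>lborel) = 0"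
    by (rule integral_dd_zero)
  moreover have "dd (to_wo e) (\<lambda>x. f (of_wo x)) x = dd e f (of_wo x)" for x
  proof -
    have "f differentiable at (of_wo x)" using f by (simp add: times_diff_on_Suc)
    from dd_compose[OF bounded_linear_imp_differentiable[OF bounded_linear_of_wo] this, of "to_wo e"]
    show ?thesis by (simp add: dd_bounded_linear[OF bounded_linear_of_wo])
  qed
  ultimately show ?thesis by (simp add: cint_def)
qed

text \<open>Both functions vanish off the open sets that \<open>\<tau>\<close> relates, so the
  integrals over the whole space are integrals over these sets.\<close>

lemma cint_change_of_variables:
  assumes "open S" and D: "\<And>z. z \<in> S \<Longrightarrow> (\<tau> has_derivative D z) (at z)" and inj: "inj_on \<tau> S"
    and f: "ccont f" "\<And>z. z \<notin> \<tau> ` S \<Longrightarrow> f z = 0"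
    and h: "ccont h" "\<And>z. z \<notin> S \<Longrightarrow> h z = 0" "\<And>z. z \<in> S \<Longrightarrow> h z = \<bar>real_det (D z)\<bar> * f (\<tau> z)"
  shows "cint h = cint f"
proof -
  let ?S = "to_wo ` S" and ?g = "\<lambda>x. to_wo (\<tau> (of_wo x))"
  have int: "integral UNIV (\<lambda>x. g (of_wo x)) = cint g" if "ccont g" for g :: "complex^'n \<Rightarrow> real"
    unfolding cint_def by (rule integral_lborel[OF ccont_integrable[OF ccont_of_wo[OF that]]])
  have ai: "(\<lambda>x. g (of_wo x)) absolutely_integrable_on UNIV" if "ccont g" for g :: "complex^'n \<Rightarrow> real"
    using ccont_integrable[OF ccont_of_wo[OF that]]
    by (simp add: set_integrable_def integrable_completion)
  \<comment> \<open>The theorem applied below concerns functions with values in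
    \<open>real^'n\<close>; real values are regarded as vectors with one component.\<close>
  have vec: "(\<lambda>x. \<chi> i::1. g (of_wo x)) absolutely_integrable_on V"
      "integral V (\<lambda>x. \<chi> i::1. g (of_wo x)) $ 1 = cint g"
    if g: "ccont g" "\<And>x. x \<notin> V \<Longrightarrow> g (of_wo x) = 0" for g :: "complex^'n \<Rightarrow> real" and V
  proof -
    have eq: "(\<lambda>x. if x \<in> V then g (of_wo x) else 0) = (\<lambda>x. g (of_wo x))"
      using g(2) by (auto simp: fun_eq_iff)
    have "(\<lambda>x. if x \<in> V then g (of_wo x) else 0) absolutely_integrable_on UNIV"
      unfolding eq by (rule ai[OF g(1)])
    then have a: "(\<lambda>x. g (of_wo x)) absolutely_integrable_on V"
      by (rule iffD1[OF absolutely_integrable_restrict_UNIV])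
    then show A: "(\<lambda>x. \<chi> i::1. g (of_wo x)) absolutely_integrable_on V"
      by (subst absolutely_integrable_componentwise_iff) (auto simp: Basis_vec_def inner_axis)
    have "integral V (\<lambda>x. \<chi> i::1. g (of_wo x)) $ 1 = integral V (\<lambda>x. (\<chi> i::1. g (of_wo x)) $ 1)"
      by (rule integral_component_eq_cart[symmetric]) (rule set_lebesgue_integral_eq_integral(1)[OF A])
    also have "\<dots> = integral UNIV (\<lambda>x. if x \<in> V then g (of_wo x) else 0)"
      by (simp add: integral_restrict_UNIV)
    finally show "integral V (\<lambda>x. \<chi> i::1. g (of_wo x)) $ 1 = cint g"
      unfolding eq int[OF g(1)] .
  qed
  have f0: "f (of_wo x) = 0" if "x \<notin> ?g ` ?S" for x
  proof (rule f(2))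
    show "of_wo x \<notin> \<tau> ` S"
    proof
      assume "of_wo x \<in> \<tau> ` S"
      then obtain y where y: "y \<in> S" "of_wo x = \<tau> y" by blast
      then have "x = ?g (to_wo y)" by (metis of_wo_to_wo to_wo_of_wo)
      then show False using that y(1) by blast
    qed
  qed
  have h0: "h (of_wo x) = 0" if "x \<notin> ?S" for x
  proof (rule h(2))
    show "of_wo x \<notin> S" using that by (metis imageI to_wo_of_wo)
  qed
  have S': "?S = of_wo -` S" by (auto simp: image_iff) (metis to_wo_of_wo)
  have "open ?S" unfolding S' by (rule open_vimage[OF assms(1) continuous_on_of_wo])
  have "integral (?g ` ?S) (\<lambda>x. \<chi> i::1. f (of_wo x)) = integral ?S (\<lambda>x. \<bar>det (matrix (\<lambda>v. to_wo (D (of_wo x) (of_wo v))))\<bar> *\<^sub>R (\<chi> i::1. f (of_wo (?g x))))"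
  proof (rule integral_change_of_variables)
    show "?S \<in> sets lebesgue" using \<open>open ?S\<close> by (simp add: lmeasurable_open borel_open)
    show "(?g has_derivative (\<lambda>v. to_wo (D (of_wo x) (of_wo v)))) (at x within ?S)" if "x \<in> ?S" for x
    proof -
      have "of_wo x \<in> S" using that by auto
      have 1: "(of_wo has_derivative of_wo) (at x)"
        by (rule bounded_linear_imp_has_derivative[OF bounded_linear_of_wo])
      have "((\<lambda>x. \<tau> (of_wo x)) has_derivative (\<lambda>v. D (of_wo x) (of_wo v))) (at x)"
        by (rule has_derivative_compose[OF 1 D[OF \<open>of_wo x \<in> S\<close>]])
      from has_derivative_at_withinI[OF bounded_linear.has_derivative[OF bounded_linear_to_wo this]]
      show ?thesis .
    qed
    show "inj_on ?g ?S"
    proof (rule inj_onI)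
      fix x y assume xy: "x \<in> ?S" "y \<in> ?S" "?g x = ?g y"
      then have "of_wo (?g x) = of_wo (?g y)" by simp
      then have "\<tau> (of_wo x) = \<tau> (of_wo y)" by simp
      moreover have "of_wo x \<in> S" "of_wo y \<in> S" using xy by auto
      ultimately have "of_wo x = of_wo y" using inj by (simp add: inj_on_def)
      then show "x = y" by (metis to_wo_of_wo)
    qed
    show "(\<lambda>x. \<chi> i::1. f (of_wo x)) absolutely_integrable_on (?g ` ?S) \<or>
        (\<lambda>x. \<bar>det (matrix (\<lambda>v. to_wo (D (of_wo x) (of_wo v))))\<bar> *\<^sub>R (\<chi> i::1. f (of_wo (?g x)))) absolutely_integrable_on ?S"
      using vec(1)[OF f(1) f0] ..
  qed
  moreover have "integral ?S (\<lambda>x. \<bar>det (matrix (\<lambda>v. to_wo (D (of_wo x) (of_wo v))))\<bar> *\<^sub>R (\<chi> i::1. f (of_wo (?g x)))) =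
      integral ?S (\<lambda>x. \<chi> i::1. h (of_wo x))"
    by (rule integral_cong) (auto simp: det_wo h(3) vec_eq_iff)
  ultimately have "integral (?g ` ?S) (\<lambda>x. \<chi> i::1. f (of_wo x)) $ 1 = integral ?S (\<lambda>x. \<chi> i::1. h (of_wo x)) $ 1"
    by simp
  then show ?thesis using vec(2)[OF f(1) f0] vec(2)[OF h(1) h0] by simp
qed

section \<open>Holomorphic functions of several variables are smooth\<close>

text \<open>The transition maps of a complex manifold are only assumed to be complex differentiable;
  their smoothness follows from Cauchy's integral formula on complex lines.\<close>

definition cholo :: "(complex^'n \<Rightarrow> complex) \<Rightarrow> (complex^'n) set \<Rightarrow> bool" where
  "cholo f U \<longleftrightarrow> (\<forall>z\<in>U. f differentiable at z \<and> (\<forall>v. dd (\<i> *s v) f z = \<i> * dd v f z))"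

lemma norm_vector_smult: "norm (c *s v :: complex^'n) = norm c * norm v"
  by (simp add: norm_vec_def norm_mult L2_set_right_distrib)

lemma cholo_smult:
  assumes "cholo f U" "z \<in> U"
  shows "dd (c *s v) f z = c * dd v f z"
proof -
  have d: "f differentiable at z" and i: "dd (\<i> *s v) f z = \<i> * dd v f z"
    using assms by (auto simp: cholo_def)
  have c: "c *s v = Re c *\<^sub>R v + Im c *\<^sub>R (\<i> *s v)"
    by (simp add: vec_eq_iff complex_eq_iff)
  have "dd (c *s v) f z = Re c *\<^sub>R dd v f z + Im c *\<^sub>R (\<i> * dd v f z)"
    unfolding c dd_add_dir[OF d] dd_scaleR_dir[OF d] i ..
  then show ?thesis by (simp add: complex_eq_iff)
qed

lemma cholo_line:
  assumes "cholo f U" "z + \<zeta> *s v \<in> U"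
  shows "((\<lambda>\<zeta>. f (z + \<zeta> *s v)) has_field_derivative dd v f (z + \<zeta> *s v)) (at \<zeta>)"
proof -
  have d: "f differentiable at (z + \<zeta> *s v)" using assms by (auto simp: cholo_def)
  have "bounded_linear (\<lambda>\<zeta>::complex. \<zeta> *s v)"
    by (rule linear_conv_bounded_linear[THEN iffD1], rule linearI) (simp_all add: vec_eq_iff distrib_right)
  then have "((\<lambda>\<zeta>. z + \<zeta> *s v) has_derivative (\<lambda>h. h *s v)) (at \<zeta>)"
    using has_derivative_add[OF has_derivative_const[of z] bounded_linear_imp_has_derivative] by simp
  from has_derivative_compose[OF this has_derivative_dd[OF d]]
  show ?thesis
    unfolding has_field_derivative_def cholo_smult[OF assms] mult.commute[of _ "dd v f (z + \<zeta> *s v)"] .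
qed

text \<open>Cauchy's formula for the derivative at the centre of the function restricted to the
  complex line along \<open>v\<close>. The velocity of the circle cancels one factor of the squared
  denominator; the result is an ordinary integral in which \<open>z\<close> is a parameter.\<close>

lemma cholo_cauchy:
  assumes f: "cholo f U" and "r > 0" and U: "\<And>\<zeta>. norm \<zeta> \<le> r \<Longrightarrow> z + \<zeta> *s v \<in> U"
  shows "dd v f z = integral {0..1} (\<lambda>t. f (z + (r * exp (2 * of_real pi * \<i> * of_real t)) *s v) / (r * exp (2 * of_real pi * \<i> * of_real t)))"
proof -
  let ?g = "\<lambda>\<zeta>. f (z + \<zeta> *s v)" and ?E = "\<lambda>t. exp (2 * of_real pi * \<i> * of_real t) :: complex"
  have D: "(?g has_field_derivative dd v f (z + \<zeta> *s v)) (at \<zeta>)" if "norm \<zeta> \<le> r" for \<zeta>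
    by (rule cholo_line[OF f U[OF that]])
  have c: "continuous_on (cball 0 r) ?g"
    by (rule continuous_at_imp_continuous_on) (auto intro!: DERIV_isCont[OF D])
  have h: "?g holomorphic_on ball 0 r"
  proof (rule holomorphic_onI)
    fix \<zeta> :: complex assume "\<zeta> \<in> ball 0 r"
    then have "(?g has_field_derivative dd v f (z + \<zeta> *s v)) (at \<zeta>)" by (intro D) simp
    then show "?g field_differentiable at \<zeta> within ball 0 r"
      by (rule field_differentiable_at_within[OF field_differentiable_def[THEN meta_eq_to_obj_eq, THEN iffD2, OF exI]])
  qed
  have 0: "0 \<in> ball (0::complex) r" using \<open>r > 0\<close> by simp
  note C = Cauchy_derivative_integral_circlepath[OF c h 0]
  have "(?g has_field_derivative dd v f z) (at 0)" using D[of 0] \<open>r > 0\<close> by simp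
  from DERIV_unique[OF this C(2)]
  have eq: "contour_integral (circlepath 0 r) (\<lambda>u. ?g u / (u - 0)^2) = 2 * of_real pi * \<i> * dd v f z" by simp
  from has_contour_integral_integral[OF C(1)]
  have "((\<lambda>t. ?g (r * ?E t) / (r * ?E t)^2 * (2 * of_real pi * \<i> * r * ?E t)) has_integral 2 * of_real pi * \<i> * dd v f z) {0..1}"
    unfolding has_contour_integral_def eq
    by (rule has_integral_eq[rotated]) (simp only: atLeastAtMost_iff vector_derivative_circlepath01, simp add: circlepath)
  from has_integral_mult_right[OF this, of "1 / (2 * of_real pi * \<i>)"]
  have "((\<lambda>t. ?g (r * ?E t) / (r * ?E t)) has_integral 1 / (2 * of_real pi * \<i>) * (2 * of_real pi * \<i> * dd v f z)) {0..1}"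
  proof (rule has_integral_eq[rotated])
    fix t :: real
    have "of_real r * ?E t \<noteq> 0" using \<open>r > 0\<close> by simp
    then show "1 / (2 * of_real pi * \<i>) * (?g (r * ?E t) / (r * ?E t)^2 * (2 * of_real pi * \<i> * r * ?E t)) = ?g (r * ?E t) / (r * ?E t)"
      by (simp add: power2_eq_square)
  qed
  then show ?thesis by (simp add: integral_unique)
qed

text \<open>One radius serves all base points near \<open>z0\<close>, so that the Cauchy integral
  can be treated as a parameter integral.\<close>

lemma cholo_cauchy_local:
  assumes f: "cholo f U" and "open U" "z0 \<in> U"
  obtains r \<delta> where "r > 0" "\<delta> > 0"
    "\<And>z \<zeta>. z \<in> ball z0 \<delta> \<Longrightarrow> norm \<zeta> \<le> r \<Longrightarrow> z + \<zeta> *s v \<in> U"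
proof -
  obtain d where d: "d > 0" "ball z0 d \<subseteq> U" using assms(2,3) openE by blast
  define r where "r = d / 2 / (norm v + 1)"
  have nv: "norm v + 1 > 0" using norm_ge_zero[of v] by linarith
  have "r > 0" using d(1) nv by (simp add: r_def)
  have "z + \<zeta> *s v \<in> U" if "z \<in> ball z0 (d/2)" "norm \<zeta> \<le> r" for z \<zeta>
  proof -
    have "dist z0 (z + \<zeta> *s v) \<le> dist z0 z + norm (\<zeta> *s v)"
      using dist_triangle[of z0 "z + \<zeta> *s v" z] by (simp add: dist_norm)
    also have "norm (\<zeta> *s v) \<le> r * norm v" unfolding norm_vector_smult using that(2) by (simp add: mult_right_mono)
    also have "r * norm v \<le> r * (norm v + 1)" using \<open>r > 0\<close> by simp
    also have "\<dots> = d / 2" using nv unfolding r_def by (metis nonzero_eq_divide_eq less_irrefl)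
    also have "dist z0 z + d / 2 < d" using that(1) by simp
    finally show ?thesis using d(2) by (auto simp: subset_iff)
  qed
  with \<open>r > 0\<close> d(1) show ?thesis by (intro that[of r "d/2"]) auto
qed

lemma cholo_continuous_on: "cholo f U \<Longrightarrow> continuous_on U f"
  unfolding cholo_def by (auto intro!: continuous_at_imp_continuous_on differentiable_imp_continuous_within)

lemma cauchy_kernel_continuous:
  assumes g: "continuous_on U g" and "r > 0" and U: "\<And>z \<zeta>. z \<in> B \<Longrightarrow> norm \<zeta> \<le> r \<Longrightarrow> z + \<zeta> *s v \<in> U"
  shows "continuous_on (B \<times> {0..1}) (\<lambda>(z, t::real). g (z + (r * exp (2 * of_real pi * \<i> * of_real t)) *s v) / (r * exp (2 * of_real pi * \<i> * of_real t)) :: complex)"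
proof -
  have s: "(c *s v) = (\<chi> i. c * v $ i)" for c :: complex and v :: "complex^'n" by (simp add: vec_eq_iff)
  have "continuous_on (B \<times> {0..1}) (\<lambda>p. fst p + (of_real r * exp (2 * of_real pi * \<i> * of_real (snd p :: real))) *s v)"
    unfolding s by (intro continuous_intros continuous_on_vec_lambda)
  moreover have "fst p + (of_real r * exp (2 * of_real pi * \<i> * of_real (snd p))) *s v \<in> U" if "p \<in> B \<times> {0..1::real}" for p
    using that \<open>r > 0\<close> by (intro U) (auto simp: norm_mult norm_exp_eq_Re)
  ultimately have "continuous_on (B \<times> {0..1}) (\<lambda>p. g (fst p + (of_real r * exp (2 * of_real pi * \<i> * of_real (snd p :: real))) *s v))"
    by (intro continuous_on_compose2[OF g]) auto
  then show ?thesis unfolding split_beta using \<open>r > 0\<close> by (intro continuous_intros) auto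
qed

text \<open>Only existence of the derivative is assumed in \<open>cholo\<close>. Its continuity
  comes from the Cauchy integral and is needed for differentiating under the integral in
  \<open>cholo_dd\<close>.\<close>

lemma cholo_dd_continuous_on:
  assumes f: "cholo f U" and "open U"
  shows "continuous_on U (dd v f)"
proof (rule continuous_at_imp_continuous_on, rule ballI)
  fix z0 assume "z0 \<in> U"
  obtain r \<delta> where r: "r > 0" "\<delta> > 0" and U: "\<And>z \<zeta>. z \<in> ball z0 \<delta> \<Longrightarrow> norm \<zeta> \<le> r \<Longrightarrow> z + \<zeta> *s v \<in> U"
    using cholo_cauchy_local[where v = v, OF assms \<open>z0 \<in> U\<close>] by blast
  let ?k = "\<lambda>z (t::real). f (z + (r * exp (2 * of_real pi * \<i> * of_real t)) *s v) / (r * exp (2 * of_real pi * \<i> * of_real t))"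
  have "continuous_on (ball z0 \<delta>) (\<lambda>z. integral (cbox 0 1) (?k z))"
  proof (rule integral_continuous_on_param)
    have "continuous_on (ball z0 \<delta> \<times> {0..1}) (\<lambda>(z, t). ?k z t)"
      by (rule cauchy_kernel_continuous[OF cholo_continuous_on[OF f] r(1) U])
    then show "continuous_on (ball z0 \<delta> \<times> cbox 0 1) (\<lambda>(z, t). ?k z t)" by simp
  qed
  moreover have "integral (cbox 0 1) (?k z) = dd v f z" if "z \<in> ball z0 \<delta>" for z
    using cholo_cauchy[OF f r(1) U[OF that]] by simp
  ultimately have "continuous_on (ball z0 \<delta>) (dd v f)" by (rule continuous_on_eq) simp
  then show "isCont (dd v f) z0" using r(2) by (simp add: continuous_on_eq_continuous_at)
qed

text \<open>The Cauchy integral is differentiated under the integral sign, and its derivative is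
  complex linear because that of the kernel is. Iteration yields derivatives of all orders.\<close>

lemma cholo_dd:
  assumes f: "cholo f U" and "open U"
  shows "cholo (dd v f) U"
  unfolding cholo_def
proof (intro ballI)
  fix z0 assume "z0 \<in> U"
  obtain r \<delta> where r: "r > 0" "\<delta> > 0" and U: "\<And>z \<zeta>. z \<in> ball z0 \<delta> \<Longrightarrow> norm \<zeta> \<le> r \<Longrightarrow> z + \<zeta> *s v \<in> U"
    using cholo_cauchy_local[where v = v, OF assms \<open>z0 \<in> U\<close>] by blast
  let ?e = "\<lambda>t::real. r * exp (2 * of_real pi * \<i> * of_real t) :: complex"
  let ?k = "\<lambda>z (t::real). f (z + ?e t *s v) / ?e t"
  let ?B = "ball z0 \<delta>"
  have inU: "z + ?e t *s v \<in> U" if "z \<in> ?B" for z t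
    using that r(1) by (intro U) (simp_all add: norm_mult norm_exp_eq_Re)
  \<comment> \<open>The derivative of the kernel in \<open>z\<close>, packaged as a bounded linear
    function since the Leibniz rule integrates the derivatives as such.\<close>
  define k' where "k' z t = Blinfun (\<lambda>w. dd w f (z + ?e t *s v) / ?e t)" for z and t :: real
  have df: "f differentiable at (z + ?e t *s v)" if "z \<in> ?B" for z t
    using f inU[OF that] by (auto simp: cholo_def)
  have bl: "bounded_linear (\<lambda>w. dd w f (z + ?e t *s v) / ?e t)" if "z \<in> ?B" for z t
    using bounded_linear_compose[OF bounded_linear_divide has_derivative_bounded_linear[OF has_derivative_dd[OF df[OF that]]]] .
  have k': "blinfun_apply (k' z t) = (\<lambda>w. dd w f (z + ?e t *s v) / ?e t)" if "z \<in> ?B" for z t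
    unfolding k'_def by (rule bounded_linear_Blinfun_apply[OF bl[OF that]])
  have deriv: "((\<lambda>z. integral (cbox 0 1) (?k z)) has_derivative blinfun_apply (integral (cbox 0 1) (k' z0))) (at z0 within ?B)"
  proof (rule leibniz_rule)
    show "((\<lambda>z. ?k z t) has_derivative blinfun_apply (k' z t)) (at z within ?B)" if "z \<in> ?B" "t \<in> cbox 0 1" for z t
    proof -
      have "((\<lambda>z. f (z + ?e t *s v)) has_derivative (\<lambda>w. dd w f (z + ?e t *s v))) (at z)"
        using has_derivative_compose[OF has_derivative_add[OF has_derivative_ident has_derivative_const] has_derivative_dd[OF df[OF that(1)]]] by simp
      from bounded_linear.has_derivative[OF bounded_linear_divide this]
      show ?thesis unfolding k'[OF that(1)] by (rule has_derivative_at_withinI)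
    qed
    have ck: "continuous_on (?B \<times> {0..1}) (\<lambda>(z, t). ?k z t)"
      by (rule cauchy_kernel_continuous[OF cholo_continuous_on[OF f] r(1) U])
    show "?k z integrable_on cbox 0 1" if "z \<in> ?B" for z
    proof -
      have "continuous_on {0..1} (\<lambda>t. (\<lambda>(z, t). ?k z t) (z, t))"
        by (rule continuous_on_compose2[OF ck]) (use that in \<open>auto intro!: continuous_intros\<close>)
      then show ?thesis by (simp add: integrable_continuous_real)
    qed
    show "continuous_on (?B \<times> cbox 0 1) (\<lambda>(z, t). k' z t)"
    proof (rule continuous_on_blinfun_componentwise)
      fix w :: "complex^'a"
      have "continuous_on (?B \<times> {0..1}) (\<lambda>(z, t). dd w f (z + ?e t *s v) / ?e t)"
        by (rule cauchy_kernel_continuous[OF cholo_dd_continuous_on[OF f \<open>open U\<close>] r(1) U])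
      then show "continuous_on (?B \<times> cbox 0 1) (\<lambda>x. blinfun_apply (case x of (z, t) \<Rightarrow> k' z t) w)"
        by (rule continuous_on_cong[THEN iffD1, rotated 2]) (auto simp: k')
    qed
  qed (use r(2) in auto)
  have eq: "dd v f z = integral (cbox 0 1) (?k z)" if "z \<in> ?B" for z
    using cholo_cauchy[OF f r(1) U[OF that]] by simp
  have D: "(dd v f has_derivative blinfun_apply (integral (cbox 0 1) (k' z0))) (at z0)"
  proof -
    have "((\<lambda>z. integral (cbox 0 1) (?k z)) has_derivative blinfun_apply (integral (cbox 0 1) (k' z0))) (at z0)"
      using deriv r(2) by (simp only: at_within_open centre_in_ball open_ball)
    from has_derivative_transform_within_open[OF this open_ball[of z0 \<delta>]] show ?thesis
      using r(2) eq by simp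
  qed
  have i: "blinfun_apply (integral (cbox 0 1) (k' z0)) (\<i> *s w) = \<i> * blinfun_apply (integral (cbox 0 1) (k' z0)) w" for w
  proof -
    have z0: "z0 \<in> ?B" using r(2) by simp
    have int: "k' z0 integrable_on cbox 0 1"
    proof -
      have "continuous_on {0..1} (k' z0)"
      proof (rule continuous_on_blinfun_componentwise)
        fix w :: "complex^'a"
        have c: "continuous_on (?B \<times> {0..1}) (\<lambda>(z, t). dd w f (z + ?e t *s v) / ?e t)"
          by (rule cauchy_kernel_continuous[OF cholo_dd_continuous_on[OF f \<open>open U\<close>] r(1) U])
        have "continuous_on {0..1} (\<lambda>t. (\<lambda>(z, t). dd w f (z + ?e t *s v) / ?e t) (z0, t))"
          by (rule continuous_on_compose2[OF c]) (use z0 in \<open>auto intro!: continuous_intros\<close>)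
        then show "continuous_on {0..1} (\<lambda>t. blinfun_apply (k' z0 t) w)" by (simp add: k'[OF z0])
      qed
      then show ?thesis by (simp add: integrable_continuous_real)
    qed
    have ap: "blinfun_apply (integral (cbox 0 1) (k' z0)) w = integral (cbox 0 1) (\<lambda>t. dd w f (z0 + ?e t *s v) / ?e t)" for w
      using blinfun_apply_integral[OF int, of w] by (simp add: k'[OF z0])
    have "(\<lambda>t. dd (\<i> *s w) f (z0 + ?e t *s v) / ?e t) = (\<lambda>t. \<i> * (dd w f (z0 + ?e t *s v) / ?e t))"
      unfolding cholo_smult[OF f inU[OF z0]] by (rule ext) (rule times_divide_eq_right[symmetric])
    then show ?thesis unfolding ap by (simp only: integral_mult_right)
  qed
  show "dd v f differentiable at z0 \<and> (\<forall>w. dd (\<i> *s w) (dd v f) z0 = \<i> * dd w (dd v f) z0)"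
    unfolding dd_eqI[OF D] using i differentiableI[OF D] by blast
qed

lemma cholo_smooth_on:
  assumes "cholo f U" "open U"
  shows "smooth_on f U"
  unfolding smooth_on_def
proof
  fix k
  show "times_diff_on k f U"
    using assms(1)
  proof (induction k arbitrary: f)
    case 0
    then show ?case by (simp add: cholo_continuous_on)
  next
    case (Suc k)
    then show ?case using cholo_dd[OF _ assms(2)] by (auto simp: times_diff_on_Suc cholo_def)
  qed
qed

section \<open>Manifolds\<close>

lemma times_diff_on_local:
  assumes "open S" "\<And>x. x \<in> S \<Longrightarrow> \<exists>T. open T \<and> x \<in> T \<and> times_diff_on k f T"
  shows "times_diff_on k f S"
  using assms(2)
proof (induction k arbitrary: f)
  case 0
  show ?case
    unfolding times_diff_on.simps
  proof (rule continuous_at_imp_continuous_on, rule ballI)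
    fix x assume "x \<in> S"
    with 0 obtain T where "open T" "x \<in> T" "continuous_on T f" by auto
    then show "isCont f x" by (simp add: continuous_on_eq_continuous_at)
  qed
next
  case (Suc k)
  show ?case unfolding times_diff_on_Suc
  proof (intro conjI ballI allI)
    show "f differentiable at x" if "x \<in> S" for x
      using Suc.prems[OF that] unfolding times_diff_on_Suc by blast
    show "times_diff_on k (dd v f) S" for v
      by (rule Suc.IH) (use Suc.prems in \<open>unfold times_diff_on_Suc, blast\<close>)
  qed
qed

text \<open>The cut-off profile. One continuous derivative is enough, because the divergence theorem
  differentiates the partition of unity only once.\<close>

lemma times_diff_on_max_sq: "times_diff_on 1 (\<lambda>x::real. (max 0 x)\<^sup>2) UNIV"
proof -
  have D: "((\<lambda>x::real. (max 0 x)\<^sup>2) has_derivative (\<lambda>h. 2 * max 0 x * h)) (at x)" for x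
  proof -
    consider "x > 0" | "x < 0" | "x = 0" by linarith
    then have "((\<lambda>x::real. (max 0 x)\<^sup>2) has_field_derivative 2 * max 0 x) (at x)"
    proof cases
      case 1
      have "((\<lambda>x::real. x\<^sup>2) has_field_derivative 2 * max 0 x) (at x)"
        using 1 by (auto intro!: derivative_eq_intros)
      then show ?thesis by (rule has_field_derivative_transform_within_open[where S = "{0<..}"]) (use 1 in auto)
    next
      case 2
      have "((\<lambda>x::real. 0) has_field_derivative 2 * max 0 x) (at x)"
        using 2 by (auto intro!: derivative_eq_intros)
      then show ?thesis by (rule has_field_derivative_transform_within_open[where S = "{..<0}"]) (use 2 in auto)
    next
      case 3
      have "((\<lambda>h::real. (max 0 h)\<^sup>2 / h) \<longlongrightarrow> 0) (at 0)"
      proof (rule Lim_null_comparison)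
        show "\<forall>\<^sub>F h in at 0. norm ((max 0 h)\<^sup>2 / h) \<le> \<bar>h\<bar>"
          by (rule always_eventually) (auto simp: max_def power2_eq_square)
        show "((\<lambda>h::real. \<bar>h\<bar>) \<longlongrightarrow> 0) (at 0)" by (rule tendsto_rabs_zero) (rule tendsto_ident_at)
      qed
      then show ?thesis unfolding 3 by (simp add: has_field_derivative_iff)
    qed
    then show ?thesis by (simp add: has_field_derivative_def)
  qed
  have "times_diff_on (Suc 0) (\<lambda>x::real. (max 0 x)\<^sup>2) UNIV"
    by (rule times_diff_on_SucI[OF open_UNIV D]) (auto intro!: continuous_intros)
  then show ?thesis by simp
qed

definition extend0 :: "'a set \<Rightarrow> ('a \<Rightarrow> 'b::zero) \<Rightarrow> 'a \<Rightarrow> 'b" where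
  "extend0 S f x = (if x \<in> S then f x else 0)"

text \<open>The open sets \<open>S\<close> and the complement of \<open>K\<close> cover the space,
  and the extension agrees with \<open>f\<close> on the one and with zero on the other.\<close>

lemma times_diff_on_extend0:
  fixes K :: "'a::euclidean_space set"
  assumes "open S" "times_diff_on k f S" "compact K" "K \<subseteq> S" "\<And>x. x \<in> S \<Longrightarrow> x \<notin> K \<Longrightarrow> f x = 0"
  shows "times_diff_on k (extend0 S f) UNIV"
proof (rule times_diff_on_local[OF open_UNIV])
  fix x :: 'a
  show "\<exists>T. open T \<and> x \<in> T \<and> times_diff_on k (extend0 S f) T"
  proof (cases "x \<in> S")
    case True
    have "times_diff_on k (extend0 S f) S"
      using times_diff_on_cong[OF assms(1), of "extend0 S f" f k] assms(2) by (simp add: extend0_def)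
    with True assms(1) show ?thesis by blast
  next
    case False
    have o: "open (- K)" using assms(3) by (simp add: compact_imp_closed open_Compl)
    have "times_diff_on k (extend0 S f) (- K)"
      using times_diff_on_cong[OF o, of "extend0 S f" "\<lambda>_. 0" k] times_diff_on_const assms(5)
      by (auto simp: extend0_def)
    with False o assms(4) show ?thesis by blast
  qed
qed

lemma ccont_extend0:
  fixes K :: "'a::euclidean_space set"
  assumes "open S" "continuous_on S f" "compact K" "K \<subseteq> S" "\<And>x. x \<in> S \<Longrightarrow> x \<notin> K \<Longrightarrow> f x = 0"
  shows "ccont (extend0 S f)"
  unfolding ccont_def
proof
  show "continuous_on UNIV (extend0 S f)"
    using times_diff_on_extend0[of S 0 f K] assms by simp
  show "\<exists>K. compact K \<and> (\<forall>x. x \<notin> K \<longrightarrow> extend0 S f x = 0)"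
    using assms(3,5) by (auto simp: extend0_def)
qed

lemma cholo_cong:
  assumes "open U" "\<And>z. z \<in> U \<Longrightarrow> f z = g z"
  shows "cholo f U \<longleftrightarrow> cholo g U"
  unfolding cholo_def
  using dd_cong[OF assms(1) _ assms(2)] differentiable_cong_open[OF assms(1) _ assms(2)] by simp

section \<open>Atlases and transition maps\<close>

locale manifold =
  fixes A :: "('i, 'm::{t2_space, second_countable_topology}, 'e::euclidean_space) atlas"
  assumes manifold: "topological_manifold A"
begin

lemma open_patch: "c \<in> indices A \<Longrightarrow> open (patch A c)"
  and open_chart_image: "c \<in> indices A \<Longrightarrow> open (chart_image A c)"
  and chart_homeomorphism:
    "c \<in> indices A \<Longrightarrow> homeomorphism (patch A c) (chart_image A c) (chart A c) (chart_inv A c)"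
  and ex_patch: "\<exists>c\<in>indices A. p \<in> patch A c"
  and connected: "connected (UNIV :: 'm set)"
  using manifold unfolding topological_manifold_def by blast+

lemma chart_inv_chart: "c \<in> indices A \<Longrightarrow> p \<in> patch A c \<Longrightarrow> chart_inv A c (chart A c p) = p"
  and chart_chart_inv: "c \<in> indices A \<Longrightarrow> z \<in> chart_image A c \<Longrightarrow> chart A c (chart_inv A c z) = z"
  and chart_inv_in: "c \<in> indices A \<Longrightarrow> z \<in> chart_image A c \<Longrightarrow> chart_inv A c z \<in> patch A c"
  and chart_in: "c \<in> indices A \<Longrightarrow> p \<in> patch A c \<Longrightarrow> chart A c p \<in> chart_image A c"
  and continuous_on_chart: "c \<in> indices A \<Longrightarrow> continuous_on (patch A c) (chart A c)"
  and continuous_on_chart_inv: "c \<in> indices A \<Longrightarrow> continuous_on (chart_image A c) (chart_inv A c)"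
  using chart_homeomorphism[of c] by (auto simp: homeomorphism_def)

lemma overlap_iff:
  "c \<in> indices A \<Longrightarrow> z \<in> overlap A c d \<longleftrightarrow> z \<in> chart_image A c \<and> chart_inv A c z \<in> patch A d"
  unfolding overlap_def
  by (auto simp: chart_inv_chart chart_in) (metis IntI chart_chart_inv chart_inv_in imageI)

lemma open_vimage_chart_inv:
  assumes "c \<in> indices A" "open V"
  shows "open {z \<in> chart_image A c. chart_inv A c z \<in> V}"
proof -
  have "open (chart_image A c \<inter> chart_inv A c -` V)"
    by (rule continuous_open_preimage[OF continuous_on_chart_inv open_chart_image]) (use assms in auto)
  moreover have "{z \<in> chart_image A c. chart_inv A c z \<in> V} = chart_image A c \<inter> chart_inv A c -` V" by blast
  ultimately show ?thesis by simp
qed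

lemma open_overlap:
  assumes "c \<in> indices A" "d \<in> indices A"
  shows "open (overlap A c d)"
proof -
  have "overlap A c d = {z \<in> chart_image A c. chart_inv A c z \<in> patch A d}"
    using overlap_iff[OF assms(1)] by blast
  then show ?thesis using open_vimage_chart_inv[OF assms(1) open_patch[OF assms(2)]] by simp
qed

lemma transition_eq: "transition A c d z = chart A d (chart_inv A c z)"
  by (simp add: transition_def)

lemma chart_inv_transition:
  "c \<in> indices A \<Longrightarrow> d \<in> indices A \<Longrightarrow> z \<in> overlap A c d \<Longrightarrow> chart_inv A d (transition A c d z) = chart_inv A c z"
  by (simp add: transition_eq overlap_iff chart_inv_chart)

lemma transition_in:
  assumes "c \<in> indices A" "d \<in> indices A" "z \<in> overlap A c d"
  shows "transition A c d z \<in> overlap A d c" "transition A c d z \<in> chart_image A d"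
  using assms by (simp_all add: overlap_iff chart_inv_transition) (simp_all add: transition_eq chart_in chart_inv_in)

lemma transition_transition:
  assumes "c \<in> indices A" "d \<in> indices A" "z \<in> overlap A c d"
  shows "transition A d c (transition A c d z) = z"
  using assms chart_inv_transition[OF assms] by (simp add: transition_eq[of d c] overlap_iff chart_chart_inv)

lemma overlap_subset: "c \<in> indices A \<Longrightarrow> overlap A c d \<subseteq> chart_image A c"
  by (auto simp: overlap_iff)

lemma transition_image:
  assumes "c \<in> indices A" "d \<in> indices A"
  shows "transition A c d ` overlap A c d = overlap A d c"
  using transition_in(1)[OF assms] transition_in(1)[OF assms(2,1)] transition_transition[OF assms(2,1)]
  by (auto simp: image_iff) metis

lemma inj_on_transition:
  assumes "c \<in> indices A" "d \<in> indices A"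
  shows "inj_on (transition A c d) (overlap A c d)"
  using transition_transition[OF assms] by (rule inj_on_inverseI)

end

locale holomorphic_atlas =
  fixes A :: "('i, 'm::{t2_space, second_countable_topology}, complex^'n) atlas"
  assumes complex_manifold: "complex_manifold A"
begin

sublocale manifold A
  using complex_manifold by unfold_locales (simp add: complex_manifold_def)

lemma transition_derivative:
  assumes "c \<in> indices A" "d \<in> indices A" "z \<in> overlap A c d"
  obtains J where "(transition A c d has_derivative (\<lambda>v. J *v v)) (at z)" "\<And>v. dd v (transition A c d) z = J *v v"
proof -
  obtain J where J: "(transition A c d has_derivative (\<lambda>v. J *v v)) (at z)"
    using complex_manifold assms unfolding complex_manifold_def by blast
  with dd_eqI[OF J] show ?thesis using that by blast
qed

lemma cholo_transition:
  assumes cd: "c \<in> indices A" "d \<in> indices A"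
  shows "cholo (\<lambda>z. transition A c d z $ k) (overlap A c d)"
  unfolding cholo_def
proof (intro ballI)
  fix z assume z: "z \<in> overlap A c d"
  obtain J where J: "(transition A c d has_derivative (\<lambda>v. J *v v)) (at z)" "\<And>v. dd v (transition A c d) z = J *v v"
    using transition_derivative[OF cd z] by blast
  have d: "transition A c d differentiable at z" using J(1) by (rule differentiableI)
  show "(\<lambda>z. transition A c d z $ k) differentiable at z \<and>
    (\<forall>v. dd (\<i> *s v) (\<lambda>z. transition A c d z $ k) z = \<i> * dd v (\<lambda>z. transition A c d z $ k) z)"
    using bounded_linear.differentiable_apply[OF bounded_linear_vec_nth d]
    by (simp add: dd_vec_nth[OF d] J(2) matrix_vector_mult_def sum_distrib_left mult_ac)
qed

lemma smooth_on_transition: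
  assumes cd: "c \<in> indices A" "d \<in> indices A"
  shows "smooth_on (transition A c d) (overlap A c d)"
  using smooth_on_vec[OF open_overlap[OF cd]] cholo_smooth_on[OF cholo_transition[OF cd] open_overlap[OF cd]] by blast

lemma cholo_dd_transition:
  assumes cd: "c \<in> indices A" "d \<in> indices A"
  shows "cholo (\<lambda>z. dd v (transition A c d) z $ k) (overlap A c d)"
  by (rule cholo_cong[OF open_overlap[OF cd], THEN iffD1, OF _ cholo_dd[OF cholo_transition[OF cd] open_overlap[OF cd]]])
    (simp add: dd_vec_nth smooth_on_differentiable[OF smooth_on_transition[OF cd]])

lemma differentiable_transition:
  "c \<in> indices A \<Longrightarrow> d \<in> indices A \<Longrightarrow> z \<in> overlap A c d \<Longrightarrow> transition A c d differentiable at z"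
  using smooth_on_differentiable[OF smooth_on_transition] .

lemma dd_transition_inverse:
  assumes cd: "c \<in> indices A" "d \<in> indices A" and z: "z \<in> overlap A c d"
  shows "dd (dd v (transition A c d) z) (transition A d c) (transition A c d z) = v"
proof -
  have "dd (dd v (transition A c d) z) (transition A d c) (transition A c d z) = dd v (\<lambda>z. transition A d c (transition A c d z)) z"
    by (rule dd_compose[symmetric]) (use differentiable_transition cd z transition_in in auto)
  also have "\<dots> = dd v (\<lambda>z. z) z"
    by (rule dd_cong[OF open_overlap[OF cd] z]) (rule transition_transition[OF cd])
  also have "\<dots> = v" by (rule dd_eqI) (rule has_derivative_ident)
  finally show ?thesis .
qed

end

section \<open>The divergence theorem on a compact complex manifold\<close>

lemma rdiv_scaleR:
  fixes Y :: "complex^'n \<Rightarrow> complex^'n"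
  assumes u: "u differentiable at z" and Y: "Y differentiable at z"
  shows "rdiv (\<lambda>z. u z *\<^sub>R Y z) z = u z * rdiv Y z + dd (Y z) u z"
  unfolding rdiv_def dd_scaleR[OF u Y] dd_expand[OF u, of "Y z"]
  by (simp add: vector_scaleR_component sum.distrib sum_distrib_left algebra_simps)

lemma rdiv_cong:
  assumes "open S" "z \<in> S" "\<And>y. y \<in> S \<Longrightarrow> X y = Y y"
  shows "rdiv X z = rdiv Y z"
proof -
  have "dd v X z = dd v Y z" for v by (rule dd_cong[OF assms])
  then show ?thesis by (simp add: rdiv_def)
qed

lemma ccont_dd:
  assumes "times_diff_on 1 f UNIV" "compact K" "\<And>x. x \<notin> K \<Longrightarrow> f x = 0"
  shows "ccont (dd e f)"
  unfolding ccont_def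
proof (intro conjI exI allI impI)
  show "continuous_on UNIV (dd e f)" using assms(1) by (simp add: times_diff_on_Suc)
  fix x assume "x \<notin> K"
  have "dd e f x = dd e (\<lambda>_. 0) x"
    by (rule dd_cong[of "- K"]) (use assms \<open>x \<notin> K\<close> in \<open>auto simp: compact_imp_closed open_Compl\<close>)
  then show "dd e f x = 0" by (simp add: dd_const)
qed fact

lemma cint_rdiv:
  fixes G :: "complex^'n \<Rightarrow> complex^'n"
  assumes G: "times_diff_on 1 G UNIV" and K: "compact K" "\<And>x. x \<notin> K \<Longrightarrow> G x = 0"
  shows "cint (rdiv G) = 0"
proof -
  have dG: "G differentiable at z" for z using G by (simp add: times_diff_on_Suc)
  have dG': "(\<lambda>z. G z $ \<beta>) differentiable at z" for z \<beta>
    by (rule bounded_linear.differentiable_apply[OF bounded_linear_vec_nth dG])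
  have c: "times_diff_on 1 (\<lambda>z. l (G z $ \<beta>)) UNIV" if "bounded_linear l" for l :: "complex \<Rightarrow> real" and \<beta>
    by (rule times_diff_on_compose[OF _ _ _ times_diff_on_bounded_linear G, of UNIV])
      (simp_all add: bounded_linear_compose[OF that bounded_linear_vec_nth])
  have z: "l (G x $ \<beta>) = 0" if "bounded_linear l" "x \<notin> K" for l :: "complex \<Rightarrow> real" and \<beta> x
    using K(2)[OF that(2)] linear_0[OF bounded_linear.linear[OF that(1)]] by simp
  note RI = bounded_linear_Re bounded_linear_Im
  have cc: "ccont (dd e (\<lambda>z. l (G z $ \<beta>)))" if "bounded_linear l" for l :: "complex \<Rightarrow> real" and \<beta> e
    by (rule ccont_dd[OF c[OF that] K(1) z[OF that]])
  have c0: "cint (dd e (\<lambda>z. l (G z $ \<beta>))) = 0" if "bounded_linear l" for l :: "complex \<Rightarrow> real" and \<beta> e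
    by (rule cint_dd_zero[OF c[OF that] K(1) z[OF that]])
  have "rdiv G z = (\<Sum>\<beta>\<in>UNIV. dd (axis \<beta> 1) (\<lambda>z. Re (G z $ \<beta>)) z + dd (axis \<beta> \<i>) (\<lambda>z. Im (G z $ \<beta>)) z)" for z
    unfolding rdiv_def dd_Re[OF dG'] dd_Im[OF dG'] dd_vec_nth[OF dG] ..
  then have "rdiv G = (\<lambda>z. \<Sum>\<beta>\<in>UNIV. dd (axis \<beta> 1) (\<lambda>z. Re (G z $ \<beta>)) z + dd (axis \<beta> \<i>) (\<lambda>z. Im (G z $ \<beta>)) z)"
    by (rule ext)
  then show ?thesis
    by (simp add: cint_sum ccont_add cint_add cc[OF RI(1)] cc[OF RI(2)] c0[OF RI(1)] c0[OF RI(2)])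
qed

section \<open>Partitions of unity and integration by parts\<close>

locale compact_holomorphic_atlas = holomorphic_atlas A
  for A :: "('i, 'm::{t2_space, second_countable_topology}, complex^'n) atlas" +
  assumes compact: "compact (UNIV :: 'm set)"
begin

lemma compact_chart:
  assumes "c \<in> indices A" "compact K" "K \<subseteq> patch A c"
  shows "compact (chart A c ` K)" "chart A c ` K \<subseteq> chart_image A c"
    "\<And>z. z \<in> chart_image A c \<Longrightarrow> z \<notin> chart A c ` K \<Longrightarrow> chart_inv A c z \<notin> K"
  using compact_continuous_image[OF continuous_on_subset[OF continuous_on_chart assms(3)] assms(2)] assms
  by (auto simp: chart_in chart_chart_inv subset_iff image_iff)

text \<open>Transplants a radial bump from a closed ball inside one chart image. In any other chart
  it is differentiable because the patch \<open>c\<close> and the complement of the compact set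
  \<open>K\<close> cover the manifold.\<close>

lemma bump_exists:
  assumes c: "c \<in> indices A" and p: "p \<in> patch A c"
  shows "\<exists>b K. compact K \<and> K \<subseteq> patch A c \<and> (\<forall>q. b q \<ge> (0::real)) \<and> (\<forall>q. q \<notin> K \<longrightarrow> b q = 0) \<and>
    p \<in> {q. b q > 0} \<and> open {q. b q > 0} \<and>
    (\<forall>d\<in>indices A. times_diff_on 1 (\<lambda>z. b (chart_inv A d z)) (chart_image A d))"
proof -
  define z0 where "z0 = chart A c p"
  have z0: "z0 \<in> chart_image A c" using chart_in[OF c p] by (simp add: z0_def)
  obtain r where r: "r > 0" "cball z0 r \<subseteq> chart_image A c"
    using open_contains_cball[THEN iffD1, OF open_chart_image[OF c]] z0 by blast
  define u where "u z = (max 0 (r\<^sup>2 - (norm (z - z0))\<^sup>2))\<^sup>2" for z :: "complex^'n"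
  define b where "b q = (if q \<in> patch A c then u (chart A c q) else 0)" for q
  define K where "K = chart_inv A c ` cball z0 r"
  have u_pos: "u z > 0 \<longleftrightarrow> z \<in> ball z0 r" for z
  proof -
    have "norm (z - z0) < r \<longleftrightarrow> (norm (z - z0))\<^sup>2 < r\<^sup>2" 
      by (meson norm_ge_zero r(1) power_strict_mono power2_less_imp_less less_imp_le zero_less_numeral)
    then show ?thesis by (auto simp: u_def max_def dist_norm norm_minus_commute)
  qed
  have u0: "u z \<ge> 0" for z by (simp add: u_def)
  have K: "compact K" unfolding K_def
    by (rule compact_continuous_image[OF continuous_on_subset[OF continuous_on_chart_inv[OF c] r(2)]]) simp
  have KP: "K \<subseteq> patch A c" using r(2) chart_inv_in[OF c] by (auto simp: K_def)
  have bK: "b q = 0" if "q \<notin> K" for q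
  proof (cases "q \<in> patch A c")
    case True
    have "chart A c q \<notin> ball z0 r"
    proof
      assume "chart A c q \<in> ball z0 r"
      then have "chart_inv A c (chart A c q) \<in> K" unfolding K_def by (intro imageI) simp
      with that chart_inv_chart[OF c True] show False by simp
    qed
    then show ?thesis using True u_pos[of "chart A c q"] u0[of "chart A c q"] by (simp add: b_def)
  qed (simp add: b_def)
  have "b q > 0 \<longleftrightarrow> q \<in> patch A c \<and> chart A c q \<in> ball z0 r" for q
    using u_pos[of "chart A c q"] by (simp add: b_def del: mem_ball)
  then have "{q. b q > 0} = patch A c \<inter> chart A c -` ball z0 r" by blast
  then have o: "open {q. b q > 0}"
    by (simp only: continuous_open_preimage[OF continuous_on_chart[OF c] open_patch[OF c] open_ball])
  have pb: "b p > 0" using p u_pos[of z0] r(1) by (simp add: b_def z0_def)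
  have us: "times_diff_on 1 u UNIV"
  proof -
    have "smooth_on (\<lambda>z. r\<^sup>2 - (z - z0) \<bullet> (z - z0)) UNIV" by (intro smooth_intros) simp_all
    then have "times_diff_on 1 (\<lambda>z. r\<^sup>2 - (norm (z - z0))\<^sup>2) UNIV" by (simp add: smooth_on_def power2_norm_eq_inner)
    from times_diff_on_compose[OF open_UNIV open_UNIV _ times_diff_on_max_sq this]
    show ?thesis by (simp add: u_def[abs_def])
  qed
  have "times_diff_on 1 (\<lambda>z. b (chart_inv A d z)) (chart_image A d)" if d: "d \<in> indices A" for d
  proof (rule times_diff_on_local[OF open_chart_image[OF d]])
    fix z assume z: "z \<in> chart_image A d"
    show "\<exists>T. open T \<and> z \<in> T \<and> times_diff_on 1 (\<lambda>z. b (chart_inv A d z)) T"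
    proof (cases "chart_inv A d z \<in> patch A c")
      case True
      have "times_diff_on 1 (transition A d c) (overlap A d c)" using smooth_on_transition[OF d c] by (simp add: smooth_on_def)
      from times_diff_on_compose[OF open_overlap[OF d c] open_UNIV _ us this]
      have "times_diff_on 1 (\<lambda>z. u (transition A d c z)) (overlap A d c)" by simp
      then have "times_diff_on 1 (\<lambda>z. b (chart_inv A d z)) (overlap A d c)"
        using times_diff_on_cong[OF open_overlap[OF d c], of "\<lambda>z. b (chart_inv A d z)" "\<lambda>z. u (transition A d c z)" 1]
        by (simp add: overlap_iff[OF d] b_def transition_eq)
      with True z open_overlap[OF d c] show ?thesis by (auto simp: overlap_iff[OF d])
    next
      case False
      \<comment> \<open>Near a point outside the patch \<open>c\<close> the bump vanishes
        identically. \<open>K\<close> is closed because the space is Hausdorff.\<close>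
      let ?T = "{z \<in> chart_image A d. chart_inv A d z \<in> - K}"
      have oT: "open ?T" by (rule open_vimage_chart_inv[OF d]) (simp add: K compact_imp_closed open_Compl)
      have "times_diff_on 1 (\<lambda>z. b (chart_inv A d z)) ?T"
        using times_diff_on_cong[OF oT, of "\<lambda>z. b (chart_inv A d z)" "\<lambda>z. 0" 1] times_diff_on_const bK by simp
      moreover have "z \<in> ?T" using False KP z by auto
      ultimately show ?thesis using oT by blast
    qed
  qed
  then show ?thesis using K KP bK o pb u0 by (intro exI[of _ b] exI[of _ K]) (auto simp: b_def)
qed

text \<open>The members are indexed by the points around which the bumps are built. A point and its
  chart can be prescribed with a member positive there, so that a vanishing integral yields a
  statement at that point.\<close>

lemma partition_of_unity:
  assumes c0: "c0 \<in> indices A" and p0: "p0 \<in> patch A c0"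
  obtains L c K \<rho> where "finite L" "p0 \<in> L" "c p0 = c0" "\<rho> p0 p0 > (0::real)"
    "\<And>p. p \<in> L \<Longrightarrow> c p \<in> indices A" "\<And>p. p \<in> L \<Longrightarrow> compact (K p)" "\<And>p. p \<in> L \<Longrightarrow> K p \<subseteq> patch A (c p)"
    "\<And>p q. p \<in> L \<Longrightarrow> \<rho> p q \<ge> 0" "\<And>p q. p \<in> L \<Longrightarrow> q \<notin> K p \<Longrightarrow> \<rho> p q = 0"
    "\<And>p d. p \<in> L \<Longrightarrow> d \<in> indices A \<Longrightarrow> times_diff_on 1 (\<lambda>z. \<rho> p (chart_inv A d z)) (chart_image A d)"
    "\<And>q. (\<Sum>p\<in>L. \<rho> p q) = 1"
proof -
  obtain c1 where c1: "\<And>p. c1 p \<in> indices A \<and> p \<in> patch A (c1 p)" using ex_patch by metis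
  define c where "c p = (if p = p0 then c0 else c1 p)" for p
  have c: "c p \<in> indices A" "p \<in> patch A (c p)" for p using c1 c0 p0 by (auto simp: c_def)
  have "\<forall>p. \<exists>bK. compact (snd bK) \<and> snd bK \<subseteq> patch A (c p) \<and> (\<forall>q. fst bK q \<ge> (0::real)) \<and> (\<forall>q. q \<notin> snd bK \<longrightarrow> fst bK q = 0) \<and>
    p \<in> {q. fst bK q > 0} \<and> open {q. fst bK q > 0} \<and>
    (\<forall>d\<in>indices A. times_diff_on 1 (\<lambda>z. fst bK (chart_inv A d z)) (chart_image A d))"
    using bump_exists[OF c] by simp
  from choice[OF this] obtain bK where bK: "\<And>p. compact (snd (bK p)) \<and> snd (bK p) \<subseteq> patch A (c p) \<and> (\<forall>q. fst (bK p) q \<ge> (0::real)) \<and> (\<forall>q. q \<notin> snd (bK p) \<longrightarrow> fst (bK p) q = 0) \<and>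
    p \<in> {q. fst (bK p) q > 0} \<and> open {q. fst (bK p) q > 0} \<and>
    (\<forall>d\<in>indices A. times_diff_on 1 (\<lambda>z. fst (bK p) (chart_inv A d z)) (chart_image A d))" by blast
  define b where "b p = fst (bK p)" for p
  define K where "K p = snd (bK p)" for p
  have K: "compact (K p)" "K p \<subseteq> patch A (c p)" and b0: "b p q \<ge> 0" and bK0: "q \<notin> K p \<Longrightarrow> b p q = 0"
    and bp: "b p p > 0" and bo: "open {q. b p q > 0}"
    and bs: "d \<in> indices A \<Longrightarrow> times_diff_on 1 (\<lambda>z. b p (chart_inv A d z)) (chart_image A d)" for p q d
    using bK[of p] by (auto simp: b_def K_def)
  have "UNIV \<subseteq> (\<Union>p\<in>UNIV. {q. b p q > 0})" using bp by auto
  from compactE_image[OF compact _ this] bo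
  obtain L0 where L0: "finite L0" "UNIV \<subseteq> (\<Union>p\<in>L0. {q. b p q > 0})" by auto
  \<comment> \<open>The finite subcover need not use the bump around \<open>p0\<close>, so it is
    added.\<close>
  define L where "L = insert p0 L0"
  define s where "s q = (\<Sum>p\<in>L. b p q)" for q
  have L: "finite L" using L0 by (simp add: L_def)
  have s: "s q > 0" for q
  proof -
    obtain p where p: "p \<in> L" "b p q > 0" using L0(2) by (auto simp: L_def)
    have "b p q \<le> s q" unfolding s_def by (rule member_le_sum) (use p L b0 in auto)
    with p show ?thesis by simp
  qed
  show ?thesis
  proof (rule that[of L c "\<lambda>p q. b p q / s q" K])
    show "b p0 p0 / s p0 > 0" using bp s by simp
    show "(\<Sum>p\<in>L. b p q / s q) = 1" for q
      using s[of q] unfolding sum_divide_distrib[symmetric] s_def[symmetric] by simp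
    show "times_diff_on 1 (\<lambda>z. b p (chart_inv A d z) / s (chart_inv A d z)) (chart_image A d)" if "d \<in> indices A" for p d
    proof -
      have o: "open (chart_image A d)" by (rule open_chart_image[OF that])
      have "times_diff_on 1 (\<lambda>z. s (chart_inv A d z)) (chart_image A d)"
        unfolding s_def by (rule times_diff_on_sum[OF o bs[OF that]])
      from times_diff_on_inverse[OF o this]
      have "times_diff_on 1 (\<lambda>z. inverse (s (chart_inv A d z))) (chart_image A d)" using s by (metis less_irrefl)
      from bounded_bilinear.times_diff_on[OF bounded_bilinear_mult o bs[OF that] this]
      show ?thesis by (simp only: divide_inverse)
    qed
  qed (use L c K b0 bK0 s in \<open>auto simp: L_def c_def less_imp_le\<close>)
qed

text \<open>For a partition of unity $\rho_p$ supported in charts, $\int \rho_p \operatorname{div} X =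
  - \int X \rho_p$ by integration by parts in one chart. Integrals over \<open>M\<close> are avoided: each
  $\int X \rho_p$ is split by $1 = \sum_y \rho_y$ and its parts are moved to the chart of \<open>y\<close>, where
  $\sum_p X \rho_p = 0$.\<close>

theorem divergence_theorem:
  fixes vl :: "'i \<Rightarrow> complex^'n \<Rightarrow> real" and X :: "'i \<Rightarrow> complex^'n \<Rightarrow> complex^'n"
  assumes vl: "\<And>c. c \<in> indices A \<Longrightarrow> smooth_on (vl c) (chart_image A c)"
    and vl_pos: "\<And>c z. c \<in> indices A \<Longrightarrow> z \<in> chart_image A c \<Longrightarrow> vl c z > 0"
    and vl_transition: "\<And>c d z. c \<in> indices A \<Longrightarrow> d \<in> indices A \<Longrightarrow> z \<in> overlap A c d \<Longrightarrow>
      vl c z = \<bar>real_det (\<lambda>v. dd v (transition A c d) z)\<bar> * vl d (transition A c d z)"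
    and X: "\<And>c. c \<in> indices A \<Longrightarrow> smooth_on (X c) (chart_image A c)"
    and X_transition: "\<And>c d z. c \<in> indices A \<Longrightarrow> d \<in> indices A \<Longrightarrow> z \<in> overlap A c d \<Longrightarrow>
      X d (transition A c d z) = dd (X c z) (transition A c d) z"
    and q: "\<And>c. c \<in> indices A \<Longrightarrow> continuous_on (chart_image A c) (q c)"
      "\<And>c z. c \<in> indices A \<Longrightarrow> z \<in> chart_image A c \<Longrightarrow> q c z \<ge> 0"
    and div: "\<And>c z. c \<in> indices A \<Longrightarrow> z \<in> chart_image A c \<Longrightarrow>
      rdiv (\<lambda>z. vl c z *\<^sub>R X c z) z = vl c z * q c z"
    and c0: "c0 \<in> indices A" and z0: "z0 \<in> chart_image A c0"
  shows "q c0 z0 = 0"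
proof -
  define p0 where "p0 = chart_inv A c0 z0"
  have p0: "p0 \<in> patch A c0" by (simp add: p0_def chart_inv_in c0 z0)
  obtain L c K \<rho> where L: "finite L" "p0 \<in> L" and cp0: "c p0 = c0" and \<rho>0: "\<rho> p0 p0 > (0::real)"
    and c: "\<And>p. p \<in> L \<Longrightarrow> c p \<in> indices A" and K: "\<And>p. p \<in> L \<Longrightarrow> compact (K p)" "\<And>p. p \<in> L \<Longrightarrow> K p \<subseteq> patch A (c p)"
    and \<rho>: "\<And>p q. p \<in> L \<Longrightarrow> \<rho> p q \<ge> 0" and \<rho>K: "\<And>p q. p \<in> L \<Longrightarrow> q \<notin> K p \<Longrightarrow> \<rho> p q = 0"
    and \<rho>_diff: "\<And>p d. p \<in> L \<Longrightarrow> d \<in> indices A \<Longrightarrow> times_diff_on 1 (\<lambda>z. \<rho> p (chart_inv A d z)) (chart_image A d)"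
    and \<rho>_sum: "\<And>q. (\<Sum>p\<in>L. \<rho> p q) = 1"
    by (rule partition_of_unity[OF c0 p0]) blast
  let ?U = "chart_image A" and ?\<psi> = "chart_inv A"
  \<comment> \<open>The derivative of the p-th partition function along the field, in chart
    \<open>d\<close>. By \<open>w_transition\<close> it is a function on the manifold.\<close>
  define w where "w d p z = dd (X d z) (\<lambda>z. \<rho> p (?\<psi> d z)) z" for d p z
  have \<rho>_d: "(\<lambda>z. \<rho> p (?\<psi> d z)) differentiable at z" if "p \<in> L" "d \<in> indices A" "z \<in> ?U d" for p d z
    using \<rho>_diff[OF that(1,2)] that(3) by (simp add: times_diff_on_Suc)
  have \<rho>_cont: "continuous_on (?U d) (\<lambda>z. \<rho> p (?\<psi> d z))" if "p \<in> L" "d \<in> indices A" for p d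
    using times_diff_on_SucD[of 0] \<rho>_diff[OF that] by simp
  have vl_cont: "continuous_on (?U d) (vl d)" if "d \<in> indices A" for d
    by (rule smooth_on_continuous_on[OF vl[OF that]])
  have w_cont: "continuous_on (?U d) (w d p)" if "p \<in> L" "d \<in> indices A" for p d
  proof -
    have D: "continuous_on (?U d) (dd e (\<lambda>z. \<rho> p (?\<psi> d z)))" for e
      using \<rho>_diff[OF that] by (simp add: times_diff_on_Suc)
    have "continuous_on (?U d) (\<lambda>z. \<Sum>\<beta>\<in>UNIV. Re (X d z $ \<beta>) *\<^sub>R dd (axis \<beta> 1) (\<lambda>z. \<rho> p (?\<psi> d z)) z
        + Im (X d z $ \<beta>) *\<^sub>R dd (axis \<beta> \<i>) (\<lambda>z. \<rho> p (?\<psi> d z)) z)"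
      by (intro continuous_intros D smooth_on_continuous_on[OF X[OF that(2)]])
    then show ?thesis
    proof (rule continuous_on_eq)
      fix z assume "z \<in> ?U d"
      from dd_expand[OF \<rho>_d[OF that this], of "X d z", symmetric]
      show "(\<Sum>\<beta>\<in>UNIV. Re (X d z $ \<beta>) *\<^sub>R dd (axis \<beta> 1) (\<lambda>z. \<rho> p (?\<psi> d z)) z
        + Im (X d z $ \<beta>) *\<^sub>R dd (axis \<beta> \<i>) (\<lambda>z. \<rho> p (?\<psi> d z)) z) = w d p z"
        unfolding w_def .
    qed
  qed
  have w_zero: "w d p z = 0" if "p \<in> L" "d \<in> indices A" "z \<in> ?U d" "?\<psi> d z \<notin> K p" for p d z
  proof -
    have "w d p z = dd (X d z) (\<lambda>_. 0) z"
      unfolding w_def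
    proof (rule dd_cong)
      show "open {z \<in> ?U d. ?\<psi> d z \<in> - K p}"
        by (rule open_vimage_chart_inv[OF that(2)]) (simp add: K(1)[OF that(1)] compact_imp_closed open_Compl)
      show "z \<in> {z \<in> ?U d. ?\<psi> d z \<in> - K p}" using that(3,4) by blast
      show "\<rho> p (?\<psi> d y) = 0" if "y \<in> {z \<in> ?U d. ?\<psi> d z \<in> - K p}" for y
        using that by (intro \<rho>K[OF \<open>p \<in> L\<close>]) blast
    qed
    then show ?thesis by (simp add: dd_const)
  qed
  have w_sum: "(\<Sum>p\<in>L. w d p z) = 0" if "d \<in> indices A" "z \<in> ?U d" for d z
  proof -
    have "(\<Sum>p\<in>L. w d p z) = dd (X d z) (\<lambda>z. \<Sum>p\<in>L. \<rho> p (?\<psi> d z)) z"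
      unfolding w_def by (rule dd_sum[symmetric]) (rule \<rho>_d[OF _ that])
    then show ?thesis by (simp add: \<rho>_sum dd_const)
  qed
  have w_transition: "w e p (transition A d e z) = w d p z"
    if "p \<in> L" "d \<in> indices A" "e \<in> indices A" "z \<in> overlap A d e" for p d e z
  proof -
    have "w d p z = dd (X d z) (\<lambda>z. \<rho> p (?\<psi> e (transition A d e z))) z"
      unfolding w_def
      by (rule dd_cong[OF open_overlap[OF that(2,3)] that(4)]) (simp add: chart_inv_transition[OF that(2,3)])
    also have "\<dots> = w e p (transition A d e z)"
      unfolding w_def X_transition[OF that(2-4)]
      by (rule dd_compose[OF differentiable_transition[OF that(2-4)] \<rho>_d[OF that(1,3) transition_in(2)[OF that(2-4)]]])
    finally show ?thesis by simp
  qed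
  define I where "I p f = extend0 (?U (c p)) f" for p and f :: "complex^'n \<Rightarrow> real"
  have cc: "ccont (I p f)"
    if "p \<in> L" "continuous_on (?U (c p)) f" "\<And>z. z \<in> ?U (c p) \<Longrightarrow> ?\<psi> (c p) z \<notin> K p \<Longrightarrow> f z = 0" for p f
    unfolding I_def
    by (rule ccont_extend0[OF open_chart_image that(2) compact_chart(1)[OF _ K] compact_chart(2)[OF _ K]])
      (use c that compact_chart(3)[OF _ K] in auto)
  \<comment> \<open>\<open>S1 p\<close> is the integral of the divergence weighted with the p-th
    partition function, \<open>S2 p\<close> that of the derivative of this function along the field;
    they cancel by integration by parts in the chart of \<open>p\<close>.\<close>
  define S1 where "S1 p = cint (I p (\<lambda>z. \<rho> p (?\<psi> (c p) z) * (vl (c p) z * q (c p) z)))" for p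
  define S2 where "S2 p = cint (I p (\<lambda>z. vl (c p) z * w (c p) p z))" for p
  have cc1: "ccont (I p (\<lambda>z. \<rho> p (?\<psi> (c p) z) * (vl (c p) z * q (c p) z)))" if "p \<in> L" for p
    by (rule cc[OF that]) (use that in \<open>auto intro!: continuous_intros \<rho>_cont vl_cont q c simp: \<rho>K\<close>)
  have cc2: "ccont (I p (\<lambda>z. vl (c p) z * w (c p) p z))" if "p \<in> L" for p
    by (rule cc[OF that]) (use that in \<open>auto intro!: continuous_intros w_cont vl_cont c simp: w_zero c\<close>)
  have S12: "S1 p + S2 p = 0" if p: "p \<in> L" for p
  proof -
    let ?c = "c p"
    let ?Y = "\<lambda>z. vl ?c z *\<^sub>R X ?c z"
    define G where "G = extend0 (?U ?c) (\<lambda>z. \<rho> p (?\<psi> ?c z) *\<^sub>R ?Y z)"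
    note o = open_chart_image[OF c[OF p]]
    note KK = compact_chart[OF c[OF p] K(1)[OF p] K(2)[OF p]]
    have sY: "smooth_on ?Y (?U ?c)" by (intro smooth_intros o vl X c p)
    have G: "times_diff_on 1 G UNIV"
      unfolding G_def
    proof (rule times_diff_on_extend0[OF o _ KK(1,2)])
      show "times_diff_on 1 (\<lambda>z. \<rho> p (?\<psi> ?c z) *\<^sub>R ?Y z) (?U ?c)"
        by (rule bounded_bilinear.times_diff_on[OF bounded_bilinear_scaleR o \<rho>_diff[OF p c[OF p]]])
          (use sY in \<open>simp add: smooth_on_def\<close>)
    qed (use KK(3) \<rho>K[OF p] in auto)
    have G0: "G z = 0" if "z \<notin> chart A ?c ` K p" for z
      using that KK(3)[of z] \<rho>K[OF p] by (auto simp: G_def extend0_def)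
    have rG: "rdiv G z = I p (\<lambda>z. \<rho> p (?\<psi> ?c z) * (vl ?c z * q ?c z)) z + I p (\<lambda>z. vl ?c z * w ?c p z) z" for z
    proof (cases "z \<in> ?U ?c")
      case True
      have dY: "?Y differentiable at z" by (rule smooth_on_differentiable[OF sY True])
      have "rdiv G z = rdiv (\<lambda>z. \<rho> p (?\<psi> ?c z) *\<^sub>R ?Y z) z"
        by (rule rdiv_cong[OF o True]) (simp add: G_def extend0_def)
      also have "\<dots> = \<rho> p (?\<psi> ?c z) * rdiv ?Y z + dd (?Y z) (\<lambda>z. \<rho> p (?\<psi> ?c z)) z"
        by (rule rdiv_scaleR[OF \<rho>_d[OF p c[OF p] True] dY])
      also have "dd (?Y z) (\<lambda>z. \<rho> p (?\<psi> ?c z)) z = vl ?c z * w ?c p z"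
        by (simp add: dd_scaleR_dir[OF \<rho>_d[OF p c[OF p] True]] w_def)
      finally show ?thesis using True by (simp add: I_def extend0_def div[OF c[OF p] True])
    next
      case False
      have "rdiv G z = rdiv (\<lambda>_. 0) z"
        by (rule rdiv_cong[of "- chart A ?c ` K p"])
          (use KK(1,2) False G0 in \<open>auto simp: compact_imp_closed open_Compl\<close>)
      then show ?thesis using False by (simp add: I_def extend0_def rdiv_def dd_const)
    qed
    have "cint (rdiv G) = S1 p + S2 p"
      unfolding S1_def S2_def cint_add[OF cc1[OF p] cc2[OF p], symmetric] by (rule arg_cong[of _ _ cint]) (rule ext, rule rG)
    with cint_rdiv[OF G KK(1) G0] show ?thesis by simp
  qed
  have S1_nonneg: "I p (\<lambda>z. \<rho> p (?\<psi> (c p) z) * (vl (c p) z * q (c p) z)) z \<ge> 0" if "p \<in> L" for p z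
    using that c[OF that] by (auto simp: I_def extend0_def intro!: mult_nonneg_nonneg \<rho> q less_imp_le[OF vl_pos])
  \<comment> \<open>Summed over \<open>y\<close> these terms give the integrand of
    \<open>S2 p\<close>; summed over \<open>p\<close> in a fixed chart they cancel by
    \<open>w_sum\<close>.\<close>
  define T where "T p y d = (\<lambda>z. \<rho> y (?\<psi> d z) * (vl d z * w d p z))" for p y d
  have T0: "T p y d z = 0" if "p \<in> L" "y \<in> L" "d \<in> indices A" "z \<in> ?U d" "?\<psi> d z \<notin> K p \<inter> K y" for p y d z
    using that \<rho>K w_zero by (auto simp: T_def)
  have T_cont: "continuous_on (?U d) (T p y d)" if "p \<in> L" "y \<in> L" "d \<in> indices A" for p y d
    unfolding T_def by (intro continuous_intros \<rho>_cont w_cont vl_cont that)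
  have ccT: "ccont (I x (T p y (c x)))" if "p \<in> L" "y \<in> L" "x = p \<or> x = y" for p y x
    by (rule cc[OF _ T_cont[OF that(1,2)] T0[OF that(1,2)]]) (use that c in auto)
  \<comment> \<open>The integrand is supported in \<open>K p \<inter> K y\<close>, inside the
    overlap of both charts, so both integrals live on the domain of one transition map.\<close>
  have swap: "cint (I p (T p y (c p))) = cint (I y (T p y (c y)))" if p: "p \<in> L" and y: "y \<in> L" for p y
  proof (rule cint_change_of_variables[where S = "overlap A (c p) (c y)" and \<tau> = "transition A (c p) (c y)"
        and D = "\<lambda>z v. dd v (transition A (c p) (c y)) z"])
    note cd = c[OF p] c[OF y]
    show "open (overlap A (c p) (c y))" by (rule open_overlap[OF cd])
    show "(transition A (c p) (c y) has_derivative (\<lambda>v. dd v (transition A (c p) (c y)) z)) (at z)"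
      if "z \<in> overlap A (c p) (c y)" for z
      by (rule has_derivative_dd[OF differentiable_transition[OF cd that]])
    show "inj_on (transition A (c p) (c y)) (overlap A (c p) (c y))" by (rule inj_on_transition[OF cd])
    show "ccont (I y (T p y (c y)))" "ccont (I p (T p y (c p)))" using ccT p y by auto
    show "I y (T p y (c y)) z = 0" if "z \<notin> transition A (c p) (c y) ` overlap A (c p) (c y)" for z
    proof (cases "z \<in> ?U (c y)")
      case True
      with that have "?\<psi> (c y) z \<notin> patch A (c p)" unfolding transition_image[OF cd] overlap_iff[OF cd(2)] by blast
      then have "T p y (c y) z = 0" using K(2)[OF p] by (intro T0 p y cd True) auto
      then show ?thesis by (simp add: I_def extend0_def)
    qed (simp add: I_def extend0_def)
    show "I p (T p y (c p)) z = 0" if "z \<notin> overlap A (c p) (c y)" for z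
    proof (cases "z \<in> ?U (c p)")
      case True
      with that have "?\<psi> (c p) z \<notin> patch A (c y)" unfolding overlap_iff[OF cd(1)] by blast
      then have "T p y (c p) z = 0" using K(2)[OF y] by (intro T0 p y cd True) auto
      then show ?thesis by (simp add: I_def extend0_def)
    qed (simp add: I_def extend0_def)
    show "I p (T p y (c p)) z = \<bar>real_det (\<lambda>v. dd v (transition A (c p) (c y)) z)\<bar> * I y (T p y (c y)) (transition A (c p) (c y) z)"
      if z: "z \<in> overlap A (c p) (c y)" for z
    proof -
      have "z \<in> ?U (c p)" using overlap_subset[OF cd(1)] z by blast
      then show ?thesis
        by (simp add: I_def extend0_def transition_in(2)[OF cd z] T_def chart_inv_transition[OF cd z]
            w_transition[OF p cd z] vl_transition[OF cd z] mult_ac)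
    qed
  qed
  have "(\<Sum>p\<in>L. S2 p) = (\<Sum>p\<in>L. \<Sum>y\<in>L. cint (I p (T p y (c p))))"
  proof (rule sum.cong[OF refl])
    fix p assume p: "p \<in> L"
    have "(\<Sum>y\<in>L. T p y (c p) z) = vl (c p) z * w (c p) p z" for z
      unfolding T_def sum_distrib_right[symmetric] \<rho>_sum by simp
    then have "I p (\<lambda>z. vl (c p) z * w (c p) p z) z = (\<Sum>y\<in>L. I p (T p y (c p)) z)" for z
      by (simp add: I_def extend0_def)
    then have "I p (\<lambda>z. vl (c p) z * w (c p) p z) = (\<lambda>z. \<Sum>y\<in>L. I p (T p y (c p)) z)" by (rule ext)
    then show "S2 p = (\<Sum>y\<in>L. cint (I p (T p y (c p))))"
      unfolding S2_def using cint_sum[of L "\<lambda>y. I p (T p y (c p))"] ccT[OF p] by simp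
  qed
  also have "\<dots> = (\<Sum>p\<in>L. \<Sum>y\<in>L. cint (I y (T p y (c y))))"
    by (rule sum.cong[OF refl], rule sum.cong[OF refl], rule swap)
  also have "\<dots> = (\<Sum>y\<in>L. \<Sum>p\<in>L. cint (I y (T p y (c y))))" by (rule sum.swap)
  also have "\<dots> = (\<Sum>y\<in>L. 0)"
  proof (rule sum.cong[OF refl])
    fix y assume y: "y \<in> L"
    have "(\<Sum>p\<in>L. T p y (c y) z) = 0" if "z \<in> ?U (c y)" for z
      unfolding T_def sum_distrib_left[symmetric] w_sum[OF c[OF y] that] by simp
    then have "(\<Sum>p\<in>L. I y (T p y (c y)) z) = 0" for z
      by (cases "z \<in> ?U (c y)") (simp_all add: I_def extend0_def)
    then have "(\<lambda>z. \<Sum>p\<in>L. I y (T p y (c y)) z) = (\<lambda>z. 0)" by (rule ext)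
    moreover have "cint (\<lambda>z. \<Sum>p\<in>L. I y (T p y (c y)) z) = (\<Sum>p\<in>L. cint (I y (T p y (c y))))"
      by (rule cint_sum) (rule ccT[OF _ y], auto)
    ultimately show "(\<Sum>p\<in>L. cint (I y (T p y (c y)))) = 0" by (simp add: cint_def)
  qed
  finally have "(\<Sum>p\<in>L. S2 p) = 0" by simp
  moreover have "(\<Sum>p\<in>L. S1 p) + (\<Sum>p\<in>L. S2 p) = 0"
    unfolding sum.distrib[symmetric] using S12 by (intro sum.neutral ballI)
  ultimately have "(\<Sum>p\<in>L. S1 p) = 0" by simp
  moreover have "S1 p \<ge> 0" if "p \<in> L" for p unfolding S1_def by (rule cint_nonneg) (rule S1_nonneg[OF that])
  \<comment> \<open>A vanishing sum of non-negative integrals. The member at \<open>p0\<close> is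
    positive at the point in question and leaves only \<open>q\<close> to vanish there.\<close>
  ultimately have "S1 p0 = 0" using sum_nonneg_eq_0_iff[OF L(1), of S1] L(2) by blast
  from cint_zero_imp[OF cc1[OF L(2)] S1_nonneg[OF L(2)] this[unfolded S1_def], of z0]
  have "\<rho> p0 (?\<psi> c0 z0) * (vl c0 z0 * q c0 z0) = 0" using z0 by (simp add: I_def extend0_def cp0)
  then show ?thesis using \<rho>0 vl_pos[OF c0 z0] by (simp add: p0_def)
qed

end

section \<open>Change of charts\<close>

text \<open>Reduces the complex bilinear form to real inner products, so that equality of the pulled
  back real metrics suffices for comparing charts.\<close>

lemma bil_Complex:
  "bil M (\<chi> k. Complex (a $ k) (b $ k)) (\<chi> k. Complex (a' $ k) (b' $ k)) =
    Complex (a \<bullet> (M *v a') - b \<bullet> (M *v b')) (a \<bullet> (M *v b') + b \<bullet> (M *v a'))"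
  by (simp add: bil_def inner_vec_def matrix_vector_mult_def complex_eq_iff sum_distrib_left
      sum_subtractf[symmetric] sum.distrib[symmetric] algebra_simps)

lemma (in map_chart) cpush_eq:
  "z \<in> S \<Longrightarrow> cpush F X z = (\<chi> k. Complex (dd (fst X) F z $ k) (dd (snd X) F z $ k))"
  by (simp add: vec_eq_iff cpush_nth complex_eq_iff)

lemma cdd_ahol_cholo:
  assumes "cholo f V" "z \<in> V"
  shows "cdd (ahol e) f z = 0"
proof -
  have "f differentiable at z" "dd (\<i> *s e) f z = \<i> * dd e f z" using assms by (auto simp: cholo_def)
  then show ?thesis by (simp add: cdd_ahol mult.assoc[symmetric])
qed

context hermitian_chart
begin

lemma hermitian_form_left_cancel:
  assumes "z \<in> U" "\<And>v. hermitian_form (H z) v x = hermitian_form (H z) v y"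
  shows "x = y"
proof (rule ccontr)
  assume "x \<noteq> y"
  then have "Re (hermitian_form (H z) (x - y) (x - y)) > 0" by (intro pos_H assms(1)) simp
  moreover have "hermitian_form (H z) (x - y) x = hermitian_form (H z) (x - y) (x - y) + hermitian_form (H z) (x - y) y"
    unfolding hermitian_form_add(2)[symmetric] by simp
  ultimately show False using assms(2)[of "x - y"] by simp
qed

end

text \<open>\<open>hdiv\<close> is the trace over a unitary frame of the antiholomorphic derivatives of \<open>pform\<close>.
  This is independent of the chart because the Jacobian of a transition map is holomorphic.\<close>

context harmonic_chart
begin

definition pform :: "complex^'n \<Rightarrow> complex^'n \<Rightarrow> complex^'n \<Rightarrow> complex" where
  "pform u v z = bil (K (F z)) (cpush F (hol u) z) (cpush F (hol v) z)"

lemma pform_expand: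
  "z \<in> U \<Longrightarrow> pform u v z = (\<Sum>\<alpha>\<in>UNIV. \<Sum>\<mu>\<in>UNIV. u $ \<alpha> * v $ \<mu> * hopf \<alpha> \<mu> z)"
  unfolding pform_def cpush_hol bil_sum bil_scale hopf_def by (subst sum.swap) (simp add: sum_distrib_left mult_ac)

lemma cdd_pform:
  assumes z: "z \<in> U"
  shows "cdd X (pform u v) z = (\<Sum>\<alpha>\<in>UNIV. \<Sum>\<mu>\<in>UNIV. u $ \<alpha> * v $ \<mu> * cdd X (hopf \<alpha> \<mu>) z)"
proof -
  have d: "hopf \<alpha> \<mu> differentiable at z" for \<alpha> \<mu> by (rule smooth_on_differentiable[OF smooth_hopf z])
  have "cdd X (pform u v) z = cdd X (\<lambda>z. \<Sum>\<alpha>\<in>UNIV. \<Sum>\<mu>\<in>UNIV. u $ \<alpha> * v $ \<mu> * hopf \<alpha> \<mu> z) z"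
    by (rule cdd_cong[OF open_U z pform_expand])
  then show ?thesis by (simp add: cdd_sum cdd_mult d)
qed

lemma hdiv_frame:
  fixes e :: "'n \<Rightarrow> complex^'n"
  assumes z: "z \<in> U" and e: "\<And>a b. hermitian_form (H z) (e a) (e b) = (if a = b then 1 else 0)"
  shows "(\<Sum>\<alpha>\<in>UNIV. v $ \<alpha> * hdiv \<alpha> z) = (\<Sum>a\<in>UNIV. cdd (ahol (e a)) (pform v (e a)) z)"
proof -
  have d: "hopf \<alpha> \<mu> differentiable at z" for \<alpha> \<mu> by (rule smooth_on_differentiable[OF smooth_hopf z])
  have "(\<Sum>\<alpha>\<in>UNIV. v $ \<alpha> * hdiv \<alpha> z) =
      (\<Sum>\<alpha>\<in>UNIV. \<Sum>\<mu>\<in>UNIV. \<Sum>\<nu>\<in>UNIV. \<Sum>a\<in>UNIV. v $ \<alpha> * e a $ \<mu> * cnj (e a $ \<nu>) * dzb \<nu> (hopf \<alpha> \<mu>) z)"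
    unfolding hdiv_def hinv_frame[OF e] by (simp add: sum_distrib_left sum_distrib_right mult.assoc)
  also have "\<dots> = (\<Sum>a\<in>UNIV. \<Sum>\<alpha>\<in>UNIV. \<Sum>\<mu>\<in>UNIV. \<Sum>\<nu>\<in>UNIV. v $ \<alpha> * e a $ \<mu> * cnj (e a $ \<nu>) * dzb \<nu> (hopf \<alpha> \<mu>) z)"
    unfolding sum.cartesian_product
    by (rule sum.reindex_bij_witness[where i = "\<lambda>(a, \<alpha>, \<mu>, \<nu>). (\<alpha>, \<mu>, \<nu>, a)" and j = "\<lambda>(\<alpha>, \<mu>, \<nu>, a). (a, \<alpha>, \<mu>, \<nu>)"]) auto
  also have "\<dots> = (\<Sum>a\<in>UNIV. cdd (ahol (e a)) (pform v (e a)) z)"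
  proof (rule sum.cong[OF refl])
    fix a
    show "(\<Sum>\<alpha>\<in>UNIV. \<Sum>\<mu>\<in>UNIV. \<Sum>\<nu>\<in>UNIV. v $ \<alpha> * e a $ \<mu> * cnj (e a $ \<nu>) * dzb \<nu> (hopf \<alpha> \<mu>) z) =
        cdd (ahol (e a)) (pform v (e a)) z"
      unfolding cdd_pform[OF z] cdd_hol_expand(2)[OF d, where u = "e a"] by (simp add: sum_distrib_left mult.assoc)
  qed
  finally show ?thesis .
qed

text \<open>Characterises \<open>hfield\<close> as half the Hermitian dual of the 1-form
  \<open>hdiv\<close>, a description that can be compared between charts.\<close>

lemma hermitian_form_hfield:
  assumes z: "z \<in> U"
  shows "hermitian_form (H z) v (hfield z) = (\<Sum>\<alpha>\<in>UNIV. v $ \<alpha> * hdiv \<alpha> z) / 2"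
proof -
  have "hermitian_form (H z) v (hfield z) =
      (\<Sum>\<alpha>\<in>UNIV. \<Sum>\<beta>\<in>UNIV. H z $ \<alpha> $ \<beta> * v $ \<alpha> * (\<Sum>\<kappa>\<in>UNIV. hinv \<kappa> \<beta> z * hdiv \<kappa> z) / 2)"
    by (simp add: hermitian_form_def hfield_def)
  also have "\<dots> = (\<Sum>\<alpha>\<in>UNIV. \<Sum>\<beta>\<in>UNIV. \<Sum>\<kappa>\<in>UNIV. (v $ \<alpha> * hdiv \<kappa> z / 2) * (H z $ \<alpha> $ \<beta> * hinv \<kappa> \<beta> z))"
    by (simp add: sum_distrib_left sum_divide_distrib mult_ac)
  also have "\<dots> = (\<Sum>\<alpha>\<in>UNIV. \<Sum>\<kappa>\<in>UNIV. \<Sum>\<beta>\<in>UNIV. (v $ \<alpha> * hdiv \<kappa> z / 2) * (H z $ \<alpha> $ \<beta> * hinv \<kappa> \<beta> z))"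
    by (rule sum.cong[OF refl], rule sum.swap)
  also have "\<dots> = (\<Sum>\<alpha>\<in>UNIV. \<Sum>\<kappa>\<in>UNIV. (v $ \<alpha> * hdiv \<kappa> z / 2) * (if \<alpha> = \<kappa> then 1 else 0))"
    unfolding sum_distrib_left[symmetric] hinv_left(1)[OF z] ..
  also have "\<dots> = (\<Sum>\<alpha>\<in>UNIV. v $ \<alpha> * hdiv \<alpha> z) / 2"
    by (simp add: sum_divide_distrib if_distrib[of "\<lambda>x. _ * x"] cong: if_cong)
  finally show ?thesis .
qed

end

text \<open>Two chart representations of one map and a holomorphic change of coordinates between
  them. The target enters only through the pulled back metric, so its charts may differ as
  well.\<close>

locale chart_change =
  C: harmonic_chart U H T K F + C': harmonic_chart U' H' T' K' F'
  for U :: "(complex^'n) set" and H and T :: "(real^'d) set" and K and F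
    and U' :: "(complex^'n) set" and H' and T' :: "(real^'d) set" and K' and F' +
  fixes V :: "(complex^'n) set" and \<tau> :: "complex^'n \<Rightarrow> complex^'n"
  assumes open_V: "open V" and V_subset: "V \<subseteq> U" and \<tau>_in: "\<And>z. z \<in> V \<Longrightarrow> \<tau> z \<in> U'"
    and smooth_\<tau>: "smooth_on \<tau> V" and cholo_dd_\<tau>: "\<And>v k. cholo (\<lambda>z. dd v \<tau> z $ k) V"
    and dd_\<tau>_scale: "\<And>v z. z \<in> V \<Longrightarrow> dd (\<i> *s v) \<tau> z = \<i> *s dd v \<tau> z"
    and surj_\<tau>: "\<And>z. z \<in> V \<Longrightarrow> surj (\<lambda>v. dd v \<tau> z)"
    and isometry: "\<And>z u v. z \<in> V \<Longrightarrow>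
      hermitian_form (H z) u v = hermitian_form (H' (\<tau> z)) (dd u \<tau> z) (dd v \<tau> z)"
    and pullback: "\<And>z u v. z \<in> V \<Longrightarrow>
      dd u F z \<bullet> (K (F z) *v dd v F z) = dd (dd u \<tau> z) F' (\<tau> z) \<bullet> (K' (F' (\<tau> z)) *v dd (dd v \<tau> z) F' (\<tau> z))"
begin

lemma differentiable_\<tau>: "z \<in> V \<Longrightarrow> \<tau> differentiable at z"
  by (rule smooth_on_differentiable[OF smooth_\<tau>])

lemma hol_\<tau>: "z \<in> V \<Longrightarrow> hol (dd v \<tau> z) = (dd (fst (hol v)) \<tau> z, dd (snd (hol v)) \<tau> z)"
  and ahol_\<tau>: "z \<in> V \<Longrightarrow> ahol (dd v \<tau> z) = (dd (fst (ahol v)) \<tau> z, dd (snd (ahol v)) \<tau> z)"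
  by (simp_all add: hol_def ahol_def dd_minus_dir dd_scaleR_dir differentiable_\<tau> dd_\<tau>_scale)

lemma bil_cpush:
  assumes z: "z \<in> V"
  shows "bil (K (F z)) (cpush F X z) (cpush F Y z) =
    bil (K' (F' (\<tau> z))) (cpush F' (dd (fst X) \<tau> z, dd (snd X) \<tau> z) (\<tau> z))
      (cpush F' (dd (fst Y) \<tau> z, dd (snd Y) \<tau> z) (\<tau> z))"
proof -
  have zU: "z \<in> U" "\<tau> z \<in> U'" using z V_subset \<tau>_in by auto
  show ?thesis unfolding C.cpush_eq[OF zU(1)] C'.cpush_eq[OF zU(2)] bil_Complex fst_conv snd_conv pullback[OF z] ..
qed

lemma pform_\<tau>: "z \<in> V \<Longrightarrow> C.pform u v z = C'.pform (dd u \<tau> z) (dd v \<tau> z) (\<tau> z)"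
  unfolding C.pform_def C'.pform_def by (simp add: hol_\<tau> bil_cpush[of z "hol u" "hol v"])

lemma energy_\<tau>:
  assumes z: "z \<in> V"
  shows "bil (K (F z)) (cpush F (hol v) z) (cnj_vec (cpush F (hol v) z)) =
    bil (K' (F' (\<tau> z))) (cpush F' (hol (dd v \<tau> z)) (\<tau> z)) (cnj_vec (cpush F' (hol (dd v \<tau> z)) (\<tau> z)))"
proof -
  have zU: "z \<in> U" "\<tau> z \<in> U'" using z V_subset \<tau>_in by auto
  show ?thesis
    unfolding C.cnj_cpush[OF zU(1)] C'.cnj_cpush[OF zU(2)] cnj_dir_hol
    unfolding hol_\<tau>[OF z] ahol_\<tau>[OF z] by (rule bil_cpush[OF z])
qed

lemma cdd_ahol_\<tau>:
  assumes z: "z \<in> V" and \<phi>: "\<phi> differentiable at (\<tau> z)"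
  shows "cdd (ahol e) (\<lambda>y. \<phi> (\<tau> y)) z = cdd (ahol (dd e \<tau> z)) \<phi> (\<tau> z)"
  unfolding ahol_\<tau>[OF z] cdd_def fst_conv snd_conv dd_compose[OF differentiable_\<tau>[OF z] \<phi>] ..

lemma cdd_pform_\<tau>:
  assumes z: "z \<in> V"
  shows "cdd (ahol e) (C.pform u v) z = cdd (ahol (dd e \<tau> z)) (C'.pform (dd u \<tau> z) (dd v \<tau> z)) (\<tau> z)"
proof -
  let ?X = "ahol e"
  have d: "C'.hopf \<alpha> \<mu> differentiable at (\<tau> z)" for \<alpha> \<mu>
    by (rule smooth_on_differentiable[OF C'.smooth_hopf \<tau>_in[OF z]])
  have d\<tau>: "(\<lambda>y. C'.hopf \<alpha> \<mu> (\<tau> y)) differentiable at z" for \<alpha> \<mu>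
    using differentiable_chain_at[OF differentiable_\<tau>[OF z] d] by (simp add: o_def)
  have dc: "(\<lambda>y. dd w \<tau> y $ \<alpha>) differentiable at z" for w \<alpha>
    using cholo_dd_\<tau> z unfolding cholo_def by blast
  \<comment> \<open>The transported vectors vary with the point, but holomorphically, so the
    antiholomorphic derivative passes over their components.\<close>
  have dc0: "cdd ?X (\<lambda>y. dd w \<tau> y $ \<alpha>) z = 0" for w \<alpha>
    by (rule cdd_ahol_cholo[OF cholo_dd_\<tau> z])
  have "cdd ?X (C.pform u v) z =
      cdd ?X (\<lambda>y. \<Sum>\<alpha>\<in>UNIV. \<Sum>\<mu>\<in>UNIV. (dd u \<tau> y $ \<alpha> * dd v \<tau> y $ \<mu>) * C'.hopf \<alpha> \<mu> (\<tau> y)) z"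
    by (rule cdd_cong[OF open_V z]) (simp add: pform_\<tau> C'.pform_expand \<tau>_in)
  also have "\<dots> = (\<Sum>\<alpha>\<in>UNIV. \<Sum>\<mu>\<in>UNIV. dd u \<tau> z $ \<alpha> * dd v \<tau> z $ \<mu> * cdd ?X (\<lambda>y. C'.hopf \<alpha> \<mu> (\<tau> y)) z)"
    by (simp add: cdd_sum cdd_mult d\<tau> dc dc0)
  finally show ?thesis unfolding C'.cdd_pform[OF \<tau>_in[OF z]] cdd_ahol_\<tau>[OF z d] .
qed

text \<open>Both sides are tested against an arbitrary vector, which is the image of some
  \<open>v\<close>. The isometry carries a unitary frame to a unitary frame, in which
  \<open>hdiv_frame\<close> expresses both pairings.\<close>

lemma hfield_\<tau>:
  assumes z: "z \<in> V"
  shows "C'.hfield (\<tau> z) = dd (C.hfield z) \<tau> z"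
proof (rule C'.hermitian_form_left_cancel[OF \<tau>_in[OF z]])
  fix w
  have zU: "z \<in> U" using z V_subset by auto
  obtain v where w: "w = dd v \<tau> z" using surj_\<tau>[OF z] by (metis surjD)
  obtain e :: "'n \<Rightarrow> complex^'n" where "\<forall>a b. hermitian_form (H z) (e a) (e b) = (if a = b then 1 else 0)"
    using C.unitary_frame[OF zU] by blast
  note e = this[rule_format]
  have e': "hermitian_form (H' (\<tau> z)) (dd (e a) \<tau> z) (dd (e b) \<tau> z) = (if a = b then 1 else 0)" for a b
    using isometry[OF z, of "e a" "e b"] e by simp
  have "hermitian_form (H' (\<tau> z)) w (C'.hfield (\<tau> z)) = (\<Sum>\<alpha>\<in>UNIV. w $ \<alpha> * C'.hdiv \<alpha> (\<tau> z)) / 2"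
    by (rule C'.hermitian_form_hfield[OF \<tau>_in[OF z]])
  also have "\<dots> = (\<Sum>\<alpha>\<in>UNIV. v $ \<alpha> * C.hdiv \<alpha> z) / 2"
    unfolding C'.hdiv_frame[OF \<tau>_in[OF z] e'] C.hdiv_frame[OF zU e] cdd_pform_\<tau>[OF z] w ..
  also have "\<dots> = hermitian_form (H z) v (C.hfield z)"
    by (rule C.hermitian_form_hfield[OF zU, symmetric])
  also have "\<dots> = hermitian_form (H' (\<tau> z)) w (dd (C.hfield z) \<tau> z)"
    unfolding w by (rule isometry[OF z])
  finally show "hermitian_form (H' (\<tau> z)) w (C'.hfield (\<tau> z)) = hermitian_form (H' (\<tau> z)) w (dd (C.hfield z) \<tau> z)" .
qed

text \<open>Determinants in the transformation law of the real metric; the square of the Jacobian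
  determinant becomes an absolute value under the root.\<close>

lemma vol_\<tau>:
  assumes z: "z \<in> V"
  shows "C.vol z = \<bar>real_det (\<lambda>v. dd v \<tau> z)\<bar> * C'.vol (\<tau> z)"
proof -
  let ?J = "matrix (\<lambda>x. realify (dd (complexify x) \<tau> z))"
  let ?G = "real_part_metric (H' (\<tau> z))"
  have "real_part_metric (H z) $ k $ l = (transpose ?J ** ?G ** ?J) $ k $ l" for k l
  proof -
    have "real_part_metric (H z) $ k $ l =
        Re (hermitian_form (H' (\<tau> z)) (complexify (realify (dd (complexify (axis k 1)) \<tau> z))) (complexify (realify (dd (complexify (axis l 1)) \<tau> z))))"
      by (simp add: real_part_metric_def isometry[OF z])
    also have "\<dots> = (\<Sum>i\<in>UNIV. \<Sum>j\<in>UNIV. ?J $ i $ k * ?G $ i $ j * ?J $ j $ l)"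
      unfolding real_part_metric_apply by (simp add: matrix_def)
    also have "\<dots> = (\<Sum>j\<in>UNIV. \<Sum>i\<in>UNIV. ?J $ i $ k * ?G $ i $ j * ?J $ j $ l)" by (rule sum.swap)
    also have "\<dots> = (transpose ?J ** ?G ** ?J) $ k $ l"
      by (simp add: matrix_matrix_mult_def transpose_def sum_distrib_right)
    finally show ?thesis .
  qed
  then have "real_part_metric (H z) = transpose ?J ** ?G ** ?J" by (simp add: vec_eq_iff)
  then have "det (real_part_metric (H z)) = (real_det (\<lambda>v. dd v \<tau> z))\<^sup>2 * det ?G"
    by (simp add: det_mul real_det_def power2_eq_square)
  then show ?thesis by (simp add: C.vol_def C'.vol_def real_sqrt_mult)
qed

end

section \<open>Harmonic maps from compact Kaehler manifolds\<close>

context harmonic_chart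
begin

lemma smooth_bochner: "smooth_on bochner U"
  unfolding bochner_def[abs_def]
  by (rule smooth_on_sum smooth_on_mult smooth_hinv smooth_on_cdd' smooth_hdiv open_U)+

lemma energy_expand:
  assumes z: "z \<in> U"
  shows "bil (K (F z)) (cpush F (hol W) z) (cnj_vec (cpush F (hol W) z)) =
    (\<Sum>\<alpha>\<in>UNIV. \<Sum>\<beta>\<in>UNIV. W $ \<alpha> * cnj (W $ \<beta>) * bil (K (F z)) (df \<alpha> z) (dfb \<beta> z))"
  unfolding cnj_cpush[OF z] cnj_dir_hol
  unfolding cpush_hol[OF z] cpush_ahol[OF z] bil_sum bil_scale
  by (subst sum.swap) (simp add: sum_distrib_left mult_ac)

text \<open>Joint continuity in point and vector, as \<open>energy_expand\<close> gives a Hermitian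
  form in \<open>W\<close> with coefficients continuous in \<open>z\<close>.\<close>

lemma continuous_energy:
  "continuous_on (U \<times> UNIV) (\<lambda>(z, W). Re (bil (K (F z)) (cpush F (hol W) z) (cnj_vec (cpush F (hol W) z))))"
proof -
  have c: "continuous_on (U \<times> (UNIV :: (complex^'n) set)) (\<lambda>p. bil (K (F (fst p))) (df \<alpha> (fst p)) (dfb \<beta> (fst p)))" for \<alpha> \<beta>
    by (rule continuous_on_compose2[OF smooth_on_continuous_on[OF smooth_bil[OF smooth_df smooth_dfb]]])
      (auto intro!: continuous_intros)
  have "continuous_on (U \<times> UNIV) (\<lambda>p. Re (\<Sum>\<alpha>\<in>UNIV. \<Sum>\<beta>\<in>UNIV. snd p $ \<alpha> * cnj (snd p $ \<beta>) * bil (K (F (fst p))) (df \<alpha> (fst p)) (dfb \<beta> (fst p))))"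
    by (intro continuous_intros c)
  then show ?thesis
    by (rule continuous_on_eq) (auto simp: energy_expand)
qed

end

lemma (in hermitian_chart) continuous_hermitian_form:
  "continuous_on (U \<times> UNIV) (\<lambda>(z, W). Re (hermitian_form (H z) W W))"
proof -
  have c: "continuous_on (U \<times> (UNIV :: (complex^'n) set)) (\<lambda>p. H (fst p) $ \<alpha> $ \<beta>)" for \<alpha> \<beta>
    by (rule continuous_on_compose2[OF smooth_on_continuous_on[OF smooth_H_entry]]) (auto intro!: continuous_intros)
  have d: "continuous_on (U \<times> (UNIV :: (complex^'n) set)) (\<lambda>p. snd p $ \<alpha>)" for \<alpha>
    by (intro continuous_intros)
  show ?thesis
    unfolding split_beta hermitian_form_def
    by (rule continuous_on_Re continuous_on_sum continuous_on_mult c d continuous_on_cnj)+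
qed

text \<open>Replaces compactness of the unit sphere bundle: finitely many compact pieces, each with
  its own coordinate expression of the same function.\<close>

lemma finite_family_attains_sup:
  fixes R :: "'a \<Rightarrow> 'b::topological_space \<Rightarrow> real"
  assumes "finite L" "\<And>p. p \<in> L \<Longrightarrow> compact (S p)" "\<And>p. p \<in> L \<Longrightarrow> continuous_on (S p) (R p)"
    and "p0 \<in> L" "S p0 \<noteq> {}"
  shows "\<exists>p\<in>L. \<exists>x\<in>S p. \<forall>q\<in>L. \<forall>y\<in>S q. R q y \<le> R p x"
proof -
  define L' where "L' = {p \<in> L. S p \<noteq> {}}"
  have "\<forall>p\<in>L'. \<exists>x. x \<in> S p \<and> (\<forall>y\<in>S p. R p y \<le> R p x)"
  proof
    fix p assume p: "p \<in> L'"
    then show "\<exists>x. x \<in> S p \<and> (\<forall>y\<in>S p. R p y \<le> R p x)"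
      using continuous_attains_sup[OF assms(2) _ assms(3), of p] by (auto simp: L'_def)
  qed
  from bchoice[OF this] obtain x where x: "\<And>p. p \<in> L' \<Longrightarrow> x p \<in> S p \<and> (\<forall>y\<in>S p. R p y \<le> R p (x p))" by blast
  have L': "finite L'" "L' \<noteq> {}" using assms by (auto simp: L'_def)
  obtain p where p: "p \<in> L'" "\<And>q. q \<in> L' \<Longrightarrow> R q (x q) \<le> R p (x p)"
    using obtains_MAX[OF L', of "\<lambda>q. R q (x q)"] Max_ge[OF finite_imageI[OF L'(1)]] by (metis imageI)
  have "R q y \<le> R p (x p)" if "q \<in> L" "y \<in> S q" for q y
  proof -
    have q: "q \<in> L'" using that by (auto simp: L'_def)
    have "R q y \<le> R q (x q)" using x[OF q] that(2) by blast
    also have "\<dots> \<le> R p (x p)" by (rule p(2)[OF q])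
    finally show ?thesis .
  qed
  then show ?thesis using p(1) x[OF p(1)] by (intro bexI[of _ p] bexI[of _ "x p"]) (auto simp: L'_def)
qed

text \<open>The atlas of the domain is adapted to \<open>f\<close>: the patch \<open>c\<close> is mapped into the patch \<open>j c\<close> of the
  target, and \<open>F c\<close> is the local representation.\<close>

locale harmonic_atlas = compact_holomorphic_atlas A
  for A :: "('i, 'm::{t2_space, second_countable_topology}, complex^'n) atlas" +
  fixes h :: "'i \<Rightarrow> complex^'n \<Rightarrow> complex^'n^'n"
    and B :: "('j, 'p::{t2_space, second_countable_topology}, real^'d) atlas"
    and g :: "'j \<Rightarrow> real^'d \<Rightarrow> real^'d^'d"
    and f :: "'m \<Rightarrow> 'p" and j :: "'i \<Rightarrow> 'j" and F :: "'i \<Rightarrow> complex^'n \<Rightarrow> real^'d"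
  assumes kaehler_A: "kaehler_manifold A h" and RC: "uniformly_RC_positive A h"
    and riemannian_B: "riemannian_manifold B g" and curvature_B: "nonpositive_complex_sectional_curvature B g"
    and j: "\<And>c. c \<in> indices A \<Longrightarrow> j c \<in> indices B"
    and f_patch: "\<And>c p. c \<in> indices A \<Longrightarrow> p \<in> patch A c \<Longrightarrow> f p \<in> patch B (j c)"
    and F_eq: "\<And>c z. c \<in> indices A \<Longrightarrow> z \<in> chart_image A c \<Longrightarrow> F c z = chart B (j c) (f (chart_inv A c z))"
    and smooth_on_F: "\<And>c. c \<in> indices A \<Longrightarrow> smooth_on (F c) (chart_image A c)"
    and harmonic_F: "\<And>c z. c \<in> indices A \<Longrightarrow> z \<in> chart_image A c \<Longrightarrow>
      pullback_nabla_adjoint (\<lambda>x. real_part_metric (h c (complexify x))) (g (j c)) (F c \<circ> complexify)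
        (\<lambda>b. pd b (F c \<circ> complexify)) (realify z) = 0"
begin

sublocale N: manifold B
  using riemannian_B by unfold_locales (simp add: riemannian_manifold_def smooth_manifold_def)

abbreviation "energy c z W \<equiv> Re (bil (g (j c) (F c z)) (cpush (F c) (hol W) z) (cnj_vec (cpush (F c) (hol W) z)))"

lemma harmonic_chart:
  assumes c: "c \<in> indices A"
  shows "harmonic_chart (chart_image A c) (h c) (chart_image B (j c)) (g (j c)) (F c)"
proof -
  have hm: "hermitian_metric A h" using kaehler_A by (simp add: kaehler_manifold_def)
  have rm: "riemannian_metric B g" using riemannian_B by (simp add: riemannian_manifold_def)
  interpret kaehler_map_chart "chart_image A c" "h c" "chart_image B (j c)" "g (j c)" "F c"
  proof unfold_locales
    show "open (chart_image A c)" by (rule open_chart_image[OF c])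
    show "smooth_on (h c) (chart_image A c)" using hm c by (simp add: hermitian_metric_def)
    show "h c z $ \<beta> $ \<alpha> = cnj (h c z $ \<alpha> $ \<beta>)" if "z \<in> chart_image A c" for z \<alpha> \<beta>
      using hm c that unfolding hermitian_metric_def by blast
    show "Re (hermitian_form (h c z) v v) > 0" if "z \<in> chart_image A c" "v \<noteq> 0" for z v
      using hm c that unfolding hermitian_metric_def by blast
    show "ext_deriv2 (fundamental_form (h c)) z u v w = 0" if "z \<in> chart_image A c" for z u v w
      using kaehler_A c that unfolding kaehler_manifold_def by blast
    show "open (chart_image B (j c))" by (rule N.open_chart_image[OF j[OF c]])
    show "smooth_on (g (j c)) (chart_image B (j c))" using rm j[OF c] by (simp add: riemannian_metric_def)
    show "transpose (g (j c) x) = g (j c) x" if "x \<in> chart_image B (j c)" for x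
      using rm j[OF c] that unfolding riemannian_metric_def by blast
    show "v \<bullet> (g (j c) x *v v) > 0" if "x \<in> chart_image B (j c)" "v \<noteq> 0" for x v
      using rm j[OF c] that unfolding riemannian_metric_def by blast
    show "smooth_on (F c) (chart_image A c)" by (rule smooth_on_F[OF c])
    show "F c z \<in> chart_image B (j c)" if "z \<in> chart_image A c" for z
      unfolding F_eq[OF c that] by (rule N.chart_in[OF j[OF c] f_patch[OF c chart_inv_in[OF c that]]])
  qed
  show ?thesis
  proof unfold_locales
    show "(\<Sum>\<alpha>\<in>UNIV. \<Sum>\<beta>\<in>UNIV. hinv \<alpha> \<beta> z *s cnabla (g (j c)) (F c) (ahol (axis \<beta> 1)) (cpush (F c) (hol (axis \<alpha> 1))) z) = 0"
      if "z \<in> chart_image A c" for z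
      by (rule harmonic_from_adjoint[OF that _ harmonic_F[OF c that]]) (simp add: o_def)
    show "Re (complex_curvature (g (j c)) x Z (cnj_vec W) W (cnj_vec Z)) \<le> 0" if "x \<in> chart_image B (j c)" for x Z W
      using curvature_B j[OF c] that unfolding nonpositive_complex_sectional_curvature_def by blast
  qed
qed

lemma chart_change:
  assumes cd: "c \<in> indices A" "d \<in> indices A"
  shows "chart_change (chart_image A c) (h c) (chart_image B (j c)) (g (j c)) (F c)
    (chart_image A d) (h d) (chart_image B (j d)) (g (j d)) (F d) (overlap A c d) (transition A c d)"
proof -
  interpret C: harmonic_chart "chart_image A c" "h c" "chart_image B (j c)" "g (j c)" "F c" by (rule harmonic_chart[OF cd(1)])
  interpret C': harmonic_chart "chart_image A d" "h d" "chart_image B (j d)" "g (j d)" "F d" by (rule harmonic_chart[OF cd(2)])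
  have hm: "hermitian_metric A h" using kaehler_A by (simp add: kaehler_manifold_def)
  have rm: "riemannian_metric B g" and sm: "smooth_manifold B" using riemannian_B by (simp_all add: riemannian_manifold_def)
  let ?\<tau> = "transition A c d" and ?\<sigma> = "transition B (j c) (j d)" and ?V = "overlap A c d"
  note jj = j[OF cd(1)] j[OF cd(2)]
  show ?thesis
  proof unfold_locales
    show "open ?V" by (rule open_overlap[OF cd])
    show "?V \<subseteq> chart_image A c" by (rule overlap_subset[OF cd(1)])
    show "?\<tau> z \<in> chart_image A d" if "z \<in> ?V" for z by (rule transition_in(2)[OF cd that])
    show "smooth_on ?\<tau> ?V" by (rule smooth_on_transition[OF cd])
    show "cholo (\<lambda>z. dd v ?\<tau> z $ k) ?V" for v k by (rule cholo_dd_transition[OF cd])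
    show "dd (\<i> *s v) ?\<tau> z = \<i> *s dd v ?\<tau> z" if z: "z \<in> ?V" for v z
    proof -
      obtain J where J: "\<And>v. dd v ?\<tau> z = J *v v" using transition_derivative[OF cd z] by blast
      show ?thesis unfolding J by (simp add: vec_eq_iff matrix_vector_mult_def sum_distrib_left mult_ac)
    qed
    show "surj (\<lambda>v. dd v ?\<tau> z)" if z: "z \<in> ?V" for z
    proof (rule surjI)
      fix v
      have "dd (dd v (transition A d c) (?\<tau> z)) (transition A c d) (transition A d c (?\<tau> z)) = v"
        by (rule dd_transition_inverse[OF cd(2,1) transition_in(1)[OF cd z]])
      then show "dd (dd v (transition A d c) (?\<tau> z)) ?\<tau> z = v" unfolding transition_transition[OF cd z] .
    qed
    show "hermitian_form (h c z) u v = hermitian_form (h d (?\<tau> z)) (dd u ?\<tau> z) (dd v ?\<tau> z)" if "z \<in> ?V" for z u v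
      using hm cd that unfolding hermitian_metric_def dd_def by blast
    show "dd u (F c) z \<bullet> (g (j c) (F c z) *v dd v (F c) z) =
        dd (dd u ?\<tau> z) (F d) (?\<tau> z) \<bullet> (g (j d) (F d (?\<tau> z)) *v dd (dd v ?\<tau> z) (F d) (?\<tau> z))" if z: "z \<in> ?V" for z u v
    proof -
      have F: "F c y \<in> overlap B (j c) (j d) \<and> F d (?\<tau> y) = ?\<sigma> (F c y)" if y: "y \<in> ?V" for y
      proof -
        have yU: "y \<in> chart_image A c" using overlap_subset[OF cd(1)] y by blast
        have p: "f (chart_inv A c y) \<in> patch B (j c)" "f (chart_inv A c y) \<in> patch B (j d)"
          using y f_patch[OF cd(1)] f_patch[OF cd(2)] unfolding overlap_iff[OF cd(1)] by (blast intro: chart_inv_in[OF cd(1)])+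
        have "F d (?\<tau> y) = chart B (j d) (f (chart_inv A c y))"
          by (simp add: F_eq[OF cd(2) transition_in(2)[OF cd y]] chart_inv_transition[OF cd y])
        then show ?thesis
          using p by (simp add: F_eq[OF cd(1) yU] N.overlap_iff[OF jj(1)] N.transition_eq N.chart_inv_chart[OF jj(1)] N.chart_in[OF jj(1)])
      qed
      let ?x = "F c z"
      have x: "?x \<in> overlap B (j c) (j d)" using F[OF z] by blast
      have zU: "z \<in> chart_image A c" using overlap_subset[OF cd(1)] z by blast
      have d\<sigma>: "?\<sigma> differentiable at ?x"
        by (rule smooth_on_differentiable[OF _ x]) (use sm jj in \<open>unfold smooth_manifold_def, blast\<close>)
      have dF: "F c differentiable at z" by (rule smooth_on_differentiable[OF smooth_on_F[OF cd(1)] zU])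
      have dF': "F d differentiable at (?\<tau> z)"
        by (rule smooth_on_differentiable[OF smooth_on_F[OF cd(2)] transition_in(2)[OF cd z]])
      have D: "dd (dd w ?\<tau> z) (F d) (?\<tau> z) = dd (dd w (F c) z) ?\<sigma> ?x" for w
      proof -
        have "dd (dd w ?\<tau> z) (F d) (?\<tau> z) = dd w (\<lambda>y. F d (?\<tau> y)) z"
          by (rule dd_compose[OF differentiable_transition[OF cd z] dF', symmetric])
        also have "\<dots> = dd w (\<lambda>y. ?\<sigma> (F c y)) z"
          by (rule dd_cong[OF open_overlap[OF cd] z]) (use F in blast)
        also have "\<dots> = dd (dd w (F c) z) ?\<sigma> ?x" by (rule dd_compose[OF dF d\<sigma>])
        finally show ?thesis .
      qed
      define J where "J = real_jacobian B (j c) (j d) ?x"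
      have J: "dd w ?\<sigma> ?x = J *v w" for w
        unfolding J_def real_jacobian_def dd_def[symmetric] by (rule matrix_vector_mul(2)[OF linear_dd[OF d\<sigma>], THEN fun_cong, symmetric])
      have G: "g (j c) ?x = transpose J ** g (j d) (?\<sigma> ?x) ** J"
        using rm[unfolded riemannian_metric_def] jj x unfolding J_def by blast
      have tr: "a \<bullet> (transpose J *v w) = (J *v a) \<bullet> w" for a w
        by (simp only: dot_lmul_matrix[symmetric] vector_transpose_matrix)
      show ?thesis
        unfolding D J G matrix_vector_mul_assoc[symmetric] tr F[OF z, THEN conjunct2] ..
    qed
  qed
qed

lemma bochner_eq_0:
  assumes c: "c \<in> indices A" and z: "z \<in> chart_image A c"
  shows "Re (harmonic_chart.bochner (h c) (g (j c)) (F c) z) = 0"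
proof (rule divergence_theorem[where vl = "\<lambda>c. hermitian_chart.vol (h c)"
      and X = "\<lambda>c. harmonic_chart.hfield (h c) (g (j c)) (F c)"
      and q = "\<lambda>c z. Re (harmonic_chart.bochner (h c) (g (j c)) (F c) z)", OF _ _ _ _ _ _ _ _ c z])
  fix c assume c: "c \<in> indices A"
  interpret C: harmonic_chart "chart_image A c" "h c" "chart_image B (j c)" "g (j c)" "F c" by (rule harmonic_chart[OF c])
  show "smooth_on C.vol (chart_image A c)" by (rule C.smooth_vol)
  show "smooth_on C.hfield (chart_image A c)" by (rule C.smooth_hfield)
  show "continuous_on (chart_image A c) (\<lambda>z. Re (C.bochner z))"
    by (intro continuous_intros smooth_on_continuous_on[OF C.smooth_bochner])
  show "C.vol z > 0" if "z \<in> chart_image A c" for z by (rule C.vol_pos[OF that])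
  show "Re (C.bochner z) \<ge> 0" if "z \<in> chart_image A c" for z by (rule C.bochner_nonneg[OF that])
  show "rdiv (\<lambda>z. C.vol z *\<^sub>R C.hfield z) z = C.vol z * Re (C.bochner z)" if "z \<in> chart_image A c" for z
    by (rule C.rdiv_hfield[OF that])
  fix d z assume d: "d \<in> indices A" and z: "z \<in> overlap A c d"
  show "C.vol z = \<bar>real_det (\<lambda>v. dd v (transition A c d) z)\<bar> * hermitian_chart.vol (h d) (transition A c d z)"
    by (rule chart_change.vol_\<tau>[OF chart_change[OF c d] z])
  show "harmonic_chart.hfield (h d) (g (j d)) (F d) (transition A c d z) = dd (C.hfield z) (transition A c d) z"
    by (rule chart_change.hfield_\<tau>[OF chart_change[OF c d] z])
qed

text \<open>The ratio of energy to squared length is homogeneous of degree zero in the vector and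
  independent of the chart, so its maximum over finitely many compact pieces bounds it
  everywhere.\<close>

lemma energy_max:
  obtains c0 z0 W0 m where "c0 \<in> indices A" "z0 \<in> chart_image A c0" "W0 \<noteq> 0"
    "energy c0 z0 W0 = m * Re (hermitian_form (h c0 z0) W0 W0)"
    "\<And>c z W. c \<in> indices A \<Longrightarrow> z \<in> chart_image A c \<Longrightarrow> energy c z W \<le> m * Re (hermitian_form (h c z) W W)"
proof -
  let ?N = "\<lambda>c z W. Re (hermitian_form (h c z) W W)"
  obtain p0 :: 'm where True by blast
  obtain c0 where c0: "c0 \<in> indices A" "p0 \<in> patch A c0" using ex_patch by blast
  obtain L c K and \<rho> :: "'m \<Rightarrow> 'm \<Rightarrow> real" where L: "finite L" "p0 \<in> L" and \<rho>0: "\<rho> p0 p0 > 0"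
    and c: "\<And>p. p \<in> L \<Longrightarrow> c p \<in> indices A" and K: "\<And>p. p \<in> L \<Longrightarrow> compact (K p)" "\<And>p. p \<in> L \<Longrightarrow> K p \<subseteq> patch A (c p)"
    and \<rho>K: "\<And>p q. p \<in> L \<Longrightarrow> q \<notin> K p \<Longrightarrow> \<rho> p q = 0" and \<rho>_sum: "\<And>q. (\<Sum>p\<in>L. \<rho> p q) = 1"
    by (rule partition_of_unity[OF c0]) blast
  \<comment> \<open>By homogeneity the Euclidean unit sphere of the coordinates serves as well as
    the sphere of the Hermitian metric.\<close>
  define S where "S p = chart A (c p) ` K p \<times> sphere (0 :: complex^'n) 1" for p
  define R where "R p = (\<lambda>(z, W). energy (c p) z W / ?N (c p) z W)" for p
  have SU: "z \<in> chart_image A (c p)" "W \<noteq> 0" if "p \<in> L" "(z, W) \<in> S p" for p z W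
    using that compact_chart(2)[OF c K] by (auto simp: S_def)
  have NS: "?N d z W > 0" if "d \<in> indices A" "z \<in> chart_image A d" "W \<noteq> 0" for d z W
    using hermitian_chart.pos_H that harmonic_chart[OF that(1)]
    unfolding harmonic_chart_def kaehler_chart_def by blast
  have "continuous_on (S p) (R p)" if p: "p \<in> L" for p
  proof -
    interpret C: harmonic_chart "chart_image A (c p)" "h (c p)" "chart_image B (j (c p))" "g (j (c p))" "F (c p)"
      by (rule harmonic_chart[OF c[OF p]])
    have sub: "S p \<subseteq> chart_image A (c p) \<times> UNIV" using SU[OF p] by auto
    have "continuous_on (S p) (\<lambda>x. (\<lambda>(z, W). energy (c p) z W) x / (\<lambda>(z, W). ?N (c p) z W) x)"
      by (rule continuous_on_divide[OF continuous_on_subset[OF C.continuous_energy sub] continuous_on_subset[OF C.continuous_hermitian_form sub]])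
        (use SU[OF p] NS[OF c[OF p]] in \<open>force simp: less_imp_neq[symmetric]\<close>)
    then show ?thesis unfolding R_def split_beta .
  qed
  moreover have "compact (S p)" if "p \<in> L" for p
    unfolding S_def by (intro compact_Times compact_chart(1) c K that) simp
  moreover have "S p0 \<noteq> {}"
  proof -
    have "p0 \<in> K p0" using \<rho>K[OF L(2), of p0] \<rho>0 by force
    moreover have "axis undefined 1 \<in> sphere (0 :: complex^'n) 1" by (simp add: norm_axis_1)
    ultimately show ?thesis unfolding S_def by blast
  qed
  ultimately obtain p x where p: "p \<in> L" and x: "x \<in> S p" and max: "\<And>q y. q \<in> L \<Longrightarrow> y \<in> S q \<Longrightarrow> R q y \<le> R p x"
    using finite_family_attains_sup[OF L(1), of S R p0] L(2) by blast
  obtain z0 W0 where x_eq: "x = (z0, W0)" by (cases x)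
  note zW = SU[OF p x[unfolded x_eq]]
  define m where "m = R p x"
  have m_eq: "energy (c p) z0 W0 = m * ?N (c p) z0 W0"
    using NS[OF c[OF p] zW] by (simp add: m_def R_def x_eq)
  have le: "energy d z W \<le> m * ?N d z W" if d: "d \<in> indices A" and z: "z \<in> chart_image A d" for d z W
  proof (cases "W = 0")
    case True
    interpret C: harmonic_chart "chart_image A d" "h d" "chart_image B (j d)" "g (j d)" "F d"
      by (rule harmonic_chart[OF d])
    show ?thesis using True by (simp add: C.energy_expand[OF z] hermitian_form_def)
  next
    case W: False
    \<comment> \<open>The partition functions vanish off the sets \<open>K q\<close> but sum to 1,
      so these sets cover the manifold.\<close>
    have "\<exists>q\<in>L. chart_inv A d z \<in> K q"
    proof (rule ccontr)
      assume "\<not> ?thesis"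
      then have "(\<Sum>q\<in>L. \<rho> q (chart_inv A d z)) = 0" using \<rho>K by (intro sum.neutral) blast
      then show False using \<rho>_sum by simp
    qed
    then obtain q where q: "q \<in> L" "chart_inv A d z \<in> K q" by blast
    note cd = d c[OF q(1)]
    have zV: "z \<in> overlap A d (c q)" using z q K(2) unfolding overlap_iff[OF d] by blast
    let ?\<tau> = "transition A d (c q)"
    interpret CC: chart_change "chart_image A d" "h d" "chart_image B (j d)" "g (j d)" "F d"
      "chart_image A (c q)" "h (c q)" "chart_image B (j (c q))" "g (j (c q))" "F (c q)" "overlap A d (c q)" ?\<tau>
      by (rule chart_change[OF cd])
    define W' where "W' = dd W ?\<tau> z"
    have E: "energy d z W = energy (c q) (?\<tau> z) W'" unfolding W'_def using CC.energy_\<tau>[OF zV] by simp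
    have N: "?N d z W = ?N (c q) (?\<tau> z) W'" unfolding W'_def CC.isometry[OF zV] ..
    have \<tau>U: "?\<tau> z \<in> chart_image A (c q)" by (rule transition_in(2)[OF cd zV])
    have "?N d z W > 0" by (rule NS[OF d z W])
    then have W': "W' \<noteq> 0" unfolding N by (auto simp: hermitian_form_def)
    \<comment> \<open>Energy and squared length both scale with the square of \<open>r\<close>,
      which reduces the claim to the unit vector \<open>V\<close>.\<close>
    define r where "r = norm W'"
    define V where "V = (1 / r) *\<^sub>R W'"
    have r: "r > 0" using W' by (simp add: r_def)
    have W'V: "W' = of_real r *s V" using r by (simp add: V_def vec_eq_iff) (simp add: scaleR_conv_of_real)
    have V: "norm V = 1" using r by (simp add: V_def r_def)
    have "(?\<tau> z, V) \<in> S q" using q V by (simp add: S_def transition_eq)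
    from max[OF q(1) this] have "R q (?\<tau> z, V) \<le> m" by (simp add: m_def)
    moreover have "?N (c q) (?\<tau> z) V > 0" by (rule NS[OF cd(2) \<tau>U]) (use V in auto)
    ultimately have *: "energy (c q) (?\<tau> z) V \<le> m * ?N (c q) (?\<tau> z) V" by (simp add: R_def divide_le_eq)
    have e: "energy (c q) (?\<tau> z) W' = r\<^sup>2 * energy (c q) (?\<tau> z) V"
      unfolding CC.C'.energy_expand[OF \<tau>U] W'V by (simp add: power2_eq_square sum_distrib_left algebra_simps)
    have n: "?N (c q) (?\<tau> z) W' = r\<^sup>2 * ?N (c q) (?\<tau> z) V"
      unfolding W'V by (simp add: hermitian_form_scale power2_eq_square)
    show ?thesis unfolding E N e n using mult_left_mono[OF *, of "r\<^sup>2"] by (simp add: mult.left_commute)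
  qed
  show ?thesis by (rule that[OF c[OF p] zW m_eq le])
qed

text \<open>A positive maximal ratio \<open>m\<close> is excluded by \<open>no_maximum\<close>;
  otherwise the energy of every vector is non-positive, hence its (1,0)-image under df vanishes, and
  so does the real part of that image.\<close>

lemma dd_F_eq_0:
  assumes c: "c \<in> indices A" and z: "z \<in> chart_image A c"
  shows "dd v (F c) z = 0"
proof -
  obtain c0 z0 W0 m where max: "c0 \<in> indices A" "z0 \<in> chart_image A c0" "W0 \<noteq> 0"
    "energy c0 z0 W0 = m * Re (hermitian_form (h c0 z0) W0 W0)"
    "\<And>c z W. c \<in> indices A \<Longrightarrow> z \<in> chart_image A c \<Longrightarrow> energy c z W \<le> m * Re (hermitian_form (h c z) W W)"
    using energy_max by blast
  interpret C0: harmonic_chart "chart_image A c0" "h c0" "chart_image B (j c0)" "g (j c0)" "F c0"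
    by (rule harmonic_chart[OF max(1)])
  have "m \<le> 0"
  proof (rule ccontr)
    assume "\<not> m \<le> 0"
    then have m: "m > 0" by simp
    obtain u where u: "\<And>v. v \<noteq> 0 \<Longrightarrow> Re (chern_curvature (h c0) z0 u v) > 0"
      using RC max(1,2) unfolding uniformly_RC_positive_def by blast
    have hess: "C0.hess \<alpha> \<beta> y = 0" if "y \<in> chart_image A c0" for \<alpha> \<beta> y
      by (rule C0.bochner_zero[OF that bochner_eq_0[OF max(1) that]])
    show False by (rule C0.no_maximum[OF hess max(2) u m max(3) max(5)[OF max(1)] max(4)])
  qed
  interpret C: harmonic_chart "chart_image A c" "h c" "chart_image B (j c)" "g (j c)" "F c"
    by (rule harmonic_chart[OF c])
  \<comment> \<open>\<open>hol\<close> halves its argument, so the first component of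
    \<open>hol ?W\<close> is \<open>v\<close> itself.\<close>
  let ?W = "2 *\<^sub>R v"
  have "Re (hermitian_form (h c z) ?W ?W) \<ge> 0"
  proof (cases "?W = 0")
    case False
    then show ?thesis using C.pos_H[OF z False] by simp
  qed (simp add: hermitian_form_def)
  with \<open>m \<le> 0\<close> have "m * Re (hermitian_form (h c z) ?W ?W) \<le> 0" by (simp add: mult_nonpos_nonneg)
  with max(5)[OF c z, of ?W] have "energy c z ?W \<le> 0" by linarith
  then have "cpush (F c) (hol ?W) z = 0" using C.bil_cnj_pos[OF C.F_in[OF z]] by (meson not_le)
  then have "(\<chi> k. Complex (dd (fst (hol ?W)) (F c) z $ k) (dd (snd (hol ?W)) (F c) z $ k)) = 0"
    unfolding C.cpush_eq[OF z] .
  then have "dd v (F c) z $ k = 0" for k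
    by (simp add: vec_eq_iff hol_def complex_eq_iff)
  then show ?thesis by (simp add: vec_eq_iff)
qed

theorem f_constant: "f constant_on UNIV"
proof (rule locally_constant_imp_constant[OF connected])
  fix p :: 'm
  obtain c where c: "c \<in> indices A" "p \<in> patch A c" using ex_patch by blast
  have z: "chart A c p \<in> chart_image A c" by (rule chart_in[OF c])
  obtain r where r: "r > 0" "ball (chart A c p) r \<subseteq> chart_image A c"
    using open_contains_ball[THEN iffD1, OF open_chart_image[OF c(1)]] z by blast
  have "\<exists>k. \<forall>z\<in>ball (chart A c p) r. F c z = k"
  proof (rule has_derivative_zero_constant[OF convex_ball])
    fix z assume "z \<in> ball (chart A c p) r"
    then have z: "z \<in> chart_image A c" using r(2) by blast
    have "(F c has_derivative (\<lambda>v. dd v (F c) z)) (at z)"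
      by (rule has_derivative_dd[OF smooth_on_differentiable[OF smooth_on_F[OF c(1)] z]])
    then show "(F c has_derivative (\<lambda>v. 0)) (at z within ball (chart A c p) r)"
      unfolding dd_F_eq_0[OF c(1) z] by (rule has_derivative_at_withinI)
  qed
  then obtain k where k: "\<And>z. z \<in> ball (chart A c p) r \<Longrightarrow> F c z = k" by blast
  let ?T = "patch A c \<inter> chart A c -` ball (chart A c p) r"
  have Fk: "chart B (j c) (f q) = k" if "q \<in> ?T" for q
    using k[of "chart A c q"] that F_eq[OF c(1) chart_in[OF c(1), of q]] by (auto simp: chart_inv_chart[OF c(1)])
  \<comment> \<open>The target chart is injective on its patch, so a constant local representation
    means a constant map.\<close>
  have fq: "f q = chart_inv B (j c) k" if "q \<in> ?T" for q
    using N.chart_inv_chart[OF j[OF c(1)] f_patch[OF c(1)], of q] Fk[OF that] that by simp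
  have p: "p \<in> ?T" using c(2) r(1) by simp
  have "open ?T" by (rule continuous_open_preimage[OF continuous_on_chart[OF c(1)] open_patch[OF c(1)] open_ball])
  then show "\<exists>T. openin (top_of_set UNIV) T \<and> p \<in> T \<and> (\<forall>x\<in>T. f x = f p)"
    using p fq by (intro exI[of _ ?T]) (simp add: subtopology_UNIV)
qed

end

text \<open>Each patch is cut down so that \<open>f\<close> maps it into one patch of the target.
  The charts themselves are unchanged, so coordinate expressions of tensors are simply
  restricted.\<close>

definition refined_atlas ::
  "('i, 'm, 'e) atlas \<Rightarrow> ('j, 'p, 'd) atlas \<Rightarrow> ('m \<Rightarrow> 'p) \<Rightarrow> ('i \<times> 'j, 'm, 'e) atlas" where
  "refined_atlas A B f =
     \<lparr>indices = indices A \<times> indices B, patch = (\<lambda>(i, j). patch A i \<inter> f -` patch B j), chart = (\<lambda>(i, j). chart A i)\<rparr>"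

lemma refined_atlas_simps [simp]:
  "indices (refined_atlas A B f) = indices A \<times> indices B"
  "patch (refined_atlas A B f) (i, j) = patch A i \<inter> f -` patch B j"
  "chart (refined_atlas A B f) (i, j) = chart A i"
  by (simp_all add: refined_atlas_def)

lemma chart_image_refined_atlas: "chart_image (refined_atlas A B f) (i, j) = local_dom A B f i j"
  by (simp add: chart_image_def local_dom_def)

lemma local_dom_subset: "local_dom A B f i j \<subseteq> chart_image A i"
  by (auto simp: local_dom_def chart_image_def)

lemma overlap_refined_atlas:
  "overlap (refined_atlas A B f) (i, j) (i', j') \<subseteq> overlap A i i'"
  "overlap (refined_atlas A B f) (i, j) (i', j') \<subseteq> local_dom A B f i j"
  by (auto simp: overlap_def local_dom_def)

context
  fixes A :: "('i, 'm::{t2_space, second_countable_topology}, complex^'n) atlas"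
    and B :: "('j, 'p::{t2_space, second_countable_topology}, 'd::euclidean_space) atlas"
    and f :: "'m \<Rightarrow> 'p"
  assumes A: "complex_manifold A" and B: "topological_manifold B" and f: "continuous_on UNIV f"
begin

interpretation A: holomorphic_atlas A by unfold_locales (rule A)
interpretation B: manifold B by unfold_locales (rule B)

text \<open>\<open>chart_inv\<close> depends on the patch through the domain of the inverse, so the
  two inverses are compared only on the image of the smaller patch.\<close>

lemma chart_inv_refined_atlas:
  assumes "i \<in> indices A" "z \<in> local_dom A B f i j"
  shows "chart_inv (refined_atlas A B f) (i, j) z = chart_inv A i z"
proof -
  obtain p where p: "p \<in> patch A i" "f p \<in> patch B j" "z = chart A i p" using assms(2) by (auto simp: local_dom_def)
  have inj: "inj_on (chart A i) (patch A i)" using A.chart_inv_chart[OF assms(1)] by (rule inj_on_inverseI)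
  have "chart_inv (refined_atlas A B f) (i, j) z = p"
    unfolding chart_inv_def p(3) refined_atlas_simps by (rule inv_into_f_f[OF inj_on_subset[OF inj]]) (use p in auto)
  then show ?thesis using A.chart_inv_chart[OF assms(1) p(1)] p(3) by simp
qed

lemma open_local_dom:
  assumes "i \<in> indices A" "j \<in> indices B"
  shows "open (local_dom A B f i j)"
proof -
  have o: "open (f -` patch B j)" using open_vimage[OF B.open_patch[OF assms(2)] f] .
  have "local_dom A B f i j = {z \<in> chart_image A i. chart_inv A i z \<in> f -` patch B j}"
    unfolding local_dom_def chart_image_def by (auto simp: A.chart_inv_chart[OF assms(1)])
  then show ?thesis using A.open_vimage_chart_inv[OF assms(1) o] by simp
qed

lemma topological_manifold_refined_atlas: "topological_manifold (refined_atlas A B f)"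
  unfolding topological_manifold_def
proof (intro conjI ballI)
  show "connected (UNIV :: 'm set)" by (rule A.connected)
  show "(\<Union>i\<in>indices (refined_atlas A B f). patch (refined_atlas A B f) i) = UNIV"
  proof -
    have "\<exists>i\<in>indices A \<times> indices B. p \<in> patch (refined_atlas A B f) i" for p
    proof -
      obtain i j where "i \<in> indices A" "p \<in> patch A i" "j \<in> indices B" "f p \<in> patch B j"
        using A.ex_patch[of p] B.ex_patch[of "f p"] by blast
      then show ?thesis by (intro bexI[of _ "(i, j)"]) auto
    qed
    then show ?thesis by auto
  qed
  fix k assume "k \<in> indices (refined_atlas A B f)"
  then obtain i j where k: "k = (i, j)" and ij: "i \<in> indices A" "j \<in> indices B" by auto
  show "open (patch (refined_atlas A B f) k)"
    unfolding k refined_atlas_simps by (intro open_Int A.open_patch[OF ij(1)] open_vimage[OF B.open_patch[OF ij(2)] f])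
  show "open (chart_image (refined_atlas A B f) k)"
    unfolding k chart_image_refined_atlas by (rule open_local_dom[OF ij])
  have h: "homeomorphism (patch A i \<inter> f -` patch B j) (local_dom A B f i j) (chart A i) (chart_inv A i)"
    by (rule homeomorphism_of_subsets[OF A.chart_homeomorphism[OF ij(1)] _ local_dom_subset]) (auto simp: local_dom_def)
  show "homeomorphism (patch (refined_atlas A B f) k) (chart_image (refined_atlas A B f) k)
      (chart (refined_atlas A B f) k) (chart_inv (refined_atlas A B f) k)"
    unfolding k chart_image_refined_atlas refined_atlas_simps
    by (rule homeomorphism_cong[OF h]) (simp_all add: chart_inv_refined_atlas[OF ij(1)])
qed

lemma transition_refined_atlas:
  assumes "i \<in> indices A" "z \<in> local_dom A B f i j"
  shows "transition (refined_atlas A B f) (i, j) (i', j') z = transition A i i' z"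
  using chart_inv_refined_atlas[OF assms] by (simp add: transition_def)

lemma dd_transition_refined_atlas:
  assumes "i \<in> indices A" "j \<in> indices B" "z \<in> local_dom A B f i j"
  shows "dd v (transition (refined_atlas A B f) (i, j) (i', j')) z = dd v (transition A i i') z"
  by (rule dd_cong[OF open_local_dom[OF assms(1,2)] assms(3)]) (rule transition_refined_atlas[OF assms(1)])

lemma complex_manifold_refined_atlas: "complex_manifold (refined_atlas A B f)"
  unfolding complex_manifold_def
proof (intro conjI ballI)
  show "topological_manifold (refined_atlas A B f)" by (rule topological_manifold_refined_atlas)
  fix k k' z assume "k \<in> indices (refined_atlas A B f)" "k' \<in> indices (refined_atlas A B f)"
    and z: "z \<in> overlap (refined_atlas A B f) k k'"
  then obtain i j i' j' where k: "k = (i, j)" "k' = (i', j')"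
    and ij: "i \<in> indices A" "j \<in> indices B" "i' \<in> indices A" by auto
  have zo: "z \<in> overlap A i i'" and zd: "z \<in> local_dom A B f i j"
    using z overlap_refined_atlas[of A B f i j i' j'] unfolding k by auto
  obtain J where J: "(transition A i i' has_derivative (\<lambda>v. J *v v)) (at z)"
    using A.transition_derivative[OF ij(1,3) zo] by blast
  have "(transition (refined_atlas A B f) k k' has_derivative (\<lambda>v. J *v v)) (at z)"
    unfolding k
    by (rule has_derivative_transform_within_open[OF J open_local_dom[OF ij(1,2)] zd])
      (rule transition_refined_atlas[OF ij(1), symmetric])
  then show "\<exists>J. (transition (refined_atlas A B f) k k' has_derivative (\<lambda>v. J *v v)) (at z)" by blast
qed

lemma kaehler_manifold_refined_atlas:
  assumes "kaehler_manifold A h"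
  shows "kaehler_manifold (refined_atlas A B f) (\<lambda>(i, j). h i)"
  unfolding kaehler_manifold_def
proof (intro conjI)
  have hm: "hermitian_metric A h" using assms by (simp add: kaehler_manifold_def)
  show "complex_manifold (refined_atlas A B f)" by (rule complex_manifold_refined_atlas)
  show "hermitian_metric (refined_atlas A B f) (\<lambda>(i, j). h i)"
    unfolding hermitian_metric_def refined_atlas_simps
  proof (intro conjI)
    have "smooth_on (h i) (local_dom A B f i j) \<and> (\<forall>z\<in>local_dom A B f i j.
        (\<forall>\<alpha> \<beta>. h i z $ \<beta> $ \<alpha> = cnj (h i z $ \<alpha> $ \<beta>)) \<and> (\<forall>v. v \<noteq> 0 \<longrightarrow> Re (hermitian_form (h i z) v v) > 0))"
      if "i \<in> indices A" for i j
      using hm[unfolded hermitian_metric_def] that local_dom_subset[of A B f i j]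
      by (meson smooth_on_subset subsetD)
    then show "\<forall>k\<in>indices A \<times> indices B. smooth_on (case k of (i, j) \<Rightarrow> h i) (chart_image (refined_atlas A B f) k) \<and>
        (\<forall>z\<in>chart_image (refined_atlas A B f) k.
          (\<forall>\<alpha> \<beta>. (case k of (i, j) \<Rightarrow> h i) z $ \<beta> $ \<alpha> = cnj ((case k of (i, j) \<Rightarrow> h i) z $ \<alpha> $ \<beta>)) \<and>
          (\<forall>v. v \<noteq> 0 \<longrightarrow> Re (hermitian_form ((case k of (i, j) \<Rightarrow> h i) z) v v) > 0))"
      by (intro ballI, elim SigmaE, hypsubst, unfold prod.case chart_image_refined_atlas, blast)
    have "hermitian_form (h i z) u v = hermitian_form (h i' (transition (refined_atlas A B f) (i, j) (i', j') z))
        (frechet_derivative (transition (refined_atlas A B f) (i, j) (i', j')) (at z) u)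
        (frechet_derivative (transition (refined_atlas A B f) (i, j) (i', j')) (at z) v)"
      if "i \<in> indices A" "j \<in> indices B" "i' \<in> indices A" and z: "z \<in> overlap (refined_atlas A B f) (i, j) (i', j')" for i j i' j' z u v
    proof -
      have zo: "z \<in> overlap A i i'" and zd: "z \<in> local_dom A B f i j"
        using z overlap_refined_atlas[of A B f i j i' j'] by auto
      show ?thesis
        using hm[unfolded hermitian_metric_def] that(1,3) zo
        unfolding dd_def[symmetric] dd_transition_refined_atlas[OF that(1,2) zd] transition_refined_atlas[OF that(1) zd] by blast
    qed
    then show "\<forall>k\<in>indices A \<times> indices B. \<forall>k'\<in>indices A \<times> indices B. \<forall>z\<in>overlap (refined_atlas A B f) k k'. \<forall>u v.
        hermitian_form ((case k of (i, j) \<Rightarrow> h i) z) u v =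
        hermitian_form ((case k' of (i, j) \<Rightarrow> h i) (transition (refined_atlas A B f) k k' z))
          (frechet_derivative (transition (refined_atlas A B f) k k') (at z) u)
          (frechet_derivative (transition (refined_atlas A B f) k k') (at z) v)"
      by (intro ballI, elim SigmaE, hypsubst, unfold prod.case, blast)
  qed
  show "\<forall>k\<in>indices (refined_atlas A B f). \<forall>z\<in>chart_image (refined_atlas A B f) k. \<forall>u v w.
      ext_deriv2 (fundamental_form (case k of (i, j) \<Rightarrow> h i)) z u v w = 0"
    using assms subsetD[OF local_dom_subset[of A B f]]
    by (simp add: kaehler_manifold_def chart_image_refined_atlas split_paired_all)
qed

end

text \<open>An equality of functions, also outside the chart images: the inverses are choices from
  the same predicate, because \<open>realify\<close> and \<open>complexify\<close> are mutually
  inverse.\<close>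

lemma chart_inv_underlying_atlas:
  fixes A :: "('i, 'm, complex^'k) atlas"
  shows "chart_inv (underlying_atlas A) i = chart_inv A i \<circ> complexify"
proof -
  have "realify z = x \<longleftrightarrow> z = complexify x" for z :: "complex^'k" and x by auto
  then show ?thesis by (simp add: chart_inv_def underlying_atlas_def inv_into_def fun_eq_iff)
qed

lemma local_rep_underlying_atlas: "local_rep (underlying_atlas A) B f i j = local_rep A B f i j \<circ> complexify"
  by (simp add: local_rep_def chart_inv_underlying_atlas o_assoc)

lemma local_dom_underlying_atlas: "local_dom (underlying_atlas A) B f i j = realify ` local_dom A B f i j"
  by (simp add: local_dom_def underlying_atlas_def image_comp)

lemma underlying_metric_eq: "underlying_metric h i = (\<lambda>x. real_part_metric (h i (complexify x)))"
  by (simp add: underlying_metric_def real_part_metric_def fun_eq_iff)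

theorem theorem1p3:
  fixes A :: "('i, 'm::{t2_space, second_countable_topology}, complex^'n) atlas"
    and h :: "'i \<Rightarrow> complex^'n \<Rightarrow> complex^'n^'n"
    and B :: "('j, 'p::{t2_space, second_countable_topology}, real^'d) atlas"
    and g :: "'j \<Rightarrow> real^'d \<Rightarrow> real^'d^'d"
  assumes "compact (UNIV :: 'm set)"
    and "kaehler_manifold A h"
    and "uniformly_RC_positive A h"
    and "riemannian_manifold B g"
    and "nonpositive_complex_sectional_curvature B g"
  shows "\<not> (\<exists>f :: 'm \<Rightarrow> 'p.
            harmonic_map (underlying_atlas A) (underlying_metric h) B g f \<and>
            \<not> f constant_on UNIV)"
proof -
  have A: "complex_manifold A" using assms(2) by (simp add: kaehler_manifold_def)
  have B: "topological_manifold B" using assms(4) by (simp add: riemannian_manifold_def smooth_manifold_def)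
  have "f constant_on UNIV" if f: "harmonic_map (underlying_atlas A) (underlying_metric h) B g f" for f
  proof -
    have sf: "smooth_map (underlying_atlas A) B f" using f by (simp add: harmonic_map_def)
    have cf: "continuous_on UNIV f" using sf by (simp add: smooth_map_def)
    have ind: "indices (underlying_atlas A) = indices A" by (simp add: underlying_atlas_def)
    note ctx = A B cf
    \<comment> \<open>The second index component names the target chart, whence \<open>snd\<close>;
      the local representations are taken in complex coordinates.\<close>
    interpret harmonic_atlas "refined_atlas A B f" "\<lambda>(i, j). h i" B g f snd "\<lambda>(i, j). local_rep A B f i j"
    proof unfold_locales
      show "complex_manifold (refined_atlas A B f)" by (rule complex_manifold_refined_atlas[OF ctx])
      show "compact (UNIV :: 'm set)" by fact
      show "kaehler_manifold (refined_atlas A B f) (\<lambda>(i, j). h i)"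
        by (rule kaehler_manifold_refined_atlas[OF ctx assms(2)])
      show "uniformly_RC_positive (refined_atlas A B f) (\<lambda>(i, j). h i)"
        using assms(3) subsetD[OF local_dom_subset[of A B f]]
        by (simp add: uniformly_RC_positive_def chart_image_refined_atlas split_paired_all)
      show "riemannian_manifold B g" "nonpositive_complex_sectional_curvature B g" by fact+
      fix k assume "k \<in> indices (refined_atlas A B f)"
      then obtain i j where k: "k = (i, j)" and ij: "i \<in> indices A" "j \<in> indices B" by auto
      show "snd k \<in> indices B" using ij k by simp
      show "f p \<in> patch B (snd k)" if "p \<in> patch (refined_atlas A B f) k" for p
        using that by (simp add: k)
      show "(case k of (i, j) \<Rightarrow> local_rep A B f i j) z = chart B (snd k) (f (chart_inv (refined_atlas A B f) k z))"
        if "z \<in> chart_image (refined_atlas A B f) k" for z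
        using that chart_inv_refined_atlas[OF ctx ij(1), of z j] by (simp add: k chart_image_refined_atlas local_rep_def)
      have o: "open (local_dom A B f i j)" by (rule open_local_dom[OF ctx ij])
      show "smooth_on (case k of (i, j) \<Rightarrow> local_rep A B f i j) (chart_image (refined_atlas A B f) k)"
      proof -
        have "realify ` local_dom A B f i j = complexify -` local_dom A B f i j"
          by (auto simp: image_iff) (metis realify_complexify)
        then have o': "open (realify ` local_dom A B f i j)"
          using open_vimage[OF o linear_continuous_on[OF bounded_linear_complexify]] by simp
        have "smooth_on (local_rep A B f i j \<circ> complexify) (realify ` local_dom A B f i j)"
          using sf ij by (simp add: smooth_map_def ind local_rep_underlying_atlas local_dom_underlying_atlas)
        from smooth_on_compose[OF o o' this smooth_on_bounded_linear[OF bounded_linear_realify]]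
        show ?thesis by (simp add: k chart_image_refined_atlas)
      qed
      show "pullback_nabla_adjoint (\<lambda>x. real_part_metric ((case k of (i, j) \<Rightarrow> h i) (complexify x))) (g (snd k))
          ((case k of (i, j) \<Rightarrow> local_rep A B f i j) \<circ> complexify)
          (\<lambda>b. pd b ((case k of (i, j) \<Rightarrow> local_rep A B f i j) \<circ> complexify)) (realify z) = 0"
        if "z \<in> chart_image (refined_atlas A B f) k" for z
        using f ij that
        by (simp add: k harmonic_map_def ind local_rep_underlying_atlas local_dom_underlying_atlas
            chart_image_refined_atlas underlying_metric_eq)
    qed
    show ?thesis by (rule f_constant)
  qed
  then show ?thesis by blast
qed



end
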